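(* Given a simple graph $G=(V,E)$ on $n$ vertices and $m$ edges, the size $\nu(G)$ of a maximum matching of $G$ can be computed in $\mathsf{CLP}$.
   Context: $\nu(G)$ is the maximum cardinality of a set of pairwise vertex-disjoint edges of $G$. A catalytic Turing machine has a read-only input tape, a write-only output tape, a read-write work tape, and a read-write catalytic tape initially containing an arbitrary string $\tau$; on every input and every $\tau$ it must halt with the correct output and with the catalytic tape restored to $\tau$. $\mathsf{CL}$ is the class of functions computable by such machines with $O(\log n)$ work space and polynomial catalytic space; $\mathsf{CLP}$ consists of those computable by $\mathsf{CL}$ machines that simultaneously run in polynomial time. *)

theory Defs
  imports Complex_Main "HOL-Library.Landau_Symbols"
begin

section \<open>Simple graphs and matchings\<close>

definition simple_graph :: "'a set \<Rightarrow> 'a set set \<Rightarrow> bool" where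
  "simple_graph V E \<longleftrightarrow> finite V \<and> (\<forall>e\<in>E. e \<subseteq> V \<and> card e = 2)"

definition matching :: "'a set set \<Rightarrow> 'a set set \<Rightarrow> bool" where
  "matching E M \<longleftrightarrow> M \<subseteq> E \<and> pairwise disjnt M"

definition matching_number :: "'a set set \<Rightarrow> nat" where
  "matching_number E = Max (card ` {M. matching E M})"

section \<open>Binary encodings\<close>

text \<open>A graph is presented by its adjacency matrix, row by row, with respect to an
  enumeration \<open>vs\<close> of its vertices.\<close>

definition adjacency_string :: "'a list \<Rightarrow> 'a set set \<Rightarrow> bool list" where
  "adjacency_string vs E = concat (map (\<lambda>u. map (\<lambda>v. {u, v} \<in> E) vs) vs)"

text \<open>Binary numeral, most significant bit first, without leading zeros; zero is the numeral
  consisting of the single digit 0.\<close>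

fun binary :: "nat \<Rightarrow> bool list" where
  "binary n = (if n < 2 then [n = 1] else binary (n div 2) @ [odd n])"

declare binary.simps [simp del]

section \<open>Catalytic Turing machines\<close>

datatype move = MoveLeft | Stay | MoveRight

datatype input_symbol = LeftEnd | InBit bool | RightEnd

record action =
  next_state :: nat
  input_move :: move
  work_write :: nat
  work_move :: move
  cat_write :: bool
  cat_move :: move
  emit :: "bool option"

text \<open>States are the numbers below \<open>num_states\<close>, work symbols the numbers below
  \<open>num_symbols\<close>, where 0 is the blank. The catalytic alphabet is exactly \<open>{0,1}\<close>, as for the
  initial contents: further symbols there would amount to additional clean memory.\<close>

record machine =
  num_states :: nat
  num_symbols :: nat
  start_state :: nat
  halt_state :: nat
  transition :: "nat \<Rightarrow> input_symbol \<Rightarrow> nat \<Rightarrow> bool \<Rightarrow> action"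

definition wf_machine :: "machine \<Rightarrow> bool" where
  "wf_machine M \<longleftrightarrow>
     0 < num_symbols M \<and> start_state M < num_states M \<and> halt_state M < num_states M \<and>
     (\<forall>q < num_states M. \<forall>a. \<forall>g < num_symbols M. \<forall>b.
        next_state (transition M q a g b) < num_states M \<and>
        work_write (transition M q a g b) < num_symbols M)"

text \<open>The output tape is one-way: a step may append a bit to it, and it is never read.\<close>

record config =
  state :: nat
  input_pos :: nat
  work_tape :: "nat \<Rightarrow> nat"
  work_pos :: nat
  cat_tape :: "bool list"
  cat_pos :: nat
  out_tape :: "bool list"

text \<open>The input occupies cells 1 to \<open>length x\<close>, between two end markers.\<close>

definition read_input :: "bool list \<Rightarrow> nat \<Rightarrow> input_symbol" where
  "read_input x i =
     (if i = 0 then LeftEnd else if i \<le> length x then InBit (x ! (i - 1)) else RightEnd)"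

text \<open>On every tape, a left move from cell 0 has no effect.\<close>

fun move_head :: "move \<Rightarrow> nat \<Rightarrow> nat" where
  "move_head MoveLeft i = i - 1"
| "move_head Stay i = i"
| "move_head MoveRight i = i + 1"

definition initial :: "machine \<Rightarrow> bool list \<Rightarrow> config" where
  "initial M \<tau> =
     \<lparr>state = start_state M, input_pos = 0, work_tape = (\<lambda>_. 0), work_pos = 0,
      cat_tape = \<tau>, cat_pos = 0, out_tape = []\<rparr>"

definition step :: "machine \<Rightarrow> bool list \<Rightarrow> config \<Rightarrow> config" where
  "step M x c =
     (if state c = halt_state M then c
      else
        let a = transition M (state c) (read_input x (input_pos c))
                  (work_tape c (work_pos c)) (cat_tape c ! cat_pos c)
        in \<lparr>state = next_state a,
            input_pos = min (length x + 1) (move_head (input_move a) (input_pos c)),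
            work_tape = (work_tape c)(work_pos c := work_write a),
            work_pos = move_head (work_move a) (work_pos c),
            cat_tape = (cat_tape c)[cat_pos c := cat_write a],
            cat_pos = move_head (cat_move a) (cat_pos c),
            out_tape = out_tape c @ (case emit a of None \<Rightarrow> [] | Some b \<Rightarrow> [b])\<rparr>)"

definition run :: "machine \<Rightarrow> bool list \<Rightarrow> bool list \<Rightarrow> nat \<Rightarrow> config" where
  "run M x \<tau> t = (step M x ^^ t) (initial M \<tau>)"

text \<open>\<open>M\<close> uses work space \<open>s\<close> and catalytic space \<open>c\<close>, as functions of the input length. The
  catalytic tape is not delimited by markers that the machine could read; its head has to stay on
  the \<open>c n\<close> cells that hold \<open>\<tau>\<close>. Hence \<open>c\<close> need not be constructible, and no information can be
  passed to the machine through the choice of \<open>c\<close>.\<close>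

definition space_bounded :: "machine \<Rightarrow> (nat \<Rightarrow> nat) \<Rightarrow> (nat \<Rightarrow> nat) \<Rightarrow> bool" where
  "space_bounded M s c \<longleftrightarrow>
     (\<forall>x \<tau>. length \<tau> = c (length x) \<longrightarrow>
        (\<forall>t. work_pos (run M x \<tau> t) < s (length x) \<and> cat_pos (run M x \<tau> t) < c (length x)))"

definition computes :: "machine \<Rightarrow> (nat \<Rightarrow> nat) \<Rightarrow> (bool list \<Rightarrow> bool list) \<Rightarrow> bool" where
  "computes M c f \<longleftrightarrow>
     (\<forall>x \<tau>. length \<tau> = c (length x) \<longrightarrow>
        (\<exists>t. state (run M x \<tau> t) = halt_state M \<and>
             out_tape (run M x \<tau> t) = f x \<and> cat_tape (run M x \<tau> t) = \<tau>))"

definition time_bounded :: "machine \<Rightarrow> (nat \<Rightarrow> nat) \<Rightarrow> (nat \<Rightarrow> nat) \<Rightarrow> bool" where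
  "time_bounded M c T \<longleftrightarrow>
     (\<forall>x \<tau>. length \<tau> = c (length x) \<longrightarrow>
        (\<exists>t \<le> T (length x). state (run M x \<tau> t) = halt_state M))"

definition logarithmic :: "(nat \<Rightarrow> nat) \<Rightarrow> bool" where
  "logarithmic s \<longleftrightarrow> (\<lambda>n. real (s n)) \<in> O(\<lambda>n. ln (real n))"

definition polynomial :: "(nat \<Rightarrow> nat) \<Rightarrow> bool" where
  "polynomial p \<longleftrightarrow> (\<exists>k. (\<lambda>n. real (p n)) \<in> O(\<lambda>n. real n ^ k))"

definition CL_machine ::
    "machine \<Rightarrow> (nat \<Rightarrow> nat) \<Rightarrow> (nat \<Rightarrow> nat) \<Rightarrow> (bool list \<Rightarrow> bool list) \<Rightarrow> bool" where
  "CL_machine M s c f \<longleftrightarrow>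
     wf_machine M \<and> logarithmic s \<and> polynomial c \<and> space_bounded M s c \<and> computes M c f"

definition CL :: "(bool list \<Rightarrow> bool list) set" where
  "CL = {f. \<exists>M s c. CL_machine M s c f}"

definition CLP :: "(bool list \<Rightarrow> bool list) set" where
  "CLP = {f. \<exists>M s c T. CL_machine M s c f \<and> polynomial T \<and> time_bounded M c T}"

end

theory Submission
  imports Defs "HOL-Library.Countable" "Jordan_Normal_Form.Determinant"
    "HOL-Computational_Algebra.Formal_Power_Series"
begin

text \<open>Give the edges of the graph integer weights and let \<open>T\<close> be the resulting skew-symmetric
  matrix; its rank is at most \<open>2 \<nu>\<close>. Equality holds as soon as no change of a single weight enlarges
  the set of pairs \<open>(w, k)\<close> for which \<open>T\<close> with vertex \<open>w\<close> deleted has a nonsingular principal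
  \<open>k \<times> k\<close> submatrix. The weights are read off the catalytic tape, and while some weight can be
  improved in this sense it is overwritten. All but a few values of a weight are optimal, since the
  coefficients of \<open>det (I - y T)\<close> are polynomials of low degree in it; hence the new value can be chosen
  so that it also records the edge changed in the previous step and the position of the old value among
  the few bad ones, and the whole search can be undone afterwards. The number of pairs grows with every
  step, so there are polynomially many steps. The coefficients of \<open>det (I - y T)\<close> are entries of a power
  of an acyclic matrix of polynomial size; repeated squaring is carried out in catalytic registers by
  adding and subtracting products in the manner of Ben-Or and Cleve, which needs only a logarithmic
  clock. The algorithm is written in a small imperative language that is compiled to machines.\<close>

section \<open>Structured Turing machine programs\<close>

text \<open>Why the pairs \<open>(w, k)\<close> and not only the rank: the vertices that some
  nonsingular principal submatrix of maximum size avoids play the part of the set D of the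
  Gallai-Edmonds decomposition. If a change of weight cannot raise the rank, kernel vectors are
  proportional along every edge that meets D; if it cannot enlarge D either, certain vectors
  \<open>e_v - c e_u\<close> are images of vectors supported on D. Counting these images bounds the
  corank by the number of components of D, all odd, minus the number of outside neighbours of D, and
  this is the Tutte-Berge bound for matchings. A weight is a sum of many summands because the new
  value is the only record of the value it replaces: were it overwritten by a later step, the record
  would be lost. Step \<open>s\<close> therefore writes into summand \<open>s\<close>, which stays
  untouched until the step is undone. A new value consists of the previous edge, below
  \<open>B\<close>, followed by two digits in base \<open>N\<close>: the index of the old value, and
  a free digit whose \<open>N\<close> choices outnumber the bad values. This asks for
  \<open>B * N * N = B ^ 7\<close> values.\<close>

text \<open>The control part of a view is a small register next to the scanned symbols; the empty list
  plays the role of the blank.\<close>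

type_synonym view = "nat \<times> input_symbol \<times> nat list \<times> bool"
type_synonym eff = "nat \<times> move \<times> nat list \<times> move \<times> bool \<times> move \<times> bool option"

datatype tm =
    TSkip
  | TAct "view \<Rightarrow> eff"
  | TSeq tm tm
  | TIf "view \<Rightarrow> bool" tm tm
  | TWhile "view \<Rightarrow> bool" tm

fun noop :: "view \<Rightarrow> eff" where
  "noop (r, a, g, b) = (r, Stay, g, Stay, b, Stay, None)"

fun tstep :: "tm \<Rightarrow> view \<Rightarrow> tm \<times> eff" where
  "tstep TSkip v = (TSkip, noop v)"
| "tstep (TAct f) v = (TSkip, f v)"
| "tstep (TSeq c1 c2) v =
     (if c1 = TSkip then (c2, noop v) else (TSeq (fst (tstep c1 v)) c2, snd (tstep c1 v)))"
| "tstep (TIf b c1 c2) v = (if b v then c1 else c2, noop v)"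
| "tstep (TWhile b c) v = (if b v then TSeq c (TWhile b c) else TSkip, noop v)"

text \<open>Register, input head, work tape, work head, catalytic tape, catalytic head, output.\<close>

type_synonym acfg = "nat \<times> nat \<times> (nat \<Rightarrow> nat list) \<times> nat \<times> bool list \<times> nat \<times> bool list"

fun view_of :: "bool list \<Rightarrow> acfg \<Rightarrow> view" where
  "view_of x (r, i, T, w, C, p, ot) = (r, read_input x i, T w, C ! p)"

fun app :: "bool list \<Rightarrow> eff \<Rightarrow> acfg \<Rightarrow> acfg" where
  "app x (r', im, g, wm, b, cm, em) (r, i, T, w, C, p, ot) =
     (r', min (length x + 1) (move_head im i), T(w := g), move_head wm w, C[p := b],
      move_head cm p, ot @ (case em of None \<Rightarrow> [] | Some b \<Rightarrow> [b]))"

definition cstep :: "bool list \<Rightarrow> tm \<times> acfg \<Rightarrow> tm \<times> acfg" where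
  "cstep x cs = (fst (tstep (fst cs) (view_of x (snd cs))),
                 app x (snd (tstep (fst cs) (view_of x (snd cs)))) (snd cs))"

lemma cstep_pair: "cstep x (c, s) = (fst (tstep c (view_of x s)), app x (snd (tstep c (view_of x s))) s)"
  by (simp add: cstep_def)

fun ok :: "bool list \<Rightarrow> nat \<Rightarrow> nat list set \<Rightarrow> nat \<Rightarrow> nat \<Rightarrow> acfg \<Rightarrow> bool" where
  "ok x K S sw sc (r, i, T, w, C, p, ot) \<longleftrightarrow>
     r < K \<and> i \<le> length x + 1 \<and> (\<forall>j. T j \<in> S) \<and> w < sw \<and> p < sc"

lemma app_noop: "ok x K S sw sc s \<Longrightarrow> app x (noop (view_of x s)) s = s"
  by (cases s) (auto simp: fun_eq_iff)

text \<open>Every rule imposes \<open>okp\<close> on the configurations it mentions, so that it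
  holds throughout a run: space bounds concern all moments and not only the end.\<close>

inductive bs :: "bool list \<Rightarrow> (acfg \<Rightarrow> bool) \<Rightarrow> tm \<Rightarrow> acfg \<Rightarrow> nat \<Rightarrow> acfg \<Rightarrow> bool"
  for x okp where
  bs_skip: "okp s \<Longrightarrow> bs x okp TSkip s 0 s"
| bs_act: "okp s \<Longrightarrow> okp (app x (f (view_of x s)) s) \<Longrightarrow>
     bs x okp (TAct f) s 1 (app x (f (view_of x s)) s)"
| bs_seq: "bs x okp c1 s t s' \<Longrightarrow> bs x okp c2 s' t' s'' \<Longrightarrow>
     bs x okp (TSeq c1 c2) s (t + 1 + t') s''"
| bs_ifT: "okp s \<Longrightarrow> b (view_of x s) \<Longrightarrow> bs x okp c1 s t s' \<Longrightarrow> bs x okp (TIf b c1 c2) s (t + 1) s'"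
| bs_ifF: "okp s \<Longrightarrow> \<not> b (view_of x s) \<Longrightarrow> bs x okp c2 s t s' \<Longrightarrow> bs x okp (TIf b c1 c2) s (t + 1) s'"
| bs_whileF: "okp s \<Longrightarrow> \<not> b (view_of x s) \<Longrightarrow> bs x okp (TWhile b c) s 1 s"
| bs_whileT: "okp s \<Longrightarrow> b (view_of x s) \<Longrightarrow> bs x okp (TSeq c (TWhile b c)) s t s' \<Longrightarrow>
     bs x okp (TWhile b c) s (t + 1) s'"

lemma bs_ok: "bs x okp c s t s' \<Longrightarrow> okp s \<and> okp s'"
  by (induction rule: bs.induct) auto

lemma steps_seq:
  assumes "\<forall>i<t. fst ((cstep x ^^ i) (c1, s)) \<noteq> TSkip" and "i \<le> t"
  shows "(cstep x ^^ i) (TSeq c1 c2, s) =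
    (TSeq (fst ((cstep x ^^ i) (c1, s))) c2, snd ((cstep x ^^ i) (c1, s)))"
  using assms(2)
proof (induction i)
  case (Suc i)
  then have "fst ((cstep x ^^ i) (c1, s)) \<noteq> TSkip" using assms(1) by simp
  moreover obtain d s' where "(cstep x ^^ i) (c1, s) = (d, s')" by (metis prod.exhaust)
  ultimately show ?case using Suc by (simp add: cstep_pair)
qed simp

text \<open>\<open>TSkip\<close> must not occur before time \<open>t\<close>, because under
  \<open>TSeq\<close> it would already hand control to the second program.\<close>

definition reaches :: "bool list \<Rightarrow> (acfg \<Rightarrow> bool) \<Rightarrow> tm \<Rightarrow> acfg \<Rightarrow> nat \<Rightarrow> tm \<Rightarrow> acfg \<Rightarrow> bool" where
  "reaches x okp c s t c' s' \<longleftrightarrow> (cstep x ^^ t) (c, s) = (c', s') \<and>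
     (\<forall>i\<le>t. okp (snd ((cstep x ^^ i) (c, s)))) \<and> (\<forall>i<t. fst ((cstep x ^^ i) (c, s)) \<noteq> TSkip)"

lemma reaches_trans:
  assumes "reaches x okp c s t c' s'" and "reaches x okp c' s' t' c'' s''"
  shows "reaches x okp c s (t + t') c'' s''"
proof -
  have *: "(cstep x ^^ (t + i)) (c, s) = (cstep x ^^ i) (c', s')" for i
    using assms(1) by (simp add: reaches_def funpow_add add.commute[of t])
  have "okp (snd ((cstep x ^^ i) (c, s)))" if "i \<le> t + t'" for i
    using assms *[of "i - t"] that by (cases "i \<le> t") (auto simp: reaches_def)
  moreover have "fst ((cstep x ^^ i) (c, s)) \<noteq> TSkip" if "i < t + t'" for i
    using assms *[of "i - t"] that by (cases "i < t") (auto simp: reaches_def)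
  ultimately show ?thesis using assms * by (simp add: reaches_def)
qed

lemma reaches_seq:
  assumes "reaches x okp c s t c' s'"
  shows "reaches x okp (TSeq c d) s t (TSeq c' d) s'"
  using assms steps_seq[of t x c s _ d] unfolding reaches_def by auto

lemma reaches_step:
  assumes "okp s" and "okp s'" and "c \<noteq> TSkip" and "cstep x (c, s) = (c', s')"
  shows "reaches x okp c s 1 c' s'"
  using assms by (auto simp: reaches_def le_Suc_eq)

lemma bs_reaches:
  assumes "bs x okp c s t s'" and okp: "okp = ok x K S sw sc"
  shows "reaches x okp c s t TSkip s'"
  using assms(1)
proof (induction rule: bs.induct)
  case (bs_skip s)
  then show ?case by (simp add: reaches_def)
next
  case (bs_act s f)
  then show ?case by (intro reaches_step) (auto simp: cstep_def)
next
  case (bs_seq c1 s t s' c2 t' s'')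
  have "okp s'" using bs_seq bs_ok by blast
  then have "reaches x okp (TSeq TSkip c2) s' 1 c2 s'"
    using app_noop okp by (intro reaches_step) (auto simp: cstep_def)
  then show ?case using reaches_trans[OF reaches_trans[OF reaches_seq]] bs_seq by blast
next
  case (bs_ifT s b c1 t s' c2)
  then have "reaches x okp (TIf b c1 c2) s 1 c1 s"
    using app_noop okp by (intro reaches_step) (auto simp: cstep_def)
  then show ?case using bs_ifT reaches_trans by (metis add.commute)
next
  case (bs_ifF s b c2 t s' c1)
  then have "reaches x okp (TIf b c1 c2) s 1 c2 s"
    using app_noop okp by (intro reaches_step) (auto simp: cstep_def)
  then show ?case using bs_ifF reaches_trans by (metis add.commute)
next
  case (bs_whileF s b c)
  then show ?case using app_noop okp by (intro reaches_step) (auto simp: cstep_def)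
next
  case (bs_whileT s b c t s')
  then have "reaches x okp (TWhile b c) s 1 (TSeq c (TWhile b c)) s"
    using app_noop okp by (intro reaches_step) (auto simp: cstep_def)
  then show ?case using bs_whileT reaches_trans by (metis add.commute)
qed

section \<open>Compilation of structured programs to machines\<close>

fun resid :: "tm \<Rightarrow> tm set" where
  "resid TSkip = {TSkip}"
| "resid (TAct f) = {TAct f, TSkip}"
| "resid (TSeq c1 c2) = (\<lambda>r. TSeq r c2) ` resid c1 \<union> resid c2"
| "resid (TIf b c1 c2) = {TIf b c1 c2} \<union> resid c1 \<union> resid c2"
| "resid (TWhile b c) = {TWhile b c, TSkip} \<union> (\<lambda>r. TSeq r (TWhile b c)) ` resid c"

lemma resid_basic: "finite (resid c)" "c \<in> resid c" "TSkip \<in> resid c"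
  by (induction c) auto

lemma resid_closed: "c' \<in> resid c \<Longrightarrow> fst (tstep c' v) \<in> resid c"
proof (induction c arbitrary: c')
  case (TSeq c1 c2)
  show ?case
  proof (cases "c' \<in> resid c2")
    case False
    then obtain r where r: "c' = TSeq r c2" "r \<in> resid c1" using TSeq by auto
    show ?thesis using r TSeq.IH(1)[of r] resid_basic(2)[of c2] by auto
  qed (use TSeq in auto)
next
  case (TIf b c1 c2)
  then show ?case using resid_basic(2) by auto
next
  case (TWhile b c)
  then show ?case using resid_basic(2)[of c] by (auto split: if_splits)
qed auto

text \<open>The empty list stands for the blank and has to become symbol 0; all other symbols are
  shifted away from it.\<close>

definition enc_sym :: "nat list \<Rightarrow> nat" where
  "enc_sym g = (if g = [] then 0 else Suc (to_nat g))"

lemma inj_enc_sym: "inj enc_sym"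
  by (auto simp: inj_on_def enc_sym_def split: if_splits)

text \<open>States are the pairs of a residual program and a register value, finitely many by
  \<open>resid_basic\<close>; the machine then simulates \<open>cstep\<close> step for step. It
  depends on the program, the alphabet and the register bound alone, so one machine serves all
  inputs, tapes and space bounds.\<close>

theorem machine_of_program:
  fixes c :: tm and K :: nat and S :: "nat list set"
  assumes "finite S" and "[] \<in> S" and "0 < K"
  shows "\<exists>M. wf_machine M \<and> (\<forall>x \<tau> sw sc t i T w C p ot.
    bs x (ok x K S sw sc) c (0, 0, (\<lambda>_. []), 0, \<tau>, 0, []) t (0, i, T, w, C, p, ot) \<longrightarrow>
    (\<forall>t'. work_pos (run M x \<tau> t') < sw \<and> cat_pos (run M x \<tau> t') < sc) \<and>
    state (run M x \<tau> t) = halt_state M \<and> out_tape (run M x \<tau> t) = ot \<and> cat_tape (run M x \<tau> t) = C)"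
proof -
  define Q where "Q = resid c \<times> {..<K}"
  have finQ: "finite Q" by (simp add: Q_def resid_basic)
  obtain enc :: "tm \<times> nat \<Rightarrow> nat" and nq where enc: "enc ` Q = {i. i < nq}" "inj_on enc Q"
    using finite_imp_inj_to_nat_seg[OF finQ] by metis
  define dec where "dec = inv_into Q enc"
  have dec: "dec (enc p) = p" if "p \<in> Q" for p using that enc(2) by (simp add: dec_def)
  \<comment> \<open>Outside \<open>Q\<close> the code falls back to a legal state: well-formedness
    also concerns transitions that no run ever takes.\<close>
  define enc' where "enc' p = enc (if p \<in> Q then p else (c, 0))" for p
  define decS where "decS = inv_into UNIV enc_sym"
  have decS: "decS (enc_sym g) = g" for g using inj_enc_sym by (simp add: decS_def)
  define encS' where "encS' g = enc_sym (if g \<in> S then g else [])" for g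
  define tr where "tr q a g b = (case tstep (fst (dec q)) (snd (dec q), a, decS g, b) of
      (c', r', im, g', wm, b', cm, em) \<Rightarrow>
      \<lparr>next_state = enc' (c', r'), input_move = im, work_write = encS' g', work_move = wm,
       cat_write = b', cat_move = cm, emit = em\<rparr>)" for q a g b
  define M where "M = \<lparr>num_states = nq, num_symbols = Suc (Max (enc_sym ` S)),
     start_state = enc (c, 0), halt_state = enc (TSkip, 0), transition = tr\<rparr>"
  have cQ: "(c, 0) \<in> Q" "(TSkip, 0) \<in> Q" using assms by (auto simp: Q_def resid_basic)
  have lt: "enc p < nq" if "p \<in> Q" for p using that enc(1) by blast
  have ltS: "enc_sym g < Suc (Max (enc_sym ` S))" if "g \<in> S" for g
    using that assms(1) by (simp add: less_Suc_eq_le)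
  have wf: "wf_machine M"
    using cQ assms
    by (auto simp: wf_machine_def M_def tr_def enc'_def encS'_def split: prod.split intro!: lt ltS)
  define conc :: "tm \<times> acfg \<Rightarrow> config" where
    "conc = (\<lambda>(d, (r, i, T, w, C, p, ot)). \<lparr>state = enc (d, r), input_pos = i,
       work_tape = enc_sym \<circ> T, work_pos = w, cat_tape = C, cat_pos = p, out_tape = ot\<rparr>)"
  have sim: "step M x (conc ds) = conc (cstep x ds)"
    if "ok x K S sw sc (snd ds)" "ok x K S sw sc (snd (cstep x ds))" "fst ds \<in> resid c"
    for x ds sw sc
  proof -
    obtain d s0 where ds0: "ds = (d, s0)" by (rule prod.exhaust)
    obtain r i T w C p ot where "s0 = (r, i, T, w, C, p, ot)" by (rule prod_cases7)
    with ds0 have ds: "ds = (d, (r, i, T, w, C, p, ot))" by simp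
    have inQ: "(d, r) \<in> Q" using that by (simp add: ds Q_def)
    show ?thesis
    proof (cases "(d, r) = (TSkip, 0)")
      case True
      then have "cstep x ds = ds" using app_noop[OF that(1)] ds by (auto simp: cstep_def)
      then show ?thesis using True by (simp add: ds conc_def step_def M_def)
    next
      case False
      then have ne: "enc (d, r) \<noteq> enc (TSkip, 0)" using inQ cQ enc(2) by (auto dest: inj_onD)
      obtain c' e where e: "tstep d (r, read_input x i, T w, C ! p) = (c', e)" by (rule prod.exhaust)
      obtain r' im g' wm b' cm em where "e = (r', im, g', wm, b', cm, em)" by (rule prod_cases7)
      with e have st: "tstep d (r, read_input x i, T w, C ! p) = (c', r', im, g', wm, b', cm, em)"
        by simp
      have "c' \<in> resid c"
        using resid_closed[of d c "(r, read_input x i, T w, C ! p)"] that(3) st by (simp add: ds)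
      moreover have "r' < K" "g' \<in> S"
        using that(2) by (auto simp: ds cstep_def st dest: spec[of _ w])
      ultimately have "(c', r') \<in> Q" by (simp add: Q_def)
      then show ?thesis using ne inQ \<open>g' \<in> S\<close>
        by (auto simp: ds conc_def step_def M_def tr_def dec decS cstep_def st enc'_def encS'_def Let_def)
    qed
  qed
  have main: "(\<forall>t'. work_pos (run M x \<tau> t') < sw \<and> cat_pos (run M x \<tau> t') < sc) \<and>
    state (run M x \<tau> t) = halt_state M \<and> out_tape (run M x \<tau> t) = ot \<and> cat_tape (run M x \<tau> t) = C"
    if b: "bs x (ok x K S sw sc) c (0, 0, (\<lambda>_. []), 0, \<tau>, 0, []) t (0, i, T, w, C, p, ot)"
    for x \<tau> sw sc t i T w C p ot
  proof -
    let ?s = "(0, 0, (\<lambda>_. []), 0, \<tau>, 0, []) :: acfg"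
    let ?s' = "(0, i, T, w, C, p, ot) :: acfg"
    let ?ok = "ok x K S sw sc"
    have re: "reaches x ?ok c ?s t TSkip ?s'" using bs_reaches[OF b refl] .
    \<comment> \<open>After halting nothing moves any more, which extends the space bound to all
      times beyond \<open>t\<close>.\<close>
    have fixp: "(cstep x ^^ j) (TSkip, ?s') = (TSkip, ?s')" for j
    proof (induction j)
      case (Suc j)
      have "app x (noop (view_of x ?s')) ?s' = ?s'"
        using re by (intro app_noop[of _ K S sw sc]) (auto simp: reaches_def)
      then have "cstep x (TSkip, ?s') = (TSkip, ?s')" by (simp add: cstep_def)
      then show ?case using Suc by simp
    qed simp
    have okall: "?ok (snd ((cstep x ^^ j) (c, ?s)))" for j
    proof (cases "j \<le> t")
      case False
      then have "j = j - t + t" by simp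
      then have "(cstep x ^^ j) (c, ?s) = (cstep x ^^ (j - t)) ((cstep x ^^ t) (c, ?s))"
        using fun_cong[OF funpow_add[of "j - t" t "cstep x"], of "(c, ?s)"] by simp
      moreover have t: "(cstep x ^^ t) (c, ?s) = (TSkip, ?s')" using re by (simp add: reaches_def)
      ultimately have "(cstep x ^^ j) (c, ?s) = (TSkip, ?s')" using fixp[of "j - t"] by simp
      moreover have "?ok (snd ((cstep x ^^ t) (c, ?s)))"
        using re unfolding reaches_def by (elim conjE allE[of _ t]) (rule mp, assumption, simp)
      ultimately show ?thesis by (simp only: t)
    qed (use re in \<open>auto simp: reaches_def\<close>)
    have rc: "fst ((cstep x ^^ j) (c, ?s)) \<in> resid c" for j
      by (induction j) (auto simp: resid_basic cstep_def intro: resid_closed)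
    have init: "initial M \<tau> = conc (c, ?s)"
      by (auto simp: initial_def M_def conc_def enc_sym_def fun_eq_iff)
    have R: "run M x \<tau> j = conc ((cstep x ^^ j) (c, ?s))" for j
    proof (induction j)
      case 0
      then show ?case by (simp add: run_def init)
    next
      case (Suc j)
      have "step M x (conc ((cstep x ^^ j) (c, ?s))) = conc ((cstep x ^^ Suc j) (c, ?s))"
        using sim[of x sw sc "(cstep x ^^ j) (c, ?s)"] okall[of j] okall[of "Suc j"] rc[of j] by simp
      then show ?case using Suc by (simp add: run_def)
    qed
    have bound: "work_pos (conc (d, s)) < sw \<and> cat_pos (conc (d, s)) < sc" if "?ok s" for d s
      using that by (cases s) (auto simp: conc_def)
    have "work_pos (run M x \<tau> j) < sw \<and> cat_pos (run M x \<tau> j) < sc" for j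
    proof -
      obtain d s where ds: "(cstep x ^^ j) (c, ?s) = (d, s)" by (rule prod.exhaust)
      then have "?ok s" using okall[of j] by simp
      then show ?thesis using bound ds R[of j] by simp
    qed
    moreover have "run M x \<tau> t = conc (TSkip, ?s')" using R re by (simp add: reaches_def)
    ultimately show ?thesis by (simp add: conc_def M_def)
  qed
  show ?thesis using wf main by blast
qed

section \<open>Sweeps over a multi-track work tape\<close>

text \<open>A work cell is a flag marking cell 0, followed by one base-\<open>d\<close> digit per variable; cell
  number \<open>i\<close> holds the digits of weight \<open>d ^ i\<close>.\<close>

definition digs :: "nat \<Rightarrow> nat \<Rightarrow> (nat \<Rightarrow> nat) \<Rightarrow> nat \<Rightarrow> nat list" where
  "digs d V st i = map (\<lambda>v. st v div d ^ i mod d) [0..<V]"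

definition tape :: "nat \<Rightarrow> nat \<Rightarrow> nat \<Rightarrow> (nat \<Rightarrow> nat) \<Rightarrow> nat \<Rightarrow> nat list" where
  "tape d V L st i = (if i < L then (if i = 0 then 1 else 0) # digs d V st i else [])"

lemma tape_lt: "i < L \<Longrightarrow> tape d V L st i = (if i = 0 then 1 else 0) # digs d V st i"
  and tape_end: "tape d V L st L = []"
  by (simp_all add: tape_def)

text \<open>One alphabet has to serve two bases: words are in base 2 while the space is being marked
  off and in base \<open>D\<close> afterwards.\<close>

definition syms :: "nat \<Rightarrow> nat \<Rightarrow> nat list set" where
  "syms D V = insert [] ((\<lambda>(f, ds). f # ds) ` ({..<2} \<times> {ds. set ds \<subseteq> {..<D} \<and> length ds = V}))"

lemma finite_syms: "finite (syms D V)"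
  by (simp add: syms_def finite_lists_length_eq)

lemma tape_in_syms: "0 < d \<Longrightarrow> d \<le> D \<Longrightarrow> tape d V L st i \<in> syms D V"
  by (auto simp: syms_def tape_def digs_def image_iff intro!: less_le_trans[OF mod_less_divisor])

lemma digs_upd: "v < V \<Longrightarrow> digs d V (st(v := z)) i = (digs d V st i)[v := z div d ^ i mod d]"
  by (auto simp: digs_def intro!: nth_equalityI simp: nth_list_update)

lemma digs_nth: "v < V \<Longrightarrow> digs d V st i ! v = st v div d ^ i mod d"
  by (simp add: digs_def)

lemma digs_length [simp]: "length (digs d V st i) = V"
  by (simp add: digs_def)

lemma bs_actI:
  "okp s \<Longrightarrow> s' = app x (f (view_of x s)) s \<Longrightarrow> okp s' \<Longrightarrow> bs x okp (TAct f) s 1 s'"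
  using bs_act by blast

section \<open>Running a finite transducer over the digits of all words\<close>

definition rloop :: "(nat \<Rightarrow> nat list \<Rightarrow> nat \<times> nat list) \<Rightarrow> tm" where
  "rloop \<delta> = TWhile (\<lambda>(r, a, g, b). g \<noteq> [])
     (TAct (\<lambda>(r, a, g, b). (fst (\<delta> r (tl g)), Stay, hd g # snd (\<delta> r (tl g)), MoveRight, b, Stay, None)))"

definition goleft :: tm where
  "goleft = TAct (\<lambda>(r, a, g, b). (r, Stay, g, MoveLeft, b, Stay, None))"

definition lloop :: tm where
  "lloop = TWhile (\<lambda>(r, a, g, b). hd g = 0) goleft"

definition setr :: "nat \<Rightarrow> tm" where
  "setr q = TAct (\<lambda>(r, a, g, b). (q, Stay, g, Stay, b, Stay, None))"

definition sweep :: "nat \<Rightarrow> (nat \<Rightarrow> nat list \<Rightarrow> nat \<times> nat list) \<Rightarrow> tm" where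
  "sweep q \<delta> = TSeq (setr q) (TSeq (rloop \<delta>) (TSeq goleft lloop))"

text \<open>Left of the head the tape is already the new one \<open>A'\<close>, from the head on it
  is still \<open>A\<close>; the induction is on the distance to the blank at
  \<open>L\<close>.\<close>

lemma bs_rloop:
  assumes step: "\<And>j. j < L \<Longrightarrow> A j = f j # a j \<and> A' j = f j # a' j \<and> \<delta> (Q j) (a j) = (Q (Suc j), a' j)"
    and blank: "A L = []"
    and bnd: "\<And>j. j \<le> L \<Longrightarrow> Q j < K" "\<And>j. A j \<in> S" "\<And>j. A' j \<in> S" "L < sw" "ip \<le> length x + 1" "p < sc"
    and "i \<le> L"
  shows "\<exists>t \<le> 4 * (L - i) + 1. bs x (ok x K S sw sc) (rloop \<delta>)
    (Q i, ip, (\<lambda>j. if j < i then A' j else A j), i, C, p, ot) t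
    (Q L, ip, (\<lambda>j. if j < L then A' j else A j), L, C, p, ot)"
  using \<open>i \<le> L\<close>
proof (induction "L - i" arbitrary: i)
  case 0
  then have "i = L" by simp
  then show ?case using blank bnd unfolding rloop_def \<open>i = L\<close>
    by (intro exI[of _ 1] conjI bs_whileF) auto
next
  case (Suc m)
  then have i: "i < L" by simp
  let ?ok = "ok x K S sw sc"
  let ?s = "\<lambda>i. (Q i, ip, (\<lambda>j. if j < i then A' j else A j), i, C, p, ot)"
  obtain t where t: "t \<le> 4 * (L - Suc i) + 1" "bs x ?ok (rloop \<delta>) (?s (Suc i)) t (?s L)"
  proof -
    have "m = L - Suc i" using Suc.hyps(2) by linarith
    then show thesis using Suc.hyps(1)[of "Suc i"] i that by auto
  qed
  have ok: "?ok (?s j)" if "j \<le> L" for j using bnd that by auto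
  have upd: "(\<lambda>j. if j < i then A' j else A j)(i := A' i) = (\<lambda>j. if j < Suc i then A' j else A j)"
    by (auto simp: fun_eq_iff less_Suc_eq)
  have "bs x ?ok (TAct (\<lambda>(r, a, g, b). (fst (\<delta> r (tl g)), Stay, hd g # snd (\<delta> r (tl g)),
      MoveRight, b, Stay, None))) (?s i) 1 (?s (Suc i))"
    using step[OF i] ok[of i] ok[of "Suc i"] i bnd(5)
    by (intro bs_actI) (auto simp: upd[symmetric])
  then have "bs x ?ok (rloop \<delta>) (?s i) (1 + 1 + t + 1) (?s L)"
    unfolding rloop_def using t(2) step[OF i] ok[of i] i
    by (intro bs_whileT bs_seq) (auto simp: rloop_def)
  then show ?case using t(1) i by (intro exI[of _ "1 + 1 + t + 1"]) auto
qed

lemma bs_goleft: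
  assumes "ok x K S sw sc (r, ip, T, i, C, p, ot)"
  shows "bs x (ok x K S sw sc) goleft (r, ip, T, i, C, p, ot) 1 (r, ip, T, i - 1, C, p, ot)"
  using assms unfolding goleft_def by (intro bs_actI) (auto simp: fun_eq_iff)

lemma bs_lloop:
  assumes "hd (T 0) \<noteq> 0" and "\<And>j. 0 < j \<Longrightarrow> j \<le> i \<Longrightarrow> hd (T j) = 0"
    and "ok x K S sw sc (r, ip, T, i, C, p, ot)"
  shows "\<exists>t \<le> 4 * i + 1. bs x (ok x K S sw sc) lloop (r, ip, T, i, C, p, ot) t (r, ip, T, 0, C, p, ot)"
  using assms(2,3)
proof (induction i)
  case 0
  then show ?case using assms(1) unfolding lloop_def by (intro exI[of _ 1] conjI bs_whileF) auto
next
  case (Suc i)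
  then obtain t where t: "t \<le> 4 * i + 1"
    "bs x (ok x K S sw sc) lloop (r, ip, T, i, C, p, ot) t (r, ip, T, 0, C, p, ot)" by auto
  have "bs x (ok x K S sw sc) lloop (r, ip, T, Suc i, C, p, ot) (1 + 1 + t + 1) (r, ip, T, 0, C, p, ot)"
    unfolding lloop_def using Suc.prems t(2) bs_goleft[OF Suc.prems(2)]
    by (intro bs_whileT bs_seq) (auto simp: lloop_def)
  then show ?case using t(1) by (intro exI[of _ "1 + 1 + t + 1"]) auto
qed

lemma bs_setr:
  assumes "ok x K S sw sc (r, ip, T, i, C, p, ot)" and "q < K"
  shows "bs x (ok x K S sw sc) (setr q) (r, ip, T, i, C, p, ot) 1 (q, ip, T, i, C, p, ot)"
  using assms unfolding setr_def by (intro bs_actI) (auto simp: fun_eq_iff)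

text \<open>The register ends as \<open>Q L\<close>, the final state of the transducer. This is how
  the outcome of a comparison leaves a sweep.\<close>

lemma bs_sweep:
  assumes Q: "Q 0 = q" "\<And>j. j \<le> L \<Longrightarrow> Q j < 3"
    and step: "\<And>j. j < L \<Longrightarrow> \<delta> (Q j) (digs d V st j) = (Q (Suc j), digs d V st' j)"
    and dims: "0 < L" "L < sw" "0 < d" "d \<le> D"
    and "r < 3" "ip \<le> length x + 1" "p < sc"
  shows "\<exists>t \<le> 8 * L + 10. bs x (ok x 3 (syms D V) sw sc) (sweep q \<delta>)
    (r, ip, tape d V L st, 0, C, p, ot) t (Q L, ip, tape d V L st', 0, C, p, ot)"
proof -
  let ?ok = "ok x 3 (syms D V) sw sc"
  have in_s: "tape d V L st j \<in> syms D V" for st j using dims by (intro tape_in_syms)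
  have "\<exists>t \<le> 4 * (L - 0) + 1. bs x ?ok (rloop \<delta>)
     (Q 0, ip, (\<lambda>j. if j < 0 then tape d V L st' j else tape d V L st j), 0, C, p, ot) t
     (Q L, ip, (\<lambda>j. if j < L then tape d V L st' j else tape d V L st j), L, C, p, ot)"
    by (rule bs_rloop[where f = "\<lambda>j. if j = 0 then 1 else 0" and a = "digs d V st" and a' = "digs d V st'"])
      (use step assms in_s in \<open>auto simp: tape_lt tape_end\<close>)
  then obtain t1 where t1: "t1 \<le> 4 * L + 1" "bs x ?ok (rloop \<delta>) (Q 0, ip, tape d V L st, 0, C, p, ot) t1
    (Q L, ip, (\<lambda>j. if j < L then tape d V L st' j else tape d V L st j), L, C, p, ot)"
    by auto
  have "(\<lambda>j. if j < L then tape d V L st' j else tape d V L st j) = tape d V L st'"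
    by (auto simp: tape_def)
  note t1 = t1[unfolded this]
  have ok: "?ok (q', ip, tape d V L st', i, C, p, ot)" if "q' < 3" "i \<le> L" for q' i
    using assms in_s that by auto
  have "\<exists>t \<le> 4 * (L - 1) + 1. bs x ?ok lloop (Q L, ip, tape d V L st', L - 1, C, p, ot) t
    (Q L, ip, tape d V L st', 0, C, p, ot)"
  proof (rule bs_lloop)
    show "?ok (Q L, ip, tape d V L st', L - 1, C, p, ot)" using Q by (intro ok) auto
  qed (use dims in \<open>auto simp: tape_lt\<close>)
  then obtain t2 where t2: "t2 \<le> 4 * (L - 1) + 1" "bs x ?ok lloop (Q L, ip, tape d V L st', L - 1, C, p, ot) t2
    (Q L, ip, tape d V L st', 0, C, p, ot)" by blast
  have "bs x ?ok (setr q) (r, ip, tape d V L st, 0, C, p, ot) 1 (Q 0, ip, tape d V L st, 0, C, p, ot)"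
    using bs_setr[of x 3 "syms D V" sw sc r ip "tape d V L st" 0 C p ot q] assms in_s Q(2)[of 0] by auto
  then have "bs x ?ok (sweep q \<delta>) (r, ip, tape d V L st, 0, C, p, ot) (1 + 1 + (t1 + 1 + (1 + 1 + t2)))
     (Q L, ip, tape d V L st', 0, C, p, ot)"
    unfolding sweep_def using t1(2) t2(2) bs_goleft[OF ok[of "Q L" L]] Q
    by (intro bs_seq) auto
  then show ?thesis using t1(1) t2(1)
    by (intro exI[of _ "1 + 1 + (t1 + 1 + (1 + 1 + t2))"]) auto
qed

subsection \<open>Arithmetic by sweeps\<close>

lemma digit_mod: "i < L \<Longrightarrow> (y mod d ^ L) div d ^ i mod d = y div d ^ i mod (d :: nat)"
proof -
  assume "i < L"
  then obtain k where L: "L = i + Suc k" using less_iff_Suc_add by auto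
  have "y mod d ^ L div d ^ i = y div d ^ i mod d ^ Suc k"
    by (simp only: L power_add mod_mult2_eq) (cases "d = 0"; simp)
  then show ?thesis by (simp add: mod_mod_cancel)
qed

text \<open>The same digit is written everywhere: 0 yields the number 0, the largest digit yields
  the largest word.\<close>

definition zero_step :: "nat \<Rightarrow> nat \<Rightarrow> nat \<Rightarrow> nat list \<Rightarrow> nat \<times> nat list" where
  "zero_step z v r ds = (r, ds[v := z])"

definition copy_step :: "nat \<Rightarrow> nat \<Rightarrow> nat \<Rightarrow> nat list \<Rightarrow> nat \<times> nat list" where
  "copy_step u v r ds = (r, ds[u := ds ! v])"

text \<open>Register value 1 is the pending carry; a sweep for an increment therefore starts with
  1.\<close>

definition inc_step :: "nat \<Rightarrow> nat \<Rightarrow> nat \<Rightarrow> nat list \<Rightarrow> nat \<times> nat list" where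
  "inc_step d v r ds = (if r = 1 then if ds ! v + 1 = d then (1, ds[v := 0]) else (0, ds[v := ds ! v + 1])
     else (0, ds))"

definition cmp_step :: "nat \<Rightarrow> nat \<Rightarrow> nat \<Rightarrow> nat list \<Rightarrow> nat \<times> nat list" where
  "cmp_step u v r ds = (if ds ! u < ds ! v then 1 else if ds ! v < ds ! u then 2 else r, ds)"

definition cmpv :: "nat \<Rightarrow> nat \<Rightarrow> nat" where
  "cmpv a b = (if a < b then 1 else if a = b then 0 else 2)"

lemma div_add_mult: "a < b \<Longrightarrow> (a + q * b) div b = (q :: nat)"
  by simp

text \<open>The carry into position \<open>i\<close> when 1 is added to \<open>y\<close>: it arrives
  there exactly if all lower digits roll over.\<close>

definition carry :: "nat \<Rightarrow> nat \<Rightarrow> nat \<Rightarrow> nat" where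
  "carry d y i = (if (y + 1) mod d ^ i = 0 then 1 else 0)"

lemma inc_digit:
  fixes y d :: nat
  assumes "0 < d"
  shows "carry d y i = 1 \<Longrightarrow> y div d ^ i mod d + 1 = d \<Longrightarrow> (y + 1) div d ^ i mod d = 0 \<and> carry d y (Suc i) = 1"
    and "carry d y i = 1 \<Longrightarrow> y div d ^ i mod d + 1 \<noteq> d \<Longrightarrow>
       (y + 1) div d ^ i mod d = y div d ^ i mod d + 1 \<and> carry d y (Suc i) = 0"
    and "carry d y i \<noteq> 1 \<Longrightarrow> (y + 1) div d ^ i mod d = y div d ^ i mod d \<and> carry d y (Suc i) = 0"
proof -
  have pos: "0 < d ^ i" using assms by simp
  have c1: "\<exists>m. y + 1 = (m + 1) * d ^ i \<and> y div d ^ i = m \<and> (y + 1) div d ^ i = m + 1 \<and>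
      (carry d y (Suc i) = 1 \<longleftrightarrow> (m + 1) mod d = 0)" if "carry d y i = 1"
  proof -
    have "d ^ i dvd y + 1" using that by (auto simp: carry_def split: if_splits)
    then obtain k where k: "y + 1 = k * d ^ i" by (metis dvd_def mult.commute)
    then have "k > 0" by (cases k) auto
    define m where "m = k - 1"
    have m: "y + 1 = (m + 1) * d ^ i" using k \<open>k > 0\<close> by (simp add: m_def)
    have "y + 1 = m * d ^ i + d ^ i" unfolding m by simp
    then have y: "y = (d ^ i - 1) + m * d ^ i" using pos by linarith
    have "y div d ^ i = m" unfolding y using pos by (intro div_add_mult) simp
    moreover have "(y + 1) div d ^ i = m + 1" unfolding m using pos by simp
    moreover have "(y + 1) mod d ^ Suc i = 0 \<longleftrightarrow> (m + 1) mod d = 0"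
      using pos assms by (simp only: m power_Suc mod_mult_mult2) auto
    ultimately show ?thesis using m by (auto simp: carry_def)
  qed
  have c01: "carry d y j = 0 \<or> carry d y j = 1" for j by (simp add: carry_def)
  show "carry d y i = 1 \<Longrightarrow> y div d ^ i mod d + 1 = d \<Longrightarrow> (y + 1) div d ^ i mod d = 0 \<and> carry d y (Suc i) = 1"
  proof -
    assume ci: "carry d y i = 1" and eq: "y div d ^ i mod d + 1 = d"
    obtain m where m: "y div d ^ i = m" "(y + 1) div d ^ i = m + 1"
      "carry d y (Suc i) = 1 \<longleftrightarrow> (m + 1) mod d = 0" using c1[OF ci] by metis
    have "(m + 1) mod d = 0" using eq m(1) by (simp add: mod_Suc)
    then show ?thesis using m by simp
  qed
  show "carry d y i = 1 \<Longrightarrow> y div d ^ i mod d + 1 \<noteq> d \<Longrightarrow>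
       (y + 1) div d ^ i mod d = y div d ^ i mod d + 1 \<and> carry d y (Suc i) = 0"
  proof -
    assume ci: "carry d y i = 1" and ne: "y div d ^ i mod d + 1 \<noteq> d"
    obtain m where m: "y div d ^ i = m" "(y + 1) div d ^ i = m + 1"
      "carry d y (Suc i) = 1 \<longleftrightarrow> (m + 1) mod d = 0" using c1[OF ci] by metis
    have "m mod d < d" using assms by simp
    then have "(m + 1) mod d = m mod d + 1" using ne m(1) by (simp add: mod_Suc)
    then show ?thesis using m c01[of "Suc i"] by auto
  qed
  show "carry d y i \<noteq> 1 \<Longrightarrow> (y + 1) div d ^ i mod d = y div d ^ i mod d \<and> carry d y (Suc i) = 0"
  proof -
    assume ci: "carry d y i \<noteq> 1"
    then have nd: "(y + 1) mod d ^ i \<noteq> 0" by (auto simp: carry_def split: if_splits)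
    then have "(y + 1) div d ^ i = y div d ^ i" by (simp add: div_Suc)
    moreover have "(y + 1) mod d ^ Suc i \<noteq> 0"
      using nd by (metis dvd_mult_left mod_eq_0_iff_dvd power_Suc2)
    ultimately show ?thesis by (simp add: carry_def)
  qed
qed

text \<open>The carry out of the last cell is dropped, whence the reduction modulo
  \<open>d ^ L\<close>.\<close>

lemma inc_step_digs:
  fixes st :: "nat \<Rightarrow> nat"
  assumes "v < V" "0 < d" "j < L"
  shows "inc_step d v (carry d (st v) j) (digs d V st j) = (carry d (st v) (Suc j), digs d V (st(v := (st v + 1) mod d ^ L)) j)"
proof -
  have u: "digs d V (st(v := (st v + 1) mod d ^ L)) j = (digs d V st j)[v := (st v + 1) div d ^ j mod d]"
    using assms by (simp add: digs_upd digit_mod del: add_0_right One_nat_def Suc_eq_plus1)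
  have n: "digs d V st j ! v = st v div d ^ j mod d" using assms by (simp add: digs_nth)
  have i: "(digs d V st j)[v := st v div d ^ j mod d] = digs d V st j"
    using list_update_id[of "digs d V st j" v] by (simp only: n)
  note * = inc_digit[OF assms(2), where y = "st v" and i = j]
  consider "carry d (st v) j = 1" "st v div d ^ j mod d + 1 = d" | "carry d (st v) j = 1" "st v div d ^ j mod d + 1 \<noteq> d" | "carry d (st v) j \<noteq> 1"
    by blast
  then show ?thesis
  proof cases
    case 1
    then show ?thesis using *(1) unfolding inc_step_def u n by simp
  next
    case 2
    then show ?thesis using *(2) unfolding inc_step_def u n by simp
  next
    case 3
    then show ?thesis using *(3) i unfolding inc_step_def u n by simp
  qed
qed

text \<open>Digits arrive least significant first, so a later difference overrides earlier ones.
  After \<open>j\<close> digits the register compares the residues modulo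
  \<open>d ^ j\<close>.\<close>

lemma cmp_step_digs:
  assumes "u < V" "v < V" "0 < d"
  shows "cmp_step u v (cmpv (st u mod d ^ j) (st v mod d ^ j)) (digs d V st j) =
    (cmpv (st u mod d ^ Suc j) (st v mod d ^ Suc j), digs d V st j)"
proof -
  have e: "y mod d ^ Suc j = d ^ j * (y div d ^ j mod d) + y mod d ^ j" for y
    by (metis mod_mult2_eq mult.commute power_Suc)
  have l: "d ^ j * a + a' < d ^ j * b + b'" if "a < b" "a' < d ^ j" for a a' b b'
  proof -
    have "d ^ j * a + a' < d ^ j * (a + 1)" using that by simp
    also have "\<dots> \<le> d ^ j * b" using that by (intro mult_left_mono) auto
    finally show ?thesis by simp
  qed
  have m: "y mod d ^ j < d ^ j" for y using assms by simp
  show ?thesis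
    using l[OF _ m, of "st u div d ^ j mod d" "st v div d ^ j mod d" "st u" "st v mod d ^ j"]
      l[OF _ m, of "st v div d ^ j mod d" "st u div d ^ j mod d" "st v" "st u mod d ^ j"]
    unfolding e by (auto simp: cmp_step_def cmpv_def digs_nth assms)
qed

lemma top_digit: "i < L \<Longrightarrow> 0 < d \<Longrightarrow> (d ^ L - 1) div d ^ i mod d = d - (1::nat)"
proof -
  assume "i < L" "0 < d"
  then obtain k where L: "L = i + Suc k" using less_iff_Suc_add by auto
  have p: "0 < d ^ i" "0 < d ^ k" using \<open>0 < d\<close> by auto
  have "d ^ L - 1 = (d ^ i - 1) + (d ^ Suc k - 1) * d ^ i"
    using p \<open>0 < d\<close> by (simp add: L power_add algebra_simps)
  then have "(d ^ L - 1) div d ^ i = d ^ Suc k - 1"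
    using div_add_mult[of "d ^ i - 1" "d ^ i" "d ^ Suc k - 1"] p by simp
  also have "\<dots> = (d - 1) + (d ^ k - 1) * d" using p \<open>0 < d\<close> by (simp add: algebra_simps)
  finally have "(d ^ L - 1) div d ^ i = (d - 1) + (d ^ k - 1) * d" .
  then show ?thesis using \<open>0 < d\<close> mod_mult_self1[of "d - 1" "d ^ k - 1" d] by simp
qed

section \<open>Word-level programs\<close>

type_synonym wst = "(nat \<Rightarrow> nat) \<times> nat \<times> bool list \<times> nat \<times> bool list"

fun conc :: "nat \<Rightarrow> nat \<Rightarrow> nat \<Rightarrow> nat \<Rightarrow> wst \<Rightarrow> acfg" where
  "conc D V L r (st, ip, C, cp, ot) = (r, ip, tape D V L st, 0, C, cp, ot)"

text \<open>The catalytic head may use \<open>D ^ L\<close> cells, so that addresses are exactly the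
  values of a word. One work cell beyond the \<open>L\<close> digits is visited as the terminating
  blank.\<close>

abbreviation okw :: "nat \<Rightarrow> nat \<Rightarrow> nat \<Rightarrow> bool list \<Rightarrow> acfg \<Rightarrow> bool" where
  "okw D V L x \<equiv> ok x 3 (syms D V) (L + 1) (D ^ L)"

text \<open>Between word-level instructions the register is scratch: arbitrary on entry, unspecified
  on exit. The time is only an upper bound.\<close>

definition rn :: "nat \<Rightarrow> nat \<Rightarrow> nat \<Rightarrow> bool list \<Rightarrow> tm \<Rightarrow> wst \<Rightarrow> nat \<Rightarrow> wst \<Rightarrow> bool" where
  "rn D V L x p \<sigma> t \<sigma>' \<longleftrightarrow> (\<forall>r<3. \<exists>t'\<le>t. \<exists>r'<3. bs x (okw D V L x) p (conc D V L r \<sigma>) t' (conc D V L r' \<sigma>'))"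

fun heads_ok :: "nat \<Rightarrow> bool list \<Rightarrow> wst \<Rightarrow> bool" where
  "heads_ok W x (st, ip, C, cp, ot) \<longleftrightarrow> ip \<le> length x + 1 \<and> cp < W"

fun setv :: "nat \<Rightarrow> nat \<Rightarrow> (nat \<Rightarrow> nat) \<times> 'a \<Rightarrow> (nat \<Rightarrow> nat) \<times> 'a" where
  "setv v y (st, c) = (st(v := y), c)"

abbreviation zerov :: "nat \<Rightarrow> tm" where "zerov v \<equiv> sweep 0 (zero_step 0 v)"
abbreviation topv :: "nat \<Rightarrow> nat \<Rightarrow> tm" where "topv D v \<equiv> sweep 0 (zero_step (D - 1) v)"
abbreviation copyv :: "nat \<Rightarrow> nat \<Rightarrow> tm" where "copyv u v \<equiv> sweep 0 (copy_step u v)"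
abbreviation incv :: "nat \<Rightarrow> nat \<Rightarrow> tm" where "incv D v \<equiv> sweep 1 (inc_step D v)"
abbreviation cmpw :: "nat \<Rightarrow> nat \<Rightarrow> tm" where "cmpw u v \<equiv> sweep 0 (cmp_step u v)"

definition ifcmp :: "nat \<Rightarrow> nat \<Rightarrow> nat \<Rightarrow> tm \<Rightarrow> tm \<Rightarrow> tm" where
  "ifcmp c u v p q = TSeq (cmpw u v) (TIf (\<lambda>(r, a, g, b). r = c) p q)"

definition lfor :: "nat \<Rightarrow> nat \<Rightarrow> nat \<Rightarrow> tm \<Rightarrow> tm" where
  "lfor D i b p = TSeq (zerov i) (TSeq (cmpw i b)
     (TWhile (\<lambda>(r, a, g, b). r = 1) (TSeq p (TSeq (incv D i) (cmpw i b)))))"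

definition head_act :: "move \<Rightarrow> bool \<Rightarrow> move \<Rightarrow> bool option \<Rightarrow> tm" where
  "head_act im fl cm em = TAct (\<lambda>(r, a, g, b). (r, im, g, Stay, b \<noteq> fl, cm, em))"

context
  fixes D V L :: nat and x :: "bool list"
  assumes D: "2 \<le> D" and L: "1 \<le> L"
begin

lemma okw_conc: "r < 3 \<Longrightarrow> heads_ok (D ^ L) x \<sigma> \<Longrightarrow> okw D V L x (conc D V L r \<sigma>)"
  using D tape_in_syms[of D D V L] by (cases \<sigma>) auto

lemma rn_sweep:
  assumes "Q 0 = q" "\<And>j. j \<le> L \<Longrightarrow> Q j < 3"
    and "\<And>j. j < L \<Longrightarrow> \<delta> (Q j) (digs D V st j) = (Q (Suc j), digs D V st' j)"
    and "heads_ok (D ^ L) x (st, c)"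
  shows "r < 3 \<Longrightarrow> \<exists>t\<le>8 * L + 10. bs x (okw D V L x) (sweep q \<delta>) (conc D V L r (st, c)) t (conc D V L (Q L) (st', c))"
    and "rn D V L x (sweep q \<delta>) (st, c) (8 * L + 10) (st', c)"
proof -
  obtain ip C cp ot where c: "c = (ip, C, cp, ot)" by (metis prod_cases4)
  show *: "\<exists>t\<le>8 * L + 10. bs x (okw D V L x) (sweep q \<delta>) (conc D V L r (st, c)) t (conc D V L (Q L) (st', c))"
    if "r < 3" for r
    using bs_sweep[of Q q L \<delta> D V st st' "L + 1" D r ip x cp "D ^ L" C ot] assms D L that
    by (auto simp: c)
  show "rn D V L x (sweep q \<delta>) (st, c) (8 * L + 10) (st', c)"
    using * assms(2)[of L] unfolding rn_def by fastforce
qed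

lemma rn_zerov:
  assumes "v < V" "heads_ok (D ^ L) x (st, c)"
  shows "rn D V L x (zerov v) (st, c) (8 * L + 10) (setv v 0 (st, c))"
  using rn_sweep(2)[of "\<lambda>_. 0" 0 "zero_step 0 v" st "st(v := 0)" c] assms
  by (auto simp: zero_step_def digs_upd)

lemma rn_topv:
  assumes "v < V" "heads_ok (D ^ L) x (st, c)"
  shows "rn D V L x (topv D v) (st, c) (8 * L + 10) (setv v (D ^ L - 1) (st, c))"
  using rn_sweep(2)[of "\<lambda>_. 0" 0 "zero_step (D - 1) v" st "st(v := D ^ L - 1)" c] assms top_digit[of _ L D] D
  by (auto simp: zero_step_def digs_upd)

lemma rn_copyv:
  assumes "u < V" "v < V" "heads_ok (D ^ L) x (st, c)"
  shows "rn D V L x (copyv u v) (st, c) (8 * L + 10) (setv u (st v) (st, c))"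
  using rn_sweep(2)[of "\<lambda>_. 0" 0 "copy_step u v" st "st(u := st v)" c] assms
  by (auto simp: copy_step_def digs_upd digs_nth)

lemma rn_incv:
  assumes "v < V" "heads_ok (D ^ L) x (st, c)"
  shows "rn D V L x (incv D v) (st, c) (8 * L + 10) (setv v ((st v + 1) mod D ^ L) (st, c))"
proof -
  have "carry D (st v) 0 = 1" "carry D (st v) j < 3" for j by (auto simp: carry_def)
  moreover have "inc_step D v (carry D (st v) j) (digs D V st j) =
      (carry D (st v) (Suc j), digs D V (st(v := (st v + 1) mod D ^ L)) j)" if "j < L" for j
    by (rule inc_step_digs) (use assms(1) that D in linarith)+
  ultimately show ?thesis
    using rn_sweep(2)[of "carry D (st v)" 1 "inc_step D v" st "st(v := (st v + 1) mod D ^ L)" c] assms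
    by simp
qed

lemma bs_cmpw:
  assumes "u < V" "v < V" "heads_ok (D ^ L) x (st, c)" "st u < D ^ L" "st v < D ^ L" "r < 3"
  shows "\<exists>t\<le>8 * L + 10. bs x (okw D V L x) (cmpw u v) (conc D V L r (st, c)) t
    (conc D V L (cmpv (st u) (st v)) (st, c))"
proof -
  let ?Q = "\<lambda>j. cmpv (st u mod D ^ j) (st v mod D ^ j)"
  have "?Q 0 = 0" "?Q j < 3" for j by (auto simp: cmpv_def)
  moreover have "cmp_step u v (?Q j) (digs D V st j) = (?Q (Suc j), digs D V st j)" for j
    by (rule cmp_step_digs) (use assms(1,2) D in linarith)+
  ultimately have "\<exists>t\<le>8 * L + 10. bs x (okw D V L x) (cmpw u v) (conc D V L r (st, c)) t (conc D V L (?Q L) (st, c))"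
    using assms(3,6) by (intro rn_sweep(1)) auto
  then show ?thesis using assms(4,5) by simp
qed

lemma rn_skip: "heads_ok (D ^ L) x \<sigma> \<Longrightarrow> rn D V L x TSkip \<sigma> 0 \<sigma>"
  unfolding rn_def by (meson bs_skip okw_conc order_refl)

lemma rn_mono: "rn D V L x p \<sigma> t \<sigma>' \<Longrightarrow> t \<le> t' \<Longrightarrow> rn D V L x p \<sigma> t' \<sigma>'"
  unfolding rn_def by (meson order_trans)

lemma rn_seq:
  assumes "rn D V L x p \<sigma> t \<sigma>'" and "rn D V L x q \<sigma>' t' \<sigma>''"
  shows "rn D V L x (TSeq p q) \<sigma> (t + t' + 1) \<sigma>''"
  unfolding rn_def
proof (intro allI impI)
  fix r :: nat assume "r < 3"
  then obtain t1 r1 where 1: "t1 \<le> t" "r1 < 3" "bs x (okw D V L x) p (conc D V L r \<sigma>) t1 (conc D V L r1 \<sigma>')"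
    using assms(1) unfolding rn_def by blast
  then obtain t2 r2 where 2: "t2 \<le> t'" "r2 < 3" "bs x (okw D V L x) q (conc D V L r1 \<sigma>') t2 (conc D V L r2 \<sigma>'')"
    using assms(2) unfolding rn_def by blast
  show "\<exists>ta\<le>t + t' + 1. \<exists>r'<3. bs x (okw D V L x) (TSeq p q) (conc D V L r \<sigma>) ta (conc D V L r' \<sigma>'')"
    using bs_seq[OF 1(3) 2(3)] 1 2 by (intro exI[of _ "t1 + 1 + t2"] exI[of _ r2] conjI) auto
qed

lemma rn_if:
  assumes "heads_ok (D ^ L) x \<sigma>"
    and "\<And>r. P (view_of x (conc D V L r \<sigma>)) = Q" and "Q \<Longrightarrow> rn D V L x p \<sigma> t \<sigma>'" and "\<not> Q \<Longrightarrow> rn D V L x q \<sigma> t \<sigma>'"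
  shows "rn D V L x (TIf P p q) \<sigma> (t + 1) \<sigma>'"
  unfolding rn_def
proof (intro allI impI)
  fix r :: nat assume r: "r < 3"
  note ok = okw_conc[OF r assms(1)]
  show "\<exists>t'\<le>t + 1. \<exists>r'<3. bs x (okw D V L x) (TIf P p q) (conc D V L r \<sigma>) t' (conc D V L r' \<sigma>')"
  proof (cases Q)
    case True
    then obtain t1 r1 where "t1 \<le> t" "r1 < 3" "bs x (okw D V L x) p (conc D V L r \<sigma>) t1 (conc D V L r1 \<sigma>')"
      using assms(3) r unfolding rn_def by blast
    then show ?thesis using bs_ifT[where b = P and okp = "okw D V L x", OF ok] True assms(2)
      by (intro exI[of _ "t1 + 1"] exI[of _ r1] conjI) auto
  next
    case False
    then obtain t1 r1 where "t1 \<le> t" "r1 < 3" "bs x (okw D V L x) q (conc D V L r \<sigma>) t1 (conc D V L r1 \<sigma>')"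
      using assms(4) r unfolding rn_def by blast
    then show ?thesis using bs_ifF[where b = P and okp = "okw D V L x", OF ok] False assms(2)
      by (intro exI[of _ "t1 + 1"] exI[of _ r1] conjI) auto
  qed
qed

lemma rn_ifcmp:
  assumes "u < V" "v < V" "heads_ok (D ^ L) x (st, d)" "st u < D ^ L" "st v < D ^ L"
    and "cmpv (st u) (st v) = c \<Longrightarrow> rn D V L x p (st, d) t \<sigma>'"
    and "cmpv (st u) (st v) \<noteq> c \<Longrightarrow> rn D V L x q (st, d) t \<sigma>'"
  shows "rn D V L x (ifcmp c u v p q) (st, d) (t + 8 * L + 12) \<sigma>'"
  unfolding rn_def ifcmp_def
proof (intro allI impI)
  fix r :: nat assume r: "r < 3"
  let ?r = "cmpv (st u) (st v)" and ?ok = "okw D V L x"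
  have r': "?r < 3" by (simp add: cmpv_def)
  obtain t1 where t1: "t1 \<le> 8 * L + 10" "bs x ?ok (cmpw u v) (conc D V L r (st, d)) t1 (conc D V L ?r (st, d))"
    using bs_cmpw[of u v st d r] assms r by blast
  note ok = okw_conc[OF r' assms(3)]
  obtain ip C cp ot where d: "d = (ip, C, cp, ot)" by (metis prod_cases4)
  have "\<exists>t2\<le>t + 1. \<exists>r'<3. bs x ?ok (TIf (\<lambda>(r, a, g, b). r = c) p q) (conc D V L ?r (st, d)) t2 (conc D V L r' \<sigma>')"
  proof (cases "?r = c")
    case True
    then obtain t1 r1 where "t1 \<le> t" "r1 < 3" "bs x ?ok p (conc D V L ?r (st, d)) t1 (conc D V L r1 \<sigma>')"
      using assms(6) r' unfolding rn_def by blast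
    then show ?thesis using bs_ifT[where b = "\<lambda>(r, a, g, b). r = c" and okp = ?ok, OF ok] True d
      by (intro exI[of _ "t1 + 1"] exI[of _ r1] conjI) auto
  next
    case False
    then obtain t1 r1 where "t1 \<le> t" "r1 < 3" "bs x ?ok q (conc D V L ?r (st, d)) t1 (conc D V L r1 \<sigma>')"
      using assms(7) r' unfolding rn_def by blast
    then show ?thesis using bs_ifF[where b = "\<lambda>(r, a, g, b). r = c" and okp = ?ok, OF ok] False d
      by (intro exI[of _ "t1 + 1"] exI[of _ r1] conjI) auto
  qed
  then obtain t2 r2 where 2: "t2 \<le> t + 1" "r2 < 3"
    "bs x ?ok (TIf (\<lambda>(r, a, g, b). r = c) p q) (conc D V L ?r (st, d)) t2 (conc D V L r2 \<sigma>')" by blast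
  show "\<exists>t'\<le>t + 8 * L + 12. \<exists>r'<3. bs x ?ok (TSeq (cmpw u v) (TIf (\<lambda>(r, a, g, b). r = c) p q))
     (conc D V L r (st, d)) t' (conc D V L r' \<sigma>')"
    using bs_seq[OF t1(2) 2(3)] t1(1) 2(1,2) by (intro exI[of _ "t1 + 1 + t2"] exI[of _ r2] conjI) auto
qed

text \<open>\<open>s k\<close> is the state at the head of round \<open>k\<close> and
  \<open>u k\<close> the state after its body. A round costs the body, two sweeps of at most
  \<open>8 * L + 10\<close> steps each for incrementing and comparing, and the control
  steps.\<close>

lemma rn_lfor:
  fixes s :: "nat \<Rightarrow> wst" and u :: "nat \<Rightarrow> wst"
  assumes iv: "i < V" "b < V" "i \<noteq> b" and m: "m < D ^ L"
    and s0: "s 0 = setv i 0 \<sigma>" and hok: "heads_ok (D ^ L) x \<sigma>"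
    and sk: "\<And>k. k \<le> m \<Longrightarrow> fst (s k) b = m \<and> fst (s k) i = k \<and> heads_ok (D ^ L) x (s k)"
    and uk: "\<And>k. k < m \<Longrightarrow> rn D V L x p (s k) t (u k) \<and> fst (u k) i = k \<and> fst (u k) b = m \<and>
        heads_ok (D ^ L) x (u k) \<and> s (Suc k) = setv i (Suc k) (u k)"
  shows "rn D V L x (lfor D i b p) \<sigma> ((m + 1) * (t + 16 * L + 25) + 16 * L + 30) (s m)"
proof -
  let ?ok = "okw D V L x"
  let ?body = "TSeq p (TSeq (incv D i) (cmpw i b))"
  let ?P = "\<lambda>(r::nat, a::input_symbol, g::nat list, b::bool). r = 1"
  have loop: "\<exists>t'\<le>(m - k) * (t + 16 * L + 25) + 1. bs x ?ok (TWhile ?P ?body) (conc D V L (cmpv k m) (s k)) t'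
     (conc D V L (cmpv m m) (s m))" if "k \<le> m" for k
    using that
  proof (induction "m - k" arbitrary: k)
    case 0
    then have "k = m" by simp
    have "?ok (conc D V L (cmpv m m) (s m))" using sk[of m] by (intro okw_conc) (auto simp: cmpv_def)
    then show ?case unfolding \<open>k = m\<close>
      by (intro exI[of _ 1] conjI bs_whileF) (cases "s m"; auto simp: cmpv_def)+
  next
    case (Suc n)
    then have k: "k < m" by simp
    have n: "n = m - Suc k" using Suc.hyps(2) by linarith
    obtain t1 where t1: "t1 \<le> (m - Suc k) * (t + 16 * L + 25) + 1" "bs x ?ok (TWhile ?P ?body)
       (conc D V L (cmpv (Suc k) m) (s (Suc k))) t1 (conc D V L (cmpv m m) (s m))"
      using Suc.hyps(1)[OF n] k by auto
    have c1: "cmpv k m = 1" using k by (simp add: cmpv_def)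
    obtain ta ra where a: "ta \<le> t" "ra < 3" "bs x ?ok p (conc D V L 1 (s k)) ta (conc D V L ra (u k))"
      using uk[OF k] unfolding rn_def by (metis one_less_numeral_iff semiring_norm(77))
    obtain su cu where u: "u k = (su, cu)" by (rule prod.exhaust)
    have sui: "su i = k" "su b = m" "heads_ok (D ^ L) x (su, cu)" using uk[OF k] u by auto
    have "rn D V L x (incv D i) (su, cu) (8 * L + 10) (setv i ((su i + 1) mod D ^ L) (su, cu))"
      using rn_incv iv sui by blast
    moreover have "setv i ((su i + 1) mod D ^ L) (su, cu) = s (Suc k)"
      using uk[OF k] u sui k m by simp
    ultimately obtain tb rb where bb: "tb \<le> 8 * L + 10" "rb < 3"
      "bs x ?ok (incv D i) (conc D V L ra (u k)) tb (conc D V L rb (s (Suc k)))"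
      using a(2) u unfolding rn_def by metis
    obtain ss cs where ss: "s (Suc k) = (ss, cs)" by (rule prod.exhaust)
    have ssi: "ss i = Suc k" "ss b = m" "heads_ok (D ^ L) x (ss, cs)" using sk[of "Suc k"] k ss by auto
    obtain tc where cc: "tc \<le> 8 * L + 10"
      "bs x ?ok (cmpw i b) (conc D V L rb (s (Suc k))) tc (conc D V L (cmpv (Suc k) m) (s (Suc k)))"
      using bs_cmpw[of i b ss cs rb] iv ssi bb(2) k m ss by auto
    have "bs x ?ok (TWhile ?P ?body) (conc D V L 1 (s k)) (ta + 1 + (tb + 1 + tc) + 1 + t1 + 1) (conc D V L (cmpv m m) (s m))"
    proof (rule bs_whileT)
      show "?ok (conc D V L 1 (s k))" using sk[of k] k by (intro okw_conc) auto
      show "?P (view_of x (conc D V L 1 (s k)))" by (cases "s k") auto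
    qed (intro bs_seq, fact+)
    moreover have "(m - k) * (t + 16 * L + 25) = (m - Suc k) * (t + 16 * L + 25) + (t + 16 * L + 25)"
      using k by (metis Suc_diff_Suc add.commute mult_Suc)
    ultimately show ?case unfolding c1 using t1(1) a(1) bb(1) cc(1)
      by (intro exI[of _ "ta + 1 + (tb + 1 + tc) + 1 + t1 + 1"] conjI) linarith+
  qed
  obtain t0 where t0: "t0 \<le> m * (t + 16 * L + 25) + 1" "bs x ?ok (TWhile ?P ?body) (conc D V L (cmpv 0 m) (s 0)) t0
     (conc D V L (cmpv m m) (s m))" using loop[of 0] by auto
  show ?thesis unfolding rn_def lfor_def
  proof (intro allI impI)
    fix r :: nat assume r: "r < 3"
    obtain st c where \<sigma>: "\<sigma> = (st, c)" by (rule prod.exhaust)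
    obtain t1 r1 where 1: "t1 \<le> 8 * L + 10" "r1 < 3" "bs x ?ok (zerov i) (conc D V L r \<sigma>) t1 (conc D V L r1 (s 0))"
      using rn_zerov[of i st c] iv hok \<sigma> r s0 unfolding rn_def by metis
    obtain s0' c0 where ss: "s 0 = (s0', c0)" by (rule prod.exhaust)
    obtain t2 where 2: "t2 \<le> 8 * L + 10" "bs x ?ok (cmpw i b) (conc D V L r1 (s 0)) t2 (conc D V L (cmpv 0 m) (s 0))"
      using bs_cmpw[of i b s0' c0 r1] iv sk[of 0] 1(2) m ss D by auto
    show "\<exists>t'\<le>(m + 1) * (t + 16 * L + 25) + 16 * L + 30. \<exists>r'<3. bs x ?ok (TSeq (zerov i) (TSeq (cmpw i b)
        (TWhile ?P ?body))) (conc D V L r \<sigma>) t' (conc D V L r' (s m))"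
      using bs_seq[OF 1(3) bs_seq[OF 2(2) t0(2)]] 1(1) 2(1) t0(1)
      by (intro exI[of _ "t1 + 1 + (t2 + 1 + t0)"] exI[of _ "cmpv m m"] conjI) (auto simp: cmpv_def)
  qed
qed

lemma rn_head_act:
  assumes "heads_ok (D ^ L) x (st, ip, C, cp, ot)" "move_head cm cp < D ^ L" "cp < length C"
  shows "rn D V L x (head_act im fl cm em) (st, ip, C, cp, ot) 1
    (st, min (length x + 1) (move_head im ip), C[cp := (C ! cp \<noteq> fl)], move_head cm cp,
     ot @ (case em of None \<Rightarrow> [] | Some b \<Rightarrow> [b]))" (is "rn _ _ _ _ _ ?s _ ?s'")
  unfolding rn_def
proof (intro allI impI)
  fix r :: nat assume r: "r < 3"
  have "bs x (okw D V L x) (head_act im fl cm em) (conc D V L r ?s) 1 (conc D V L r ?s')"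
    unfolding head_act_def
  proof (rule bs_actI)
    show "okw D V L x (conc D V L r ?s)" using assms r by (intro okw_conc) auto
    show "okw D V L x (conc D V L r ?s')" using assms r by (intro okw_conc) auto
  qed (auto simp: fun_eq_iff)
  then show "\<exists>t'\<le>1. \<exists>r'<3. bs x (okw D V L x) (head_act im fl cm em) (conc D V L r ?s) t' (conc D V L r' ?s')"
    using r by blast
qed

end

subsection \<open>Programs with polynomial running time\<close>

type_synonym s3 = "(nat \<Rightarrow> nat) \<times> bool list \<times> bool list"

text \<open>Input and catalytic head rest on cell 0 between instructions and need not be
  stored.\<close>

fun lift :: "s3 \<Rightarrow> wst" where
  "lift (st, C, ot) = (st, 0, C, 0, ot)"

fun good :: "nat \<Rightarrow> s3 \<Rightarrow> bool" where
  "good W (st, C, ot) \<longleftrightarrow> 4 \<le> W \<and> (\<forall>v. st v < W) \<and> length C = W"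

text \<open>The exponent \<open>k\<close> and the number \<open>m\<close> of tracks depend on the program only.\<close>

definition okp :: "nat \<Rightarrow> tm \<Rightarrow> (nat \<Rightarrow> bool list \<Rightarrow> s3 \<Rightarrow> s3 \<Rightarrow> bool) \<Rightarrow> bool" where
  "okp D p R \<longleftrightarrow> (\<exists>k m. \<forall>V\<ge>m. \<forall>L\<ge>1. \<forall>x s. good (D ^ L) s \<longrightarrow>
     (\<exists>s'. rn D V L x p (lift s) ((D ^ L) ^ k) (lift s') \<and> good (D ^ L) s' \<and> R (D ^ L) x s s'))"

text \<open>The value 2 beyond the end is what lets a program determine the length of its
  input.\<close>

definition inval :: "bool list \<Rightarrow> nat \<Rightarrow> nat" where
  "inval x k = (if k < length x then if x ! k then 1 else 0 else 2)"

abbreviation "cat_right \<equiv> head_act Stay False MoveRight None"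
abbreviation "cat_left \<equiv> head_act Stay False MoveLeft None"
abbreviation "in_right \<equiv> head_act MoveRight False Stay None"
abbreviation "in_left \<equiv> head_act MoveLeft False Stay None"

text \<open>The head walks to the cell and back by counting. The bit survives the way back only as
  the branch taken, since the loops overwrite the register.\<close>

definition catbitp :: "nat \<Rightarrow> nat \<Rightarrow> nat \<Rightarrow> nat \<Rightarrow> tm" where
  "catbitp D t a i = TSeq (lfor D i a cat_right) (TIf (\<lambda>(r, c, g, b). b)
     (TSeq (lfor D i a cat_left) (TSeq (zerov t) (incv D t)))
     (TSeq (lfor D i a cat_left) (zerov t)))"

definition flipp :: "nat \<Rightarrow> nat \<Rightarrow> nat \<Rightarrow> tm" where
  "flipp D a i = TSeq (lfor D i a cat_right) (TSeq (head_act Stay True Stay None) (lfor D i a cat_left))"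

text \<open>The input starts in cell 1, hence the additional step to the right. The head may be held
  up at the right marker; walking back the full distance still ends on cell 0, where left moves have
  no effect.\<close>

definition inbitp :: "nat \<Rightarrow> nat \<Rightarrow> nat \<Rightarrow> nat \<Rightarrow> tm" where
  "inbitp D t a i = TSeq (lfor D i a in_right) (TSeq in_right
     (TIf (\<lambda>(r, c, g, b). c = RightEnd)
       (TSeq in_left (TSeq (lfor D i a in_left) (TSeq (zerov t) (TSeq (incv D t) (incv D t)))))
       (TIf (\<lambda>(r, c, g, b). c = InBit True)
         (TSeq in_left (TSeq (lfor D i a in_left) (TSeq (zerov t) (incv D t))))
         (TSeq in_left (TSeq (lfor D i a in_left) (zerov t))))))"

lemma word_ge: "4 \<le> D \<Longrightarrow> 1 \<le> L \<Longrightarrow> 4 \<le> D ^ (L::nat)" for D :: nat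
  by (metis le_trans one_le_numeral power_increasing power_one_right)

text \<open>Times are bounded by powers of the word size; constants and sums are absorbed by
  generous increases of the exponent, which depends on the program alone.\<close>

lemma time_basic:
  fixes W :: nat
  assumes "2 \<le> W" "L \<le> W"
  shows "16 * L + 40 \<le> W ^ 7"
proof -
  have "(2::nat) ^ 6 \<le> W ^ 6" using assms by (intro power_mono) auto
  then have "64 * W \<le> W ^ 6 * W" by simp
  moreover have "W ^ 6 * W = W ^ 7" by (simp add: eval_nat_numeral)
  moreover have "16 * L + 40 \<le> 64 * W" using assms by linarith
  ultimately show ?thesis by linarith
qed

lemma time_add:
  fixes W :: nat
  assumes "2 \<le> W" "a \<le> W ^ i" "b \<le> W ^ j"
  shows "a + b + 32 \<le> W ^ (i + j + 7)"
proof -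
  have W: "1 \<le> W" using assms by simp
  have "(2::nat) ^ 5 \<le> W ^ 5" using assms by (intro power_mono) auto
  also have "\<dots> \<le> W ^ (i + j + 5)" using W by (intro power_increasing) auto
  finally have 1: "32 \<le> W ^ (i + j + 5)" by simp
  have 2: "W ^ i \<le> W ^ (i + j + 5)" "W ^ j \<le> W ^ (i + j + 5)" using W by (auto intro!: power_increasing)
  have "(2::nat) ^ 2 \<le> W ^ 2" using assms by (intro power_mono) auto
  then have "4 * W ^ (i + j + 5) \<le> W ^ 2 * W ^ (i + j + 5)" by (intro mult_right_mono) auto
  also have "\<dots> = W ^ (i + j + 7)" by (simp flip: power_add add: ac_simps)
  finally show ?thesis using 1 2 assms by linarith
qed

lemma time_mult:
  fixes W :: nat
  assumes "2 \<le> W" "L \<le> W" "m < W" "t \<le> W ^ k"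
  shows "(m + 1) * (t + 16 * L + 25) + 16 * L + 30 \<le> W ^ (k + 16)"
proof -
  have W: "1 \<le> W" using assms by simp
  have "t + 16 * L + 40 \<le> W ^ k + W ^ 7" using time_basic[OF assms(1,2)] assms(4) by linarith
  also have "\<dots> \<le> W ^ k * W ^ 7 + W ^ k * W ^ 7"
    using W by (intro add_mono) (auto simp: mult_le_cancel1 mult_le_cancel2)
  finally have 1: "t + 16 * L + 40 \<le> 2 * W ^ (k + 7)" by (simp add: power_add)
  have "(m + 1) * (t + 16 * L + 25) \<le> W * (t + 16 * L + 40)"
    using assms by (intro mult_mono) auto
  then have "(m + 1) * (t + 16 * L + 25) + 16 * L + 30 \<le> W * (t + 16 * L + 40) + (t + 16 * L + 40)"
    by linarith
  also have "\<dots> \<le> W * (t + 16 * L + 40) + W * (t + 16 * L + 40)" using W by simp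
  also have "\<dots> = 2 * W * (t + 16 * L + 40)" by simp
  also have "\<dots> \<le> 2 * W * (2 * W ^ (k + 7))" by (rule mult_left_mono[OF 1]) simp
  also have "\<dots> = 4 * W ^ (k + 8)" using power_Suc[of W "k + 7"] by (simp add: add.commute)
  also have "\<dots> \<le> W ^ 2 * W ^ (k + 8)"
    using power_mono[of 2 W 2] assms by (intro mult_right_mono) auto
  also have "\<dots> = W ^ (k + 10)" by (simp flip: power_add add: ac_simps)
  also have "\<dots> \<le> W ^ (k + 16)" using W by (intro power_increasing) auto
  finally show ?thesis .
qed

lemma L_le_word: "2 \<le> D \<Longrightarrow> L \<le> D ^ L" for D :: nat
  by (meson le_trans less_exp less_imp_le power_mono zero_le)

lemma okpI:
  assumes "\<And>V L x s. m \<le> V \<Longrightarrow> 1 \<le> L \<Longrightarrow> good (D ^ L) s \<Longrightarrow>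
     \<exists>s' t. rn D V L x p (lift s) t (lift s') \<and> t \<le> (D ^ L) ^ k \<and> good (D ^ L) s' \<and> R (D ^ L) x s s'"
    and "2 \<le> D"
  shows "okp D p R"
  unfolding okp_def
proof (rule exI[of _ k], rule exI[of _ m], intro allI impI)
  fix V L x s assume "m \<le> V" "1 \<le> L" "good (D ^ L) s"
  then obtain s' t where "rn D V L x p (lift s) t (lift s')" "t \<le> (D ^ L) ^ k" "good (D ^ L) s'" "R (D ^ L) x s s'"
    using assms(1) by blast
  then show "\<exists>s'. rn D V L x p (lift s) ((D ^ L) ^ k) (lift s') \<and> good (D ^ L) s' \<and> R (D ^ L) x s s'"
    using rn_mono[OF assms(2) \<open>1 \<le> L\<close>] by blast
qed

lemma okp_mono:
  assumes "okp D p R" and "\<And>W x s s'. good W s \<Longrightarrow> good W s' \<Longrightarrow> R W x s s' \<Longrightarrow> R' W x s s'"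
  shows "okp D p R'"
  using assms(1) unfolding okp_def using assms(2) by meson

context
  fixes D :: nat
  assumes D: "4 \<le> D"
begin

lemma D2: "2 \<le> D" using D by simp

lemma okp_basic:
  assumes "\<And>V L x st c. v < V \<Longrightarrow> 1 \<le> L \<Longrightarrow> heads_ok (D ^ L) x (st, c) \<Longrightarrow>
      rn D V L x p (st, c) (8 * L + 10) (setv u (f (D ^ L) st) (st, c))"
    and "\<And>W st. (\<forall>v. st v < W) \<Longrightarrow> 4 \<le> W \<Longrightarrow> f W st < W"
  shows "okp D p (\<lambda>W x s s'. s' = setv u (f W (fst s)) s)"
proof (rule okpI[where k = 7 and m = "Suc v"])
  fix V L x s assume h: "Suc v \<le> V" "1 \<le> L" "good (D ^ L) s"
  obtain st C ot where s: "s = (st, C, ot)" by (rule prod_cases3)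
  have W: "4 \<le> D ^ L" using word_ge D h by blast
  have "rn D V L x p (lift s) (8 * L + 10) (lift (setv u (f (D ^ L) st) s))"
    using assms(1)[of V L x st "(0, C, 0, ot)"] h W s D by simp
  moreover have "8 * L + 10 \<le> (D ^ L) ^ 7"
    using time_basic[of "D ^ L" L] W L_le_word[OF D2, of L] by linarith
  moreover have "good (D ^ L) (setv u (f (D ^ L) st) s)" using h(3) s assms(2)[of st "D ^ L"] W by auto
  ultimately show "\<exists>s' t. rn D V L x p (lift s) t (lift s') \<and> t \<le> (D ^ L) ^ 7 \<and> good (D ^ L) s' \<and>
      s' = setv u (f (D ^ L) (fst s)) s" using s by auto
qed (use D in simp)

lemma okp_zerov: "okp D (zerov v) (\<lambda>W x s s'. s' = setv v 0 s)"
  using okp_basic[of v "zerov v" v "\<lambda>_ _. 0"] rn_zerov D2 by auto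

lemma okp_topv: "okp D (topv D v) (\<lambda>W x s s'. s' = setv v (W - 1) s)"
  using okp_basic[of v "topv D v" v "\<lambda>W _. W - 1"] rn_topv D2 by auto

lemma okp_incv: "okp D (incv D v) (\<lambda>W x s s'. s' = setv v ((fst s v + 1) mod W) s)"
  using okp_basic[of v "incv D v" v "\<lambda>W st. (st v + 1) mod W"] rn_incv D2 by auto

lemma okp_copyv: "okp D (copyv u v) (\<lambda>W x s s'. s' = setv u (fst s v) s)"
  using okp_basic[of "max u v" "copyv u v" u "\<lambda>W st. st v"] rn_copyv D2 by auto

lemma okp_skip: "okp D TSkip (\<lambda>W x s s'. s' = s)"
proof (rule okpI[where k = 0 and m = 0])
  fix V L x s assume "1 \<le> L" "good (D ^ L) s"
  then show "\<exists>s' t. rn D V L x TSkip (lift s) t (lift s') \<and> t \<le> (D ^ L) ^ 0 \<and> good (D ^ L) s' \<and> s' = s"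
    using rn_skip[OF D2, of L x "lift s" V] D by (cases s) auto
qed (use D in simp)

lemma okp_seq:
  assumes "okp D p R" and "okp D q R'"
  shows "okp D (TSeq p q) (\<lambda>W x s s''. \<exists>s'. good W s' \<and> R W x s s' \<and> R' W x s' s'')"
proof -
  obtain k m where 1: "\<And>V L x s. m \<le> V \<Longrightarrow> 1 \<le> L \<Longrightarrow> good (D ^ L) s \<Longrightarrow>
     \<exists>s'. rn D V L x p (lift s) ((D ^ L) ^ k) (lift s') \<and> good (D ^ L) s' \<and> R (D ^ L) x s s'"
    using assms(1) unfolding okp_def by meson
  obtain k' m' where 2: "\<And>V L x s. m' \<le> V \<Longrightarrow> 1 \<le> L \<Longrightarrow> good (D ^ L) s \<Longrightarrow>
     \<exists>s'. rn D V L x q (lift s) ((D ^ L) ^ k') (lift s') \<and> good (D ^ L) s' \<and> R' (D ^ L) x s s'"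
    using assms(2) unfolding okp_def by meson
  show ?thesis
  proof (rule okpI[where k = "k + k' + 7" and m = "max m m'"])
    fix V L x s assume h: "max m m' \<le> V" "1 \<le> L" "good (D ^ L) s"
    obtain s' where s': "rn D V L x p (lift s) ((D ^ L) ^ k) (lift s')" "good (D ^ L) s'" "R (D ^ L) x s s'"
      using 1[of V L s x] h by auto
    obtain s'' where s'': "rn D V L x q (lift s') ((D ^ L) ^ k') (lift s'')" "good (D ^ L) s''" "R' (D ^ L) x s' s''"
      using 2[of V L s' x] h s' by auto
    have "(D ^ L) ^ k + (D ^ L) ^ k' + 1 \<le> (D ^ L) ^ (k + k' + 7)"
      using time_add[of "D ^ L" "(D ^ L) ^ k" k "(D ^ L) ^ k'" k'] word_ge[OF D h(2)] by linarith
    then show "\<exists>s'' t. rn D V L x (TSeq p q) (lift s) t (lift s'') \<and> t \<le> (D ^ L) ^ (k + k' + 7) \<and>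
        good (D ^ L) s'' \<and> (\<exists>s'. good (D ^ L) s' \<and> R (D ^ L) x s s' \<and> R' (D ^ L) x s' s'')"
      using rn_seq[OF D2 h(2) s'(1) s''(1)] s' s'' by blast
  qed (use D in simp)
qed

lemma okp_ifcmp:
  assumes "okp D p R" and "okp D q R'"
  shows "okp D (ifcmp c u v p q)
    (\<lambda>W x s s'. if cmpv (fst s u) (fst s v) = c then R W x s s' else R' W x s s')"
proof -
  obtain k m where 1: "\<And>V L x s. m \<le> V \<Longrightarrow> 1 \<le> L \<Longrightarrow> good (D ^ L) s \<Longrightarrow>
     \<exists>s'. rn D V L x p (lift s) ((D ^ L) ^ k) (lift s') \<and> good (D ^ L) s' \<and> R (D ^ L) x s s'"
    using assms(1) unfolding okp_def by meson
  obtain k' m' where 2: "\<And>V L x s. m' \<le> V \<Longrightarrow> 1 \<le> L \<Longrightarrow> good (D ^ L) s \<Longrightarrow>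
     \<exists>s'. rn D V L x q (lift s) ((D ^ L) ^ k') (lift s') \<and> good (D ^ L) s' \<and> R' (D ^ L) x s s'"
    using assms(2) unfolding okp_def by meson
  show ?thesis
  proof (rule okpI[where k = "k + k' + 7 + 7 + 7" and m = "max (max m m') (Suc (max u v))"])
    fix V L x s assume h: "max (max m m') (Suc (max u v)) \<le> V" "1 \<le> L" "good (D ^ L) s"
    obtain st C ot where s: "s = (st, C, ot)" by (rule prod_cases3)
    have W: "4 \<le> D ^ L" using word_ge D h by blast
    define t where "t = (D ^ L) ^ k + (D ^ L) ^ k' + 32"
    have t: "t \<le> (D ^ L) ^ (k + k' + 7)"
      unfolding t_def using W by (intro time_add) auto
    have "t + (16 * L + 40) + 32 \<le> (D ^ L) ^ (k + k' + 7 + 7 + 7)"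
      using W time_basic[of "D ^ L" L] L_le_word[OF D2, of L] by (intro time_add t) auto
    then have T: "t + 8 * L + 12 \<le> (D ^ L) ^ (k + k' + 7 + 7 + 7)" by linarith
    have "\<exists>s'. (if cmpv (st u) (st v) = c then rn D V L x p (lift s) t (lift s') \<and> R (D ^ L) x s s'
        else rn D V L x q (lift s) t (lift s') \<and> R' (D ^ L) x s s') \<and> good (D ^ L) s'"
    proof (cases "cmpv (st u) (st v) = c")
      case True
      obtain s' where e: "rn D V L x p (lift s) ((D ^ L) ^ k) (lift s')" and "good (D ^ L) s'" "R (D ^ L) x s s'"
        using 1[of V L s x] h by auto
      moreover have "rn D V L x p (lift s) t (lift s')"
        by (rule rn_mono[OF D2 h(2) e]) (simp add: t_def)
      ultimately show ?thesis using True by (intro exI[of _ s']) simp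
    next
      case False
      obtain s' where e: "rn D V L x q (lift s) ((D ^ L) ^ k') (lift s')" and "good (D ^ L) s'" "R' (D ^ L) x s s'"
        using 2[of V L s x] h by auto
      moreover have "rn D V L x q (lift s) t (lift s')"
        by (rule rn_mono[OF D2 h(2) e]) (simp add: t_def)
      ultimately show ?thesis using False by (intro exI[of _ s']) simp
    qed
    then obtain s' where s': "cmpv (st u) (st v) = c \<Longrightarrow> rn D V L x p (lift s) t (lift s') \<and> R (D ^ L) x s s'"
      "cmpv (st u) (st v) \<noteq> c \<Longrightarrow> rn D V L x q (lift s) t (lift s') \<and> R' (D ^ L) x s s'" "good (D ^ L) s'"
      by (auto split: if_splits)
    have "rn D V L x (ifcmp c u v p q) (st, 0, C, 0, ot) (t + 8 * L + 12) (lift s')"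
      using s' h s W D by (intro rn_ifcmp[OF D2]) auto
    then show "\<exists>s' t. rn D V L x (ifcmp c u v p q) (lift s) t (lift s') \<and>
        t \<le> (D ^ L) ^ (k + k' + 7 + 7 + 7) \<and> good (D ^ L) s' \<and>
        (if cmpv (fst s u) (fst s v) = c then R (D ^ L) x s s' else R' (D ^ L) x s s')"
      using s' T s by (intro exI[of _ s'] exI[of _ "t + 8 * L + 12"]) auto
  qed (use D in simp)
qed

lemma lift_setv: "lift (setv v y s) = setv v y (lift s)"
  by (cases s) auto

lemma okp_lfor:
  assumes p: "okp D p R" and "i \<noteq> b"
    and frame: "\<And>W x s s'. R W x s s' \<Longrightarrow> fst s' i = fst s i \<and> fst s' b = fst s b"
  shows "okp D (lfor D i b p) (\<lambda>W x s s'. \<exists>f. f 0 = setv i 0 s \<and> s' = f (fst s b) \<and>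
     (\<forall>k<fst s b. \<exists>u. good W (f k) \<and> good W u \<and> fst (f k) i = k \<and> R W x (f k) u \<and> f (Suc k) = setv i (Suc k) u))"
proof -
  obtain k m where 1: "\<And>V L x s. m \<le> V \<Longrightarrow> 1 \<le> L \<Longrightarrow> good (D ^ L) s \<Longrightarrow>
     \<exists>s'. rn D V L x p (lift s) ((D ^ L) ^ k) (lift s') \<and> good (D ^ L) s' \<and> R (D ^ L) x s s'"
    using p unfolding okp_def by meson
  show ?thesis
  proof (rule okpI[where k = "k + 16" and m = "max m (Suc (max i b))"])
    fix V L x s assume h: "max m (Suc (max i b)) \<le> V" "1 \<le> L" "good (D ^ L) s"
    let ?W = "D ^ L"
    have W: "4 \<le> ?W" using word_ge D h by blast
    define M where "M = fst s b"
    have M: "M < ?W" using h(3) by (cases s) (auto simp: M_def)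
    \<comment> \<open>The body is specified by a relation only; a choice of successors makes the
      sequence of loop states definable by recursion.\<close>
    obtain g where g: "\<And>s. good ?W s \<Longrightarrow> rn D V L x p (lift s) (?W ^ k) (lift (g s)) \<and> good ?W (g s) \<and> R ?W x s (g s)"
      using 1[of V L _ x] h by (metis max.boundedE)
    define f where "f = rec_nat (setv i 0 s) (\<lambda>j s. setv i (Suc j) (g s))"
    have f0: "f 0 = setv i 0 s" and fS: "f (Suc j) = setv i (Suc j) (g (f j))" for j
      by (simp_all add: f_def)
    have set_good: "good ?W (setv i j s)" if "good ?W s" "j < ?W" for j s
      using that by (cases s) auto
    have fst_setv: "fst (setv i j s) = (fst s)(i := j)" for j and s :: s3 by (cases s) auto
    have inv: "good ?W (f j) \<and> fst (f j) i = j \<and> fst (f j) b = M" if "j \<le> M" for j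
      using that
    proof (induction j)
      case 0
      then show ?case using f0 set_good[OF h(3), of 0] W D \<open>i \<noteq> b\<close> by (auto simp: fst_setv M_def)
    next
      case (Suc j)
      then have I: "good ?W (f j)" "fst (f j) i = j" "fst (f j) b = M" by auto
      then show ?case using fS[of j] g[OF I(1)] frame[of ?W x "f j" "g (f j)"] set_good[of "g (f j)" "Suc j"]
          Suc.prems M \<open>i \<noteq> b\<close> by (auto simp: fst_setv)
    qed
    have fl: "fst (lift s) = fst s" for s by (cases s) auto
    have hl: "heads_ok ?W x (lift s)" for s using W D by (cases s) auto
    have "rn D V L x (lfor D i b p) (lift s) ((M + 1) * (?W ^ k + 16 * L + 25) + 16 * L + 30) (lift (f M))"
    proof (rule rn_lfor[OF D2 h(2), where s = "\<lambda>j. lift (f j)" and u = "\<lambda>j. lift (g (f j))"])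
      fix j assume j: "j < M"
      then have I: "good ?W (f j)" "fst (f j) i = j" "fst (f j) b = M" using inv[of j] by auto
      show "rn D V L x p (lift (f j)) (?W ^ k) (lift (g (f j))) \<and> fst (lift (g (f j))) i = j \<and>
        fst (lift (g (f j))) b = M \<and> heads_ok ?W x (lift (g (f j))) \<and> lift (f (Suc j)) = setv i (Suc j) (lift (g (f j)))"
        using g[OF I(1)] frame[of ?W x "f j" "g (f j)"] I by (auto simp: fl hl fS lift_setv)
    qed (use h M \<open>i \<noteq> b\<close> inv in \<open>auto simp: fl hl f0 lift_setv\<close>)
    moreover have "(M + 1) * (?W ^ k + 16 * L + 25) + 16 * L + 30 \<le> ?W ^ (k + 16)"
      using W M L_le_word[OF D2, of L] by (intro time_mult) auto
    moreover have "\<exists>u. good ?W (f j) \<and> good ?W u \<and> fst (f j) i = j \<and> R ?W x (f j) u \<and> f (Suc j) = setv i (Suc j) u"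
      if "j < M" for j
      using inv[of j] g[of "f j"] that by (intro exI[of _ "g (f j)"]) (auto simp: fS)
    ultimately show "\<exists>s' t. rn D V L x (lfor D i b p) (lift s) t (lift s') \<and> t \<le> ?W ^ (k + 16) \<and> good ?W s' \<and>
        (\<exists>f. f 0 = setv i 0 s \<and> s' = f (fst s b) \<and>
     (\<forall>k<fst s b. \<exists>u. good ?W (f k) \<and> good ?W u \<and> fst (f k) i = k \<and> R ?W x (f k) u \<and> f (Suc k) = setv i (Suc k) u))"
      using f0 inv[of M] unfolding M_def by (intro exI[of _ "f (fst s b)"] exI conjI) (auto simp: M_def)
  qed (use D in simp)
qed

end

lemma rn_seqW:
  assumes "4 \<le> D" "1 \<le> L" "rn D V L x p \<sigma> ((D ^ L) ^ i) \<sigma>'" "rn D V L x q \<sigma>' ((D ^ L) ^ j) \<sigma>''"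
  shows "rn D V L x (TSeq p q) \<sigma> ((D ^ L) ^ (i + j + 7)) \<sigma>''"
proof -
  have "(D ^ L) ^ i + (D ^ L) ^ j + 32 \<le> (D ^ L) ^ (i + j + 7)"
    using word_ge[OF assms(1,2)] by (intro time_add) auto
  moreover have "2 \<le> D" using assms(1) by simp
  ultimately show ?thesis using assms(2) rn_mono[OF _ _ rn_seq[OF _ _ assms(3,4)]] by simp
qed

lemma rn_ifW:
  assumes "4 \<le> D" "1 \<le> L" "heads_ok (D ^ L) x \<sigma>"
    and "\<And>r. P (view_of x (conc D V L r \<sigma>)) = Q"
    and "Q \<Longrightarrow> rn D V L x p \<sigma> ((D ^ L) ^ i) \<sigma>'" and "\<not> Q \<Longrightarrow> rn D V L x q \<sigma> ((D ^ L) ^ j) \<sigma>'"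
  shows "rn D V L x (TIf P p q) \<sigma> ((D ^ L) ^ (i + j + 7)) \<sigma>'"
proof -
  let ?W = "D ^ L"
  have le: "?W ^ i + ?W ^ j + 32 \<le> ?W ^ (i + j + 7)"
    using word_ge[OF assms(1,2)] by (intro time_add) auto
  have D: "2 \<le> D" using assms(1) by simp
  have "rn D V L x (TIf P p q) \<sigma> (?W ^ i + ?W ^ j + 1) \<sigma>'"
  proof (rule rn_if[OF D assms(2,3), where P = P and Q = Q])
    show "P (view_of x (conc D V L r \<sigma>)) = Q" for r by (rule assms(4))
    show "rn D V L x p \<sigma> (?W ^ i + ?W ^ j) \<sigma>'" if Q
      by (rule rn_mono[OF D assms(2) assms(5)[OF that]]) simp
    show "rn D V L x q \<sigma> (?W ^ i + ?W ^ j) \<sigma>'" if "\<not> Q"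
      by (rule rn_mono[OF D assms(2) assms(6)[OF that]]) simp
  qed
  then show ?thesis by (rule rn_mono[OF D assms(2)]) (use le in linarith)
qed

context
  fixes D V L :: nat and x :: "bool list"
  assumes D: "4 \<le> D" and L: "1 \<le> L"
begin

lemma D2': "2 \<le> D" using D by simp

lemma word4: "4 \<le> D ^ L" using word_ge D L by blast

lemma rn_basicW:
  assumes "rn D V L x p \<sigma> (8 * L + 10) \<sigma>'"
  shows "rn D V L x p \<sigma> ((D ^ L) ^ 7) \<sigma>'"
proof (rule rn_mono[OF D2' L assms])
  show "8 * L + 10 \<le> (D ^ L) ^ 7"
    using time_basic[of "D ^ L" L] word4 L_le_word[OF D2', of L] by linarith
qed

lemma head_loop_time: "m < D ^ L \<Longrightarrow> (m + 1) * (1 + 16 * L + 25) + 16 * L + 30 \<le> (D ^ L) ^ 16"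
  using time_mult[of "D ^ L" L m 1 0] word4 L_le_word[OF D2', of L] by simp

text \<open>\<open>ip\<close> and \<open>cp\<close> are the trajectories of the two heads; leaving
  them free covers walks in both directions and the clipping at both ends.\<close>

lemma rn_head_loop:
  assumes "i < V" "a < V" "i \<noteq> a" "st a < D ^ L" "length C = D ^ L"
    and "\<And>k. k \<le> st a \<Longrightarrow> ip k \<le> length x + 1 \<and> cp k < D ^ L"
    and "\<And>k. k < st a \<Longrightarrow> ip (Suc k) = min (length x + 1) (move_head im (ip k)) \<and> cp (Suc k) = move_head cm (cp k)"
  shows "rn D V L x (lfor D i a (head_act im False cm None)) (st, ip 0, C, cp 0, ot) ((D ^ L) ^ 16)
    (st(i := st a), ip (st a), C, cp (st a), ot)"
proof -
  have "rn D V L x (lfor D i a (head_act im False cm None)) (st, ip 0, C, cp 0, ot)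
     ((st a + 1) * (1 + 16 * L + 25) + 16 * L + 30) (st(i := st a), ip (st a), C, cp (st a), ot)"
  proof (rule rn_lfor[OF D2' L, where s = "\<lambda>k. (st(i := k), ip k, C, cp k, ot)"
        and u = "\<lambda>k. (st(i := k), ip (Suc k), C, cp (Suc k), ot)"])
    fix k assume k: "k < st a"
    have "rn D V L x (head_act im False cm None) (st(i := k), ip k, C, cp k, ot) 1
       (st(i := k), min (length x + 1) (move_head im (ip k)), C[cp k := (C ! cp k \<noteq> False)], move_head cm (cp k),
        ot @ (case None of None \<Rightarrow> [] | Some b \<Rightarrow> [b]))"
      using assms(5) assms(6)[of k] assms(6)[of "Suc k"] assms(7)[OF k] k by (intro rn_head_act[OF D2' L]) auto
    then show "rn D V L x (head_act im False cm None) (st(i := k), ip k, C, cp k, ot) 1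
       (st(i := k), ip (Suc k), C, cp (Suc k), ot) \<and>
       fst (st(i := k), ip (Suc k), C, cp (Suc k), ot) i = k \<and> fst (st(i := k), ip (Suc k), C, cp (Suc k), ot) a = st a \<and>
       heads_ok (D ^ L) x (st(i := k), ip (Suc k), C, cp (Suc k), ot) \<and>
       (st(i := Suc k), ip (Suc k), C, cp (Suc k), ot) = setv i (Suc k) (st(i := k), ip (Suc k), C, cp (Suc k), ot)"
      using assms(3) assms(6)[of "Suc k"] assms(7)[OF k] k by simp
  qed (use assms(1-4) assms(6)[of 0] assms(6) in auto)
  then show ?thesis by (rule rn_mono[OF D2' L]) (rule head_loop_time[OF assms(4)])
qed

lemma rn_set_bit:
  assumes "t < V" "heads_ok (D ^ L) x (st, c)"
  shows "rn D V L x (TSeq (zerov t) (incv D t)) (st, c) ((D ^ L) ^ 21) (st(t := 1), c)"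
    and "rn D V L x (TSeq (zerov t) (TSeq (incv D t) (incv D t))) (st, c) ((D ^ L) ^ 35) (st(t := 2), c)"
    and "rn D V L x (zerov t) (st, c) ((D ^ L) ^ 7) (st(t := 0), c)"
proof -
  obtain ip C cp ot where c: "c = (ip, C, cp, ot)" by (metis prod_cases4)
  have h: "heads_ok (D ^ L) x (st', c)" for st' using assms(2) by (simp add: c)
  have z: "rn D V L x (zerov t) (st, c) ((D ^ L) ^ 7) (st(t := 0), c)" for st
    using rn_basicW[OF rn_zerov[OF D2' L assms(1) h]] by simp
  have i: "rn D V L x (incv D t) (st, c) ((D ^ L) ^ 7) (st(t := (st t + 1) mod D ^ L), c)" for st
    using rn_basicW[OF rn_incv[OF D2' L assms(1) h]] by simp
  have i1: "rn D V L x (incv D t) (st(t := 0), c) ((D ^ L) ^ 7) (st(t := 1), c)"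
    using i[of "st(t := 0)"] word4 D L by simp
  have i2: "rn D V L x (incv D t) (st(t := 1), c) ((D ^ L) ^ 7) (st(t := 2), c)"
    using i[of "st(t := 1)"] word4 D L by (simp add: numeral_2_eq_2)
  show "rn D V L x (zerov t) (st, c) ((D ^ L) ^ 7) (st(t := 0), c)" by (rule z)
  show "rn D V L x (TSeq (zerov t) (incv D t)) (st, c) ((D ^ L) ^ 21) (st(t := 1), c)"
    using rn_seqW[OF D L z i1] by simp
  show "rn D V L x (TSeq (zerov t) (TSeq (incv D t) (incv D t))) (st, c) ((D ^ L) ^ 35) (st(t := 2), c)"
    using rn_seqW[OF D L z rn_seqW[OF D L i1 i2]] by simp
qed

lemma rn_catbitp:
  assumes "i < V" "a < V" "t < V" "i \<noteq> a" "t \<noteq> i" "st a < D ^ L" "length C = D ^ L"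
  shows "rn D V L x (catbitp D t a i) (st, 0, C, 0, ot) ((D ^ L) ^ 110)
    (st(i := st a, t := of_bool (C ! st a)), 0, C, 0, ot)"
proof -
  let ?m = "st a"
  have r: "rn D V L x (lfor D i a cat_right) (st, 0, C, 0, ot) ((D ^ L) ^ 16) (st(i := ?m), 0, C, ?m, ot)"
    using rn_head_loop[of i a st C "\<lambda>_. 0" "\<lambda>k. k" Stay MoveRight ot] assms by simp
  have l: "rn D V L x (lfor D i a cat_left) (st(i := ?m), 0, C, ?m, ot) ((D ^ L) ^ 16) (st(i := ?m), 0, C, 0, ot)"
    using rn_head_loop[of i a "st(i := ?m)" C "\<lambda>_. 0" "\<lambda>k. ?m - k" Stay MoveLeft ot] assms by simp
  have h: "heads_ok (D ^ L) x (st', 0, C, 0, ot)" for st' using word4 D by simp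
  have "rn D V L x (TIf (\<lambda>(r, c, g, b). b) (TSeq (lfor D i a cat_left) (TSeq (zerov t) (incv D t)))
     (TSeq (lfor D i a cat_left) (zerov t))) (st(i := ?m), 0, C, ?m, ot) ((D ^ L) ^ (44 + 30 + 7))
     (st(i := ?m, t := of_bool (C ! ?m)), 0, C, 0, ot)"
    proof (rule rn_ifW[OF D L, where Q = "C ! ?m"])
      assume "C ! ?m"
      then show "rn D V L x (TSeq (lfor D i a cat_left) (TSeq (zerov t) (incv D t))) (st(i := ?m), 0, C, ?m, ot) ((D ^ L) ^ 44)
        (st(i := ?m, t := of_bool (C ! ?m)), 0, C, 0, ot)"
        using rn_seqW[OF D L l rn_set_bit(1)[OF assms(3) h]] by simp
    next
      assume "\<not> C ! ?m"
      then show "rn D V L x (TSeq (lfor D i a cat_left) (zerov t)) (st(i := ?m), 0, C, ?m, ot) ((D ^ L) ^ 30)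
        (st(i := ?m, t := of_bool (C ! ?m)), 0, C, 0, ot)"
        using rn_seqW[OF D L l rn_set_bit(3)[OF assms(3) h]] by simp
    qed (use assms in auto)
  from rn_seqW[OF D L r this] show ?thesis
    unfolding catbitp_def by (rule rn_mono[OF D2' L]) (use word4 in \<open>auto intro!: power_increasing\<close>)
qed

lemma rn_flipp:
  assumes "i < V" "a < V" "i \<noteq> a" "st a < D ^ L" "length C = D ^ L"
  shows "rn D V L x (flipp D a i) (st, 0, C, 0, ot) ((D ^ L) ^ 46)
    (st(i := st a), 0, C[st a := \<not> C ! st a], 0, ot)"
proof -
  let ?m = "st a" and ?C = "C[st a := \<not> C ! st a]"
  have r: "rn D V L x (lfor D i a cat_right) (st, 0, C, 0, ot) ((D ^ L) ^ 16) (st(i := ?m), 0, C, ?m, ot)"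
    using rn_head_loop[of i a st C "\<lambda>_. 0" "\<lambda>k. k" Stay MoveRight ot] assms by simp
  have l: "rn D V L x (lfor D i a cat_left) (st(i := ?m), 0, ?C, ?m, ot) ((D ^ L) ^ 16) (st(i := ?m), 0, ?C, 0, ot)"
    using rn_head_loop[of i a "st(i := ?m)" ?C "\<lambda>_. 0" "\<lambda>k. ?m - k" Stay MoveLeft ot] assms by simp
  have f: "rn D V L x (head_act Stay True Stay None) (st(i := ?m), 0, C, ?m, ot) ((D ^ L) ^ 0) (st(i := ?m), 0, ?C, ?m, ot)"
    using rn_head_act[OF D2' L, where cm = Stay and im = Stay and fl = True and em = None and st = "st(i := ?m)"
        and ip = 0 and C = C and cp = ?m and ot = ot and x = x and V = V] assms by simp
  show ?thesis using rn_seqW[OF D L r rn_seqW[OF D L f l]] unfolding flipp_def by simp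
qed

lemma rn_inbitp:
  assumes "i < V" "a < V" "t < V" "i \<noteq> a" "t \<noteq> i" "st a < D ^ L" "length C = D ^ L"
  shows "rn D V L x (inbitp D t a i) (st, 0, C, 0, ot) ((D ^ L) ^ 212)
    (st(i := st a, t := inval x (st a)), 0, C, 0, ot)"
proof -
  let ?m = "st a" and ?q = "min (length x + 1) (st a + 1)"
  let ?st = "st(i := ?m)"
  have p0: "0 < D ^ L" using word4 by linarith
  have r: "rn D V L x (lfor D i a in_right) (st, 0, C, 0, ot) ((D ^ L) ^ 16) (?st, min (length x + 1) ?m, C, 0, ot)"
    using rn_head_loop[of i a st C "\<lambda>k. min (length x + 1) k" "\<lambda>_. 0" MoveRight Stay ot] assms p0 by auto
  have r1: "rn D V L x in_right (?st, min (length x + 1) ?m, C, 0, ot) ((D ^ L) ^ 0) (?st, ?q, C, 0, ot)"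
    using rn_head_act[OF D2' L, where cm = Stay and im = MoveRight and fl = False and em = None and st = ?st
        and ip = "min (length x + 1) ?m" and C = C and cp = 0 and ot = ot and x = x and V = V] assms p0
    by (auto simp: min_def split: if_splits)
  have l1: "rn D V L x in_left (?st, ?q, C, 0, ot) ((D ^ L) ^ 0) (?st, ?q - 1, C, 0, ot)"
    using rn_head_act[OF D2' L, where cm = Stay and im = MoveLeft and fl = False and em = None and st = ?st
        and ip = ?q and C = C and cp = 0 and ot = ot and x = x and V = V] assms p0
    by (auto simp: min_def split: if_splits)
  have l: "rn D V L x (lfor D i a in_left) (?st, ?q - 1, C, 0, ot) ((D ^ L) ^ 16) (?st, 0, C, 0, ot)"
    using rn_head_loop[of i a ?st C "\<lambda>k. ?q - 1 - k" "\<lambda>_. 0" MoveLeft Stay ot] assms p0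
    by (auto simp: min_def split: if_splits)
  have h: "heads_ok (D ^ L) x (st', 0, C, 0, ot)" for st' using p0 by simp
  have hq: "heads_ok (D ^ L) x (?st, ?q, C, 0, ot)" using p0 by simp
  have rd: "read_input x ?q = (if ?m < length x then InBit (x ! ?m) else RightEnd)"
    by (auto simp: read_input_def min_def)
  note sb = rn_set_bit[OF assms(3) h]
  note b2 = rn_seqW[OF D L l1 rn_seqW[OF D L l sb(2)], simplified]
  note b1 = rn_seqW[OF D L l1 rn_seqW[OF D L l sb(1)], simplified]
  note b0 = rn_seqW[OF D L l1 rn_seqW[OF D L l sb(3)], simplified]
  let ?F = "(st(i := ?m, t := inval x ?m), 0, C, 0, ot)"
  have inner: "rn D V L x (TIf (\<lambda>(r, c, g, b). c = InBit True)
         (TSeq in_left (TSeq (lfor D i a in_left) (TSeq (zerov t) (incv D t))))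
         (TSeq in_left (TSeq (lfor D i a in_left) (zerov t)))) (?st, ?q, C, 0, ot) ((D ^ L) ^ (51 + 37 + 7)) ?F"
    if "?m < length x"
    by (rule rn_ifW[OF D L hq, where Q = "x ! ?m"]) (use b1 b0 that rd in \<open>auto simp: inval_def\<close>)
  have "rn D V L x (TIf (\<lambda>(r, c, g, b). c = RightEnd)
       (TSeq in_left (TSeq (lfor D i a in_left) (TSeq (zerov t) (TSeq (incv D t) (incv D t)))))
       (TIf (\<lambda>(r, c, g, b). c = InBit True)
         (TSeq in_left (TSeq (lfor D i a in_left) (TSeq (zerov t) (incv D t))))
         (TSeq in_left (TSeq (lfor D i a in_left) (zerov t))))) (?st, ?q, C, 0, ot) ((D ^ L) ^ (65 + (51 + 37 + 7) + 7)) ?F"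
    by (rule rn_ifW[OF D L hq, where Q = "\<not> ?m < length x"]) (use b2 inner rd in \<open>auto simp: inval_def\<close>)
  from rn_seqW[OF D L r rn_seqW[OF D L r1 this]] show ?thesis
    unfolding inbitp_def by (rule rn_mono[OF D2' L]) (use p0 in \<open>auto intro!: power_increasing\<close>)
qed

end

section \<open>A small imperative language and its compiler\<close>

datatype exp =
    EN nat | EV nat | ETop
  | EAdd exp exp | EMul exp exp | ESub exp exp | EDiv exp exp | EMod exp exp
  | ELess exp exp | EEq exp exp
  | ECat exp | EIn exp

text \<open>\<open>CCall r es c\<close> runs \<open>c\<close> in a fresh frame consisting of a result slot 0 and the values of \<open>es\<close>,
  and stores the final result slot in slot \<open>r\<close> of the caller. \<open>CFor\<close> appends its counter to the
  frame.\<close>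

datatype cmd =
    CSkip | CSet nat exp | CFlip exp | CEmit exp | CSeq cmd cmd | CIf exp cmd cmd
  | CFor exp cmd | CCall nat "exp list" cmd

primrec eval :: "nat \<Rightarrow> bool list \<Rightarrow> exp \<Rightarrow> nat list \<Rightarrow> bool list \<Rightarrow> nat" where
  "eval W x (EN k) env C = k mod W"
| "eval W x (EV i) env C = (if i < length env then env ! i else 0)"
| "eval W x ETop env C = W - 1"
| "eval W x (EAdd a b) env C = (eval W x a env C + eval W x b env C) mod W"
| "eval W x (EMul a b) env C = (eval W x a env C * eval W x b env C) mod W"
| "eval W x (ESub a b) env C = eval W x a env C - eval W x b env C"
| "eval W x (EDiv a b) env C = eval W x a env C div eval W x b env C"
| "eval W x (EMod a b) env C = eval W x a env C mod eval W x b env C"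
| "eval W x (ELess a b) env C = of_bool (eval W x a env C < eval W x b env C)"
| "eval W x (EEq a b) env C = of_bool (eval W x a env C = eval W x b env C)"
| "eval W x (ECat a) env C = of_bool (C ! eval W x a env C)"
| "eval W x (EIn a) env C = inval x (eval W x a env C)"

primrec loop :: "(nat \<Rightarrow> 's \<Rightarrow> 's) \<Rightarrow> nat \<Rightarrow> 's \<Rightarrow> 's" where
  "loop f 0 s = s"
| "loop f (Suc k) s = f k (loop f k s)"

type_synonym fst3 = "nat list \<times> bool list \<times> bool list"

definition push :: "nat \<Rightarrow> fst3 \<Rightarrow> fst3" where
  "push k = (\<lambda>(env, r). (env @ [k], r))"

definition pop :: "fst3 \<Rightarrow> fst3" where
  "pop = (\<lambda>(env, r). (butlast env, r))"

primrec sem :: "nat \<Rightarrow> bool list \<Rightarrow> cmd \<Rightarrow> fst3 \<Rightarrow> fst3" where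
  "sem W x CSkip s = s"
| "sem W x (CSet i e) s = ((fst s)[i := eval W x e (fst s) (fst (snd s))], snd s)"
| "sem W x (CFlip e) s = (let a = eval W x e (fst s) (fst (snd s)) in
     (fst s, (fst (snd s))[a := \<not> fst (snd s) ! a], snd (snd s)))"
| "sem W x (CEmit e) s = (fst s, fst (snd s), snd (snd s) @ [eval W x e (fst s) (fst (snd s)) \<noteq> 0])"
| "sem W x (CSeq c d) s = sem W x d (sem W x c s)"
| "sem W x (CIf e c d) s = (if eval W x e (fst s) (fst (snd s)) \<noteq> 0 then sem W x c s else sem W x d s)"
| "sem W x (CFor e c) s = loop (\<lambda>k s. pop (sem W x c (push k s))) (eval W x e (fst s) (fst (snd s))) s"
| "sem W x (CCall r es c) s =
     (let s' = sem W x c (0 # map (\<lambda>e. eval W x e (fst s) (fst (snd s))) es, snd s)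
      in ((fst s)[r := fst s' ! 0], snd s'))"

section \<open>Word arithmetic by counting, in time polynomial in the word size\<close>

definition bin_add :: "nat \<Rightarrow> nat \<Rightarrow> tm" where
  "bin_add D t = lfor D (t + 2) (t + 1) (incv D t)"
definition bin_mul :: "nat \<Rightarrow> nat \<Rightarrow> tm" where
  "bin_mul D t = TSeq (copyv (t + 2) t) (TSeq (zerov t)
     (lfor D (t + 3) (t + 1) (lfor D (t + 4) (t + 2) (incv D t))))"
text \<open>Counting up to \<open>a\<close> and incrementing only once the counter has reached
  \<open>b\<close> yields truncated subtraction.\<close>

definition bin_sub :: "nat \<Rightarrow> nat \<Rightarrow> tm" where
  "bin_sub D t = TSeq (copyv (t + 2) t) (TSeq (zerov t)
     (lfor D (t + 3) (t + 2) (ifcmp 1 (t + 3) (t + 1) TSkip (incv D t))))"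
text \<open>Track \<open>t + 4\<close> is a running remainder that is reset on reaching the divisor.
  For divisor 0 it never is, because it has already been incremented when compared and does not wrap
  around; this agrees with the conventions for \<open>div\<close> and \<open>mod\<close>.\<close>

definition bin_div :: "nat \<Rightarrow> nat \<Rightarrow> tm" where
  "bin_div D t = TSeq (copyv (t + 2) t) (TSeq (zerov t) (TSeq (zerov (t + 4))
     (lfor D (t + 3) (t + 2) (TSeq (incv D (t + 4))
        (ifcmp 0 (t + 4) (t + 1) (TSeq (zerov (t + 4)) (incv D t)) TSkip)))))"
definition bin_mod :: "nat \<Rightarrow> nat \<Rightarrow> tm" where
  "bin_mod D t = TSeq (bin_div D t) (copyv t (t + 4))"
definition bin_cmp :: "nat \<Rightarrow> nat \<Rightarrow> nat \<Rightarrow> tm" where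
  "bin_cmp c D t = ifcmp c t (t + 1) (TSeq (zerov t) (incv D t)) (zerov t)"

text \<open>Operands lie in tracks \<open>t\<close> and \<open>t + 1\<close>, the result goes to
  \<open>t\<close>, and everything above is scratch.\<close>

definition binspec :: "(nat \<Rightarrow> nat \<Rightarrow> nat \<Rightarrow> nat) \<Rightarrow> nat \<Rightarrow> nat \<Rightarrow> bool list \<Rightarrow> s3 \<Rightarrow> s3 \<Rightarrow> bool" where
  "binspec f t W x s s' \<longleftrightarrow> snd s' = snd s \<and> (\<forall>v<t. fst s' v = fst s v) \<and>
     fst s' t = f W (fst s t) (fst s (t + 1))"

lemma setv_simps [simp]: "fst (setv v y s) = (fst s)(v := y)" "snd (setv v y s) = snd s"
  by (cases s; simp)+

context
  fixes D :: nat
  assumes D: "4 \<le> D"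
begin

lemmas okp_intros = okp_zerov[OF D] okp_topv[OF D] okp_incv[OF D] okp_copyv[OF D] okp_skip[OF D]
  okp_seq[OF D] okp_ifcmp[OF D] okp_lfor[OF D]

lemma goodD: "good W s \<Longrightarrow> 4 \<le> W \<and> (\<forall>v. fst s v < W)"
  by (cases s) auto

lemma okp_bin_add: "okp D (bin_add D t) (binspec (\<lambda>W a b. (a + b) mod W) t)"
  unfolding bin_add_def
proof (rule okp_mono[OF okp_lfor[OF D okp_incv[OF D]]])
  fix W x s s'
  assume g: "good W s" "good W s'"
    and "\<exists>f. f 0 = setv (t + 2) 0 s \<and> s' = f (fst s (t + 1)) \<and>
     (\<forall>k<fst s (t + 1). \<exists>u. good W (f k) \<and> good W u \<and> fst (f k) (t + 2) = k \<and> u = setv t ((fst (f k) t + 1) mod W) (f k) \<and>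
        f (Suc k) = setv (t + 2) (Suc k) u)"
  then obtain f where f: "f 0 = setv (t + 2) 0 s" "s' = f (fst s (t + 1))"
     "\<And>k. k < fst s (t + 1) \<Longrightarrow> f (Suc k) = setv (t + 2) (Suc k) (setv t ((fst (f k) t + 1) mod W) (f k))"
    by blast
  have "snd (f k) = snd s \<and> (\<forall>v<t. fst (f k) v = fst s v) \<and> fst (f k) t = (fst s t + k) mod W" if "k \<le> fst s (t + 1)" for k
    using that
  proof (induction k)
    case 0
    then show ?case using f(1) goodD[OF g(1)] by simp
  next
    case (Suc k)
    then show ?case using f(3)[of k] by (auto simp: mod_Suc_eq)
  qed
  then show "binspec (\<lambda>W a b. (a + b) mod W) t W x s s'" using f(2) by (simp add: binspec_def)
qed auto

lemma okp_bin_mul: "okp D (bin_mul D t) (binspec (\<lambda>W a b. (a * b) mod W) t)"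
proof -
  let ?I = "\<lambda>W (x::bool list) s s'. snd s' = snd s \<and> (\<forall>v<t + 4. v \<noteq> t \<longrightarrow> fst s' v = fst s v) \<and>
     fst s' t = (fst s t + fst s (t + 2)) mod W"
  have inner: "okp D (lfor D (t + 4) (t + 2) (incv D t)) ?I"
  proof (rule okp_mono[OF okp_lfor[OF D okp_incv[OF D]]])
    fix W x s s'
    assume g: "good W s" "good W s'"
      and "\<exists>f. f 0 = setv (t + 4) 0 s \<and> s' = f (fst s (t + 2)) \<and>
     (\<forall>k<fst s (t + 2). \<exists>u. good W (f k) \<and> good W u \<and> fst (f k) (t + 4) = k \<and> u = setv t ((fst (f k) t + 1) mod W) (f k) \<and>
        f (Suc k) = setv (t + 4) (Suc k) u)"
    then obtain f where f: "f 0 = setv (t + 4) 0 s" "s' = f (fst s (t + 2))"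
     "\<And>k. k < fst s (t + 2) \<Longrightarrow> f (Suc k) = setv (t + 4) (Suc k) (setv t ((fst (f k) t + 1) mod W) (f k))"
      by blast
    have "snd (f k) = snd s \<and> (\<forall>v<t + 4. v \<noteq> t \<longrightarrow> fst (f k) v = fst s v) \<and> fst (f k) t = (fst s t + k) mod W"
      if "k \<le> fst s (t + 2)" for k
      using that
    proof (induction k)
      case 0
      then show ?case using f(1) goodD[OF g(1)] by simp
    next
      case (Suc k)
      then show ?case using f(3)[of k] by (auto simp: mod_Suc_eq)
    qed
    then show "?I W x s s'" using f(2) by blast
  qed auto
  show ?thesis unfolding bin_mul_def
  proof (rule okp_mono[OF okp_seq[OF D okp_copyv[OF D] okp_seq[OF D okp_zerov[OF D] okp_lfor[OF D inner]]]])
    fix W x s s'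
    let ?P = "\<lambda>s s'. \<exists>f. f 0 = setv (t + 3) 0 s \<and> s' = f (fst s (t + 1)) \<and>
       (\<forall>k<fst s (t + 1). \<exists>u. good W (f k) \<and> good W u \<and> fst (f k) (t + 3) = k \<and> ?I W x (f k) u \<and> f (Suc k) = setv (t + 3) (Suc k) u)"
    assume g: "good W s" "good W s'"
      and "\<exists>s1. good W s1 \<and> s1 = setv (t + 2) (fst s t) s \<and> (\<exists>s2. good W s2 \<and> s2 = setv t 0 s1 \<and> ?P s2 s')"
    then have *: "?P (setv t 0 (setv (t + 2) (fst s t) s)) s'" by blast
    have e: "fst (setv t 0 (setv (t + 2) (fst s t) s)) (t + 1) = fst s (t + 1)" by simp
    from *[unfolded e] obtain f where f: "f 0 = setv (t + 3) 0 (setv t 0 (setv (t + 2) (fst s t) s))" "s' = f (fst s (t + 1))"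
     "\<And>k. k < fst s (t + 1) \<Longrightarrow> \<exists>u. ?I W x (f k) u \<and> f (Suc k) = setv (t + 3) (Suc k) u"
      by blast
    have "snd (f k) = snd s \<and> (\<forall>v<t. fst (f k) v = fst s v) \<and> fst (f k) (t + 2) = fst s t \<and> fst (f k) t = (fst s t * k) mod W"
      if "k \<le> fst s (t + 1)" for k
      using that
    proof (induction k)
      case 0
      then show ?case using f(1) by simp
    next
      case (Suc k)
      from f(3)[OF Suc_le_lessD[OF Suc.prems]] obtain u where u: "?I W x (f k) u" "f (Suc k) = setv (t + 3) (Suc k) u" by blast
      have "(fst s t * k mod W + fst s t) mod W = (fst s t * Suc k) mod W" by (simp add: mod_simps algebra_simps)
      then show ?case using u Suc by simp
    qed
    then show "binspec (\<lambda>W a b. (a * b) mod W) t W x s s'" using f(2) by (simp add: binspec_def)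
  qed auto
qed

lemma okp_bin_sub: "okp D (bin_sub D t) (binspec (\<lambda>W a b. a - b) t)"
  unfolding bin_sub_def
proof (rule okp_mono[OF okp_seq[OF D okp_copyv[OF D] okp_seq[OF D okp_zerov[OF D]
        okp_lfor[OF D okp_ifcmp[OF D okp_skip[OF D] okp_incv[OF D]]]]]])
  fix W x s s'
  let ?I = "\<lambda>s s'. if cmpv (fst s (t + 3)) (fst s (t + 1)) = 1 then s' = s else s' = setv t ((fst s t + 1) mod W) s"
  let ?P = "\<lambda>s s'. \<exists>f. f 0 = setv (t + 3) 0 s \<and> s' = f (fst s (t + 2)) \<and>
     (\<forall>k<fst s (t + 2). \<exists>u. good W (f k) \<and> good W u \<and> fst (f k) (t + 3) = k \<and> ?I (f k) u \<and> f (Suc k) = setv (t + 3) (Suc k) u)"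
  assume g: "good W s" "good W s'"
    and "\<exists>s1. good W s1 \<and> s1 = setv (t + 2) (fst s t) s \<and> (\<exists>s2. good W s2 \<and> s2 = setv t 0 s1 \<and> ?P s2 s')"
  then have *: "?P (setv t 0 (setv (t + 2) (fst s t) s)) s'" by blast
  have e: "fst (setv t 0 (setv (t + 2) (fst s t) s)) (t + 2) = fst s t" by simp
  from *[unfolded e] obtain f where f: "f 0 = setv (t + 3) 0 (setv t 0 (setv (t + 2) (fst s t) s))" "s' = f (fst s t)"
     "\<And>k. k < fst s t \<Longrightarrow> \<exists>u. fst (f k) (t + 3) = k \<and> ?I (f k) u \<and> f (Suc k) = setv (t + 3) (Suc k) u"
    by blast
  have "snd (f k) = snd s \<and> (\<forall>v<t. fst (f k) v = fst s v) \<and> fst (f k) (t + 1) = fst s (t + 1) \<and> fst (f k) t = k - fst s (t + 1)"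
    if "k \<le> fst s t" for k
    using that
  proof (induction k)
    case 0
    then show ?case using f(1) by simp
  next
    case (Suc k)
    from f(3)[OF Suc_le_lessD[OF Suc.prems]] obtain u where u: "fst (f k) (t + 3) = k" "?I (f k) u" "f (Suc k) = setv (t + 3) (Suc k) u" by blast
    have "fst s t < W" using goodD[OF g(1)] by blast
    then have "Suc (k - fst s (t + 1)) mod W = Suc (k - fst s (t + 1))" using Suc.prems by simp
    moreover have ih: "snd (f k) = snd s" "\<forall>v<t. fst (f k) v = fst s v" "fst (f k) (t + 1) = fst s (t + 1)"
      "fst (f k) t = k - fst s (t + 1)" using Suc by simp_all
    ultimately show ?case
    proof (cases "k < fst s (t + 1)")
      case True
      then have "u = f k" using u(1,2) ih(3) by (simp add: cmpv_def)
      then show ?thesis using u(3) ih True by simp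
    next
      case False
      then have "u = setv t ((fst (f k) t + 1) mod W) (f k)" using u(1,2) ih(3) by (simp add: cmpv_def)
      then show ?thesis using u(3) ih False \<open>Suc (k - fst s (t + 1)) mod W = Suc (k - fst s (t + 1))\<close>
        by (simp add: Suc_diff_le)
    qed
  qed
  then show "binspec (\<lambda>W a b. a - b) t W x s s'" using f(2) by (simp add: binspec_def)
qed (auto split: if_splits)

lemma okp_bin_div: "okp D (bin_div D t) (\<lambda>W x s s'. snd s' = snd s \<and> (\<forall>v<t. fst s' v = fst s v) \<and>
     fst s' t = fst s t div fst s (t + 1) \<and> fst s' (t + 4) = fst s t mod fst s (t + 1))"
proof -
  let ?I = "\<lambda>W (x::bool list) s s'. snd s' = snd s \<and> (\<forall>v<t + 4. v \<noteq> t \<longrightarrow> fst s' v = fst s v) \<and>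
     (let m = (fst s (t + 4) + 1) mod W in if m = fst s (t + 1) then fst s' (t + 4) = 0 \<and> fst s' t = (fst s t + 1) mod W
       else fst s' (t + 4) = m \<and> fst s' t = fst s t)"
  have inner: "okp D (TSeq (incv D (t + 4)) (ifcmp 0 (t + 4) (t + 1) (TSeq (zerov (t + 4)) (incv D t)) TSkip)) ?I"
  proof (rule okp_mono[OF okp_seq[OF D okp_incv[OF D] okp_ifcmp[OF D okp_seq[OF D okp_zerov[OF D] okp_incv[OF D]] okp_skip[OF D]]]])
    fix W x and s s' :: s3
    let ?s = "setv (t + 4) ((fst s (t + 4) + 1) mod W) s"
    assume "\<exists>s1. good W s1 \<and> s1 = ?s \<and> (if cmpv (fst s1 (t + 4)) (fst s1 (t + 1)) = 0
      then \<exists>s2. good W s2 \<and> s2 = setv (t + 4) 0 s1 \<and> s' = setv t ((fst s2 t + 1) mod W) s2 else s' = s1)"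
    then obtain s1 where s1: "s1 = ?s" "if cmpv (fst s1 (t + 4)) (fst s1 (t + 1)) = 0
      then \<exists>s2. good W s2 \<and> s2 = setv (t + 4) 0 s1 \<and> s' = setv t ((fst s2 t + 1) mod W) s2 else s' = s1" by blast
    have "if cmpv (fst ?s (t + 4)) (fst ?s (t + 1)) = 0
      then s' = setv t ((fst (setv (t + 4) 0 ?s) t + 1) mod W) (setv (t + 4) 0 ?s) else s' = ?s"
    proof (cases "cmpv (fst ?s (t + 4)) (fst ?s (t + 1)) = 0")
      case True
      then have "\<exists>s2. good W s2 \<and> s2 = setv (t + 4) 0 ?s \<and> s' = setv t ((fst s2 t + 1) mod W) s2"
        using s1(2) unfolding s1(1) by (simp only: if_True)
      then have "s' = setv t ((fst (setv (t + 4) 0 ?s) t + 1) mod W) (setv (t + 4) 0 ?s)" by blast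
      then show ?thesis unfolding if_P[OF True] .
    next
      case False
      then show ?thesis using s1(2) unfolding s1(1) by (simp only: if_False)
    qed
    then show "?I W x s s'" by (simp add: cmpv_def Let_def split: if_splits)
  qed
  show ?thesis unfolding bin_div_def
  proof (rule okp_mono[OF okp_seq[OF D okp_copyv[OF D] okp_seq[OF D okp_zerov[OF D] okp_seq[OF D okp_zerov[OF D]
          okp_lfor[OF D inner]]]]])
    fix W x s s'
    let ?P = "\<lambda>s s'. \<exists>f. f 0 = setv (t + 3) 0 s \<and> s' = f (fst s (t + 2)) \<and>
       (\<forall>k<fst s (t + 2). \<exists>u. good W (f k) \<and> good W u \<and> fst (f k) (t + 3) = k \<and> ?I W x (f k) u \<and> f (Suc k) = setv (t + 3) (Suc k) u)"
    assume g: "good W s" "good W s'"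
      and "\<exists>s1. good W s1 \<and> s1 = setv (t + 2) (fst s t) s \<and> (\<exists>s2. good W s2 \<and> s2 = setv t 0 s1 \<and>
        (\<exists>s3. good W s3 \<and> s3 = setv (t + 4) 0 s2 \<and> ?P s3 s'))"
    then have *: "?P (setv (t + 4) 0 (setv t 0 (setv (t + 2) (fst s t) s))) s'" by blast
    have e: "fst (setv (t + 4) 0 (setv t 0 (setv (t + 2) (fst s t) s))) (t + 2) = fst s t" by simp
    from *[unfolded e] obtain f where f: "f 0 = setv (t + 3) 0 (setv (t + 4) 0 (setv t 0 (setv (t + 2) (fst s t) s)))" "s' = f (fst s t)"
     "\<And>k. k < fst s t \<Longrightarrow> \<exists>u. ?I W x (f k) u \<and> f (Suc k) = setv (t + 3) (Suc k) u"
      by blast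
    let ?b = "fst s (t + 1)"
    have "snd (f k) = snd s \<and> (\<forall>v<t. fst (f k) v = fst s v) \<and> fst (f k) (t + 1) = ?b \<and> fst (f k) t = k div ?b \<and>
       fst (f k) (t + 4) = k mod ?b" if "k \<le> fst s t" for k
      using that
    proof (induction k)
      case 0
      then show ?case using f(1) by simp
    next
      case (Suc k)
      from f(3)[OF Suc_le_lessD[OF Suc.prems]] obtain u where u: "?I W x (f k) u" "f (Suc k) = setv (t + 3) (Suc k) u" by blast
      have W: "Suc k < W" using goodD[OF g(1)] Suc.prems le_less_trans by blast
      have m: "Suc (k mod ?b) mod W = Suc (k mod ?b)" "Suc (k div ?b) mod W = Suc (k div ?b)"
        using W mod_less_eq_dividend[of k ?b] div_le_dividend[of k ?b] by (auto intro!: mod_less simp del: mod_less_eq_dividend div_le_dividend)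
      show ?case
      proof (cases "Suc (k mod ?b) = ?b")
        case True
        then show ?thesis using u Suc m by (auto simp: Let_def mod_Suc div_Suc)
      next
        case False
        then have "Suc k mod ?b = Suc (k mod ?b)" "Suc k div ?b = k div ?b" by (auto simp: mod_Suc div_Suc)
        then show ?thesis using u Suc m False by (auto simp: Let_def)
      qed
    qed
    then show "snd s' = snd s \<and> (\<forall>v<t. fst s' v = fst s v) \<and>
     fst s' t = fst s t div ?b \<and> fst s' (t + 4) = fst s t mod ?b" using f(2) by simp
  qed (auto split: if_splits)
qed

lemma okp_bin_div': "okp D (bin_div D t) (binspec (\<lambda>W a b. a div b) t)"
  by (rule okp_mono[OF okp_bin_div]) (auto simp: binspec_def)

lemma okp_bin_mod: "okp D (bin_mod D t) (binspec (\<lambda>W a b. a mod b) t)"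
  unfolding bin_mod_def
  by (rule okp_mono[OF okp_seq[OF D okp_bin_div okp_copyv[OF D]]]) (auto simp: binspec_def)

lemma okp_bin_cmp: "okp D (bin_cmp c D t) (binspec (\<lambda>W a b. of_bool (cmpv a b = c)) t)"
  unfolding bin_cmp_def
  by (rule okp_mono[OF okp_ifcmp[OF D okp_seq[OF D okp_zerov[OF D] okp_incv[OF D]] okp_zerov[OF D]]])
    (auto simp: binspec_def dest!: goodD split: if_splits)

lemma okp_raw:
  assumes "\<And>V L x st C ot. v < V \<Longrightarrow> 1 \<le> L \<Longrightarrow> good (D ^ L) (st, C, ot) \<Longrightarrow>
      rn D V L x p (st, 0, C, 0, ot) ((D ^ L) ^ k) (lift (F x (st, C, ot))) \<and> good (D ^ L) (F x (st, C, ot))"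
  shows "okp D p (\<lambda>W x s s'. s' = F x s)"
proof (rule okpI[where k = k and m = "Suc v"])
  fix V L x and s :: s3 assume h: "Suc v \<le> V" "1 \<le> L" "good (D ^ L) s"
  obtain st C ot where s: "s = (st, C, ot)" by (rule prod_cases3)
  show "\<exists>s' t. rn D V L x p (lift s) t (lift s') \<and> t \<le> (D ^ L) ^ k \<and> good (D ^ L) s' \<and> s' = F x s"
    using assms[of V L st C ot x] h s by (intro exI[of _ "F x s"] exI[of _ "(D ^ L) ^ k"]) auto
qed (use D in simp)

lemma okp_catbitp: "okp D (catbitp D t t (t + 1))
   (\<lambda>W x s s'. s' = setv t (of_bool (fst (snd s) ! fst s t)) (setv (t + 1) (fst s t) s))"
  by (rule okp_raw[where v = "t + 1" and k = 110]) (use rn_catbitp[OF D, of _ "t + 1" _ t t] D in auto)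

lemma okp_inbitp: "okp D (inbitp D t t (t + 1))
   (\<lambda>W x s s'. s' = setv t (inval x (fst s t)) (setv (t + 1) (fst s t) s))"
  by (rule okp_raw[where v = "t + 1" and k = 212]) (use rn_inbitp[OF D, of _ "t + 1" _ t t] D in \<open>auto simp: inval_def\<close>)

lemma okp_flipp: "okp D (flipp D t (t + 1))
   (\<lambda>W x s s'. s' = ((fst s)(t + 1 := fst s t), (fst (snd s))[fst s t := \<not> fst (snd s) ! fst s t], snd (snd s)))"
  by (rule okp_raw[where v = "t + 1" and k = 46]) (use rn_flipp[OF D, of _ "t + 1" _ t] D in auto)

lemma okp_emit: "okp D (head_act Stay False Stay (Some b)) (\<lambda>W x s s'. s' = (fst s, fst (snd s), snd (snd s) @ [b]))"
proof (rule okp_raw[where v = 0 and k = 0])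
  fix V L x st C ot assume h: "1 \<le> L" "good (D ^ L) (st, C, ot)"
  have "C \<noteq> []" using h D by auto
  have "2 \<le> D" using D by simp
  from rn_head_act[OF this h(1), where cm = Stay and im = Stay and fl = False and em = "Some b" and st = st
        and ip = 0 and C = C and cp = 0 and ot = ot and x = x and V = V] h
  show "rn D V L x (head_act Stay False Stay (Some b)) (st, 0, C, 0, ot) ((D ^ L) ^ 0)
    (lift (fst (st, C, ot), fst (snd (st, C, ot)), snd (snd (st, C, ot)) @ [b])) \<and>
     good (D ^ L) (fst (st, C, ot), fst (snd (st, C, ot)), snd (snd (st, C, ot)) @ [b])"
    using D \<open>C \<noteq> []\<close> by auto
qed

end

section \<open>Compiling expressions and commands\<close>

primrec comp_exp :: "nat \<Rightarrow> nat list \<Rightarrow> exp \<Rightarrow> nat \<Rightarrow> tm" where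
  "comp_exp D \<rho> (EN k) t = ((\<lambda>p. TSeq p (incv D t)) ^^ k) (zerov t)"
| "comp_exp D \<rho> (EV i) t = (if i < length \<rho> then copyv t (\<rho> ! i) else zerov t)"
| "comp_exp D \<rho> ETop t = topv D t"
| "comp_exp D \<rho> (EAdd a b) t = TSeq (comp_exp D \<rho> a t) (TSeq (comp_exp D \<rho> b (t + 1)) (bin_add D t))"
| "comp_exp D \<rho> (EMul a b) t = TSeq (comp_exp D \<rho> a t) (TSeq (comp_exp D \<rho> b (t + 1)) (bin_mul D t))"
| "comp_exp D \<rho> (ESub a b) t = TSeq (comp_exp D \<rho> a t) (TSeq (comp_exp D \<rho> b (t + 1)) (bin_sub D t))"
| "comp_exp D \<rho> (EDiv a b) t = TSeq (comp_exp D \<rho> a t) (TSeq (comp_exp D \<rho> b (t + 1)) (bin_div D t))"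
| "comp_exp D \<rho> (EMod a b) t = TSeq (comp_exp D \<rho> a t) (TSeq (comp_exp D \<rho> b (t + 1)) (bin_mod D t))"
| "comp_exp D \<rho> (ELess a b) t = TSeq (comp_exp D \<rho> a t) (TSeq (comp_exp D \<rho> b (t + 1)) (bin_cmp 1 D t))"
| "comp_exp D \<rho> (EEq a b) t = TSeq (comp_exp D \<rho> a t) (TSeq (comp_exp D \<rho> b (t + 1)) (bin_cmp 0 D t))"
| "comp_exp D \<rho> (ECat a) t = TSeq (comp_exp D \<rho> a t) (catbitp D t t (t + 1))"
| "comp_exp D \<rho> (EIn a) t = TSeq (comp_exp D \<rho> a t) (inbitp D t t (t + 1))"

primrec comp_args :: "nat \<Rightarrow> nat list \<Rightarrow> nat \<Rightarrow> exp list \<Rightarrow> tm" where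
  "comp_args D \<rho> t [] = TSkip"
| "comp_args D \<rho> t (e # es) = TSeq (comp_exp D \<rho> e t) (comp_args D \<rho> (t + 1) es)"

text \<open>\<open>\<rho>\<close> lists the tracks of the frame and \<open>t\<close> is the first
  free track, so frames form a stack. Calls are expanded in place. A loop hands its body a copy of
  the counter, which the body may overwrite without disturbing the loop.\<close>

primrec comp :: "nat \<Rightarrow> cmd \<Rightarrow> nat list \<Rightarrow> nat \<Rightarrow> tm" where
  "comp D CSkip \<rho> t = TSkip"
| "comp D (CSet i e) \<rho> t = TSeq (comp_exp D \<rho> e t) (if i < length \<rho> then copyv (\<rho> ! i) t else TSkip)"
| "comp D (CFlip e) \<rho> t = TSeq (comp_exp D \<rho> e t) (flipp D t (t + 1))"
| "comp D (CEmit e) \<rho> t = TSeq (comp_exp D \<rho> e t) (TSeq (zerov (t + 1))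
     (ifcmp 0 t (t + 1) (head_act Stay False Stay (Some False)) (head_act Stay False Stay (Some True))))"
| "comp D (CSeq c d) \<rho> t = TSeq (comp D c \<rho> t) (comp D d \<rho> t)"
| "comp D (CIf e c d) \<rho> t = TSeq (comp_exp D \<rho> e t) (TSeq (zerov (t + 1))
     (ifcmp 0 t (t + 1) (comp D d \<rho> t) (comp D c \<rho> t)))"
| "comp D (CFor e c) \<rho> t = TSeq (comp_exp D \<rho> e t)
     (lfor D (t + 1) t (TSeq (copyv (t + 2) (t + 1)) (comp D c (\<rho> @ [t + 2]) (t + 3))))"
| "comp D (CCall r es c) \<rho> t = TSeq (zerov t) (TSeq (comp_args D \<rho> (t + 1) es)
     (TSeq (comp D c [t..<t + 1 + length es] (t + 1 + length es)) (if r < length \<rho> then copyv (\<rho> ! r) t else TSkip)))"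

definition espec :: "nat list \<Rightarrow> exp \<Rightarrow> nat \<Rightarrow> nat \<Rightarrow> bool list \<Rightarrow> s3 \<Rightarrow> s3 \<Rightarrow> bool" where
  "espec \<rho> e t W x s s' \<longleftrightarrow> snd s' = snd s \<and> (\<forall>v<t. fst s' v = fst s v) \<and>
     fst s' t = eval W x e (map (fst s) \<rho>) (fst (snd s))"

definition cspec :: "cmd \<Rightarrow> nat list \<Rightarrow> nat \<Rightarrow> nat \<Rightarrow> bool list \<Rightarrow> s3 \<Rightarrow> s3 \<Rightarrow> bool" where
  "cspec c \<rho> t W x s s' \<longleftrightarrow> (\<forall>v<t. v \<notin> set \<rho> \<longrightarrow> fst s' v = fst s v) \<and>
     (map (fst s') \<rho>, snd s') = sem W x c (map (fst s) \<rho>, snd s)"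

context
  fixes D :: nat
  assumes D: "4 \<le> D"
begin

lemma okp_bin:
  assumes a: "okp D (comp_exp D \<rho> a t) (espec \<rho> a t)" and b: "okp D (comp_exp D \<rho> b (t + 1)) (espec \<rho> b (t + 1))"
    and op: "okp D p (binspec f t)" and \<rho>: "set \<rho> \<subseteq> {..<t}"
    and ev: "\<And>W x env C. eval W x e env C = f W (eval W x a env C) (eval W x b env C)"
  shows "okp D (TSeq (comp_exp D \<rho> a t) (TSeq (comp_exp D \<rho> b (t + 1)) p)) (espec \<rho> e t)"
proof (rule okp_mono[OF okp_seq[OF D a okp_seq[OF D b op]]])
  fix W x and s s' :: s3
  assume "\<exists>s1. good W s1 \<and> espec \<rho> a t W x s s1 \<and> (\<exists>s2. good W s2 \<and> espec \<rho> b (t + 1) W x s1 s2 \<and> binspec f t W x s2 s')"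
  then obtain s1 s2 where h: "espec \<rho> a t W x s s1" "espec \<rho> b (t + 1) W x s1 s2" "binspec f t W x s2 s'" by blast
  have "map (fst s1) \<rho> = map (fst s) \<rho>" using h(1) \<rho> by (auto simp: espec_def subset_iff)
  then show "espec \<rho> e t W x s s'" using h by (simp add: espec_def binspec_def ev del: map_eq_conv)
qed

lemma okp_const: "okp D (((\<lambda>p. TSeq p (incv D t)) ^^ k) (zerov t)) (\<lambda>W x s s'. s' = setv t (k mod W) s)"
proof (induction k)
  case 0
  then show ?case using okp_zerov[OF D] by simp
next
  case (Suc k)
  show ?case unfolding funpow.simps comp_apply
  proof (rule okp_mono[OF okp_seq[OF D Suc okp_incv[OF D]]])
    fix W x and s s' :: s3
    assume "\<exists>s1. good W s1 \<and> s1 = setv t (k mod W) s \<and> s' = setv t ((fst s1 t + 1) mod W) s1"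
    then show "s' = setv t (Suc k mod W) s" by (cases s) (auto simp: mod_Suc_eq)
  qed
qed

lemma okp_comp_exp: "set \<rho> \<subseteq> {..<t} \<Longrightarrow> okp D (comp_exp D \<rho> e t) (espec \<rho> e t)"
proof (induction e arbitrary: t)
  case (EN k)
  show ?case unfolding comp_exp.simps by (rule okp_mono[OF okp_const]) (auto simp: espec_def)
next
  case (EV i)
  show ?case
  proof (cases "i < length \<rho>")
    case True
    then show ?thesis by (simp, intro okp_mono[OF okp_copyv[OF D]]) (auto simp: espec_def)
  next
    case False
    then show ?thesis by (simp, intro okp_mono[OF okp_zerov[OF D]]) (auto simp: espec_def)
  qed
next
  case ETop
  show ?case unfolding comp_exp.simps by (rule okp_mono[OF okp_topv[OF D]]) (auto simp: espec_def)
next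
  case (EAdd a b)
  have "set \<rho> \<subseteq> {..<t + 1}" using EAdd.prems by auto
  then show ?case unfolding comp_exp.simps
    by (intro okp_bin[OF EAdd.IH(1)[OF EAdd.prems] EAdd.IH(2) okp_bin_add[OF D] EAdd.prems]) auto
next
  case (EMul a b)
  have "set \<rho> \<subseteq> {..<t + 1}" using EMul.prems by auto
  then show ?case unfolding comp_exp.simps
    by (intro okp_bin[OF EMul.IH(1)[OF EMul.prems] EMul.IH(2) okp_bin_mul[OF D] EMul.prems]) auto
next
  case (ESub a b)
  have "set \<rho> \<subseteq> {..<t + 1}" using ESub.prems by auto
  then show ?case unfolding comp_exp.simps
    by (intro okp_bin[OF ESub.IH(1)[OF ESub.prems] ESub.IH(2) okp_bin_sub[OF D] ESub.prems]) auto
next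
  case (EDiv a b)
  have "set \<rho> \<subseteq> {..<t + 1}" using EDiv.prems by auto
  then show ?case unfolding comp_exp.simps
    by (intro okp_bin[OF EDiv.IH(1)[OF EDiv.prems] EDiv.IH(2) okp_bin_div'[OF D] EDiv.prems]) auto
next
  case (EMod a b)
  have "set \<rho> \<subseteq> {..<t + 1}" using EMod.prems by auto
  then show ?case unfolding comp_exp.simps
    by (intro okp_bin[OF EMod.IH(1)[OF EMod.prems] EMod.IH(2) okp_bin_mod[OF D] EMod.prems]) auto
next
  case (ELess a b)
  have "set \<rho> \<subseteq> {..<t + 1}" using ELess.prems by auto
  then show ?case unfolding comp_exp.simps
    by (intro okp_bin[OF ELess.IH(1)[OF ELess.prems] ELess.IH(2) okp_bin_cmp[OF D] ELess.prems]) (auto simp: cmpv_def)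
next
  case (EEq a b)
  have "set \<rho> \<subseteq> {..<t + 1}" using EEq.prems by auto
  then show ?case unfolding comp_exp.simps
    by (intro okp_bin[OF EEq.IH(1)[OF EEq.prems] EEq.IH(2) okp_bin_cmp[OF D] EEq.prems]) (auto simp: cmpv_def)
next
  case (ECat a)
  show ?case unfolding comp_exp.simps
  proof (rule okp_mono[OF okp_seq[OF D ECat.IH[OF ECat.prems] okp_catbitp[OF D]]])
    fix W x and s s' :: s3
    assume "\<exists>s1. good W s1 \<and> espec \<rho> a t W x s s1 \<and>
      s' = setv t (of_bool (fst (snd s1) ! fst s1 t)) (setv (t + 1) (fst s1 t) s1)"
    then obtain s1 where "espec \<rho> a t W x s s1" "s' = setv t (of_bool (fst (snd s1) ! fst s1 t)) (setv (t + 1) (fst s1 t) s1)"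
      by blast
    then show "espec \<rho> (ECat a) t W x s s'" by (simp add: espec_def)
  qed
next
  case (EIn a)
  show ?case unfolding comp_exp.simps
  proof (rule okp_mono[OF okp_seq[OF D EIn.IH[OF EIn.prems] okp_inbitp[OF D]]])
    fix W x and s s' :: s3
    assume "\<exists>s1. good W s1 \<and> espec \<rho> a t W x s s1 \<and> s' = setv t (inval x (fst s1 t)) (setv (t + 1) (fst s1 t) s1)"
    then obtain s1 where "espec \<rho> a t W x s s1" "s' = setv t (inval x (fst s1 t)) (setv (t + 1) (fst s1 t) s1)"
      by blast
    then show "espec \<rho> (EIn a) t W x s s'" by (simp add: espec_def)
  qed
qed

lemma okp_comp_args:
  "set \<rho> \<subseteq> {..<t} \<Longrightarrow> okp D (comp_args D \<rho> t es) (\<lambda>W x s s'. snd s' = snd s \<and> (\<forall>v<t. fst s' v = fst s v) \<and>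
     map (fst s') [t..<t + length es] = map (\<lambda>e. eval W x e (map (fst s) \<rho>) (fst (snd s))) es)"
proof (induction es arbitrary: t)
  case Nil
  then show ?case by (simp, intro okp_mono[OF okp_skip[OF D]]) auto
next
  case (Cons e es)
  have "set \<rho> \<subseteq> {..<t + 1}" using Cons.prems by auto
  note IH = Cons.IH[OF this]
  show ?case unfolding comp_args.simps
  proof (rule okp_mono[OF okp_seq[OF D okp_comp_exp[OF Cons.prems] IH]])
    fix W x and s s' :: s3
    assume "\<exists>s1. good W s1 \<and> espec \<rho> e t W x s s1 \<and> snd s' = snd s1 \<and> (\<forall>v<t + 1. fst s' v = fst s1 v) \<and>
     map (fst s') [t + 1..<t + 1 + length es] = map (\<lambda>e. eval W x e (map (fst s1) \<rho>) (fst (snd s1))) es"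
    then obtain s1 where s1: "espec \<rho> e t W x s s1" "snd s' = snd s1" "\<forall>v<t + 1. fst s' v = fst s1 v"
     "map (fst s') [t + 1..<t + 1 + length es] = map (\<lambda>e. eval W x e (map (fst s1) \<rho>) (fst (snd s1))) es" by blast
    have m: "map (fst s1) \<rho> = map (fst s) \<rho>" using s1(1) Cons.prems by (auto simp: espec_def subset_iff)
    have "[t..<t + length (e # es)] = t # [t + 1..<t + 1 + length es]" by (simp add: upt_rec)
    then show "snd s' = snd s \<and> (\<forall>v<t. fst s' v = fst s v) \<and>
     map (fst s') [t..<t + length (e # es)] = map (\<lambda>e. eval W x e (map (fst s) \<rho>) (fst (snd s))) (e # es)"
      using s1 m by (auto simp: espec_def)
  qed
qed

lemma map_upd_nth: "distinct \<rho> \<Longrightarrow> i < length \<rho> \<Longrightarrow> map (f(\<rho> ! i := y)) \<rho> = (map f \<rho>)[i := y]"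
  by (auto intro!: nth_equalityI simp: nth_list_update nth_eq_iff_index_eq)

lemma okp_comp:
  "distinct \<rho> \<Longrightarrow> set \<rho> \<subseteq> {..<t} \<Longrightarrow> okp D (comp D c \<rho> t) (cspec c \<rho> t)"
proof (induction c arbitrary: \<rho> t)
  case CSkip
  show ?case by (simp, rule okp_mono[OF okp_skip[OF D]]) (auto simp: cspec_def)
next
  case (CSet i e)
  note E = okp_comp_exp[OF CSet.prems(2), of e]
  show ?case
  proof (cases "i < length \<rho>")
    case True
    show ?thesis unfolding comp.simps if_P[OF True]
    proof (rule okp_mono[OF okp_seq[OF D E okp_copyv[OF D]]])
      fix W x and s s' :: s3
      assume "\<exists>s1. good W s1 \<and> espec \<rho> e t W x s s1 \<and> s' = setv (\<rho> ! i) (fst s1 t) s1"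
      then obtain s1 where s1: "espec \<rho> e t W x s s1" "s' = setv (\<rho> ! i) (fst s1 t) s1" by blast
      have "map (fst s1) \<rho> = map (fst s) \<rho>" using s1(1) CSet.prems by (auto simp: espec_def subset_iff)
      then show "cspec (CSet i e) \<rho> t W x s s'"
        using s1 CSet.prems True by (auto simp: cspec_def espec_def map_upd_nth simp del: map_eq_conv)
    qed
  next
    case False
    show ?thesis unfolding comp.simps if_not_P[OF False]
    proof (rule okp_mono[OF okp_seq[OF D E okp_skip[OF D]]])
      fix W x and s s' :: s3
      assume "\<exists>s1. good W s1 \<and> espec \<rho> e t W x s s1 \<and> s' = s1"
      then have s1: "espec \<rho> e t W x s s'" by blast
      have "map (fst s') \<rho> = map (fst s) \<rho>" using s1 CSet.prems by (auto simp: espec_def subset_iff)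
      then show "cspec (CSet i e) \<rho> t W x s s'"
        using s1 False by (auto simp: cspec_def espec_def list_update_beyond simp del: map_eq_conv)
    qed
  qed
next
  case (CFlip e)
  show ?case unfolding comp.simps
  proof (rule okp_mono[OF okp_seq[OF D okp_comp_exp[OF CFlip.prems(2)] okp_flipp[OF D]]])
    fix W x and s s' :: s3
    assume "\<exists>s1. good W s1 \<and> espec \<rho> e t W x s s1 \<and>
      s' = ((fst s1)(t + 1 := fst s1 t), (fst (snd s1))[fst s1 t := \<not> fst (snd s1) ! fst s1 t], snd (snd s1))"
    then obtain s1 where s1: "espec \<rho> e t W x s s1"
      "s' = ((fst s1)(t + 1 := fst s1 t), (fst (snd s1))[fst s1 t := \<not> fst (snd s1) ! fst s1 t], snd (snd s1))" by blast
    have "map (fst s1) \<rho> = map (fst s) \<rho>" using s1(1) CFlip.prems by (auto simp: espec_def subset_iff)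
    moreover have "Suc t \<notin> set \<rho>" using CFlip.prems by auto
    ultimately show "cspec (CFlip e) \<rho> t W x s s'" using s1 by (simp add: cspec_def espec_def Let_def del: map_eq_conv)
  qed
next
  case (CEmit e)
  show ?case unfolding comp.simps
  proof (rule okp_mono[OF okp_seq[OF D okp_comp_exp[OF CEmit.prems(2)] okp_seq[OF D okp_zerov[OF D]
          okp_ifcmp[OF D okp_emit[OF D] okp_emit[OF D]]]]])
    fix W x and s s' :: s3
    let ?Q = "\<lambda>s2 s'. if cmpv (fst s2 t) (fst s2 (t + 1)) = 0 then s' = (fst s2, fst (snd s2), snd (snd s2) @ [False])
       else s' = (fst s2, fst (snd s2), snd (snd s2) @ [True])"
    assume "\<exists>s1. good W s1 \<and> espec \<rho> e t W x s s1 \<and> (\<exists>s2. good W s2 \<and> s2 = setv (t + 1) 0 s1 \<and> ?Q s2 s')"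
    then obtain s1 where s1: "espec \<rho> e t W x s s1" "?Q (setv (t + 1) 0 s1) s'" by blast
    have "map (fst s1) \<rho> = map (fst s) \<rho>" using s1(1) CEmit.prems by (auto simp: espec_def subset_iff)
    moreover have "Suc t \<notin> set \<rho>" using CEmit.prems by auto
    moreover have "s' = ((fst s1)(t + 1 := 0), fst (snd s1), snd (snd s1) @ [fst s1 t \<noteq> 0])"
      using s1(2) by (simp add: cmpv_def split: if_splits)
    ultimately show "cspec (CEmit e) \<rho> t W x s s'" using s1(1) by (simp add: cspec_def espec_def del: map_eq_conv)
  qed
next
  case (CSeq c d)
  show ?case unfolding comp.simps
  proof (rule okp_mono[OF okp_seq[OF D CSeq.IH(1)[OF CSeq.prems] CSeq.IH(2)[OF CSeq.prems]]])
    fix W x and s s' :: s3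
    assume "\<exists>s1. good W s1 \<and> cspec c \<rho> t W x s s1 \<and> cspec d \<rho> t W x s1 s'"
    then obtain s1 where "cspec c \<rho> t W x s s1" "cspec d \<rho> t W x s1 s'" by blast
    then show "cspec (CSeq c d) \<rho> t W x s s'" by (simp add: cspec_def)
  qed
next
  case (CIf e c d)
  show ?case unfolding comp.simps
  proof (rule okp_mono[OF okp_seq[OF D okp_comp_exp[OF CIf.prems(2)] okp_seq[OF D okp_zerov[OF D]
          okp_ifcmp[OF D CIf.IH(2)[OF CIf.prems] CIf.IH(1)[OF CIf.prems]]]]])
    fix W x and s s' :: s3
    let ?Q = "\<lambda>s2 s'. if cmpv (fst s2 t) (fst s2 (t + 1)) = 0 then cspec d \<rho> t W x s2 s' else cspec c \<rho> t W x s2 s'"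
    assume "\<exists>s1. good W s1 \<and> espec \<rho> e t W x s s1 \<and> (\<exists>s2. good W s2 \<and> s2 = setv (t + 1) 0 s1 \<and> ?Q s2 s')"
    then obtain s1 where s1: "espec \<rho> e t W x s s1" "?Q (setv (t + 1) 0 s1) s'" by blast
    have "map (fst s1) \<rho> = map (fst s) \<rho>" using s1(1) CIf.prems by (auto simp: espec_def subset_iff)
    moreover have "Suc t \<notin> set \<rho>" using CIf.prems by auto
    ultimately show "cspec (CIf e c d) \<rho> t W x s s'" using s1 by (auto simp: cspec_def espec_def cmpv_def simp del: map_eq_conv split: if_splits)
  qed
next
  case (CFor e c)
  have \<rho>': "distinct (\<rho> @ [t + 2])" "set (\<rho> @ [t + 2]) \<subseteq> {..<t + 3}" using CFor.prems by (auto simp: subset_iff)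
  have nin: "t \<notin> set \<rho>" "Suc t \<notin> set \<rho>" using CFor.prems by auto
  let ?body = "TSeq (copyv (t + 2) (t + 1)) (comp D c (\<rho> @ [t + 2]) (t + 3))"
  let ?I = "\<lambda>W x s s'. (\<forall>v<t + 2. v \<notin> set \<rho> \<longrightarrow> fst s' v = fst s v) \<and>
     (map (fst s') \<rho>, snd s') = pop (sem W x c (push (fst s (t + 1)) (map (fst s) \<rho>, snd s)))"
  have body: "okp D ?body ?I"
  proof (rule okp_mono[OF okp_seq[OF D okp_copyv[OF D] CFor.IH[OF \<rho>']]])
    fix W x and s s' :: s3
    assume "\<exists>s1. good W s1 \<and> s1 = setv (t + 2) (fst s (t + 1)) s \<and> cspec c (\<rho> @ [t + 2]) (t + 3) W x s1 s'"
    then have s1: "cspec c (\<rho> @ [t + 2]) (t + 3) W x (setv (t + 2) (fst s (t + 1)) s) s'" by blast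
    have "Suc (Suc t) \<notin> set \<rho>" using CFor.prems by auto
    then have "(map (fst s') \<rho> @ [fst s' (t + 2)], snd s') = sem W x c (push (fst s (t + 1)) (map (fst s) \<rho>, snd s))"
      using s1 by (simp add: cspec_def push_def del: map_eq_conv)
    then have "pop (map (fst s') \<rho> @ [fst s' (t + 2)], snd s') = pop (sem W x c (push (fst s (t + 1)) (map (fst s) \<rho>, snd s)))"
      by simp
    moreover have "\<forall>v<t + 2. v \<notin> set \<rho> \<longrightarrow> fst s' v = fst s v" using s1 by (simp add: cspec_def)
    ultimately show "?I W x s s'" by (simp add: pop_def)
  qed
  show ?case unfolding comp.simps
  proof (rule okp_mono[OF okp_seq[OF D okp_comp_exp[OF CFor.prems(2)] okp_lfor[OF D body]]])
    fix W x and s s' :: s3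
    let ?P = "\<lambda>s s'. \<exists>f. f 0 = setv (t + 1) 0 s \<and> s' = f (fst s t) \<and> (\<forall>k<fst s t. \<exists>u. good W (f k) \<and> good W u \<and>
        fst (f k) (t + 1) = k \<and> ?I W x (f k) u \<and> f (Suc k) = setv (t + 1) (Suc k) u)"
    assume "\<exists>s1. good W s1 \<and> espec \<rho> e t W x s s1 \<and> ?P s1 s'"
    then obtain s1 f where s1: "espec \<rho> e t W x s s1" and f: "f 0 = setv (t + 1) 0 s1" "s' = f (fst s1 t)"
      "\<And>k. k < fst s1 t \<Longrightarrow> \<exists>u. fst (f k) (t + 1) = k \<and> ?I W x (f k) u \<and> f (Suc k) = setv (t + 1) (Suc k) u" by blast
    have m: "map (fst s1) \<rho> = map (fst s) \<rho>" using s1(1) CFor.prems by (auto simp: espec_def subset_iff)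
    have mm: "Suc t \<notin> set \<rho>" using CFor.prems by auto
    have "(\<forall>v<t. v \<notin> set \<rho> \<longrightarrow> fst (f k) v = fst s v) \<and> (map (fst (f k)) \<rho>, snd (f k)) =
       loop (\<lambda>k s. pop (sem W x c (push k s))) k (map (fst s) \<rho>, snd s)" if "k \<le> fst s1 t" for k
      using that
    proof (induction k)
      case 0
      then show ?case using f(1) s1 m mm by (auto simp: espec_def)
    next
      case (Suc k)
      from f(3)[OF Suc_le_lessD[OF Suc.prems]] obtain u where
        u: "fst (f k) (t + 1) = k" "?I W x (f k) u" "f (Suc k) = setv (t + 1) (Suc k) u" by blast
      have "map (fst (f (Suc k))) \<rho> = map (fst u) \<rho>" "snd (f (Suc k)) = snd u" using u(3) mm by auto
      moreover have "fst (f (Suc k)) v = fst u v" if "v < t" for v using u(3) that by simp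
      ultimately show ?case using u(1,2) Suc by (simp del: map_eq_conv)
    qed
    then show "cspec (CFor e c) \<rho> t W x s s'" using f(2) s1 by (simp add: cspec_def espec_def)
  qed (use nin in auto)
next
  case (CCall r es c)
  let ?n = "t + 1 + length es"
  have \<rho>1: "set \<rho> \<subseteq> {..<t + 1}" using CCall.prems by auto
  have \<rho>': "distinct [t..<?n]" "set [t..<?n] \<subseteq> {..<?n}" by auto
  define last where "last = (if r < length \<rho> then copyv (\<rho> ! r) t else TSkip)"
  have last: "okp D last (\<lambda>W x s s'. s' = (if r < length \<rho> then setv (\<rho> ! r) (fst s t) s else s))"
    unfolding last_def using okp_copyv[OF D] okp_skip[OF D] by simp
  show ?case unfolding comp.simps last_def[symmetric]
  proof (rule okp_mono[OF okp_seq[OF D okp_zerov[OF D] okp_seq[OF D okp_comp_args[OF \<rho>1]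
          okp_seq[OF D CCall.IH[OF \<rho>'] last]]]])
    fix W x and s s' :: s3
    let ?A = "\<lambda>s1 s2. snd s2 = snd s1 \<and> (\<forall>v<t + 1. fst s2 v = fst s1 v) \<and> map (fst s2) [t + 1..<t + 1 + length es] =
        map (\<lambda>e. eval W x e (map (fst s1) \<rho>) (fst (snd s1))) es"
    assume "\<exists>s1. good W s1 \<and> s1 = setv t 0 s \<and> (\<exists>s2. good W s2 \<and> ?A s1 s2 \<and>
      (\<exists>s3. good W s3 \<and> cspec c [t..<?n] ?n W x s2 s3 \<and> s' = (if r < length \<rho> then setv (\<rho> ! r) (fst s3 t) s3 else s3)))"
    then obtain s2 s3 where A: "?A (setv t 0 s) s2" and C: "cspec c [t..<?n] ?n W x s2 s3"
      and s': "s' = (if r < length \<rho> then setv (\<rho> ! r) (fst s3 t) s3 else s3)" by blast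
    have mm: "t \<notin> set \<rho>" using CCall.prems by auto
    have up: "[t..<?n] = t # [t + 1..<t + 1 + length es]" by (simp add: upt_rec)
    define args where "args = 0 # map (\<lambda>e. eval W x e (map (fst s) \<rho>) (fst (snd s))) es"
    have "map (fst s2) [t..<?n] = args" unfolding up args_def using A mm by (simp del: map_eq_conv)
    then have s3: "(map (fst s3) [t..<?n], snd s3) = sem W x c (args, snd s)" using C A by (simp add: cspec_def)
    have r0: "fst (sem W x c (args, snd s)) ! 0 = fst s3 t" "snd (sem W x c (args, snd s)) = snd s3"
      unfolding s3[symmetric] by (simp_all add: up del: upt_Suc)
    have fr: "fst s3 v = fst s v" if "v < t" for v
      using C A that by (auto simp: cspec_def)
    then have m3: "map (fst s3) \<rho> = map (fst s) \<rho>" using CCall.prems by (auto simp: subset_iff)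
    have "map (fst s') \<rho> = (map (fst s) \<rho>)[r := fst s3 t]"
      using s' m3 CCall.prems by (auto simp: map_upd_nth list_update_beyond simp del: map_eq_conv)
    moreover have "fst s' v = fst s v" if "v < t" "v \<notin> set \<rho>" for v using s' fr[OF that(1)] that by auto
    moreover have "snd s' = snd s3" using s' by simp
    ultimately show "cspec (CCall r es c) \<rho> t W x s s'"
      using r0 by (auto simp: cspec_def Let_def args_def[symmetric] map_upd_nth simp del: map_eq_conv)
  qed
qed

end

section \<open>Compiled programs are in CLP\<close>

fun LL :: "nat \<Rightarrow> nat" where
  "LL 0 = 1"
| "LL (Suc c) = (if Suc c = 2 ^ LL c then Suc (LL c) else LL c)"

lemma LL_bounds: "c < 2 ^ LL c" "2 ^ LL c \<le> 2 * c + 2" "1 \<le> LL c"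
  by (induction c) (auto simp: Let_def)

lemma LL_mono: "c \<le> c' \<Longrightarrow> LL c \<le> LL c'"
  by (rule lift_Suc_mono_le[of LL]) auto

definition cnt :: "nat \<Rightarrow> nat \<Rightarrow> nat" where
  "cnt c = (\<lambda>_. 0)(0 := c)"

definition write_cell :: "nat list \<Rightarrow> tm" where
  "write_cell g = TAct (\<lambda>(r, a, _, b). (r, Stay, g, Stay, b, Stay, None))"

text \<open>An increment that appends a cell with digit 1 when the carry runs off the end; the
  length of the word thereby follows the recursion of \<open>LL\<close>.\<close>

definition count_step :: "nat \<Rightarrow> tm" where
  "count_step V = TSeq (setr 1) (TSeq (rloop (inc_step 2 0))
     (TSeq (TIf (\<lambda>(r, a, g, b). r = 1) (write_cell (0 # 1 # replicate (V - 1) 0)) TSkip) (TSeq goleft lloop)))"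

text \<open>The moves across the input are counted in binary, and the length of the counter becomes
  the number of digits of all words. Thus no space bound has to be given to the machine.\<close>

definition initp :: "nat \<Rightarrow> tm" where
  "initp V = TSeq (write_cell (1 # replicate V 0))
     (TSeq (TWhile (\<lambda>(r, a, g, b). a \<noteq> RightEnd) (TSeq in_right (count_step V)))
     (TSeq (TWhile (\<lambda>(r, a, g, b). a \<noteq> LeftEnd) in_left) (zerov 0)))"

lemma bs_write_cell:
  assumes "ok x K S sw sc (r, ip, T, i, C, p, ot)" "g \<in> S"
  shows "bs x (ok x K S sw sc) (write_cell g) (r, ip, T, i, C, p, ot) 1 (r, ip, T(i := g), i, C, p, ot)"
  using assms unfolding write_cell_def by (intro bs_actI) auto

lemma bs_count_step:
  assumes V: "1 \<le> V" and D: "2 \<le> D" and L: "1 \<le> L" and c: "c < 2 ^ L"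
    and L': "L' = (if Suc c = 2 ^ L then Suc L else L)" "L' < sw"
    and "r < 3" "ip \<le> length x + 1" "p < sc"
  shows "\<exists>t \<le> 8 * L + 20. bs x (ok x 3 (syms D V) sw sc) (count_step V)
    (r, ip, tape 2 V L (cnt c), 0, C, p, ot) t (carry 2 c L, ip, tape 2 V L' (cnt (Suc c)), 0, C, p, ot)"
proof -
  let ?ok = "ok x 3 (syms D V) sw sc" and ?r = "carry 2 c L" and ?c = "(c + 1) mod 2 ^ L"
  have Lsw: "L < sw" using L' by (auto split: if_splits)
  have in_s: "tape 2 V l st j \<in> syms D V" for l st j using D by (intro tape_in_syms) auto
  have r3: "carry 2 c j < 3" for j by (simp add: carry_def)
  have ok: "?ok (q', ip, tape 2 V l st, i, C, p, ot)" if "q' < 3" "i \<le> L" for q' i l st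
    using assms in_s that Lsw by auto
  have "\<exists>t \<le> 4 * (L - 0) + 1. bs x ?ok (rloop (inc_step 2 0))
     (carry 2 c 0, ip, (\<lambda>j. if j < 0 then tape 2 V L (cnt ?c) j else tape 2 V L (cnt c) j), 0, C, p, ot) t
     (?r, ip, (\<lambda>j. if j < L then tape 2 V L (cnt ?c) j else tape 2 V L (cnt c) j), L, C, p, ot)"
  proof (rule bs_rloop[where f = "\<lambda>j. if j = 0 then 1 else 0" and a = "digs 2 V (cnt c)" and a' = "digs 2 V (cnt ?c)"])
    fix j assume j: "j < L"
    have "inc_step 2 0 (carry 2 (cnt c 0) j) (digs 2 V (cnt c) j) =
       (carry 2 (cnt c 0) (Suc j), digs 2 V ((cnt c)(0 := (cnt c 0 + 1) mod 2 ^ L)) j)"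
      using V j by (intro inc_step_digs) auto
    moreover have "(cnt c)(0 := (cnt c 0 + 1) mod 2 ^ L) = cnt ?c" "cnt c 0 = c" by (auto simp: cnt_def)
    ultimately show "tape 2 V L (cnt c) j = (if j = 0 then 1 else 0) # digs 2 V (cnt c) j \<and>
       tape 2 V L (cnt ?c) j = (if j = 0 then 1 else 0) # digs 2 V (cnt ?c) j \<and>
       inc_step 2 0 (carry 2 c j) (digs 2 V (cnt c) j) = (carry 2 c (Suc j), digs 2 V (cnt ?c) j)"
      using j by (simp add: tape_lt)
  qed (use assms in_s r3 Lsw in \<open>auto simp: tape_end\<close>)
  moreover have "(\<lambda>j. if j < L then tape 2 V L (cnt ?c) j else tape 2 V L (cnt c) j) = tape 2 V L (cnt ?c)"
    by (auto simp: tape_def)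
  moreover have "carry 2 c 0 = 1" by (simp add: carry_def)
  ultimately obtain t1 where t1: "t1 \<le> 4 * L + 1" "bs x ?ok (rloop (inc_step 2 0)) (1, ip, tape 2 V L (cnt c), 0, C, p, ot) t1
    (?r, ip, tape 2 V L (cnt ?c), L, C, p, ot)" by auto
  let ?if = "TIf (\<lambda>(r, a, g, b). r = 1) (write_cell (0 # 1 # replicate (V - 1) 0)) TSkip"
  have "\<exists>t \<le> 2. bs x ?ok ?if (?r, ip, tape 2 V L (cnt ?c), L, C, p, ot) t (?r, ip, tape 2 V L' (cnt (Suc c)), L, C, p, ot)"
  proof (cases "Suc c = 2 ^ L")
    case True
    then have r1: "?r = 1" and c0: "?c = 0" and l: "L' = Suc L" using L' by (auto simp: carry_def)
    \<comment> \<open>On overflow the old digits have all become 0, and the fresh cell carries the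
      leading 1 of \<open>2 ^ L\<close>; flag 0 says that it is not cell 0.\<close>
    have new: "(0 # 1 # replicate (V - 1) 0) = tape 2 V (Suc L) (cnt (Suc c)) L"
      using True L V by (auto simp: tape_def digs_def cnt_def intro!: nth_equalityI simp: nth_Cons nth_replicate split: nat.splits)
    have gs: "0 # 1 # replicate (V - 1) 0 \<in> syms D V" unfolding new by (rule in_s)
    have "tape 2 V L (cnt 0) j = tape 2 V (Suc L) (cnt (Suc c)) j" if "j \<noteq> L" for j
    proof -
      have "(2 ^ L) div 2 ^ j mod 2 = (0::nat)" if "j < L"
      proof -
        have "(2::nat) ^ L div 2 ^ j = 2 ^ (L - j)" using that by (simp add: power_diff)
        then show ?thesis using that by simp
      qed
      then show ?thesis using that True by (auto simp: tape_def digs_def cnt_def)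
    qed
    then have eq: "(tape 2 V L (cnt ?c))(L := 0 # 1 # replicate (V - 1) 0) = tape 2 V L' (cnt (Suc c))"
      unfolding c0 l new by (auto simp: fun_eq_iff)
    have "bs x ?ok (write_cell (0 # 1 # replicate (V - 1) 0)) (?r, ip, tape 2 V L (cnt ?c), L, C, p, ot) 1
       (?r, ip, tape 2 V L' (cnt (Suc c)), L, C, p, ot)"
      unfolding eq[symmetric] using r3 by (intro bs_write_cell ok) (auto simp: gs[simplified])
    then show ?thesis using r1 ok[OF r3, of L] bs_ifT[of ?ok "(?r, ip, tape 2 V L (cnt ?c), L, C, p, ot)" "\<lambda>(r, a, g, b). r = 1" x]
      by (intro exI[of _ "1 + 1"]) auto
  next
    case False
    then have r0: "?r \<noteq> 1" and c0: "?c = Suc c" and l: "L' = L" using L' c by (auto simp: carry_def)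
    show ?thesis unfolding c0 l
      using r0 ok[OF r3, of L] bs_ifF[of ?ok "(?r, ip, tape 2 V L (cnt (Suc c)), L, C, p, ot)" "\<lambda>(r, a, g, b). r = 1" x]
        bs_skip[of ?ok "(?r, ip, tape 2 V L (cnt (Suc c)), L, C, p, ot)" x]
      by (intro exI[of _ "0 + 1"]) auto
  qed
  then obtain t2 where t2: "t2 \<le> 2" "bs x ?ok ?if (?r, ip, tape 2 V L (cnt ?c), L, C, p, ot) t2
      (?r, ip, tape 2 V L' (cnt (Suc c)), L, C, p, ot)" by blast
  have LL': "L \<le> L'" "0 < L'" using L' L by (auto split: if_splits)
  have "\<exists>t \<le> 4 * (L - 1) + 1. bs x ?ok lloop (?r, ip, tape 2 V L' (cnt (Suc c)), L - 1, C, p, ot) t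
      (?r, ip, tape 2 V L' (cnt (Suc c)), 0, C, p, ot)"
  proof (rule bs_lloop)
    show "?ok (?r, ip, tape 2 V L' (cnt (Suc c)), L - 1, C, p, ot)" using r3 by (intro ok) auto
    show "hd (tape 2 V L' (cnt (Suc c)) 0) \<noteq> 0" using LL' by (simp add: tape_lt)
    show "hd (tape 2 V L' (cnt (Suc c)) j) = 0" if "0 < j" "j \<le> L - 1" for j using that LL' L by (simp add: tape_lt)
  qed
  then obtain t3 where t3: "t3 \<le> 4 * (L - 1) + 1" "bs x ?ok lloop (?r, ip, tape 2 V L' (cnt (Suc c)), L - 1, C, p, ot) t3
      (?r, ip, tape 2 V L' (cnt (Suc c)), 0, C, p, ot)" by blast
  have s: "bs x ?ok (setr 1) (r, ip, tape 2 V L (cnt c), 0, C, p, ot) 1 (1, ip, tape 2 V L (cnt c), 0, C, p, ot)"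
    using assms(7) by (intro bs_setr ok) auto
  have g: "bs x ?ok goleft (?r, ip, tape 2 V L' (cnt (Suc c)), L, C, p, ot) 1 (?r, ip, tape 2 V L' (cnt (Suc c)), L - 1, C, p, ot)"
    using r3 by (intro bs_goleft ok) auto
  show ?thesis unfolding count_step_def
    using bs_seq[OF s bs_seq[OF t1(2) bs_seq[OF t2(2) bs_seq[OF g t3(2)]]]] t1(1) t2(1) t3(1)
    by (intro exI[of _ "1 + 1 + (t1 + 1 + (t2 + 1 + (1 + 1 + t3)))"]) auto
qed

lemma bs_initp:
  assumes V: "1 \<le> V" and D: "2 \<le> D" and L: "L = LL (length x + 1)" and sc: "0 < sc"
  shows "\<exists>r<3. \<exists>t \<le> (length x + 4) * (8 * L + 60). bs x (ok x 3 (syms D V) (L + 1) sc) (initp V)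
    (0, 0, (\<lambda>_. []), 0, C, 0, ot) t (r, 0, tape D V L (\<lambda>_. 0), 0, C, 0, ot)"
proof -
  let ?ok = "ok x 3 (syms D V) (L + 1) sc" and ?n = "length x"
  have in_s: "tape 2 V l st j \<in> syms D V" for l st j using D by (intro tape_in_syms) auto
  have L1: "1 \<le> L" using LL_bounds(3) L by simp
  have cell: "tape 2 V 1 (cnt 0) = (\<lambda>_. [])(0 := 1 # replicate V 0)"
    by (auto simp: tape_def digs_def cnt_def fun_eq_iff map_replicate_const)
  have ok: "?ok (q', ip, tape 2 V l st, 0, C, 0, ot)" if "q' < 3" "ip \<le> ?n + 1" for q' ip l st
    using in_s that sc by auto
  have nil: "[] \<in> syms D V" by (simp add: syms_def)
  have w: "bs x ?ok (write_cell (1 # replicate V 0)) (0, 0, (\<lambda>_. []), 0, C, 0, ot) 1 (0, 0, tape 2 V 1 (cnt 0), 0, C, 0, ot)"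
    unfolding cell using in_s[of 1 "cnt 0" 0, unfolded cell] nil sc by (intro bs_write_cell) auto
  have mv: "bs x ?ok (head_act im False Stay None) (q, ip, tape 2 V l st, 0, C, 0, ot) 1
     (q, min (?n + 1) (move_head im ip), tape 2 V l st, 0, C, 0, ot)" if "q < 3" "ip \<le> ?n + 1" for q ip im l st
    unfolding head_act_def
  proof (rule bs_actI)
    show "?ok (q, min (?n + 1) (move_head im ip), tape 2 V l st, 0, C, 0, ot)" using that by (intro ok) auto
  qed (use ok[OF that] in \<open>auto simp: fun_eq_iff\<close>)
  let ?W = "TWhile (\<lambda>(r, a, g, b). a \<noteq> RightEnd) (TSeq in_right (count_step V))"
  have loop1: "\<exists>r'<3. \<exists>t \<le> (?n + 1 - j) * (8 * L + 30) + 1. bs x ?ok ?W (r, j, tape 2 V (LL j) (cnt j), 0, C, 0, ot) t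
      (r', ?n + 1, tape 2 V L (cnt (?n + 1)), 0, C, 0, ot)" if "j \<le> ?n + 1" "r < 3" for j r
    using that
  proof (induction "?n + 1 - j" arbitrary: j r)
    case 0
    then have j: "j = ?n + 1" by simp
    have "bs x ?ok ?W (r, ?n + 1, tape 2 V L (cnt (?n + 1)), 0, C, 0, ot) 1 (r, ?n + 1, tape 2 V L (cnt (?n + 1)), 0, C, 0, ot)"
      using ok[OF 0(3), of "?n + 1"] by (intro bs_whileF) (auto simp: read_input_def)
    then show ?case unfolding j L[symmetric] using 0(3) le_add2 by blast
  next
    case (Suc m)
    then have j: "j < ?n + 1" and m: "m = ?n + 1 - Suc j" by linarith+
    have mn: "LL (Suc j) \<le> L" unfolding L using j by (intro LL_mono) auto
    have mn': "LL j \<le> L" unfolding L using j by (intro LL_mono) auto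
    obtain t1 where t1: "t1 \<le> 8 * LL j + 20" "bs x ?ok (count_step V) (r, Suc j, tape 2 V (LL j) (cnt j), 0, C, 0, ot) t1
       (carry 2 j (LL j), Suc j, tape 2 V (LL (Suc j)) (cnt (Suc j)), 0, C, 0, ot)"
      using bs_count_step[OF V D LL_bounds(3)[of j] LL_bounds(1)[of j], of "LL (Suc j)" "L + 1" r "Suc j" x 0 sc C ot] Suc.prems mn j sc
      by auto
    have c3: "carry 2 j (LL j) < 3" by (simp add: carry_def)
    obtain r' t2 where t2: "r' < 3" "t2 \<le> (?n + 1 - Suc j) * (8 * L + 30) + 1"
      "bs x ?ok ?W (carry 2 j (LL j), Suc j, tape 2 V (LL (Suc j)) (cnt (Suc j)), 0, C, 0, ot) t2
      (r', ?n + 1, tape 2 V L (cnt (?n + 1)), 0, C, 0, ot)" using Suc.hyps(1)[OF m _ c3] j by auto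
    have a: "bs x ?ok in_right (r, j, tape 2 V (LL j) (cnt j), 0, C, 0, ot) 1 (r, Suc j, tape 2 V (LL j) (cnt j), 0, C, 0, ot)"
      using mv[of r j MoveRight] Suc.prems j by simp
    have "bs x ?ok ?W (r, j, tape 2 V (LL j) (cnt j), 0, C, 0, ot) (1 + 1 + t1 + 1 + t2 + 1)
      (r', ?n + 1, tape 2 V L (cnt (?n + 1)), 0, C, 0, ot)"
    proof (rule bs_whileT)
      show "?ok (r, j, tape 2 V (LL j) (cnt j), 0, C, 0, ot)" using Suc.prems by (intro ok) auto
      show "case view_of x (r, j, tape 2 V (LL j) (cnt j), 0, C, 0, ot) of (r, a, g, b) \<Rightarrow> a \<noteq> RightEnd"
        using j by (simp add: read_input_def)
    qed (rule bs_seq[OF bs_seq[OF a t1(2)] t2(3)])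
    moreover have "(?n + 1 - j) * (8 * L + 30) = (?n + 1 - Suc j) * (8 * L + 30) + (8 * L + 30)"
      using j by (metis Suc_diff_Suc add.commute mult_Suc)
    ultimately show ?case using t1(1) t2(1,2) mn'
      by (intro exI[of _ r'] conjI exI[of _ "1 + 1 + t1 + 1 + t2 + 1"]) linarith+
  qed
  let ?T = "tape 2 V L (cnt (?n + 1))"
  let ?W2 = "TWhile (\<lambda>(r, a, g, b). a \<noteq> LeftEnd) in_left"
  have loop2: "\<exists>t \<le> 4 * j + 1. bs x ?ok ?W2 (r, j, ?T, 0, C, 0, ot) t (r, 0, ?T, 0, C, 0, ot)"
    if "j \<le> ?n + 1" "r < 3" for j r
    using that(1)
  proof (induction j)
    case 0
    show ?case using ok[OF that(2), of 0]
      by (intro exI[of _ 1] conjI bs_whileF) (auto simp: read_input_def)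
  next
    case (Suc j)
    obtain t where t: "t \<le> 4 * j + 1" "bs x ?ok ?W2 (r, j, ?T, 0, C, 0, ot) t (r, 0, ?T, 0, C, 0, ot)" using Suc.IH[OF Suc_leD[OF Suc.prems]] by blast
    have a: "bs x ?ok in_left (r, Suc j, ?T, 0, C, 0, ot) 1 (r, j, ?T, 0, C, 0, ot)"
      using mv[of r "Suc j" MoveLeft] Suc.prems that by simp
    have "bs x ?ok ?W2 (r, Suc j, ?T, 0, C, 0, ot) (1 + 1 + t + 1) (r, 0, ?T, 0, C, 0, ot)"
    proof (rule bs_whileT)
      show "?ok (r, Suc j, ?T, 0, C, 0, ot)" using Suc.prems that by (intro ok) auto
      show "case view_of x (r, Suc j, ?T, 0, C, 0, ot) of (r, a, g, b) \<Rightarrow> a \<noteq> LeftEnd" by (simp add: read_input_def)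
    qed (rule bs_seq[OF a t(2)])
    moreover have "1 + 1 + t + 1 \<le> 4 * Suc j + 1" using t(1) by simp
    ultimately show ?case by blast
  qed
  obtain r1 t1 where 1: "r1 < 3" "t1 \<le> (?n + 1) * (8 * L + 30) + 1"
    "bs x ?ok ?W (0, 0, tape 2 V 1 (cnt 0), 0, C, 0, ot) t1 (r1, ?n + 1, ?T, 0, C, 0, ot)"
    using loop1[of 0 0] by auto
  obtain t2 where 2: "t2 \<le> 4 * (?n + 1) + 1" "bs x ?ok ?W2 (r1, ?n + 1, ?T, 0, C, 0, ot) t2 (r1, 0, ?T, 0, C, 0, ot)"
    using loop2[of "?n + 1" r1] 1(1) by blast
  have "\<exists>t \<le> 8 * L + 10. bs x ?ok (zerov 0) (r1, 0, tape 2 V L (cnt (?n + 1)), 0, C, 0, ot) t (0, 0, tape 2 V L (\<lambda>_. 0), 0, C, 0, ot)"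
  proof (rule bs_sweep[where Q = "\<lambda>_. 0"])
    fix j
    have "cnt (?n + 1) = (\<lambda>_. 0)(0 := ?n + 1)" "(\<lambda>_. 0 :: nat) = (cnt (?n + 1))(0 := 0)" by (auto simp: cnt_def)
    then show "zero_step 0 0 0 (digs 2 V (cnt (?n + 1)) j) = (0, digs 2 V (\<lambda>_. 0) j)"
      using digs_upd[of 0 V 2 "cnt (?n + 1)" 0 j] V by (simp add: zero_step_def)
  qed (use V D L1 sc 1 in auto)
  then obtain t3 where 3: "t3 \<le> 8 * L + 10"
    "bs x ?ok (zerov 0) (r1, 0, ?T, 0, C, 0, ot) t3 (0, 0, tape 2 V L (\<lambda>_. 0), 0, C, 0, ot)" by blast
  \<comment> \<open>Zero has the same digits in every base, which permits the passage from base 2 to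
    base \<open>D\<close>.\<close>
  have z: "tape 2 V L (\<lambda>_. 0) = tape D V L (\<lambda>_. 0)" by (auto simp: tape_def digs_def)
  have "1 + 1 + (t1 + 1 + (t2 + 1 + t3)) \<le> (?n + 4) * (8 * L + 60)"
    using 1(2) 2(1) 3(1) by (auto simp: algebra_simps)
  then show ?thesis
    using bs_seq[OF w bs_seq[OF 1(3) bs_seq[OF 2(2) 3(2)]]] unfolding initp_def z
    by (intro exI[of _ 0] conjI exI[of _ "1 + 1 + (t1 + 1 + (t2 + 1 + t3))"]) auto
qed

lemma polynomialI:
  fixes p :: "nat \<Rightarrow> nat"
  assumes "\<And>n. p n \<le> c * (n + a) ^ k"
  shows "polynomial p"
  unfolding polynomial_def
proof (intro exI bigoI eventually_sequentiallyI)
  fix n :: nat assume n: "1 \<le> n"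
  have "n + a \<le> (a + 1) * n" using n by (cases n) auto
  then have "(n + a) ^ k \<le> ((a + 1) * n) ^ k" by (rule power_mono) simp
  then have "p n \<le> c * ((a + 1) * n) ^ k" using assms[of n] by (meson le_trans mult_le_mono2)
  then have "real (p n) \<le> real (c * ((a + 1) * n) ^ k)" by (simp only: of_nat_le_iff)
  also have "c * ((a + 1) * n) ^ k = c * (a + 1) ^ k * n ^ k" by (simp only: power_mult_distrib mult.assoc)
  finally show "norm (real (p n)) \<le> real (c * (a + 1) ^ k) * norm (real n ^ k)" by simp
qed

lemma logarithmic_LL: "logarithmic (\<lambda>n. LL (n + 1) + 1)"
  unfolding logarithmic_def
proof (intro bigoI eventually_sequentiallyI)
  fix n :: nat assume n: "4 \<le> n"
  have "(2::nat) ^ LL (n + 1) \<le> 2 * (n + 1) + 2" by (rule LL_bounds)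
  also have "\<dots> \<le> n * n"
  proof -
    have "4 * n \<le> n * n" using n by simp
    moreover have "2 * (n + 1) + 2 \<le> 4 * n" using n by simp
    ultimately show ?thesis by (rule order_trans[rotated])
  qed
  finally have "real (2 ^ LL (n + 1)) \<le> real (n * n)" by (simp only: of_nat_le_iff)
  then have "ln (2 ^ LL (n + 1)) \<le> ln (real n * real n)" using n by (subst ln_le_cancel_iff) auto
  then have 1: "real (LL (n + 1)) * ln 2 \<le> 2 * ln (real n)" using n by (simp add: ln_realpow ln_mult)
  have 2: "ln 2 \<le> ln (real n)" using n by (subst ln_le_cancel_iff) auto
  have "real (LL (n + 1) + 1) * ln 2 \<le> 3 * ln (real n)" using 1 2 by (simp add: algebra_simps)
  then have "real (LL (n + 1) + 1) \<le> 3 / ln 2 * ln (real n)" by (simp add: field_simps)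
  moreover have "0 \<le> ln (real n)" using n by simp
  ultimately show "norm (real (LL (n + 1) + 1)) \<le> 3 / ln 2 * norm (ln (real n))" by simp
qed

text \<open>A large alphabet takes the place of long words: with \<open>L\<close> logarithmic, base
  \<open>2 ^ \<kappa>\<close> makes the word size the \<open>\<kappa>\<close>-th power of
  \<open>2 ^ L\<close>, hence a polynomial whose degree is at disposal. The word size is also the
  length of the catalytic tape.\<close>

theorem program_in_CLP:
  fixes c :: cmd and f :: "bool list \<Rightarrow> bool list" and \<kappa> :: nat
  assumes \<kappa>: "2 \<le> \<kappa>"
    and sem: "\<And>x \<tau>. length \<tau> = (2 ^ \<kappa>) ^ LL (length x + 1) \<Longrightarrow>
       snd (sem ((2 ^ \<kappa>) ^ LL (length x + 1)) x c ([], \<tau>, [])) = (\<tau>, f x)"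
  shows "f \<in> CLP"
proof -
  define D :: nat where "D = 2 ^ \<kappa>"
  have "(2::nat) ^ 2 \<le> 2 ^ \<kappa>" using \<kappa> by (intro power_increasing) auto
  then have D: "4 \<le> D" by (simp add: D_def)
  have "okp D (comp D c [] 0) (cspec c [] 0)" by (rule okp_comp[OF D]) auto
  then obtain k m where km: "\<And>V L x s. m \<le> V \<Longrightarrow> 1 \<le> L \<Longrightarrow> good (D ^ L) s \<Longrightarrow>
     \<exists>s'. rn D V L x (comp D c [] 0) (lift s) ((D ^ L) ^ k) (lift s') \<and> good (D ^ L) s' \<and> cspec c [] 0 (D ^ L) x s s'"
    unfolding okp_def by meson
  define V where "V = max m 1"
  define p where "p = TSeq (initp V) (TSeq (comp D c [] 0) (setr 0))"
  define Lf where "Lf n = LL (n + 1)" for n :: nat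
  define tf where "tf n = (n + 4) * (8 * Lf n + 60) + (D ^ Lf n) ^ k + 3" for n
  have nil: "[] \<in> syms D V" by (simp add: syms_def)
  obtain M where M: "wf_machine M" "\<And>x \<tau> sw sc t i T w C p' ot.
    bs x (ok x 3 (syms D V) sw sc) p (0, 0, (\<lambda>_. []), 0, \<tau>, 0, []) t (0, i, T, w, C, p', ot) \<Longrightarrow>
    (\<forall>t'. work_pos (run M x \<tau> t') < sw \<and> cat_pos (run M x \<tau> t') < sc) \<and>
    state (run M x \<tau> t) = halt_state M \<and> out_tape (run M x \<tau> t) = ot \<and> cat_tape (run M x \<tau> t) = C"
    using machine_of_program[OF finite_syms nil, of 3 p] by auto
  have main: "(\<forall>t'. work_pos (run M x \<tau> t') < Lf (length x) + 1 \<and> cat_pos (run M x \<tau> t') < D ^ Lf (length x)) \<and>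
    (\<exists>t \<le> tf (length x). state (run M x \<tau> t) = halt_state M \<and> out_tape (run M x \<tau> t) = f x \<and> cat_tape (run M x \<tau> t) = \<tau>)"
    if \<tau>: "length \<tau> = D ^ Lf (length x)" for x \<tau>
  proof -
    let ?L = "Lf (length x)" and ?W = "D ^ Lf (length x)"
    have L1: "1 \<le> ?L" using LL_bounds(3) by (simp add: Lf_def)
    have W4: "4 \<le> ?W" using word_ge[OF D L1] .
    obtain r t1 where 1: "r < 3" "t1 \<le> (length x + 4) * (8 * ?L + 60)" "bs x (okw D V ?L x) (initp V)
       (0, 0, (\<lambda>_. []), 0, \<tau>, 0, []) t1 (r, 0, tape D V ?L (\<lambda>_. 0), 0, \<tau>, 0, [])"
      using bs_initp[of V D ?L x ?W \<tau> "[]"] D W4 by (auto simp: V_def Lf_def)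
    have g: "good ?W ((\<lambda>_. 0), \<tau>, [])" using \<tau> W4 D by auto
    obtain s' where s': "rn D V ?L x (comp D c [] 0) (lift ((\<lambda>_. 0), \<tau>, [])) (?W ^ k) (lift s')"
      "cspec c [] 0 ?W x ((\<lambda>_. 0), \<tau>, []) s'" using km[OF _ L1 g, of V x] by (auto simp: V_def)
    obtain st C ot where st: "s' = (st, C, ot)" by (rule prod_cases3)
    have "(C, ot) = snd (sem ?W x c ([], \<tau>, []))" using s'(2) st by (simp add: cspec_def) (metis snd_conv)
    then have out: "C = \<tau>" "ot = f x" using sem[of \<tau> x] \<tau> by (auto simp: D_def Lf_def)
    obtain t2 r2 where 2: "t2 \<le> ?W ^ k" "r2 < 3" "bs x (okw D V ?L x) (comp D c [] 0)
       (r, 0, tape D V ?L (\<lambda>_. 0), 0, \<tau>, 0, []) t2 (r2, 0, tape D V ?L st, 0, \<tau>, 0, f x)"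
      using s'(1) 1(1) unfolding rn_def st by (auto simp: out)
    have "okw D V ?L x (r2, 0, tape D V ?L st, 0, \<tau>, 0, f x)" using bs_ok[OF 2(3)] by simp
    then have 3: "bs x (okw D V ?L x) (setr 0) (r2, 0, tape D V ?L st, 0, \<tau>, 0, f x) 1 (0, 0, tape D V ?L st, 0, \<tau>, 0, f x)"
      by (intro bs_setr) auto
    have "bs x (okw D V ?L x) p (0, 0, (\<lambda>_. []), 0, \<tau>, 0, []) (t1 + 1 + (t2 + 1 + 1)) (0, 0, tape D V ?L st, 0, \<tau>, 0, f x)"
      unfolding p_def using bs_seq[OF 1(3) bs_seq[OF 2(3) 3]] .
    from M(2)[OF this] show ?thesis using 1(2) 2(1)
      by (intro conjI exI[of _ "t1 + 1 + (t2 + 1 + 1)"]) (auto simp: tf_def)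
  qed
  have Lf_le: "2 ^ Lf n \<le> 2 * n + 4" for n using LL_bounds(2)[of "n + 1"] by (simp add: Lf_def)
  have W: "D ^ Lf n \<le> 2 ^ \<kappa> * (n + 2) ^ \<kappa>" for n
  proof -
    have "D ^ Lf n = (2 ^ Lf n) ^ \<kappa>" by (simp add: D_def power_mult[symmetric] mult.commute)
    also have "\<dots> \<le> (2 * n + 4) ^ \<kappa>" using Lf_le by (intro power_mono) auto
    also have "\<dots> = 2 ^ \<kappa> * (n + 2) ^ \<kappa>"
    proof -
      have "2 * n + 4 = 2 * (n + 2)" by simp
      then show ?thesis by (simp only: power_mult_distrib)
    qed
    finally show ?thesis .
  qed
  have "polynomial (\<lambda>n. D ^ Lf n)" using W by (rule polynomialI)
  moreover have "polynomial tf"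
  proof (rule polynomialI)
    fix n
    have "Lf n \<le> 2 * n + 4" using Lf_le[of n] less_exp[of "Lf n"] by linarith
    then have "(n + 4) * (8 * Lf n + 60) \<le> (n + 4) * (32 * (n + 4))" by (intro mult_left_mono) auto
    also have "\<dots> = 32 * (n + 4) ^ 2" by (simp add: power2_eq_square)
    also have "\<dots> \<le> 32 * (n + 4) ^ (\<kappa> * k + 2)" by (intro mult_left_mono power_increasing) auto
    finally have 1: "(n + 4) * (8 * Lf n + 60) \<le> 32 * (n + 4) ^ (\<kappa> * k + 2)" .
    have "(D ^ Lf n) ^ k \<le> (2 ^ \<kappa> * (n + 2) ^ \<kappa>) ^ k" using W by (intro power_mono) auto
    also have "\<dots> = 2 ^ (\<kappa> * k) * (n + 2) ^ (\<kappa> * k)" by (simp add: power_mult_distrib power_mult)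
    also have "\<dots> \<le> 2 ^ (\<kappa> * k) * (n + 4) ^ (\<kappa> * k)" by (intro mult_left_mono power_mono) auto
    also have "\<dots> \<le> 2 ^ (\<kappa> * k) * (n + 4) ^ (\<kappa> * k + 2)" by (intro mult_left_mono power_increasing) auto
    finally have 2: "(D ^ Lf n) ^ k \<le> 2 ^ (\<kappa> * k) * (n + 4) ^ (\<kappa> * k + 2)" .
    have 3: "3 \<le> 3 * (n + 4) ^ (\<kappa> * k + 2)" by simp
    show "tf n \<le> (35 + 2 ^ (\<kappa> * k)) * (n + 4) ^ (\<kappa> * k + 2)"
      unfolding tf_def using add_mono[OF add_mono[OF 1 2] 3] by (simp add: algebra_simps)
  qed
  moreover have "logarithmic (\<lambda>n. Lf n + 1)" using logarithmic_LL by (simp add: Lf_def)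
  ultimately have "CL_machine M (\<lambda>n. Lf n + 1) (\<lambda>n. D ^ Lf n) f \<and> polynomial tf \<and> time_bounded M (\<lambda>n. D ^ Lf n) tf"
    using M(1) main unfolding CL_machine_def space_bounded_def computes_def time_bounded_def by blast
  then show ?thesis unfolding CLP_def by blast
qed

section \<open>Skew-symmetric matrices and matchings\<close>

text \<open>Gaussian elimination by induction on the equations: the unknown \<open>i0\<close> is
  eliminated with the equation \<open>j0\<close>, and its value is recovered from the
  others.\<close>

lemma homogeneous_nontrivial:
  fixes f :: "'j \<Rightarrow> 'i \<Rightarrow> 'a::field"
  assumes "finite J" "finite I" "card J < card I"
  shows "\<exists>\<alpha>. (\<exists>i\<in>I. \<alpha> i \<noteq> 0) \<and> (\<forall>j\<in>J. (\<Sum>i\<in>I. f j i * \<alpha> i) = 0)"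
  using assms
proof (induction J arbitrary: I f rule: finite_induct)
  case empty
  then have "I \<noteq> {}" by auto
  then show ?case by (auto intro!: exI[of _ "\<lambda>_. 1"])
next
  case (insert j0 J)
  show ?case
  proof (cases "\<forall>i\<in>I. f j0 i = 0")
    case True
    have "card J < card I" using insert by simp
    then obtain \<alpha> where "\<exists>i\<in>I. \<alpha> i \<noteq> 0" "\<forall>j\<in>J. (\<Sum>i\<in>I. f j i * \<alpha> i) = 0"
      using insert.IH[of I f] insert.prems by blast
    moreover have "(\<Sum>i\<in>I. f j0 i * \<alpha> i) = 0" using True by simp
    ultimately show ?thesis by blast
  next
    case False
    then obtain i0 where i0: "i0 \<in> I" "f j0 i0 \<noteq> 0" by blast
    define g where "g j i = f j i - f j i0 * f j0 i / f j0 i0" for j i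
    have c: "card J < card (I - {i0})" using insert i0 by simp
    obtain \<alpha> where \<alpha>: "\<exists>i\<in>I - {i0}. \<alpha> i \<noteq> 0" "\<forall>j\<in>J. (\<Sum>i\<in>I - {i0}. g j i * \<alpha> i) = 0"
      using insert.IH[of "I - {i0}" g] insert.prems c by blast
    define \<beta> where "\<beta> = \<alpha>(i0 := - (\<Sum>i\<in>I - {i0}. f j0 i * \<alpha> i) / f j0 i0)"
    have b0: "\<beta> i0 = - (\<Sum>i\<in>I - {i0}. f j0 i * \<alpha> i) / f j0 i0" by (simp add: \<beta>_def)
    have sum: "(\<Sum>i\<in>I. f j i * \<beta> i) = (\<Sum>i\<in>I - {i0}. f j i * \<alpha> i) + f j i0 * \<beta> i0" for j
    proof -
      have "(\<Sum>i\<in>I. f j i * \<beta> i) = f j i0 * \<beta> i0 + (\<Sum>i\<in>I - {i0}. f j i * \<beta> i)"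
        using i0 insert.prems by (simp add: sum.remove)
      moreover have "(\<Sum>i\<in>I - {i0}. f j i * \<beta> i) = (\<Sum>i\<in>I - {i0}. f j i * \<alpha> i)"
        by (rule sum.cong) (auto simp: \<beta>_def)
      ultimately show ?thesis by simp
    qed
    have "(\<Sum>i\<in>I. f j i * \<beta> i) = 0" if "j \<in> J" for j
    proof -
      have "(\<Sum>i\<in>I - {i0}. g j i * \<alpha> i) =
          (\<Sum>i\<in>I - {i0}. f j i * \<alpha> i) - f j i0 / f j0 i0 * (\<Sum>i\<in>I - {i0}. f j0 i * \<alpha> i)"
        by (simp add: g_def left_diff_distrib sum_subtractf sum_distrib_left sum_divide_distrib algebra_simps)
      then show ?thesis using \<alpha>(2) that unfolding sum b0 by simp
    qed
    moreover have "(\<Sum>i\<in>I. f j0 i * \<beta> i) = 0" using i0 unfolding sum b0 by simp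
    moreover have "\<exists>i\<in>I. \<beta> i \<noteq> 0" using \<alpha>(1) by (auto simp: \<beta>_def)
    ultimately show ?thesis by blast
  qed
qed

section \<open>Kernel and maximum nonsingular principal submatrices\<close>

definition mv :: "'v set \<Rightarrow> ('v \<Rightarrow> 'v \<Rightarrow> real) \<Rightarrow> ('v \<Rightarrow> real) \<Rightarrow> 'v \<Rightarrow> real" where
  "mv X T y i = (\<Sum>j\<in>X. T i j * y j)"

definition nonsing :: "('v \<Rightarrow> 'v \<Rightarrow> real) \<Rightarrow> 'v set \<Rightarrow> bool" where
  "nonsing T X \<longleftrightarrow> (\<forall>y. (\<forall>i\<in>X. mv X T y i = 0) \<longrightarrow> (\<forall>i\<in>X. y i = 0))"

text \<open>Homogenisation: the right-hand side becomes the column of an extra unknown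
  \<open>None\<close>, which gives more unknowns than equations. Nonsingularity forces its value to
  be nonzero, and division by it solves the system.\<close>

lemma nonsing_solve:
  assumes "finite X" "nonsing T X"
  shows "\<exists>z. (\<forall>i. i \<notin> X \<longrightarrow> z i = 0) \<and> (\<forall>i\<in>X. mv X T z i = b i)"
proof -
  define f where "f j i = (case i of None \<Rightarrow> - b j | Some i \<Rightarrow> T j i)" for j i
  have "card X < card (insert None (Some ` X))" using assms(1) by (simp add: card_image)
  then obtain \<alpha> where \<alpha>: "\<exists>i\<in>insert None (Some ` X). \<alpha> i \<noteq> 0"
    "\<forall>j\<in>X. (\<Sum>i\<in>insert None (Some ` X). f j i * \<alpha> i) = 0"
    using homogeneous_nontrivial[of X "insert None (Some ` X)" f] assms(1) by auto
  have e: "mv X T (\<lambda>i. \<alpha> (Some i)) j = b j * \<alpha> None" if "j \<in> X" for j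
  proof -
    have "(\<Sum>i\<in>insert None (Some ` X). f j i * \<alpha> i) = - b j * \<alpha> None + (\<Sum>i\<in>X. T j i * \<alpha> (Some i))"
      using assms(1) by (subst sum.insert) (auto simp: f_def sum.reindex)
    then show ?thesis using \<alpha>(2) that by (auto simp: mv_def)
  qed
  have "\<alpha> None \<noteq> 0"
  proof
    assume a: "\<alpha> None = 0"
    then have "\<forall>i\<in>X. \<alpha> (Some i) = 0" using assms(2)[unfolded nonsing_def, THEN spec, of "\<lambda>i. \<alpha> (Some i)"] e by simp
    then show False using \<alpha>(1) a by auto
  qed
  define z where "z i = (if i \<in> X then \<alpha> (Some i) / \<alpha> None else 0)" for i
  have "mv X T z j = b j" if "j \<in> X" for j
  proof -
    have "mv X T z j = mv X T (\<lambda>i. \<alpha> (Some i)) j / \<alpha> None"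
      by (simp add: mv_def z_def sum_divide_distrib)
    then show ?thesis using e[OF that] \<open>\<alpha> None \<noteq> 0\<close> by simp
  qed
  then show ?thesis by (intro exI[of _ z]) (auto simp: z_def)
qed

lemma mv_add: "mv X T (\<lambda>i. y i + c * z i) j = mv X T y j + c * mv X T z j"
  by (simp add: mv_def algebra_simps sum.distrib sum_distrib_left)

lemma mv_sum: "finite I \<Longrightarrow> mv X T (\<lambda>i. \<Sum>w\<in>I. c w * y w i) j = (\<Sum>w\<in>I. c w * mv X T (y w) j)"
  unfolding mv_def by (simp add: sum_distrib_left, subst sum.swap) (simp add: algebra_simps)

lemma mv_superset: "finite V \<Longrightarrow> X \<subseteq> V \<Longrightarrow> (\<forall>i. i \<notin> X \<longrightarrow> y i = 0) \<Longrightarrow> mv V T y j = mv X T y j"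
  unfolding mv_def by (rule sum.mono_neutral_right) auto

definition pert :: "('v \<Rightarrow> 'v \<Rightarrow> real) \<Rightarrow> 'v \<Rightarrow> 'v \<Rightarrow> real \<Rightarrow> 'v \<Rightarrow> 'v \<Rightarrow> real" where
  "pert T u v \<delta> i j = T i j + (if i = u \<and> j = v then \<delta> else if i = v \<and> j = u then - \<delta> else 0)"

locale skew =
  fixes V :: "'v set" and T :: "'v \<Rightarrow> 'v \<Rightarrow> real"
  assumes finV: "finite V" and skew: "T i j = - T j i"
begin

lemma dot_skew: "(\<Sum>i\<in>V. y i * mv V T z i) = - (\<Sum>i\<in>V. z i * mv V T y i)"
proof -
  have "(\<Sum>i\<in>V. y i * mv V T z i) = (\<Sum>i\<in>V. \<Sum>j\<in>V. y i * T i j * z j)"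
    by (simp add: mv_def sum_distrib_left mult.assoc)
  also have "\<dots> = (\<Sum>j\<in>V. \<Sum>i\<in>V. y i * T i j * z j)" by (rule sum.swap)
  also have "\<dots> = (\<Sum>j\<in>V. \<Sum>i\<in>V. - (z j * T j i * y i))"
    by (intro sum.cong refl) (subst skew, simp)
  also have "\<dots> = - (\<Sum>i\<in>V. z i * mv V T y i)"
    by (simp add: mv_def sum_distrib_left mult.assoc sum_negf)
  finally show ?thesis .
qed

lemma dot_self: "(\<Sum>i\<in>V. y i * mv V T y i) = 0"
  using dot_skew[of y y] by linarith

definition ker :: "('v \<Rightarrow> real) \<Rightarrow> bool" where
  "ker y \<longleftrightarrow> (\<forall>i. i \<notin> V \<longrightarrow> y i = 0) \<and> (\<forall>i\<in>V. mv V T y i = 0)"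

lemma ker_dot: "ker y \<Longrightarrow> (\<Sum>i\<in>V. y i * mv V T z i) = 0"
  using dot_skew[of y z] by (simp add: ker_def)

definition maxns :: "'v set \<Rightarrow> bool" where
  "maxns X \<longleftrightarrow> X \<subseteq> V \<and> nonsing T X \<and> (\<forall>Y\<subseteq>V. nonsing T Y \<longrightarrow> card Y \<le> card X)"

text \<open>The set D of the Gallai-Edmonds decomposition, read off the kernel;
  \<open>DD_iff\<close> gives the description by avoided vertices.\<close>

definition DD :: "'v set" where
  "DD = {v\<in>V. \<exists>y. ker y \<and> y v \<noteq> 0}"

lemma nonsing_zero:
  assumes "X \<subseteq> V" "nonsing T X" "\<forall>i. i \<notin> X \<longrightarrow> y i = 0" "\<forall>i\<in>X. mv V T y i = 0"
  shows "y i = 0"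
  using assms mv_superset[OF finV assms(1,3)] by (cases "i \<in> X") (auto simp: nonsing_def)

lemma ns_solve:
  assumes "X \<subseteq> V" "nonsing T X"
  shows "\<exists>z. (\<forall>i. i \<notin> X \<longrightarrow> z i = 0) \<and> (\<forall>i\<in>X. mv V T z i = b i)"
  using nonsing_solve[OF finite_subset[OF assms(1) finV] assms(2), of b] mv_superset[OF finV assms(1)] by metis

lemma nonsingI:
  assumes "X \<subseteq> V"
    and "\<And>y. (\<forall>i. i \<notin> X \<longrightarrow> y i = 0) \<Longrightarrow> (\<forall>i\<in>X. mv V T y i = 0) \<Longrightarrow> (\<forall>i\<in>X. y i = 0)"
  shows "nonsing T X"
  unfolding nonsing_def
proof (intro allI impI)
  fix y assume y: "\<forall>i\<in>X. mv X T y i = 0"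
  define y' where "y' i = (if i \<in> X then y i else 0)" for i
  have "mv V T y' i = mv X T y i" for i
    using mv_superset[OF finV assms(1), of y'] by (simp add: y'_def mv_def)
  then have "\<forall>i\<in>X. y' i = 0" using y assms(2)[of y'] by (simp add: y'_def)
  then show "\<forall>i\<in>X. y i = 0" by (simp add: y'_def)
qed

lemma maxns_exists: "\<exists>X. maxns X"
proof -
  let ?S = "{X. X \<subseteq> V \<and> nonsing T X}"
  have "finite ?S" using finV by auto
  moreover have "{} \<in> ?S" by (simp add: nonsing_def)
  ultimately have "Max (card ` ?S) \<in> card ` ?S" by (intro Max_in) auto
  then obtain X where X: "X \<in> ?S" "card X = Max (card ` ?S)" by auto
  have "card Y \<le> card X" if "Y \<in> ?S" for Y
    unfolding X(2) using \<open>finite ?S\<close> that by (intro Max_ge) auto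
  then show ?thesis using X(1) unfolding maxns_def by blast
qed

text \<open>Solving for \<open>- T e_w\<close> on \<open>X\<close> gives a vector that
  \<open>T\<close> annihilates on \<open>X\<close>. At \<open>w\<close> skewness takes over, and a
  nonzero value at any other \<open>i\<close> would make \<open>X\<close> with \<open>i\<close> and
  \<open>w\<close> nonsingular, against maximality.\<close>

lemma basis_vector:
  assumes X: "maxns X" and w: "w \<in> V - X"
  shows "\<exists>y. ker y \<and> y w = 1 \<and> (\<forall>i. i \<notin> X \<longrightarrow> i \<noteq> w \<longrightarrow> y i = 0)"
proof -
  have XV: "X \<subseteq> V" and nX: "nonsing T X" using X by (auto simp: maxns_def)
  obtain z where z: "\<forall>i. i \<notin> X \<longrightarrow> z i = 0" "\<forall>i\<in>X. mv V T z i = - T i w"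
    using ns_solve[OF XV nX, of "\<lambda>i. - T i w"] by blast
  define e where "e = (\<lambda>i. if i = w then 1 else 0 :: real)"
  \<comment> \<open>The factor 1 brings the sum into the shape of \<open>mv_add\<close>.\<close>
  define y where "y i = z i + 1 * e i" for i
  have mve: "mv V T e i = T i w" for i
    using w finV by (simp add: mv_def e_def if_distrib sum.delta cong: if_cong)
  have mvy: "mv V T y i = mv V T z i + T i w" for i
    using mv_add[of V T z 1 e i] mve by (simp add: y_def[abs_def])
  have y0: "mv V T y i = 0" if "i \<in> X" for i using that z mvy by simp
  have yw: "y w = 1" "\<forall>i. i \<notin> X \<longrightarrow> i \<noteq> w \<longrightarrow> y i = 0" using w z by (auto simp: y_def e_def)
  \<comment> \<open>The form \<open>y^T T y\<close> vanishes, and \<open>w\<close> is the only place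
    where \<open>y\<close> and \<open>T y\<close> can both be nonzero.\<close>
  have sw: "mv V T y w = 0"
  proof -
    have "(\<Sum>i\<in>V. y i * mv V T y i) = (\<Sum>i\<in>{w}. y i * mv V T y i)"
    proof (rule sum.mono_neutral_right)
      show "\<forall>i\<in>V - {w}. y i * mv V T y i = 0"
      proof
        fix i assume "i \<in> V - {w}"
        then show "y i * mv V T y i = 0" using yw y0 by (cases "i \<in> X") auto
      qed
    qed (use finV w in auto)
    then show ?thesis using dot_self[of y] yw by simp
  qed
  have "mv V T y i = 0" if i: "i \<in> V" for i
  proof (rule ccontr)
    assume ne: "mv V T y i \<noteq> 0"
    then have iX: "i \<notin> X" "i \<noteq> w" using y0 sw by auto
    let ?Y = "insert i (insert w X)"
    have "nonsing T ?Y"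
    proof (rule nonsingI)
      show "?Y \<subseteq> V" using XV w i by auto
      fix u assume u: "\<forall>j. j \<notin> ?Y \<longrightarrow> u j = 0" "\<forall>j\<in>?Y. mv V T u j = 0"
      have "(\<Sum>j\<in>V. y j * mv V T u j) = 0"
        using u(2) yw by (intro sum.neutral) auto
      then have "(\<Sum>j\<in>V. u j * mv V T y j) = 0" using dot_skew[of y u] by simp
      moreover have "(\<Sum>j\<in>V. u j * mv V T y j) = (\<Sum>j\<in>{i}. u j * mv V T y j)"
      proof (rule sum.mono_neutral_right)
        show "\<forall>j\<in>V - {i}. u j * mv V T y j = 0"
        proof
          fix j assume "j \<in> V - {i}"
          then show "u j * mv V T y j = 0" using u y0 sw by (cases "j \<in> X"; cases "j = w") auto
        qed
      qed (use finV i in auto)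
      ultimately have ui: "u i = 0" using ne by simp
      have eq: "u j = u w * y j" for j
      proof -
        have "u j + - u w * y j = 0"
        proof (rule nonsing_zero[OF XV nX])
          show "\<forall>j. j \<notin> X \<longrightarrow> u j + - u w * y j = 0" using u(1) ui yw by (metis add.right_neutral insert_iff mult.right_neutral mult_zero_right add.right_inverse minus_mult_left)
          show "\<forall>j\<in>X. mv V T (\<lambda>j. u j + - u w * y j) j = 0" using u(2) y0 unfolding mv_add by simp
        qed
        then show ?thesis by simp
      qed
      have ue: "u = (\<lambda>j. u w * y j)" by (rule ext) (rule eq)
      have "mv V T u i = u w * mv V T y i"
        by (subst ue) (simp add: mv_def sum_distrib_left algebra_simps)
      then have "u w = 0" using u(2) ne by simp
      then show "\<forall>j\<in>?Y. u j = 0" using eq by (metis mult_zero_left)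
    qed
    moreover have "card ?Y = card X + 2" using iX w finite_subset[OF XV finV] by (simp add: card_insert_if)
    moreover have "?Y \<subseteq> V" using XV w i by auto
    ultimately have "card ?Y \<le> card X" "card ?Y = card X + 2" using X unfolding maxns_def by blast+
    then show False by linarith
  qed
  then have "ker y" using yw(2) w XV unfolding ker_def by (metis DiffE subsetD)
  then show ?thesis using yw by blast
qed

definition bv :: "'v set \<Rightarrow> 'v \<Rightarrow> 'v \<Rightarrow> real" where
  "bv X w = (SOME y. ker y \<and> y w = 1 \<and> (\<forall>i. i \<notin> X \<longrightarrow> i \<noteq> w \<longrightarrow> y i = 0))"

lemma bv:
  assumes "maxns X" "w \<in> V - X"
  shows "ker (bv X w)" "bv X w w = 1" "i \<notin> X \<Longrightarrow> i \<noteq> w \<Longrightarrow> bv X w i = 0"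
  using someI_ex[OF basis_vector[OF assms], folded bv_def] by auto

text \<open>The vectors \<open>bv X w\<close> form a basis of the kernel in which the coordinate at
  \<open>w\<close> is the value at \<open>w\<close>; a nonzero value at \<open>v\<close> must come
  from some summand.\<close>

lemma ker_expand:
  assumes X: "maxns X" and y: "ker y" and v: "y v \<noteq> 0" "v \<in> X"
  shows "\<exists>w\<in>V - X. y w \<noteq> 0 \<and> bv X w v \<noteq> 0"
proof -
  have XV: "X \<subseteq> V" and nX: "nonsing T X" using X by (auto simp: maxns_def)
  define s where "s i = (\<Sum>w\<in>V - X. y w * bv X w i)" for i
  have fin: "finite (V - X)" using finV by simp
  have mvs: "mv V T s i = 0" if "i \<in> V" for i
    using mv_sum[OF fin, of V T y "bv X" i] bv(1)[OF X] that by (simp add: s_def[abs_def] ker_def)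
  have so: "s i = y i" if "i \<notin> X" for i
  proof (cases "i \<in> V")
    case True
    have "s i = (\<Sum>w\<in>V - X. if w = i then y i else 0)"
      unfolding s_def using that bv(2,3)[OF X] by (intro sum.cong) auto
    then show ?thesis using True that fin by (simp add: sum.delta)
  next
    case False
    then show ?thesis using y bv(1)[OF X] by (auto simp: s_def ker_def)
  qed
  have "y v + - 1 * s v = 0"
  proof (rule nonsing_zero[OF XV nX])
    show "\<forall>i. i \<notin> X \<longrightarrow> y i + - 1 * s i = 0" using so by simp
    show "\<forall>i\<in>X. mv V T (\<lambda>i. y i + - 1 * s i) i = 0"
      using y XV mvs unfolding mv_add ker_def by auto
  qed
  then have "s v \<noteq> 0" using v by simp
  then show ?thesis unfolding s_def by (metis (no_types, lifting) mult_eq_0_iff sum.neutral)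
qed

text \<open>A pivot step. For a solution \<open>z\<close> on the new set, pairing with
  \<open>bv X w\<close> gives \<open>T z = 0\<close> at \<open>v\<close> as well; so
  \<open>z\<close> is a multiple of \<open>bv X w\<close>, and \<open>z v = 0\<close> makes it
  vanish.\<close>

lemma exchange:
  assumes X: "maxns X" and w: "w \<in> V - X" and v: "v \<in> X" and ne: "bv X w v \<noteq> 0"
  shows "maxns (insert w (X - {v}))"
proof -
  have XV: "X \<subseteq> V" and nX: "nonsing T X" using X by (auto simp: maxns_def)
  let ?Y = "insert w (X - {v})" and ?b = "bv X w"
  have YV: "?Y \<subseteq> V" using XV w by auto
  have "nonsing T ?Y"
  proof (rule nonsingI[OF YV])
    fix z assume z: "\<forall>i. i \<notin> ?Y \<longrightarrow> z i = 0" "\<forall>i\<in>?Y. mv V T z i = 0"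
    define \<alpha> where "\<alpha> = mv V T z v"
    have "0 = (\<Sum>i\<in>V. ?b i * mv V T z i)" using ker_dot[OF bv(1)[OF X w]] by simp
    also have "\<dots> = (\<Sum>i\<in>{v}. ?b i * mv V T z i)"
    proof (rule sum.mono_neutral_right)
      show "\<forall>i\<in>V - {v}. ?b i * mv V T z i = 0"
        using z(2) bv(3)[OF X w] by (metis DiffE insert_iff mult_eq_0_iff DiffI)
    qed (use finV v XV in auto)
    finally have a0: "mv V T z v = 0" using ne by simp
    have eq: "z i = z w * ?b i" for i
    proof -
      have "z i + - z w * ?b i = 0"
      proof (rule nonsing_zero[OF XV nX])
        show "\<forall>i. i \<notin> X \<longrightarrow> z i + - z w * ?b i = 0"
          using z(1) bv(2,3)[OF X w] by (metis DiffE add.right_inverse add_0 insert_iff mult.right_neutral mult_minus_left mult_zero_right)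
        show "\<forall>i\<in>X. mv V T (\<lambda>i. z i + - z w * ?b i) i = 0"
          using z(2) a0 bv(1)[OF X w] XV unfolding mv_add ker_def by (metis DiffI add_0 insert_iff mult_zero_right singletonD subsetD)
      qed
      then show ?thesis by simp
    qed
    have "z v = 0" using z(1) v w by auto
    then have "z w = 0" using eq[of v] ne by (metis mult_eq_0_iff)
    then show "\<forall>i\<in>?Y. z i = 0" using eq by (metis mult_zero_left)
  qed
  moreover have "card ?Y = card X"
    using v w finite_subset[OF XV finV] card_Suc_Diff1[of X v] by (simp add: card_insert_if)
  ultimately show ?thesis using X YV unfolding maxns_def by simp
qed

text \<open>A kernel vector that is nonzero at \<open>v\<close> yields an exchange that removes
  \<open>v\<close> from \<open>X\<close>; conversely \<open>bv X v\<close> is nonzero at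
  \<open>v\<close>.\<close>

lemma DD_iff: "v \<in> DD \<longleftrightarrow> v \<in> V \<and> (\<exists>X. maxns X \<and> v \<notin> X)"
proof
  assume "v \<in> DD"
  then obtain y where y: "v \<in> V" "ker y" "y v \<noteq> 0" by (auto simp: DD_def)
  obtain X where X: "maxns X" using maxns_exists by blast
  show "v \<in> V \<and> (\<exists>X. maxns X \<and> v \<notin> X)"
  proof (cases "v \<in> X")
    case True
    obtain w where w: "w \<in> V - X" "bv X w v \<noteq> 0" using ker_expand[OF X y(2,3) True] by blast
    have "v \<notin> insert w (X - {v})" using w True by auto
    then show ?thesis using exchange[OF X w(1) True w(2)] y(1) by blast
  qed (use X y in blast)
next
  assume "v \<in> V \<and> (\<exists>X. maxns X \<and> v \<notin> X)"
  then obtain X where "maxns X" "v \<in> V - X" by blast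
  then show "v \<in> DD" using bv(1,2)[of X v] unfolding DD_def by fastforce
qed

text \<open>The exchange that removes \<open>v\<close> brings in some \<open>w\<close> with
  \<open>k w \<noteq> 0\<close>, and \<open>k u = 0\<close> ensures that this is not
  \<open>u\<close>.\<close>

lemma avoid_pair:
  assumes "u \<in> DD" "v \<in> V" "u \<noteq> v" "ker k" "k u = 0" "k v \<noteq> 0"
  shows "\<exists>X. maxns X \<and> u \<notin> X \<and> v \<notin> X"
proof -
  obtain X where X: "maxns X" "u \<notin> X" using assms(1) DD_iff by blast
  show ?thesis
  proof (cases "v \<in> X")
    case True
    obtain w where w: "w \<in> V - X" "k w \<noteq> 0" "bv X w v \<noteq> 0" using ker_expand[OF X(1) assms(4,6) True] by blast
    have "u \<notin> insert w (X - {v})" "v \<notin> insert w (X - {v})" using w True X assms by auto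
    then show ?thesis using exchange[OF X(1) w(1) True w(3)] by blast
  qed (use X in blast)
qed

text \<open>With a nonzero entry of the inverse in column \<open>x\<close> at a neighbour
  \<open>j\<close> of \<open>x\<close>, deleting \<open>x\<close> and \<open>j\<close> preserves
  nonsingularity; \<open>{x, j}\<close> is matched and the rest follows by induction. This avoids
  Pfaffians.\<close>

lemma perfect_matching_of_nonsing:
  assumes "X \<subseteq> V" "nonsing T X"
  shows "\<exists>M. matching {{i, j} | i j. i \<in> X \<and> j \<in> X \<and> i \<noteq> j \<and> T i j \<noteq> 0} M \<and> card X = 2 * card M"
  using assms
proof (induction "card X" arbitrary: X rule: less_induct)
  case less
  show ?case
  proof (cases "X = {}")
    case True
    then show ?thesis by (intro exI[of _ "{}"]) (auto simp: matching_def)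
  next
    case False
    then obtain x where x: "x \<in> X" by blast
    have finX: "finite X" using less.prems finV finite_subset by blast
    obtain z where z: "\<forall>i. i \<notin> X \<longrightarrow> z i = 0" "\<forall>i\<in>X. mv V T z i = (if i = x then 1 else 0)"
      using ns_solve[OF less.prems, of "\<lambda>i. if i = x then 1 else 0"] by blast
    have "0 = (\<Sum>i\<in>V. z i * mv V T z i)" using dot_self by simp
    also have "\<dots> = (\<Sum>i\<in>{x}. z i * mv V T z i)"
    proof (rule sum.mono_neutral_right)
      show "\<forall>i\<in>V - {x}. z i * mv V T z i = 0"
      proof
        fix i assume "i \<in> V - {x}"
        then show "z i * mv V T z i = 0" using z by (cases "i \<in> X") auto
      qed
    qed (use finV x less.prems in auto)
    \<comment> \<open>\<open>z\<close> is the column \<open>x\<close> of the inverse, which is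
      skew-symmetric and so has zero diagonal.\<close>
    finally have zx: "z x = 0" using z x by simp
    have "(\<Sum>j\<in>V. T x j * z j) \<noteq> 0" using z x by (simp add: mv_def)
    then obtain j where j: "j \<in> V" "T x j * z j \<noteq> 0" by (meson sum.neutral)
    then have jX: "j \<in> X" "z j \<noteq> 0" "T x j \<noteq> 0" "j \<noteq> x" using z zx by auto
    let ?Y = "X - {x, j}"
    have YV: "?Y \<subseteq> V" using less.prems by auto
    have nY: "nonsing T ?Y"
    proof (rule nonsingI[OF YV])
      fix y assume y: "\<forall>i. i \<notin> ?Y \<longrightarrow> y i = 0" "\<forall>i\<in>?Y. mv V T y i = 0"
      have "(\<Sum>i\<in>V. y i * mv V T z i) = 0"
        using y(1) z(2) by (intro sum.neutral) (metis Diff_iff insertI1 mult_eq_0_iff)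
      then have "0 = (\<Sum>i\<in>V. z i * mv V T y i)" using dot_skew[of z y] by simp
      also have "\<dots> = (\<Sum>i\<in>{j}. z i * mv V T y i)"
      proof (rule sum.mono_neutral_right)
        show "\<forall>i\<in>V - {j}. z i * mv V T y i = 0"
          using y(2) z(1) zx by (metis Diff_iff insertCI insertE mult_eq_0_iff singletonD)
      qed (use finV j in auto)
      finally have b0: "mv V T y j = 0" using jX by simp
      define \<alpha> where "\<alpha> = mv V T y x"
      \<comment> \<open>A kernel vector of the smaller submatrix is mapped to a multiple of
        \<open>e_x\<close>, hence is a multiple of \<open>z\<close>; as \<open>z j\<close> is
        nonzero, vanishing at \<open>j\<close> kills it.\<close>
      have eq: "y i = \<alpha> * z i" for i
      proof -
        have "y i + - \<alpha> * z i = 0"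
        proof (rule nonsing_zero[OF less.prems])
          show "\<forall>i. i \<notin> X \<longrightarrow> y i + - \<alpha> * z i = 0" using y(1) z(1) by auto
          show "\<forall>i\<in>X. mv V T (\<lambda>i. y i + - \<alpha> * z i) i = 0"
            unfolding mv_add using y(2) z(2) b0 by (auto simp: \<alpha>_def)
        qed
        then show ?thesis by simp
      qed
      have "y j = 0" using y(1) by simp
      then have "\<alpha> = 0" using eq[of j] jX by simp
      then show "\<forall>i\<in>?Y. y i = 0" using eq by simp
    qed
    have cX: "card X = card ?Y + 2"
    proof -
      have "X = insert x (insert j ?Y)" using x jX by auto
      also have "card (insert x (insert j ?Y)) = card ?Y + 2" using finX jX(4) by (simp add: card_insert_if)
      finally show ?thesis .
    qed
    then obtain M where M: "matching {{i, j} | i j. i \<in> ?Y \<and> j \<in> ?Y \<and> i \<noteq> j \<and> T i j \<noteq> 0} M" "card ?Y = 2 * card M"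
      using less.hyps[OF _ YV nY] by (metis (no_types, lifting) less_add_same_cancel1 zero_less_numeral)
    have sub: "e \<subseteq> ?Y" if "e \<in> M" for e
    proof -
      have "e \<in> {{i, j} | i j. i \<in> ?Y \<and> j \<in> ?Y \<and> i \<noteq> j \<and> T i j \<noteq> 0}" using M(1) that unfolding matching_def by blast
      then show ?thesis by blast
    qed
    have "matching {{i, j} | i j. i \<in> X \<and> j \<in> X \<and> i \<noteq> j \<and> T i j \<noteq> 0} (insert {x, j} M)"
    proof -
      have "M \<subseteq> {{i, j} | i j. i \<in> X \<and> j \<in> X \<and> i \<noteq> j \<and> T i j \<noteq> 0}"
        using M(1) unfolding matching_def by blast
      moreover have "{x, j} \<in> {{i, j} | i j. i \<in> X \<and> j \<in> X \<and> i \<noteq> j \<and> T i j \<noteq> 0}" using x jX by blast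
      moreover have "pairwise disjnt (insert {x, j} M)"
        using M(1) sub unfolding matching_def pairwise_insert by (fastforce simp: disjnt_def)
      ultimately show ?thesis unfolding matching_def by blast
    qed
    moreover have "finite M"
      using sub finX by (meson finite_Pow_iff finite_Diff PowI finite_subset subsetI)
    moreover have "{x, j} \<notin> M" using sub by blast
    ultimately show ?thesis using M(2) cX by (intro exI[of _ "insert {x, j} M"]) simp
  qed
qed

end

section \<open>The effect of changing a single edge\<close>

context skew
begin

lemma mv_pert:
  assumes "u \<in> V" "v \<in> V" "u \<noteq> v"
  shows "mv V (pert T u v \<delta>) y i = mv V T y i + (if i = u then \<delta> * y v else if i = v then - \<delta> * y u else 0)"
proof -
  have "mv V (pert T u v \<delta>) y i = mv V T y i +
     (\<Sum>j\<in>V. (if i = u \<and> j = v then \<delta> else if i = v \<and> j = u then - \<delta> else 0) * y j)"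
    by (simp add: mv_def pert_def algebra_simps sum.distrib)
  also have "(\<Sum>j\<in>V. (if i = u \<and> j = v then \<delta> else if i = v \<and> j = u then - \<delta> else 0) * y j) =
     (\<Sum>j\<in>V. if j = v then (if i = u then \<delta> * y v else 0) else 0) + (\<Sum>j\<in>V. if j = u then (if i = v then - \<delta> * y u else 0) else 0)"
    unfolding sum.distrib[symmetric] using assms(3) by (intro sum.cong) auto
  also have "\<dots> = (if i = u then \<delta> * y v else if i = v then - \<delta> * y u else 0)"
    using assms finV by (simp add: sum.delta)
  finally show ?thesis .
qed

lemma skew_pert: "u \<noteq> v \<Longrightarrow> skew V (pert T u v \<delta>)"
  using finV by unfold_locales (auto simp: pert_def intro: skew)

text \<open>The edge \<open>uv\<close> is stable if some nonzero change of its value increases neither the rank nor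
  the set of vertices that are avoided by some maximum nonsingular principal submatrix.\<close>

definition stable :: "'v \<Rightarrow> 'v \<Rightarrow> bool" where
  "stable u v \<longleftrightarrow> (\<exists>\<delta>. \<delta> \<noteq> 0 \<and>
     (\<forall>X. maxns X \<longrightarrow> (\<exists>Y\<subseteq>V. nonsing (pert T u v \<delta>) Y \<and> card Y = card X) \<and>
        (\<forall>Y\<subseteq>V. nonsing (pert T u v \<delta>) Y \<longrightarrow> card Y \<le> card X) \<and>
        (\<forall>w\<in>V. \<forall>Y\<subseteq>V. w \<notin> Y \<longrightarrow> nonsing (pert T u v \<delta>) Y \<longrightarrow> card Y = card X \<longrightarrow> (\<exists>Z. maxns Z \<and> w \<notin> Z))))"

lemma stableE:
  assumes "stable u v" "maxns X"
  obtains \<delta> where "\<delta> \<noteq> 0" "\<exists>Y\<subseteq>V. nonsing (pert T u v \<delta>) Y \<and> card Y = card X"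
    "\<forall>Y\<subseteq>V. nonsing (pert T u v \<delta>) Y \<longrightarrow> card Y \<le> card X"
    "\<forall>w\<in>V. \<forall>Y\<subseteq>V. w \<notin> Y \<longrightarrow> nonsing (pert T u v \<delta>) Y \<longrightarrow> card Y = card X \<longrightarrow> (\<exists>Z. maxns Z \<and> w \<notin> Z)"
proof -
  obtain \<delta> where "\<delta> \<noteq> 0" and h: "\<forall>X. maxns X \<longrightarrow> (\<exists>Y\<subseteq>V. nonsing (pert T u v \<delta>) Y \<and> card Y = card X) \<and>
        (\<forall>Y\<subseteq>V. nonsing (pert T u v \<delta>) Y \<longrightarrow> card Y \<le> card X) \<and>
        (\<forall>w\<in>V. \<forall>Y\<subseteq>V. w \<notin> Y \<longrightarrow> nonsing (pert T u v \<delta>) Y \<longrightarrow> card Y = card X \<longrightarrow> (\<exists>Z. maxns Z \<and> w \<notin> Z))"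
    using assms(1) unfolding stable_def by (elim exE conjE) (rule that)
  then show thesis using h[THEN spec, THEN mp, OF assms(2)] that by metis
qed

text \<open>Otherwise some maximum \<open>X\<close> avoids both ends, and after the change
  \<open>X\<close> with \<open>u\<close> and \<open>v\<close> is nonsingular: the rank rises by 2,
  contrary to stability.\<close>

lemma stable_parallel:
  assumes st: "stable u v" and uv: "u \<in> DD" "v \<in> V" "u \<noteq> v" and k: "ker y" "ker y'"
  shows "y u * y' v = y v * y' u"
proof (rule ccontr)
  assume ne: "y u * y' v \<noteq> y v * y' u"
  \<comment> \<open>The combination of the two kernel vectors that vanishes at \<open>u\<close>; by
    assumption it does not vanish at \<open>v\<close>.\<close>
  define k where "k i = y u * y' i + - y' u * y i" for i
  have "mv V T k i = y u * mv V T y' i - y' u * mv V T y i" for i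
    by (simp add: k_def[abs_def] mv_def algebra_simps sum_subtractf sum_distrib_left)
  then have "ker k" using k unfolding ker_def k_def by simp
  moreover have "k u = 0" "k v \<noteq> 0" using ne by (auto simp: k_def algebra_simps)
  ultimately obtain X where X: "maxns X" "u \<notin> X" "v \<notin> X" using avoid_pair[OF uv, of k] by blast
  have XV: "X \<subseteq> V" and nX: "nonsing T X" using X by (auto simp: maxns_def)
  have uV: "u \<in> V" using uv by (simp add: DD_def)
  obtain \<delta> where \<delta>: "\<delta> \<noteq> 0" "\<exists>Y\<subseteq>V. nonsing (pert T u v \<delta>) Y \<and> card Y = card X"
     "\<forall>Y\<subseteq>V. nonsing (pert T u v \<delta>) Y \<longrightarrow> card Y \<le> card X"
     "\<forall>w\<in>V. \<forall>Y\<subseteq>V. w \<notin> Y \<longrightarrow> nonsing (pert T u v \<delta>) Y \<longrightarrow> card Y = card X \<longrightarrow> (\<exists>Z. maxns Z \<and> w \<notin> Z)"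
    by (rule stableE[OF st X(1)])
  interpret P: skew V "pert T u v \<delta>" using skew_pert[OF uv(3)] .
  note mvp = mv_pert[OF uV uv(2,3)]
  let ?Y = "insert u (insert v X)"
  have "nonsing (pert T u v \<delta>) ?Y"
  proof (rule P.nonsingI)
    show "?Y \<subseteq> V" using XV uV uv by auto
    fix z assume z: "\<forall>i. i \<notin> ?Y \<longrightarrow> z i = 0" "\<forall>i\<in>?Y. mv V (pert T u v \<delta>) z i = 0"
    have dots: "(\<Sum>i\<in>V. b i * mv V (pert T u v \<delta>) z i) = (\<Sum>i\<in>V. b i * mv V T z i) + \<delta> * (b u * z v - b v * z u)" for b
    proof -
      have "(\<Sum>i\<in>V. b i * mv V (pert T u v \<delta>) z i) = (\<Sum>i\<in>V. b i * mv V T z i) +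
         ((\<Sum>i\<in>V. if i = u then b u * (\<delta> * z v) else 0) + (\<Sum>i\<in>V. if i = v then b v * (- \<delta> * z u) else 0))"
        unfolding mvp sum.distrib[symmetric] using uv(3) by (intro sum.cong) (auto simp: algebra_simps)
      then show ?thesis using uV uv(2) finV by (simp add: sum.delta algebra_simps)
    qed
    \<comment> \<open>A kernel vector of \<open>T\<close> sees of the perturbed matrix only the two
      changed entries. Applied to \<open>bv X u\<close> and \<open>bv X v\<close> this clears the
      coordinates \<open>v\<close> and \<open>u\<close>.\<close>
    have z0: "\<delta> * (b u * z v - b v * z u) = 0" if "ker b" "\<forall>i. i \<notin> ?Y \<longrightarrow> b i = 0" for b
    proof -
      have "(\<Sum>i\<in>V. b i * mv V (pert T u v \<delta>) z i) = 0" using that(2) z(2) by (intro sum.neutral) (metis mult_eq_0_iff)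
      then show ?thesis using dots[of b] ker_dot[OF that(1), of z] by simp
    qed
    have uX: "u \<in> V - X" "v \<in> V - X" using X uV uv by auto
    have "\<delta> * (bv X u u * z v - bv X u v * z u) = 0" using bv[OF X(1) uX(1)] by (intro z0) auto
    then have zv: "z v = 0" using bv[OF X(1) uX(1)] X uv(3) \<delta> by simp
    have "\<delta> * (bv X v u * z v - bv X v v * z u) = 0" using bv[OF X(1) uX(2)] by (intro z0) auto
    then have zu: "z u = 0" using bv[OF X(1) uX(2)] X uv(3) \<delta> by simp
    have "z i = 0" for i
    proof (rule nonsing_zero[OF XV nX])
      show "\<forall>i. i \<notin> X \<longrightarrow> z i = 0" using z(1) zu zv by auto
      show "\<forall>i\<in>X. mv V T z i = 0"
      proof
        fix i assume i: "i \<in> X"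
        then have "mv V (pert T u v \<delta>) z i = 0" "i \<noteq> u" "i \<noteq> v" using z(2) X by auto
        then show "mv V T z i = 0" using mvp[of \<delta> z i] by simp
      qed
    qed
    then show "\<forall>i\<in>?Y. z i = 0" by simp
  qed
  moreover have "card ?Y = card X + 2" using X uv(3) finite_subset[OF XV finV] by (simp add: card_insert_if)
  moreover have "?Y \<subseteq> V" using XV uV uv by auto
  ultimately have "card ?Y \<le> card X" "card ?Y = card X + 2" using \<delta>(3)[THEN spec, of ?Y] by simp_all
  then show False by linarith
qed

text \<open>A preimage \<open>z\<close> of \<open>e_v - c e_u\<close> exists because every kernel
  vector is orthogonal to it. The vector \<open>bv X u + \<delta> z\<close> lies in the kernel of
  the changed matrix; if \<open>z\<close> were nonzero somewhere outside \<open>DD\<close>, the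
  change would enlarge \<open>DD\<close>.\<close>

lemma stable_image:
  assumes st: "stable u v" and uv: "u \<in> DD" "v \<in> V" "u \<noteq> v" and c: "\<And>k. ker k \<Longrightarrow> k v = c * k u"
  shows "\<exists>z. (\<forall>i. i \<notin> DD \<longrightarrow> z i = 0) \<and> (\<forall>i\<in>V. mv V T z i = (if i = v then 1 else if i = u then - c else 0))"
proof -
  obtain X where X: "maxns X" "u \<notin> X" using uv(1) DD_iff by blast
  have XV: "X \<subseteq> V" and nX: "nonsing T X" using X by (auto simp: maxns_def)
  have uV: "u \<in> V" using uv by (simp add: DD_def)
  have uX: "u \<in> V - X" using X uV by auto
  have vX: "v \<in> X"
  proof (rule ccontr)
    assume "v \<notin> X"
    then have "v \<in> V - X" using uv by auto
    then show False using bv[OF X(1), of v] c[of "bv X v"] X uv(3) by auto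
  qed
  obtain z where z: "\<forall>i. i \<notin> X \<longrightarrow> z i = 0" "\<forall>i\<in>X. mv V T z i = (if i = v then 1 else 0)"
    using ns_solve[OF XV nX, of "\<lambda>i. if i = v then 1 else 0"] by blast
  have mvz: "mv V T z i = (if i = v then 1 else if i = u then - c else 0)" if i: "i \<in> V" for i
  proof (cases "i \<in> X")
    case True
    then show ?thesis using z X by auto
  next
    case False
    then have iX: "i \<in> V - X" using i by auto
    note b = bv[OF X(1) iX]
    have "0 = (\<Sum>j\<in>V. bv X i j * mv V T z j)" using ker_dot[OF b(1)] by simp
    also have "\<dots> = (\<Sum>j\<in>{i, v}. bv X i j * mv V T z j)"
    proof (rule sum.mono_neutral_right)
      show "\<forall>j\<in>V - {i, v}. bv X i j * mv V T z j = 0"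
      proof
        fix j assume "j \<in> V - {i, v}"
        then show "bv X i j * mv V T z j = 0" using b(3) z(2) by (cases "j \<in> X") auto
      qed
    qed (use finV i uv in auto)
    also have "\<dots> = mv V T z i + bv X i v"
    proof -
      have "i \<noteq> v" using False vX by auto
      then show ?thesis using vX b(2) z(2) by simp
    qed
    finally have "mv V T z i = - c * bv X i u" using c[OF b(1)] by simp
    then show ?thesis using b False vX X(2) by auto
  qed
  have zu: "z u = 0" using z X by auto
  have "0 = (\<Sum>j\<in>V. z j * mv V T z j)" using dot_self by simp
  also have "\<dots> = (\<Sum>j\<in>{v}. z j * mv V T z j)"
  proof (rule sum.mono_neutral_right)
    show "\<forall>j\<in>V - {v}. z j * mv V T z j = 0" using mvz zu by auto
  qed (use finV uv in auto)
  finally have zv: "z v = 0" using mvz[OF uv(2)] by simp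
  obtain \<delta> where \<delta>: "\<delta> \<noteq> 0" "\<exists>Y\<subseteq>V. nonsing (pert T u v \<delta>) Y \<and> card Y = card X"
     "\<forall>Y\<subseteq>V. nonsing (pert T u v \<delta>) Y \<longrightarrow> card Y \<le> card X"
     "\<forall>w\<in>V. \<forall>Y\<subseteq>V. w \<notin> Y \<longrightarrow> nonsing (pert T u v \<delta>) Y \<longrightarrow> card Y = card X \<longrightarrow> (\<exists>Z. maxns Z \<and> w \<notin> Z)"
    by (rule stableE[OF st X(1)])
  interpret P: skew V "pert T u v \<delta>" using skew_pert[OF uv(3)] .
  note b = bv[OF X(1) uX]
  \<comment> \<open>Since \<open>z u = z v = 0\<close>, the values at \<open>u\<close> and
    \<open>v\<close> are 1 and \<open>c\<close>, so that the terms added by the perturbation cancel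
    \<open>\<delta>\<close> times the image of \<open>z\<close>.\<close>
  define y where "y i = bv X u i + \<delta> * z i" for i
  have yu: "y u = 1" "y v = c" using b zu zv c[OF b(1)] by (auto simp: y_def)
  have "P.ker y"
    unfolding P.ker_def
  proof (intro conjI allI impI ballI)
    fix i assume "i \<notin> V"
    then show "y i = 0" using b(1) z(1) XV by (auto simp: y_def ker_def)
  next
    fix i assume i: "i \<in> V"
    have "mv V T y i = \<delta> * mv V T z i" using b(1) i mv_add[of V T "bv X u" \<delta> z i] by (simp add: y_def[abs_def] ker_def)
    then show "mv V (pert T u v \<delta>) y i = 0"
      unfolding mv_pert[OF uV uv(2,3)] using mvz[OF i] yu uv(3) by (auto simp: algebra_simps)
  qed
  have "z w = 0" if w: "w \<notin> DD" for w
  proof (rule ccontr)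
    assume zw: "z w \<noteq> 0"
    then have wV: "w \<in> V" using z(1) XV by auto
    have "bv X u w = 0" using b(1) w wV by (auto simp: DD_def)
    then have "y w \<noteq> 0" using zw \<delta> by (simp add: y_def)
    then have "w \<in> P.DD" using \<open>P.ker y\<close> wV by (auto simp: P.DD_def)
    then obtain Y where Y: "P.maxns Y" "w \<notin> Y" using P.DD_iff by blast
    then have "card Y = card X" using \<delta>(2,3) unfolding P.maxns_def by (metis le_antisym)
    then have "\<exists>Z. maxns Z \<and> w \<notin> Z" using \<delta>(4) wV Y unfolding P.maxns_def by blast
    then show False using w wV DD_iff by blast
  qed
  then show ?thesis using mvz by blast
qed

end

section \<open>The Gallai-Edmonds structure of a graph all of whose edges are stable\<close>

locale stable_graph = skew V T for V :: "'v::linorder set" and T +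
  fixes E :: "'v \<Rightarrow> 'v \<Rightarrow> bool"
  assumes symE: "E u v \<Longrightarrow> E v u" and irrE: "\<not> E u u" and EV: "E u v \<Longrightarrow> u \<in> V \<and> v \<in> V"
    and supp: "T u v \<noteq> 0 \<Longrightarrow> u \<in> V \<Longrightarrow> v \<in> V \<Longrightarrow> E u v"
    and stab: "E u v \<Longrightarrow> stable u v"
begin

definition AA :: "'v set" where
  "AA = {a\<in>V - DD. \<exists>u\<in>DD. E u a}"

definition RR :: "('v \<times> 'v) set" where
  "RR = {(u, v). u \<in> DD \<and> v \<in> DD \<and> E u v}"

text \<open>In vector form \<open>T z = e_v - c e_u\<close> on \<open>V\<close>, with
  \<open>z\<close> supported on \<open>DD\<close>.\<close>

definition img :: "'v \<Rightarrow> 'v \<Rightarrow> real \<Rightarrow> ('v \<Rightarrow> real) \<Rightarrow> bool" where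
  "img u v c z \<longleftrightarrow> (\<forall>i. i \<notin> DD \<longrightarrow> z i = 0) \<and>
     (\<forall>i\<in>V. mv V T z i = (if i = v then 1 else 0) - c * (if i = u then 1 else 0))"

lemma DV: "DD \<subseteq> V" by (auto simp: DD_def)

lemma edge_img:
  assumes "u \<in> DD" "v \<in> DD" "E u v"
  shows "\<exists>c z. img u v c z"
proof -
  obtain y where y: "ker y" "y u \<noteq> 0" using assms(1) by (auto simp: DD_def)
  have ne: "u \<noteq> v" using assms irrE by auto
  have vV: "v \<in> V" using assms DV by auto
  have c: "k v = y v / y u * k u" if "ker k" for k
    using stable_parallel[OF stab[OF assms(3)] assms(1) vV ne y(1) that] y(2) by (simp add: field_simps)
  have "\<exists>z. (\<forall>i. i \<notin> DD \<longrightarrow> z i = 0) \<and> (\<forall>i\<in>V. mv V T z i = (if i = v then 1 else if i = u then - (y v / y u) else 0))"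
    by (rule stable_image[OF stab[OF assms(3)] assms(1) vV ne]) (rule c)
  then obtain z where "\<forall>i. i \<notin> DD \<longrightarrow> z i = 0"
    "\<forall>i\<in>V. mv V T z i = (if i = v then 1 else if i = u then - (y v / y u) else 0)" by blast
  then have "img u v (y v / y u) z" using ne unfolding img_def by auto
  then show ?thesis by blast
qed

text \<open>The relations telescope along a path in \<open>DD\<close>, the factors \<open>c\<close>
  being multiplied.\<close>

lemma class_img: "(u, v) \<in> RR\<^sup>* \<Longrightarrow> u \<in> DD \<Longrightarrow> \<exists>c z. img u v c z"
proof (induction rule: rtrancl_induct)
  case base
  have "img u u 1 (\<lambda>_. 0)" by (simp add: img_def mv_def)
  then show ?case by blast
next
  case (step v w)
  then obtain c z where z: "img u v c z" by blast
  have "v \<in> DD" "w \<in> DD" "E v w" using step.hyps(2) by (auto simp: RR_def)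
  then obtain c' z' where z': "img v w c' z'" using edge_img by blast
  have "img u w (c' * c) (\<lambda>i. z' i + c' * z i)"
    unfolding img_def
  proof (intro conjI allI impI ballI)
    fix i assume "i \<notin> DD"
    then show "z' i + c' * z i = 0" using z z' by (simp add: img_def)
  next
    fix i assume "i \<in> V"
    then have m: "mv V T z i = (if i = v then 1 else 0) - c * (if i = u then 1 else 0)"
      "mv V T z' i = (if i = w then 1 else 0) - c' * (if i = v then 1 else 0)"
      using z z' by (simp_all add: img_def)
    show "mv V T (\<lambda>i. z' i + c' * z i) i = (if i = w then 1 else 0) - c' * c * (if i = u then 1 else 0)"
      unfolding mv_add m by (simp add: algebra_simps)
  qed
  then show ?case by blast
qed

text \<open>The case \<open>c = 0\<close> of \<open>stable_image\<close>: kernel vectors vanish at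
  \<open>a\<close>, which lies outside \<open>DD\<close>.\<close>

lemma A_img: "a \<in> AA \<Longrightarrow> \<exists>z. (\<forall>i. i \<notin> DD \<longrightarrow> z i = 0) \<and> (\<forall>i\<in>V. mv V T z i = (if i = a then 1 else 0))"
proof -
  assume "a \<in> AA"
  then obtain u where u: "u \<in> DD" "E u a" "a \<in> V" "a \<notin> DD" by (auto simp: AA_def)
  have c: "k a = 0 * k u" if "ker k" for k using that u by (auto simp: DD_def)
  have "u \<noteq> a" using u by auto
  have "\<exists>z. (\<forall>i. i \<notin> DD \<longrightarrow> z i = 0) \<and> (\<forall>i\<in>V. mv V T z i = (if i = a then 1 else if i = u then - 0 else 0))"
    by (rule stable_image[OF stab[OF u(2)] u(1,3) \<open>u \<noteq> a\<close>]) (rule c)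
  then show ?thesis by (simp cong: if_cong)
qed

text \<open>A representative of the component within \<open>DD\<close>; the order on the vertices
  serves only to make it the same for the whole component.\<close>

definition root :: "'v \<Rightarrow> 'v" where
  "root v = Min {w. (v, w) \<in> RR\<^sup>*}"

lemma RR_sym: "(u, v) \<in> RR\<^sup>* \<Longrightarrow> (v, u) \<in> RR\<^sup>*"
proof -
  have "sym RR" using symE by (auto simp: sym_def RR_def)
  then have "sym (RR\<^sup>*)" by (rule sym_rtrancl)
  then show "(u, v) \<in> RR\<^sup>* \<Longrightarrow> (v, u) \<in> RR\<^sup>*" by (rule symD)
qed

lemma RR_in: "(u, v) \<in> RR\<^sup>* \<Longrightarrow> u \<in> DD \<Longrightarrow> v \<in> DD"
  by (induction rule: rtrancl_induct) (auto simp: RR_def)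

lemma root:
  assumes "v \<in> DD"
  shows "(v, root v) \<in> RR\<^sup>*" "root v \<in> DD"
proof -
  have "finite {w. (v, w) \<in> RR\<^sup>*}"
    by (rule finite_subset[of _ DD]) (use RR_in assms finite_subset[OF DV finV] in auto)
  moreover have "v \<in> {w. (v, w) \<in> RR\<^sup>*}" by simp
  ultimately have "root v \<in> {w. (v, w) \<in> RR\<^sup>*}" unfolding root_def by (intro Min_in) auto
  then show "(v, root v) \<in> RR\<^sup>*" "root v \<in> DD" using RR_in assms by auto
qed

lemma root_eq: "(u, v) \<in> RR\<^sup>* \<Longrightarrow> root u = root v"
  unfolding root_def using RR_sym by (metis rtrancl_trans)

lemma root_edge: "u \<in> DD \<Longrightarrow> v \<in> DD \<Longrightarrow> E u v \<Longrightarrow> root u = root v"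
  by (rule root_eq) (auto simp: RR_def)

definition QQ :: "'v set" where "QQ = root ` DD"

definition cls :: "'v \<Rightarrow> 'v set" where "cls q = {v\<in>DD. root v = q}"

lemma root_idem: "q \<in> QQ \<Longrightarrow> q \<in> DD \<and> root q = q"
proof -
  assume "q \<in> QQ"
  then obtain v where "v \<in> DD" "q = root v" by (auto simp: QQ_def)
  then show ?thesis using root[of v] root_eq[OF root(1)[of v]] by simp
qed

definition zf :: "'v \<Rightarrow> 'v \<Rightarrow> real" where
  "zf v = (SOME z. \<exists>c. img (root v) v c z)"

lemma zf: "v \<in> DD \<Longrightarrow> \<exists>c. img (root v) v c (zf v)"
proof -
  assume "v \<in> DD"
  then have "\<exists>z c. img (root v) v c z" using class_img[OF RR_sym[OF root(1)]] root(2) by blast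
  then show ?thesis unfolding zf_def by (rule someI_ex)
qed

text \<open>By skewness the pairing moves \<open>T\<close> onto \<open>zf v\<close>, whose image
  meets only \<open>v\<close> and its root. A vector that vanishes at the root is thus determined at
  \<open>v\<close> by its image under \<open>T\<close>.\<close>

lemma dot_zf:
  assumes "v \<in> DD" "y (root v) = 0"
  shows "(\<Sum>j\<in>V. zf v j * mv V T y j) = - y v"
proof -
  obtain c where c: "img (root v) v c (zf v)" using zf assms by blast
  have vV: "v \<in> V" "root v \<in> V" using assms DV root(2) by auto
  have "(\<Sum>j\<in>V. y j * mv V T (zf v) j) = (\<Sum>j\<in>V. (if j = v then y v else 0) - c * (if j = root v then y (root v) else 0))"
  proof (rule sum.cong)
    fix j assume "j \<in> V"
    then have m: "mv V T (zf v) j = (if j = v then 1 else 0) - c * (if j = root v then 1 else 0)"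
      using c by (simp add: img_def)
    show "y j * mv V T (zf v) j = (if j = v then y v else 0) - c * (if j = root v then y (root v) else 0)"
      unfolding m by (cases "j = v"; cases "j = root v") (auto simp: algebra_simps)
  qed simp
  also have "\<dots> = y v - c * y (root v)"
    using vV finV by (simp add: sum_subtractf sum.delta flip: sum_distrib_left)
  finally show ?thesis using dot_skew[of "zf v" y] assms by simp
qed

text \<open>The left side counts independent vectors supported on \<open>DD\<close>: a kernel basis
  and preimages of \<open>e_a\<close> for \<open>a\<close> in \<open>AA\<close>. If there were more
  than components, a nontrivial combination would vanish at all roots. Its image lives on
  \<open>AA\<close>, where every \<open>zf v\<close> is zero, so by \<open>dot_zf\<close> it
  vanishes altogether.\<close>

lemma card_QQ:
  assumes X: "maxns X"
  shows "card (V - X) + card AA \<le> card QQ"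
proof (rule ccontr)
  assume "\<not> card (V - X) + card AA \<le> card QQ"
  have finA: "finite AA" using finV by (simp add: AA_def)
  have finQ: "finite QQ" using finite_subset[OF DV finV] by (simp add: QQ_def)
  have finX: "finite (V - X)" using finV by simp
  obtain za where za: "\<And>a. a \<in> AA \<Longrightarrow> (\<forall>i. i \<notin> DD \<longrightarrow> za a i = 0) \<and> (\<forall>i\<in>V. mv V T (za a) i = (if i = a then 1 else 0))"
    using A_img by metis
  define f where "f q i = (case i of Inl w \<Rightarrow> bv X w q | Inr a \<Rightarrow> za a q)" for q i
  let ?I = "(V - X) <+> AA"
  have "card QQ < card ?I" using \<open>\<not> _\<close> finA finX by (simp add: card_Plus)
  then obtain \<alpha> where \<alpha>: "\<exists>i\<in>?I. \<alpha> i \<noteq> 0" "\<forall>q\<in>QQ. (\<Sum>i\<in>?I. f q i * \<alpha> i) = 0"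
    using homogeneous_nontrivial[of QQ ?I f] finQ finA finX by auto
  define y1 where "y1 i = (\<Sum>w\<in>V - X. \<alpha> (Inl w) * bv X w i)" for i
  define y2 where "y2 i = (\<Sum>a\<in>AA. \<alpha> (Inr a) * za a i)" for i
  define y where "y i = y1 i + 1 * y2 i" for i
  have yf: "y q = (\<Sum>i\<in>?I. f q i * \<alpha> i)" for q
    using finA finX by (simp add: sum.Plus f_def y_def y1_def y2_def mult.commute)
  have m1: "mv V T y1 i = 0" if "i \<in> V" for i
    using mv_sum[OF finX, of V T "\<lambda>w. \<alpha> (Inl w)" "bv X" i] bv(1)[OF X] that by (simp add: y1_def[abs_def] ker_def)
  have m2: "mv V T y2 i = (if i \<in> AA then \<alpha> (Inr i) else 0)" if "i \<in> V" for i
  proof -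
    have "mv V T y2 i = (\<Sum>a\<in>AA. \<alpha> (Inr a) * mv V T (za a) i)"
      using mv_sum[OF finA, of V T "\<lambda>a. \<alpha> (Inr a)" za i] by (simp add: y2_def[abs_def])
    also have "\<dots> = (\<Sum>a\<in>AA. if a = i then \<alpha> (Inr i) else 0)"
      using za that by (intro sum.cong) auto
    finally show ?thesis using finA by (simp add: sum.delta)
  qed
  have my: "mv V T y i = (if i \<in> AA then \<alpha> (Inr i) else 0)" if "i \<in> V" for i
    using m1[OF that] m2[OF that] mv_add[of V T y1 1 y2 i] by (simp add: y_def[abs_def])
  have yD: "y i = 0" if "i \<notin> DD" for i
  proof -
    have "bv X w i = 0" if "w \<in> V - X" for w
      using bv(1)[OF X that] \<open>i \<notin> DD\<close> by (auto simp: DD_def ker_def)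
    then show ?thesis using za that by (simp add: y_def y1_def y2_def)
  qed
  have y0: "y v = 0" for v
  proof (cases "v \<in> DD")
    case True
    have "root v \<in> QQ" using True by (simp add: QQ_def)
    then have "y (root v) = 0" using yf \<alpha>(2) by simp
    then have "- y v = (\<Sum>j\<in>V. zf v j * mv V T y j)" using dot_zf[OF True] by simp
    also have "\<dots> = 0"
    proof (rule sum.neutral, rule ballI)
      fix j assume "j \<in> V"
      then show "zf v j * mv V T y j = 0"
        using zf[OF True] my[of j] by (auto simp: img_def AA_def)
    qed
    finally show ?thesis by simp
  qed (use yD in simp)
  have "\<alpha> (Inr a) = 0" if "a \<in> AA" for a
    using my[of a] that y0 by (auto simp: mv_def AA_def)
  then have b0: "y2 i = 0" for i by (simp add: y2_def)
  have "\<alpha> (Inl w) = 0" if w: "w \<in> V - X" for w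
  proof -
    have "y1 w = (\<Sum>w'\<in>V - X. if w' = w then \<alpha> (Inl w) else 0)"
      unfolding y1_def using bv(2,3)[OF X] w by (intro sum.cong) auto
    then show ?thesis using y0[of w] b0 w finX by (simp add: y_def sum.delta)
  qed
  then show False using \<alpha>(1) \<open>\<And>a. a \<in> AA \<Longrightarrow> \<alpha> (Inr a) = 0\<close> by auto
qed

text \<open>The component without its root is nonsingular and therefore has even size: a solution on
  it has image 0 at the root, by pairing with a kernel vector, and then vanishes by
  \<open>dot_zf\<close>.\<close>

lemma card_cls_odd:
  assumes q: "q \<in> QQ"
  shows "odd (card (cls q))"
proof -
  have qD: "q \<in> DD" "root q = q" using root_idem[OF q] by auto
  have cV: "cls q \<subseteq> V" using DV by (auto simp: cls_def)
  let ?X = "cls q - {q}"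
  have XV: "?X \<subseteq> V" using cV by auto
  have "nonsing T ?X"
  proof (rule nonsingI[OF XV])
    fix y assume y: "\<forall>i. i \<notin> ?X \<longrightarrow> y i = 0" "\<forall>i\<in>?X. mv V T y i = 0"
    \<comment> \<open>The support of \<open>y\<close> lies in one component, and no edge leads from
      it to another part of \<open>DD\<close>.\<close>
    have out: "mv V T y j = 0" if "j \<in> DD" "j \<notin> cls q" for j
      unfolding mv_def
    proof (rule sum.neutral, rule ballI)
      fix i assume i: "i \<in> V"
      show "T j i * y i = 0"
      proof (cases "i \<in> ?X")
        case True
        then have "T j i = 0" using supp[of j i] that root_edge[of j i] i DV by (auto simp: cls_def)
        then show ?thesis by simp
      qed (use y in auto)
    qed
    have dot: "(\<Sum>j\<in>V. k j * mv V T y j) = k q * mv V T y q" if "\<forall>i. i \<notin> DD \<longrightarrow> k i = 0" for k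
    proof -
      have "(\<Sum>j\<in>V. k j * mv V T y j) = (\<Sum>j\<in>{q}. k j * mv V T y j)"
      proof (rule sum.mono_neutral_right)
        show "\<forall>j\<in>V - {q}. k j * mv V T y j = 0"
        proof
          fix j assume "j \<in> V - {q}"
          then show "k j * mv V T y j = 0" using that y(2) out[of j] by (cases "j \<in> DD"; cases "j \<in> cls q") auto
        qed
      qed (use finV qD DV in auto)
      then show ?thesis by simp
    qed
    obtain k where k: "ker k" "k q \<noteq> 0" using qD by (auto simp: DD_def)
    have "\<forall>i. i \<notin> DD \<longrightarrow> k i = 0" using k(1) by (auto simp: DD_def ker_def)
    then have "k q * mv V T y q = 0" using dot[of k] ker_dot[OF k(1)] by simp
    then have a0: "mv V T y q = 0" using k by simp
    show "\<forall>i\<in>?X. y i = 0"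
    proof
      fix v assume v: "v \<in> ?X"
      then have vD: "v \<in> DD" "root v = q" by (auto simp: cls_def)
      have "y (root v) = 0" using y(1) vD by simp
      then have "- y v = (\<Sum>j\<in>V. zf v j * mv V T y j)" using dot_zf[OF vD(1)] by simp
      also have "\<dots> = 0" using dot[of "zf v"] zf[OF vD(1)] a0 by (auto simp: img_def)
      finally show "y v = 0" by simp
    qed
  qed
  then have "even (card ?X)" using perfect_matching_of_nonsing[OF XV] by auto
  moreover have "q \<in> cls q" using qD by (simp add: cls_def)
  moreover have "finite (cls q)" using cV finV finite_subset by blast
  ultimately show ?thesis using card_Suc_Diff1[of "cls q" q] by (metis even_Suc)
qed

text \<open>Each component, being odd, has a vertex \<open>f q\<close> that is not matched inside
  it. Such vertices are either unmatched or have distinct partners in \<open>AA\<close>, so at least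
  \<open>card QQ - card AA\<close> vertices stay unmatched, and \<open>card_QQ\<close>
  applies.\<close>

lemma matching_bound:
  assumes X: "maxns X" and M: "matching {{u, v} | u v. E u v} M"
  shows "2 * card M \<le> card X"
proof -
  have ME: "\<exists>u v. e = {u, v} \<and> E u v" if "e \<in> M" for e using M that unfolding matching_def by blast
  have c2: "card e = 2" "e \<subseteq> V" "finite e" if "e \<in> M" for e
    using ME[OF that] irrE EV by (auto simp: card_insert_if)
  have disj: "e = e'" if "e \<in> M" "e' \<in> M" "x \<in> e" "x \<in> e'" for e e' x
    using M that unfolding matching_def pairwise_def disjnt_def by blast
  have finM: "finite M" using c2(2) finV by (meson finite_Pow_iff PowI finite_subset subsetI)
  have cU: "card (\<Union>N) = 2 * card N" if "N \<subseteq> M" for N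
  proof -
    have "pairwise disjnt N" using M that unfolding matching_def by (meson pairwise_subset)
    then have "card (\<Union>N) = sum card N" using that c2(3) by (intro card_Union_disjoint) auto
    also have "\<dots> = sum (\<lambda>_. 2) N" using that c2(1) by (intro sum.cong) auto
    finally show ?thesis by simp
  qed
  have "\<exists>v\<in>cls q. \<forall>e\<in>M. v \<in> e \<longrightarrow> \<not> e \<subseteq> cls q" if q: "q \<in> QQ" for q
  proof (rule ccontr)
    assume "\<not> ?thesis"
    then have "cls q = \<Union>{e\<in>M. e \<subseteq> cls q}" by blast
    then have "card (cls q) = 2 * card {e\<in>M. e \<subseteq> cls q}" using cU[of "{e\<in>M. e \<subseteq> cls q}"] by auto
    then show False using card_cls_odd[OF q] by simp
  qed
  then obtain f where f: "\<And>q. q \<in> QQ \<Longrightarrow> f q \<in> cls q \<and> (\<forall>e\<in>M. f q \<in> e \<longrightarrow> \<not> e \<subseteq> cls q)" by metis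
  have finj: "inj_on f QQ" using f by (intro inj_onI) (metis (mono_tags, lifting) cls_def mem_Collect_eq)
  have finQ: "finite QQ" using finite_subset[OF DV finV] by (simp add: QQ_def)
  have finA: "finite AA" using finV by (simp add: AA_def)
  define P where "P = {q\<in>QQ. f q \<in> \<Union>M}"
  have "\<exists>a\<in>AA. {f q, a} \<in> M" if "q \<in> P" for q
  proof -
    have q: "q \<in> QQ" using that by (simp add: P_def)
    have "f q \<in> \<Union>M" using that by (simp add: P_def)
    then obtain e where e: "e \<in> M" "f q \<in> e" by blast
    obtain a where a: "e = {f q, a}" "E (f q) a" using ME[OF e(1)] e(2) symE by blast
    have fD: "f q \<in> DD" "root (f q) = q" using f[OF q] by (auto simp: cls_def)
    have "a \<notin> DD"
    proof
      assume "a \<in> DD"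
      then have "a \<in> cls q" using root_edge[OF fD(1) _ a(2)] fD(2) by (simp add: cls_def)
      then show False using f[OF q] e a by auto
    qed
    then have "a \<in> AA" using a fD EV by (auto simp: AA_def)
    then show ?thesis using a e by blast
  qed
  then obtain g where g: "\<And>q. q \<in> P \<Longrightarrow> g q \<in> AA \<and> {f q, g q} \<in> M" by metis
  have fD: "f q \<in> DD" if "q \<in> P" for q using f that by (auto simp: P_def cls_def)
  have "inj_on g P"
  proof (rule inj_onI)
    fix q q' assume h: "q \<in> P" "q' \<in> P" "g q = g q'"
    have "{f q, g q} = {f q', g q'}" by (rule disj[of _ _ "g q"]) (use g[OF h(1)] g[OF h(2)] h(3) in simp_all)
    moreover have "g q \<notin> DD" "f q \<in> DD" "f q' \<in> DD" using g h fD by (auto simp: AA_def)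
    ultimately have "f q = f q'" using h(3) by (auto simp: doubleton_eq_iff)
    then show "q = q'" using finj h by (auto simp: P_def dest: inj_onD)
  qed
  then have cP: "card P \<le> card AA" using g finA by (meson card_inj_on_le image_subsetI)
  have "card (QQ - P) \<le> card (V - \<Union>M)"
  proof (rule card_inj_on_le[of f])
    show "inj_on f (QQ - P)" using finj by (rule inj_on_subset) auto
    show "f ` (QQ - P) \<subseteq> V - \<Union>M" using f DV by (auto simp: P_def cls_def)
  qed (use finV in auto)
  moreover have "card (QQ - P) = card QQ - card P" using finQ by (intro card_Diff_subset) (auto simp: P_def intro: finite_subset)
  moreover have "\<Union>M \<subseteq> V" using c2(2) by blast
  moreover then have "card (V - \<Union>M) = card V - 2 * card M"
    using cU[of M] finV by (simp add: card_Diff_subset finite_subset)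
  moreover have "2 * card M \<le> card V" using cU[of M] \<open>\<Union>M \<subseteq> V\<close> finV by (metis card_mono order_refl)
  moreover have "card (V - X) = card V - card X" "card X \<le> card V"
    using X finV by (auto simp: maxns_def card_Diff_subset finite_subset card_mono)
  ultimately show ?thesis using card_QQ[OF X] cP by linarith
qed

text \<open>A perfect matching of the nonsingular part \<open>X\<close> attains the bound
  \<open>matching_bound\<close>.\<close>

theorem rank_eq_matching_number:
  assumes X: "maxns X"
  shows "card X = 2 * matching_number {{u, v} | u v. E u v}"
proof -
  let ?E = "{{u, v} | u v. E u v}"
  have XV: "X \<subseteq> V" and nX: "nonsing T X" using X by (auto simp: maxns_def)
  obtain M where M: "matching {{i, j} | i j. i \<in> X \<and> j \<in> X \<and> i \<noteq> j \<and> T i j \<noteq> 0} M" "card X = 2 * card M"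
    using perfect_matching_of_nonsing[OF XV nX] by blast
  have "matching ?E M" using M(1) supp XV unfolding matching_def by blast
  have "?E \<subseteq> Pow V" using EV by auto
  then have finE: "finite ?E" using finV by (meson finite_Pow_iff finite_subset)
  then have fin: "finite {M. matching ?E M}" unfolding matching_def by simp
  have "Max (card ` {M. matching ?E M}) = card M"
  proof (rule Max_eqI)
    fix c assume "c \<in> card ` {M. matching ?E M}"
    then show "c \<le> card M" using matching_bound[OF X] M(2) by auto
  qed (use fin \<open>matching ?E M\<close> in auto)
  then show ?thesis using M(2) by (simp add: matching_number_def)
qed

end

section \<open>Coefficients of the characteristic polynomial\<close>

text \<open>The principal minor with index set \<open>X\<close>, written by the Leibniz formula so
  as to avoid renumbering.\<close>

definition detS :: "(nat \<Rightarrow> nat \<Rightarrow> 'a::comm_ring_1) \<Rightarrow> nat set \<Rightarrow> 'a" where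
  "detS T X = (\<Sum>p | p permutes X. of_int (sign p) * (\<Prod>i\<in>X. T i (p i)))"

definition cmat :: "nat \<Rightarrow> (nat \<Rightarrow> nat \<Rightarrow> 'a::comm_ring_1) \<Rightarrow> 'a fps mat" where
  "cmat n T = mat n n (\<lambda>(i, j). of_bool (i = j) - fps_X * fps_const (T i j))"

text \<open>Power series serve as polynomials in \<open>y\<close>: \<open>cc n T k\<close> is the
  coefficient of \<open>y ^ k\<close> in \<open>det (I - y T)\<close>.\<close>

definition cc :: "nat \<Rightarrow> (nat \<Rightarrow> nat \<Rightarrow> 'a::comm_ring_1) \<Rightarrow> nat \<Rightarrow> 'a" where
  "cc n T k = fps_nth (det (cmat n T)) k"

lemma fixes_iff_permutes:
  assumes "p permutes A" "S \<subseteq> A" "finite A"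
  shows "(\<Prod>i\<in>A - S. of_bool (i = p i) :: 'b::comm_semiring_1) = of_bool (p permutes S)"
proof (cases "\<forall>i\<in>A - S. p i = i")
  case True
  then have "p permutes S" by (intro permutes_superset[OF assms(1)]) blast
  then show ?thesis using True by (simp add: prod.neutral)
next
  case False
  then obtain i where i: "i \<in> A - S" "p i \<noteq> i" by blast
  have "\<not> p permutes S" using i by (meson DiffD2 permutes_not_in)
  moreover have "(\<Prod>i\<in>A - S. of_bool (i = p i) :: 'b) = 0"
    using i assms(3) by (intro prod_zero) (auto intro!: bexI[of _ i])
  ultimately show ?thesis by simp
qed

lemma perm_sub: "S \<subseteq> A \<Longrightarrow> finite A \<Longrightarrow> (\<Sum>p | p permutes A. of_bool (p permutes S) * f p) = (\<Sum>p | p permutes S. f p)"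
  for f :: "_ \<Rightarrow> 'b::comm_semiring_1"
proof -
  assume S: "S \<subseteq> A" and fin: "finite A"
  have "(\<Sum>p | p permutes A. of_bool (p permutes S) * f p) = (\<Sum>p\<in>{p. p permutes S}. of_bool (p permutes S) * f p)"
    using S fin by (intro sum.mono_neutral_right) (auto simp: finite_permutations intro: permutes_subset)
  then show ?thesis by simp
qed

lemma detS_mat:
  fixes T :: "nat \<Rightarrow> nat \<Rightarrow> 'a::comm_ring_1"
  assumes X: "X \<subseteq> {0..<n}"
  shows "det (mat n n (\<lambda>(i, j). if i \<in> X \<and> j \<in> X then T i j else of_bool (i = j))) = detS T X"
proof -
  let ?M = "mat n n (\<lambda>(i, j). if i \<in> X \<and> j \<in> X then T i j else of_bool (i = j))"
  have "det ?M = (\<Sum>p | p permutes {0..<n}. signof p * (\<Prod>i = 0..<n. ?M $$ (i, p i)))"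
    by (rule det_def') simp
  also have "\<dots> = (\<Sum>p | p permutes {0..<n}. of_bool (p permutes X) * (of_int (sign p) * (\<Prod>i\<in>X. T i (p i))))"
  proof (rule sum.cong)
    fix p assume "p \<in> {p. p permutes {0..<n}}"
    then have p: "p permutes {0..<n}" by simp
    have "(\<Prod>i = 0..<n. ?M $$ (i, p i)) = (\<Prod>i = 0..<n. if i \<in> X \<and> p i \<in> X then T i (p i) else of_bool (i = p i))"
      using permutes_in_image[OF p] by (intro prod.cong) auto
    also have "\<dots> = (\<Prod>i\<in>{0..<n} - X. if i \<in> X \<and> p i \<in> X then T i (p i) else of_bool (i = p i)) *
        (\<Prod>i\<in>X. if i \<in> X \<and> p i \<in> X then T i (p i) else of_bool (i = p i))"
      using X by (intro prod.subset_diff) auto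
    also have "(\<Prod>i\<in>{0..<n} - X. if i \<in> X \<and> p i \<in> X then T i (p i) else of_bool (i = p i)) = (\<Prod>i\<in>{0..<n} - X. of_bool (i = p i))"
      by (intro prod.cong) auto
    also have "\<dots> = of_bool (p permutes X)" by (rule fixes_iff_permutes[OF p X]) simp
    finally have e: "(\<Prod>i = 0..<n. ?M $$ (i, p i)) = of_bool (p permutes X) *
        (\<Prod>i\<in>X. if i \<in> X \<and> p i \<in> X then T i (p i) else of_bool (i = p i))" .
    show "signof p * (\<Prod>i = 0..<n. ?M $$ (i, p i)) = of_bool (p permutes X) * (of_int (sign p) * (\<Prod>i\<in>X. T i (p i)))"
    proof (cases "p permutes X")
      case True
      then have "(\<Prod>i\<in>X. if i \<in> X \<and> p i \<in> X then T i (p i) else of_bool (i = p i)) = (\<Prod>i\<in>X. T i (p i))"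
        by (intro prod.cong) (auto simp: permutes_in_image)
      then show ?thesis using e True by simp
    qed (simp add: e)
  qed simp
  also have "\<dots> = detS T X" unfolding detS_def using X by (intro perm_sub) auto
  finally show ?thesis .
qed

lemma fps_const_sum': "fps_const (\<Sum>i\<in>S. f i) = (\<Sum>i\<in>S. fps_const (f i))"
  by (induction S rule: infinite_finite_induct) (auto simp flip: fps_const_add)

lemma fps_const_prod': "fps_const (\<Prod>i\<in>S. f i) = (\<Prod>i\<in>S. fps_const (f i))"
  by (induction S rule: infinite_finite_induct) (auto simp flip: fps_const_mult)

text \<open>Each factor of a Leibniz product is split into its identity part and its part with
  \<open>T\<close>. If \<open>S\<close> is the set of rows contributing the latter, the permutation
  fixes all other rows, and the sum over it is the minor on \<open>S\<close>.\<close>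

lemma cc_expand:
  fixes T :: "nat \<Rightarrow> nat \<Rightarrow> 'a::comm_ring_1"
  shows "cc n T k = (-1) ^ k * (\<Sum>X | X \<subseteq> {0..<n} \<and> card X = k. detS T X)"
proof -
  let ?A = "{0..<n}"
  let ?f = "\<lambda>p i. - (fps_X * fps_const (T i (p i)))"
  have "det (cmat n T) = (\<Sum>p | p permutes ?A. signof p * (\<Prod>i = 0..<n. cmat n T $$ (i, p i)))"
    by (rule det_def') (simp add: cmat_def)
  also have "\<dots> = (\<Sum>p | p permutes ?A. of_int (sign p) * (\<Sum>S\<in>Pow ?A. (\<Prod>i\<in>S. ?f p i) * of_bool (p permutes S)))"
  proof (rule sum.cong)
    fix p assume "p \<in> {p. p permutes ?A}"
    then have p: "p permutes ?A" by simp
    have "(\<Prod>i = 0..<n. cmat n T $$ (i, p i)) = (\<Prod>i\<in>?A. ?f p i + of_bool (i = p i))"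
      using permutes_in_image[OF p] by (intro prod.cong) (auto simp: cmat_def)
    also have "\<dots> = (\<Sum>S\<in>Pow ?A. (\<Prod>i\<in>S. ?f p i) * (\<Prod>i\<in>?A - S. of_bool (i = p i)))" by (rule prod_add) simp
    also have "\<dots> = (\<Sum>S\<in>Pow ?A. (\<Prod>i\<in>S. ?f p i) * of_bool (p permutes S))"
    proof (rule sum.cong)
      fix S assume "S \<in> Pow ?A"
      then show "(\<Prod>i\<in>S. ?f p i) * (\<Prod>i\<in>?A - S. of_bool (i = p i)) = (\<Prod>i\<in>S. ?f p i) * of_bool (p permutes S)"
        using fixes_iff_permutes[OF p, of S, where 'b = "'a fps"] by simp
    qed simp
    finally show "signof p * (\<Prod>i = 0..<n. cmat n T $$ (i, p i)) =
      of_int (sign p) * (\<Sum>S\<in>Pow ?A. (\<Prod>i\<in>S. ?f p i) * of_bool (p permutes S))" by simp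
  qed simp
  also have "\<dots> = (\<Sum>S\<in>Pow ?A. \<Sum>p | p permutes ?A. of_bool (p permutes S) * (of_int (sign p) * (\<Prod>i\<in>S. ?f p i)))"
    by (simp only: sum_distrib_left, subst sum.swap, intro sum.cong refl) (simp only: mult_ac)
  also have "\<dots> = (\<Sum>S\<in>Pow ?A. \<Sum>p | p permutes S. of_int (sign p) * (\<Prod>i\<in>S. ?f p i))"
    by (intro sum.cong refl perm_sub) auto
  also have "\<dots> = (\<Sum>S\<in>Pow ?A. fps_const ((-1) ^ card S * detS T S) * fps_X ^ card S)"
  proof (rule sum.cong)
    fix S assume "S \<in> Pow ?A"
    have "of_int (sign p) * (\<Prod>i\<in>S. ?f p i) =
       fps_const ((-1) ^ card S * (of_int (sign p) * (\<Prod>i\<in>S. T i (p i)))) * fps_X ^ card S" for p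
    proof -
      have "(\<Prod>i\<in>S. ?f p i) = (\<Prod>i\<in>S. (-1) * fps_X * fps_const (T i (p i)))" by simp
      also have "\<dots> = (-1) ^ card S * fps_X ^ card S * fps_const (\<Prod>i\<in>S. T i (p i))"
        by (simp only: prod.distrib prod_constant fps_const_prod')
      also have "(-1 :: 'a fps) ^ card S = fps_const ((-1) ^ card S)"
        by (simp only: fps_const_power[symmetric] fps_const_neg[symmetric] fps_const_1_eq_1)
      finally show ?thesis by (simp add: fps_of_int[symmetric] mult_ac flip: fps_const_mult)
    qed
    then show "(\<Sum>p | p permutes S. of_int (sign p) * (\<Prod>i\<in>S. ?f p i)) =
       fps_const ((-1) ^ card S * detS T S) * fps_X ^ card S"
      by (simp only: detS_def sum_distrib_left fps_const_sum' sum_distrib_right)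
  qed simp
  finally have "cc n T k = (\<Sum>S\<in>Pow ?A. fps_nth (fps_const ((-1) ^ card S * detS T S) * fps_X ^ card S) k)"
    by (simp add: cc_def fps_sum_nth)
  also have "\<dots> = (\<Sum>S\<in>Pow ?A. if card S = k then (-1) ^ k * detS T S else 0)"
    by (intro sum.cong) (auto simp: fps_X_power_mult_right_nth)
  also have "\<dots> = (\<Sum>S\<in>{S\<in>Pow ?A. card S = k}. (-1) ^ k * detS T S)"
    by (rule sum.inter_filter[symmetric]) simp
  also have "{S\<in>Pow ?A. card S = k} = {X. X \<subseteq> ?A \<and> card X = k}" by auto
  finally show ?thesis by (simp add: sum_distrib_left)
qed

lemma detS_of_int: "detS (\<lambda>i j. of_int (T i j)) X = (of_int (detS T X) :: 'a::comm_ring_1)"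
  by (simp add: detS_def)

section \<open>Principal minors of real skew-symmetric matrices\<close>

lemma detS_nonzero_iff:
  fixes T :: "nat \<Rightarrow> nat \<Rightarrow> real"
  assumes X: "X \<subseteq> {0..<n}"
  shows "detS T X \<noteq> 0 \<longleftrightarrow> nonsing T X"
proof -
  let ?M = "mat n n (\<lambda>(i, j). if i \<in> X \<and> j \<in> X then T i j else of_bool (i = j))"
  have M: "?M \<in> carrier_mat n n" by simp
  have row: "(?M *\<^sub>v v) $ i = (if i \<in> X then mv X T (\<lambda>j. v $ j) i else v $ i)"
    if "v \<in> carrier_vec n" "i < n" for v i
  proof -
    have "(?M *\<^sub>v v) $ i = (\<Sum>j = 0..<n. (if i \<in> X \<and> j \<in> X then T i j else of_bool (i = j)) * v $ j)"
      using that by (simp add: scalar_prod_def)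
    also have "\<dots> = (if i \<in> X then mv X T (\<lambda>j. v $ j) i else v $ i)"
    proof (cases "i \<in> X")
      case True
      have "(\<Sum>j = 0..<n. (if i \<in> X \<and> j \<in> X then T i j else of_bool (i = j)) * v $ j) = (\<Sum>j\<in>X. T i j * v $ j)"
        using X True by (intro sum.mono_neutral_cong_right) auto
      then show ?thesis using True by (simp add: mv_def)
    next
      case False
      have "(\<Sum>j = 0..<n. (if i \<in> X \<and> j \<in> X then T i j else of_bool (i = j)) * v $ j) = (\<Sum>j\<in>{i}. v $ j)"
        using that False by (intro sum.mono_neutral_cong_right) auto
      then show ?thesis using False by simp
    qed
    finally show ?thesis .
  qed
  have "detS T X = 0 \<longleftrightarrow> (\<exists>v. v \<in> carrier_vec n \<and> v \<noteq> 0\<^sub>v n \<and> ?M *\<^sub>v v = 0\<^sub>v n)"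
    using det_0_iff_vec_prod_zero_field[OF M] detS_mat[OF X, of T] by simp
  also have "\<dots> \<longleftrightarrow> \<not> nonsing T X"
  proof
    assume "\<exists>v. v \<in> carrier_vec n \<and> v \<noteq> 0\<^sub>v n \<and> ?M *\<^sub>v v = 0\<^sub>v n"
    then obtain v where v: "v \<in> carrier_vec n" "v \<noteq> 0\<^sub>v n" "?M *\<^sub>v v = 0\<^sub>v n" by blast
    have z: "(if i \<in> X then mv X T (\<lambda>j. v $ j) i else v $ i) = 0" if "i < n" for i
      using row[OF v(1) that] v(3) that by simp
    show "\<not> nonsing T X"
    proof
      assume ns: "nonsing T X"
      have "\<forall>i\<in>X. mv X T (\<lambda>j. v $ j) i = 0" using z X by (metis atLeastLessThan_iff subsetD)
      then have "\<forall>i\<in>X. v $ i = 0" using ns unfolding nonsing_def by blast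
      then have "v $ i = 0" if "i < n" for i using z[OF that] by metis
      then have "v = 0\<^sub>v n" using v(1) by (intro eq_vecI) auto
      then show False using v(2) by simp
    qed
  next
    assume "\<not> nonsing T X"
    then obtain y i0 where y: "\<forall>i\<in>X. mv X T y i = 0" "i0 \<in> X" "y i0 \<noteq> 0" unfolding nonsing_def by blast
    define v where "v = vec n (\<lambda>i. if i \<in> X then y i else 0)"
    have vc: "v \<in> carrier_vec n" by (simp add: v_def)
    have "mv X T (\<lambda>j. v $ j) i = mv X T y i" for i
      unfolding mv_def using X by (intro sum.cong) (auto simp: v_def)
    then have "?M *\<^sub>v v = 0\<^sub>v n" using row[OF vc] y(1) by (intro eq_vecI) (auto simp: v_def)
    moreover have "v \<noteq> 0\<^sub>v n" using y X by (auto simp: v_def dest!: arg_cong[of _ _ "\<lambda>v. v $ i0"])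
    ultimately show "\<exists>v. v \<in> carrier_vec n \<and> v \<noteq> 0\<^sub>v n \<and> ?M *\<^sub>v v = 0\<^sub>v n" using vc by blast
  qed
  finally show ?thesis by blast
qed

text \<open>On the segment from the identity to \<open>T\<close> the form is \<open>(1 - s)\<close>
  times the squared norm, so the determinant has no zero for \<open>s < 1\<close> and cannot become
  negative. This takes the place of the square of the Pfaffian.\<close>

lemma detS_skew_nonneg:
  fixes T :: "nat \<Rightarrow> nat \<Rightarrow> real"
  assumes X: "X \<subseteq> {0..<n}" and skew: "\<And>i j. T i j = - T j i"
  shows "0 \<le> detS T X"
proof (rule ccontr)
  assume neg: "\<not> 0 \<le> detS T X"
  define B where "B s i j = s * T i j + (1 - s) * of_bool (i = j)" for s i j
  define f where "f s = detS (B s) X" for s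
  have cont: "continuous_on {0..1} f" unfolding f_def detS_def B_def
    by (intro continuous_intros)
  have f1: "f 1 = detS T X"
    unfolding f_def detS_def B_def by simp
  have "detS (B 0) X = det (1\<^sub>m n :: real mat)"
    by (subst detS_mat[OF X, symmetric], rule arg_cong[of _ _ det]) (auto simp: B_def)
  then have f0: "f 0 = 1" by (simp add: f_def)
  obtain s where s: "0 \<le> s" "s \<le> 1" "f s = 0"
    using IVT2'[of f 1 0 0] f0 f1 neg cont by auto
  have "s \<noteq> 1" using s neg f1 by auto
  have "nonsing (B s) X"
    unfolding nonsing_def
  proof (intro allI impI)
    fix y assume y: "\<forall>i\<in>X. mv X (B s) y i = 0"
    have finX: "finite X" using X finite_subset by blast
    interpret S: skew X T using finX skew by unfold_locales
    have "mv X (B s) y i = s * mv X T y i + (1 - s) * y i" if "i \<in> X" for i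
    proof -
      have "mv X (B s) y i = (\<Sum>j\<in>X. s * (T i j * y j) + (if j = i then (1 - s) * y i else 0))"
        unfolding mv_def using that by (intro sum.cong) (auto simp: B_def algebra_simps)
      then show ?thesis using that finX by (simp add: sum.distrib sum.delta mv_def sum_distrib_left)
    qed
    then have "0 = (\<Sum>i\<in>X. y i * (s * mv X T y i + (1 - s) * y i))" using y by simp
    also have "\<dots> = s * (\<Sum>i\<in>X. y i * mv X T y i) + (1 - s) * (\<Sum>i\<in>X. (y i)\<^sup>2)"
      by (simp add: sum.distrib sum_subtractf sum_distrib_left algebra_simps power2_eq_square)
    finally have "(\<Sum>i\<in>X. (y i)\<^sup>2) = 0" using S.dot_self[of y] \<open>s \<noteq> 1\<close> by simp
    then show "\<forall>i\<in>X. y i = 0" using finX by (simp add: sum_nonneg_eq_0_iff)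
  qed
  then show False using detS_nonzero_iff[OF X, of "B s"] s(3) by (simp add: f_def)
qed

text \<open>All principal minors are nonnegative, so their sum vanishes only if each of them does;
  the sign in \<open>cc_expand\<close> is common to all.\<close>

theorem cc_nonzero_iff:
  fixes T :: "nat \<Rightarrow> nat \<Rightarrow> int"
  assumes skew: "\<And>i j. T i j = - T j i"
  shows "cc n T k \<noteq> 0 \<longleftrightarrow> (\<exists>X \<subseteq> {0..<n}. card X = k \<and> nonsing (\<lambda>i j. real_of_int (T i j)) X)"
proof -
  let ?R = "\<lambda>i j. real_of_int (T i j)"
  let ?S = "{X. X \<subseteq> {0..<n} \<and> card X = k}"
  have fin: "finite ?S" by (rule finite_subset[of _ "Pow {0..<n}"]) auto
  have nn: "0 \<le> detS ?R X" if "X \<in> ?S" for X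
  proof (rule detS_skew_nonneg)
    show "X \<subseteq> {0..<n}" using that by simp
    show "?R i j = - ?R j i" for i j by (subst skew) simp
  qed
  have "cc n T k \<noteq> 0 \<longleftrightarrow> (\<Sum>X\<in>?S. detS T X) \<noteq> 0" unfolding cc_expand by simp
  also have "\<dots> \<longleftrightarrow> real_of_int (\<Sum>X\<in>?S. detS T X) \<noteq> 0" by (simp only: of_int_eq_0_iff)
  also have "real_of_int (\<Sum>X\<in>?S. detS T X) = (\<Sum>X\<in>?S. detS ?R X)"
    using detS_of_int[where 'a = real] by simp
  also have "\<dots> \<noteq> 0 \<longleftrightarrow> (\<exists>X\<in>?S. detS ?R X \<noteq> 0)"
    using sum_nonneg_eq_0_iff[OF fin, of "detS ?R"] nn by blast
  also have "\<dots> \<longleftrightarrow> (\<exists>X\<in>?S. nonsing ?R X)" using detS_nonzero_iff[of _ n ?R] by auto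
  finally show ?thesis by auto
qed

text \<open>Every product in a minor of size \<open>k\<close> has \<open>k\<close> factors, each of
  degree at most 1 in \<open>a\<close>.\<close>

lemma cc_poly:
  fixes b c :: "nat \<Rightarrow> nat \<Rightarrow> int"
  shows "\<exists>p :: int poly. degree p \<le> k \<and> (\<forall>a. poly p a = cc n (\<lambda>i j. b i j + a * c i j) k)"
proof -
  let ?S = "{X. X \<subseteq> {0..<n} \<and> card X = k}"
  define p where "p = [:(-1) ^ k:] * (\<Sum>X\<in>?S. \<Sum>q | q permutes X. [:of_int (sign q):] * (\<Prod>i\<in>X. [:b i (q i), c i (q i):]))"
  have fin: "finite ?S" by (rule finite_subset[of _ "Pow {0..<n}"]) auto
  have "degree (\<Prod>i\<in>X. [:b i (q i), c i (q i):]) \<le> k" if "X \<in> ?S" for X q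
  proof -
    have "finite X" using that finite_subset by blast
    then have "degree (\<Prod>i\<in>X. [:b i (q i), c i (q i):]) \<le> sum (degree \<circ> (\<lambda>i. [:b i (q i), c i (q i):])) X"
      by (rule degree_prod_sum_le)
    also have "\<dots> \<le> sum (\<lambda>_. 1) X" by (intro sum_mono) (auto simp: degree_pCons_le)
    finally show ?thesis using that by simp
  qed
  then have "degree p \<le> k" unfolding p_def
    by (intro order_trans[OF degree_mult_le] degree_sum_le[OF fin] add_le_same_cancel1[THEN iffD2])
       (auto intro!: degree_sum_le order_trans[OF degree_mult_le] simp: finite_permutations finite_subset)
  moreover have "poly p a = cc n (\<lambda>i j. b i j + a * c i j) k" for a
    unfolding p_def cc_expand detS_def by (simp add: poly_sum poly_prod)
  ultimately show ?thesis by blast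
qed

subsection \<open>Path recursion for the coefficients\<close>

context
  fixes n :: nat and A :: "nat \<Rightarrow> nat \<Rightarrow> int"
begin

definition lead :: "nat \<Rightarrow> nat \<Rightarrow> nat \<Rightarrow> int" where
  "lead m i j = (if i < m \<and> j < m then A i j else 0)"

text \<open>The total weight of the walks from \<open>i\<close> to \<open>m\<close> with
  \<open>k + 1\<close> edges and all intermediate vertices below \<open>m\<close>.\<close>

primrec wlk :: "nat \<Rightarrow> nat \<Rightarrow> nat \<Rightarrow> int" where
  "wlk m 0 i = A i m"
| "wlk m (Suc k) i = (\<Sum>j<m. A i j * wlk m k j)"

definition wf :: "nat \<Rightarrow> nat \<Rightarrow> int fps" where
  "wf m i = Abs_fps (\<lambda>k. if k = 0 then 0 else wlk m (k - 1) i)"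

text \<open>The walks from \<open>r\<close> to \<open>m\<close> are split according to their first
  edge.\<close>

lemma wf_eq: "fps_X * fps_const (A r m) + fps_X * (\<Sum>i<m. fps_const (A r i) * wf m i) = wf m r"
proof (rule fps_ext)
  fix k
  show "fps_nth (fps_X * fps_const (A r m) + fps_X * (\<Sum>i<m. fps_const (A r i) * wf m i)) k = fps_nth (wf m r) k"
  proof (cases k)
    case (Suc k')
    then show ?thesis by (cases k') (auto simp: wf_def fps_sum_nth)
  qed (simp add: wf_def)
qed

text \<open>Schur complement: adding suitable multiples of the first \<open>m\<close> columns clears column \<open>m\<close>
  except for its diagonal entry.\<close>

lemma det_lead_Suc:
  assumes m: "m < n"
  shows "det (cmat n (lead (Suc m))) = det (cmat n (lead m)) * (1 - wf m m)"
proof -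
  let ?N = "cmat n (lead (Suc m))" and ?M = "cmat n (lead m)"
  \<comment> \<open>A unipotent column operation, which leaves the determinant unchanged.\<close>
  define P where "P = mat n n (\<lambda>(i, j). if i = j then 1 else if j = m \<and> i < m then wf m i else 0)"
  define Q where "Q = ?N * P"
  have N: "?N \<in> carrier_mat n n" and M: "?M \<in> carrier_mat n n" and P: "P \<in> carrier_mat n n"
    by (auto simp: cmat_def P_def)
  have Q: "Q \<in> carrier_mat n n" using N P by (simp add: Q_def)
  have "det P = prod_list (diag_mat P)"
    by (rule det_upper_triangular[OF _ P]) (auto simp: P_def upper_triangular_def)
  also have "diag_mat P = map (\<lambda>i. 1) [0..<n]" by (auto simp: diag_mat_def P_def)
  also have "prod_list (map (\<lambda>i. 1) [0..<n]) = (1 :: int fps)" by (induction n) auto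
  finally have detQ: "det Q = det ?N" using det_mult[OF N P] by (simp add: Q_def)
  have Qe: "Q $$ (r, j) = (\<Sum>i = 0..<n. ?N $$ (r, i) * P $$ (i, j))" if "r < n" "j < n" for r j
    using that N P by (simp add: Q_def scalar_prod_def)
  have Qj: "Q $$ (r, j) = ?N $$ (r, j)" if "r < n" "j < n" "j \<noteq> m" for r j
  proof -
    have "Q $$ (r, j) = (\<Sum>i = 0..<n. if i = j then ?N $$ (r, j) else 0)"
      unfolding Qe[OF that(1,2)] using that by (intro sum.cong) (auto simp: P_def)
    then show ?thesis using that by (simp add: sum.delta)
  qed
  have Qm: "Q $$ (r, m) = (if r = m then 1 - wf m m else 0)" if r: "r < n" for r
  proof -
    have "Q $$ (r, m) = (\<Sum>i = 0..<n. (if i = m then ?N $$ (r, m) else 0) + (if i < m then ?N $$ (r, i) * wf m i else 0))"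
      unfolding Qe[OF r m] using m by (intro sum.cong) (auto simp: P_def)
    also have "\<dots> = ?N $$ (r, m) + (\<Sum>i = 0..<n. if i < m then ?N $$ (r, i) * wf m i else 0)"
      using m by (simp add: sum.distrib sum.delta)
    also have "(\<Sum>i = 0..<n. if i < m then ?N $$ (r, i) * wf m i else 0) = (\<Sum>i<m. ?N $$ (r, i) * wf m i)"
      using m by (intro sum.mono_neutral_cong_right) auto
    finally have q: "Q $$ (r, m) = ?N $$ (r, m) + (\<Sum>i<m. ?N $$ (r, i) * wf m i)" .
    show ?thesis
    proof (cases "r \<le> m")
      case False
      then have "?N $$ (r, m) = 0" "?N $$ (r, i) = 0" if "i < m" for i
        using r m that by (auto simp: cmat_def lead_def)
      then show ?thesis using False q r m by (cases "m = 0") (auto simp: cmat_def lead_def)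
    next
      case True
      have "(\<Sum>i<m. ?N $$ (r, i) * wf m i) = (\<Sum>i<m. (if i = r then wf m r else 0) - fps_X * (fps_const (A r i) * wf m i))"
        using True r m by (intro sum.cong) (auto simp: cmat_def lead_def algebra_simps)
      also have "\<dots> = (if r < m then wf m r else 0) - fps_X * (\<Sum>i<m. fps_const (A r i) * wf m i)"
        by (simp add: sum_subtractf sum.delta sum_distrib_left)
      finally have s: "(\<Sum>i<m. ?N $$ (r, i) * wf m i) = (if r < m then wf m r else 0) - fps_X * (\<Sum>i<m. fps_const (A r i) * wf m i)" .
      have "?N $$ (r, m) = of_bool (r = m) - fps_X * fps_const (A r m)" using True r m by (auto simp: cmat_def lead_def)
      then have "Q $$ (r, m) = of_bool (r = m) + (if r < m then wf m r else 0) - wf m r"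
        unfolding q s wf_eq[of r m, symmetric] by simp
      then show ?thesis using True by auto
    qed
  qed
  have "det Q = (\<Sum>i<n. Q $$ (i, m) * cofactor Q i m)" by (rule laplace_expansion_column[OF Q m])
  also have "\<dots> = (\<Sum>i<n. if i = m then (1 - wf m m) * cofactor Q m m else 0)"
    using Qm by (intro sum.cong) auto
  finally have dQ: "det Q = (1 - wf m m) * cofactor Q m m" using m by (simp add: sum.delta)
  have "det ?M = (\<Sum>i<n. ?M $$ (i, m) * cofactor ?M i m)" by (rule laplace_expansion_column[OF M m])
  also have "\<dots> = (\<Sum>i<n. if i = m then cofactor ?M m m else 0)"
    using m by (intro sum.cong) (auto simp: cmat_def lead_def)
  finally have dM: "det ?M = cofactor ?M m m" using m by (simp add: sum.delta)
  \<comment> \<open>Away from row and column \<open>m\<close> the passage from \<open>lead m\<close>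
    to \<open>lead (Suc m)\<close> changes nothing, and neither does \<open>P\<close>.\<close>
  have "mat_delete Q m m = mat_delete ?M m m"
  proof (rule eq_matI)
    fix i j assume "i < dim_row (mat_delete ?M m m)" "j < dim_col (mat_delete ?M m m)"
    then have ij: "i < n - 1" "j < n - 1" by (auto simp: mat_delete_def cmat_def)
    define i' where "i' = (if i < m then i else Suc i)"
    define j' where "j' = (if j < m then j else Suc j)"
    have r: "i' < n" "j' < n" "i' \<noteq> m" "j' \<noteq> m" using ij by (auto simp: i'_def j'_def)
    have "mat_delete Q m m $$ (i, j) = Q $$ (i', j')" "mat_delete ?M m m $$ (i, j) = ?M $$ (i', j')"
      using ij Q M by (auto simp: mat_delete_def i'_def j'_def)
    then show "mat_delete Q m m $$ (i, j) = mat_delete ?M m m $$ (i, j)"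
      using Qj[OF r(1,2,4)] r by (auto simp: cmat_def lead_def)
  qed (use Q M in \<open>auto simp: mat_delete_def\<close>)
  then have "cofactor Q m m = cofactor ?M m m" by (simp add: cofactor_def)
  then show ?thesis using dQ dM detQ by simp
qed

definition pe :: "nat \<Rightarrow> nat \<Rightarrow> int" where
  "pe h l = fps_nth (det (cmat n (lead h))) l"

text \<open>Minus the coefficient of \<open>y ^ l\<close> in the product of the walks from
  \<open>u\<close> to \<open>h\<close> with \<open>det (I - y A)\<close> for the leading part of
  size \<open>h\<close>: a closed walk through \<open>h\<close> that has advanced to
  \<open>u\<close> and is still to be completed.\<close>

definition pf :: "nat \<Rightarrow> nat \<Rightarrow> nat \<Rightarrow> int" where
  "pf h u l = - (\<Sum>k<l. wlk h k u * pe h (l - 1 - k))"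

lemma pe_0: "pe 0 l = of_bool (l = 0)"
proof -
  have "cmat n (lead 0) = 1\<^sub>m n" by (auto simp: cmat_def lead_def)
  then show ?thesis by (simp add: pe_def)
qed

lemma pe_n: "pe n l = cc n A l"
proof -
  have "cmat n (lead n) = cmat n A" by (auto simp: cmat_def lead_def)
  then show ?thesis by (simp add: pe_def cc_def)
qed

lemma pf_0: "pf h u 0 = 0"
  by (simp add: pf_def)

text \<open>The next edge either returns to \<open>h\<close>, leaving a smaller determinant, or
  leads to another vertex below \<open>h\<close>. Each coefficient becomes a linear combination of
  coefficients of lower index, as a path recursion requires.\<close>

lemma pf_Suc: "pf h u (Suc l) = - A u h * pe h l + (\<Sum>u'<h. A u u' * pf h u' l)"
proof -
  have "(\<Sum>k<Suc l. wlk h k u * pe h (Suc l - 1 - k)) =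
     A u h * pe h l + (\<Sum>k<l. (\<Sum>j<h. A u j * wlk h k j) * pe h (l - 1 - k))"
    by (subst sum.lessThan_Suc_shift) simp
  also have "(\<Sum>k<l. (\<Sum>j<h. A u j * wlk h k j) * pe h (l - 1 - k)) = (\<Sum>j<h. A u j * (\<Sum>k<l. wlk h k j * pe h (l - 1 - k)))"
    by (simp add: sum_distrib_left sum_distrib_right mult.assoc, subst sum.swap) simp
  finally show ?thesis by (simp add: pf_def sum_negf)
qed

lemma pe_Suc: "h < n \<Longrightarrow> pe (Suc h) l = pe h l + pf h h l"
proof -
  assume h: "h < n"
  let ?d = "det (cmat n (lead h))"
  have "pe (Suc h) l = fps_nth ?d l - fps_nth (?d * wf h h) l"
    by (simp add: pe_def det_lead_Suc[OF h] algebra_simps)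
  also have "fps_nth (?d * wf h h) l = (\<Sum>i = 0..l. fps_nth ?d i * fps_nth (wf h h) (l - i))" by (rule fps_mult_nth)
  also have "\<dots> = (\<Sum>i<l. pe h i * wlk h (l - i - 1) h)"
    by (intro sum.mono_neutral_cong_right) (auto simp: wf_def pe_def)
  also have "\<dots> = (\<Sum>k<l. wlk h k h * pe h (l - 1 - k))"
    by (rule sum.reindex_bij_witness[of _ "\<lambda>k. l - 1 - k" "\<lambda>k. l - 1 - k"]) (auto simp: mult.commute)
  finally show ?thesis by (simp add: pf_def pe_def)
qed

end

section \<open>Repeated squaring of an acyclic matrix\<close>

definition mm :: "nat \<Rightarrow> (nat \<Rightarrow> nat \<Rightarrow> int) \<Rightarrow> (nat \<Rightarrow> nat \<Rightarrow> int) \<Rightarrow> nat \<Rightarrow> nat \<Rightarrow> int" where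
  "mm N A B i j = (\<Sum>t<N. A i t * B t j)"

primrec mp :: "nat \<Rightarrow> (nat \<Rightarrow> nat \<Rightarrow> int) \<Rightarrow> nat \<Rightarrow> nat \<Rightarrow> nat \<Rightarrow> int" where
  "mp N A 0 = A"
| "mp N A (Suc k) = mm N (mp N A k) (mp N A k)"

text \<open>\<open>val\<close> is fixed by \<open>A\<close>, hence by all its powers. Off the sink
  \<open>t\<close> each factor lowers the rank, so an entry of a high power can be nonzero only in
  column \<open>t\<close>, and this entry alone must account for \<open>val i\<close>.\<close>

lemma mp_dag:
  fixes val :: "nat \<Rightarrow> int" and rk :: "nat \<Rightarrow> nat"
  assumes val: "\<And>i. i < N \<Longrightarrow> val i = (\<Sum>j<N. A i j * val j)"
    and t: "t < N" "val t = 1" "rk t = 0"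
    and dag: "\<And>i j. i < N \<Longrightarrow> j < N \<Longrightarrow> j \<noteq> t \<Longrightarrow> A i j \<noteq> 0 \<Longrightarrow> rk j < rk i"
    and i: "i < N" "rk i < 2 ^ k"
  shows "mp N A k i t = val i"
proof -
  have 1: "(\<Sum>j<N. mp N A k i j * val j) = val i" if "i < N" for i k
    using that
  proof (induction k arbitrary: i)
    case (Suc k)
    have "(\<Sum>j<N. mp N A (Suc k) i j * val j) = (\<Sum>s<N. mp N A k i s * (\<Sum>j<N. mp N A k s j * val j))"
      by (simp add: mm_def sum_distrib_left sum_distrib_right mult.assoc, subst sum.swap) simp
    also have "\<dots> = (\<Sum>s<N. mp N A k i s * val s)" using Suc.IH by (intro sum.cong) auto
    finally show ?case using Suc by simp
  qed (use val in simp)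
  have 2: "rk j + 2 ^ k \<le> rk i" if "i < N" "j < N" "j \<noteq> t" "mp N A k i j \<noteq> 0" for i j k
    using that
  proof (induction k arbitrary: i j)
    case 0
    then show ?case using dag[of i j] by simp
  next
    case (Suc k)
    have "\<exists>s<N. mp N A k i s * mp N A k s j \<noteq> 0"
    proof (rule ccontr)
      assume "\<not> ?thesis"
      then have "(\<Sum>s<N. mp N A k i s * mp N A k s j) = 0" by (intro sum.neutral) auto
      then show False using Suc.prems(4) by (simp add: mm_def)
    qed
    then obtain s where s: "s < N" "mp N A k i s \<noteq> 0" "mp N A k s j \<noteq> 0" by auto
    have a: "rk j + 2 ^ k \<le> rk s" using Suc.IH[of s j] s Suc.prems by simp
    \<comment> \<open>The sink has rank 0, so from \<open>t\<close> only \<open>t\<close> itself can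
      be reached.\<close>
    have "s \<noteq> t"
    proof
      assume "s = t"
      then have "rk j + 2 ^ k \<le> 0" using a t(3) by simp
      then show False by simp
    qed
    then have "rk s + 2 ^ k \<le> rk i" using Suc.IH[of i s] s Suc.prems by simp
    then show ?case using a by simp
  qed
  have "mp N A k i j = 0" if "j < N" "j \<noteq> t" for j using 2[OF i(1) that] i(2) by fastforce
  then have "(\<Sum>j<N. mp N A k i j * val j) = (\<Sum>j\<in>{t}. mp N A k i j * val j)"
    using t by (intro sum.mono_neutral_right) auto
  then show ?thesis using 1[OF i(1), of k] t by simp
qed

text \<open>The factor \<open>N\<close> makes the bound submultiplicative: the \<open>N\<close>
  summands of a product entry are paid for by one of the two factors.\<close>

lemma mp_bound:
  assumes A: "\<And>i j. i < N \<Longrightarrow> j < N \<Longrightarrow> \<bar>A i j\<bar> \<le> b" and "i < N" "j < N"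
  shows "int N * \<bar>mp N A k i j\<bar> \<le> (int N * b) ^ 2 ^ k"
  using assms(2,3)
proof (induction k arbitrary: i j)
  case 0
  then show ?case using A by (simp add: mult_left_mono)
next
  case (Suc k)
  let ?c = "(int N * b) ^ 2 ^ k"
  have b0: "0 \<le> b" using A[OF Suc.prems] by linarith
  have "int N * \<bar>mp N A (Suc k) i j\<bar> \<le> int N * (\<Sum>s<N. \<bar>mp N A k i s\<bar> * \<bar>mp N A k s j\<bar>)"
    by (intro mult_left_mono) (auto simp: mm_def abs_mult[symmetric])
  also have "\<dots> = (\<Sum>s<N. (int N * \<bar>mp N A k i s\<bar>) * \<bar>mp N A k s j\<bar>)"
    by (simp add: sum_distrib_left mult.assoc)
  also have "\<dots> \<le> (\<Sum>s<N. ?c * \<bar>mp N A k s j\<bar>)"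
    using Suc by (intro sum_mono mult_right_mono) auto
  also have "\<dots> = ?c * (\<Sum>s<N. \<bar>mp N A k s j\<bar>)" by (simp add: sum_distrib_left)
  also have "\<dots> \<le> ?c * ?c"
  proof (rule mult_left_mono)
    have N: "0 < int N" using Suc.prems by simp
    have "int N * (\<Sum>s<N. \<bar>mp N A k s j\<bar>) = (\<Sum>s<N. int N * \<bar>mp N A k s j\<bar>)" by (simp add: sum_distrib_left)
    also have "\<dots> \<le> (\<Sum>s<N. ?c)" using Suc by (intro sum_mono) auto
    also have "\<dots> = int N * ?c" by simp
    finally show "(\<Sum>s<N. \<bar>mp N A k s j\<bar>) \<le> ?c" using N by simp
  qed (use b0 in simp)
  finally show ?case by (simp add: power_add[symmetric] mult_2)
qed

section \<open>Catalytic registers\<close>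

definition callr :: "nat \<Rightarrow> bool list \<Rightarrow> cmd \<Rightarrow> nat list \<Rightarrow> bool list \<times> bool list \<Rightarrow> nat \<times> bool list \<times> bool list" where
  "callr W x P args c = (fst (sem W x P (0 # args, c)) ! 0, snd (sem W x P (0 # args, c)))"

lemma sem_call: "sem W x (CCall r es P) (env, c) =
   (env[r := fst (callr W x P (map (\<lambda>e. eval W x e env (fst c)) es) c)],
    snd (callr W x P (map (\<lambda>e. eval W x e env (fst c)) es) c))"
  by (simp add: callr_def Let_def)

lemma loop_eq: "g 0 = s \<Longrightarrow> (\<And>k. k < m \<Longrightarrow> f k (g k) = g (Suc k)) \<Longrightarrow> loop f m s = g m"
  by (induction m) auto

lemma sem_for:
  assumes "eval W x e env (fst c) = m" "g 0 = (env, c)"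
    and "\<And>k. k < m \<Longrightarrow> pop (sem W x b (push k (g k))) = g (Suc k)"
  shows "sem W x (CFor e b) (env, c) = g m"
  using loop_eq[of g "(env, c)" m "\<lambda>k s. pop (sem W x b (push k s))"] assms by simp

lemma push_simp: "push k (env, c) = (env @ [k], c)"
  by (simp add: push_def)

lemma pop_simp: "pop (env, c) = (butlast env, c)"
  by (simp add: pop_def)

declare sem.simps(3,7,8) [simp del]

definition adrE :: "exp \<Rightarrow> exp \<Rightarrow> exp \<Rightarrow> exp \<Rightarrow> exp \<Rightarrow> exp" where
  "adrE w k i j b = EAdd (EMul (EAdd (EMul (EAdd (EMul (EAdd (EMul w (EV 3)) k) (EV 3)) i) (EV 3)) j) (EV 3)) b"

text \<open>Calling convention: slots 1 to 8 of every frame hold the parameters \<open>n, B, G, N, q, TQ, l, E8\<close>, the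
  proper arguments start at slot 9. Calls for effect only store their result in the nonexistent slot 99.\<close>

definition PRE :: "exp list" where
  "PRE = map EV [1, 2, 3, 4, 5, 6, 7, 8]"

text \<open>Origin of the constants. Coordinates stay below \<open>B\<close>, and
  \<open>N = B ^ 3\<close> counts the triples of the path recursion. The entries of the
  \<open>2 ^ l\<close>-th power have fewer than \<open>52 * B ^ 2\<close> bits, which
  \<open>G = B ^ 8\<close> exceeds. \<open>TQ\<close> is the first power of two from
  \<open>B * N * N\<close> on, and \<open>2 ^ l\<close> exceeds every rank \<open>n + k\<close> of
  the recursion. \<open>E8\<close> is the number of clock ticks. Addresses stay below
  \<open>3 * G ^ 4\<close>, at most \<open>B ^ 34\<close>, which the word size has to
  exceed.\<close>

locale prm =
  fixes W :: nat and x :: "bool list" and n B G N q TQ l E8 :: nat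
  assumes B: "B = length x + 2" and nB: "n * n \<le> length x"
    and N: "N = B ^ 3" and G: "G = B ^ 8"
    and TQ: "TQ = 2 ^ q" "B ^ 7 \<le> TQ" "TQ \<le> 2 * B ^ 7"
    and l: "2 * B \<le> 2 ^ l" "2 ^ l \<le> 4 * B" and E8: "E8 = 8 ^ l"
    and W: "B ^ 40 \<le> W"
begin

abbreviation fr :: "nat \<Rightarrow> nat list \<Rightarrow> nat list" where
  "fr r args \<equiv> r # n # B # G # N # q # TQ # l # E8 # args"

abbreviation pre :: "nat list" where
  "pre \<equiv> [n, B, G, N, q, TQ, l, E8]"

definition adr :: "nat \<Rightarrow> nat \<Rightarrow> nat \<Rightarrow> nat \<Rightarrow> nat \<Rightarrow> nat" where
  "adr w k i j b = (((w * G + k) * G + i) * G + j) * G + b"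

lemma B2: "2 \<le> B" using B by simp

lemma Bpow: "i \<le> j \<Longrightarrow> B ^ i \<le> B ^ j" using B2 by (intro power_increasing) auto

lemma n_less: "n < B"
proof -
  have "n \<le> n * n" by simp
  then show ?thesis using nB B by linarith
qed

lemma WB: "k < 40 \<Longrightarrow> a < B ^ k \<Longrightarrow> a < W"
  using Bpow[of k 40] W by linarith

lemma W_big: "1000 < W"
proof -
  have "(2::nat) ^ 10 \<le> B ^ 10" using B2 by (intro power_mono) auto
  also have "\<dots> < B ^ 11" using B2 by (intro power_strict_increasing) auto
  finally show ?thesis using WB[of 11 1000] by simp
qed

lemma modW [simp]: "0 mod W = 0" "Suc 0 mod W = 1" "1 mod W = 1" "2 mod W = 2" "4 mod W = 4" "8 mod W = 8"
  using W_big by auto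

lemma small: "n < W" "B < W" "G < W" "N < W" "TQ < W" "E8 < W"
proof -
  have B1: "B ^ i < B ^ Suc i" for i using B2 by simp
  have "B < B ^ 2" using B2 by (simp add: power2_eq_square)
  then show b: "B < W" using WB[of 2 B] by simp
  show "n < W" using n_less b by simp
  show "G < W" using WB[of 9 G] B1[of 8] by (simp add: G)
  show "N < W" using WB[of 4 N] B1[of 3] by (simp add: N)
  have "2 * B ^ 7 \<le> B * B ^ 7" using B2 by (intro mult_right_mono) auto
  then have "TQ \<le> B ^ 8" using TQ(3) by (simp add: eval_nat_numeral)
  then show "TQ < W" using WB[of 9 TQ] B1[of 8] by simp
  have "(8::nat) ^ l = (2 ^ 3) ^ l" by simp
  also have "\<dots> = (2 ^ l) ^ 3" by (simp only: power_mult[symmetric] mult.commute)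
  finally have "E8 = (2 ^ l) ^ 3" by (simp add: E8)
  also have "\<dots> \<le> (4 * B) ^ 3" using l(2) by (intro power_mono) auto
  also have "\<dots> = 2 ^ 6 * B ^ 3" by (simp add: power_mult_distrib)
  also have "\<dots> \<le> B ^ 6 * B ^ 3" using B2 by (intro mult_right_mono power_mono) auto
  also have "\<dots> = B ^ 9" by (simp flip: power_add)
  finally show "E8 < W" using WB[of 10 E8] B1[of 9] by simp
qed

lemma ql: "q < W" "l < G" "l < W"
proof -
  have "q < 2 ^ q" by (rule less_exp)
  then show "q < W" using small(5) TQ(1) by linarith
  have "l < 2 ^ l" by (rule less_exp)
  then have "l < 4 * B" using l(2) by linarith
  also have "4 * B = 2 ^ 2 * B" by simp
  also have "\<dots> \<le> B ^ 2 * B" using B2 by (intro mult_right_mono power_mono) auto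
  also have "\<dots> = B ^ 3" by (simp add: eval_nat_numeral)
  also have "\<dots> \<le> B ^ 8" by (rule Bpow) simp
  finally show "l < G" by (simp add: G)
  then show "l < W" using small by linarith
qed

lemma G3: "G ^ 4 * 3 < W" "0 < G" "N \<le> G"
proof -
  have "(3::nat) \<le> 2 ^ 2" by simp
  also have "\<dots> \<le> B ^ 2" using B2 by (intro power_mono) auto
  finally have "G ^ 4 * 3 \<le> B ^ 32 * B ^ 2" unfolding G by (intro mult_mono) (auto simp flip: power_mult)
  also have "\<dots> = B ^ 34" by (simp flip: power_add)
  also have "\<dots> < B ^ 35" using B2 by (intro power_strict_increasing) auto
  finally show "G ^ 4 * 3 < W" using WB[of 35] by simp
  show "0 < G" using B2 by (simp add: G)
  show "N \<le> G" unfolding N G by (rule Bpow) simp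
qed

lemma digit_bound: "a < A \<Longrightarrow> b < G \<Longrightarrow> a * G + b < A * G"
proof -
  assume "a < A" "b < G"
  then have "a * G + b < (a + 1) * G" by simp
  also have "\<dots> \<le> A * G" using \<open>a < A\<close> by (intro mult_right_mono) auto
  finally show ?thesis .
qed

lemma adr_less: "w < 3 \<Longrightarrow> k < G \<Longrightarrow> i < G \<Longrightarrow> j < G \<Longrightarrow> b < G \<Longrightarrow> adr w k i j b < 3 * G ^ 4"
proof -
  assume a: "w < 3" "k < G" "i < G" "j < G" "b < G"
  have e: "3 * G ^ 4 = 3 * G * G * G * G" by (simp only: power4_eq_xxxx mult.assoc)
  show ?thesis unfolding adr_def e using a by (intro digit_bound)
qed

text \<open>The word arithmetic of the address does not overflow, since the exact value is below
  \<open>3 * G ^ 4\<close>.\<close>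

lemma eval_adr:
  assumes "eval W x (EV 3) env C = G" "eval W x ew env C < 3" "eval W x ek env C < G" "eval W x ei env C < G"
    "eval W x ej env C < G" "eval W x eb env C < G"
  shows "eval W x (adrE ew ek ei ej eb) env C =
    adr (eval W x ew env C) (eval W x ek env C) (eval W x ei env C) (eval W x ej env C) (eval W x eb env C)"
proof -
  have "adr (eval W x ew env C) (eval W x ek env C) (eval W x ei env C) (eval W x ej env C) (eval W x eb env C) < W"
    using adr_less[OF assms(2-6)] G3 by simp
  moreover have "eval W x (adrE ew ek ei ej eb) env C =
    adr (eval W x ew env C) (eval W x ek env C) (eval W x ei env C) (eval W x ej env C) (eval W x eb env C) mod W"
    unfolding adrE_def eval.simps(4,5) assms(1) adr_def by (simp only: mod_simps)
  ultimately show ?thesis by simp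
qed

lemma adr_dec:
  assumes "k < G" "i < G" "j < G" "b < G"
  shows "adr w k i j b mod G = b" "adr w k i j b div G mod G = j" "adr w k i j b div G ^ 2 mod G = i"
    "adr w k i j b div G ^ 3 mod G = k" "adr w k i j b div G ^ 4 = w"
proof -
  have d: "(a * G + c) div G = a" "(a * G + c) mod G = c" if "c < G" for a c using that by auto
  have e: "G ^ 2 = G * G" "G ^ 3 = G * G * G" "G ^ 4 = G * G * G * G" by (simp_all add: eval_nat_numeral)
  show "adr w k i j b mod G = b" "adr w k i j b div G mod G = j" "adr w k i j b div G ^ 2 mod G = i"
    "adr w k i j b div G ^ 3 mod G = k" "adr w k i j b div G ^ 4 = w"
    unfolding adr_def e div_mult2_eq using assms by (simp_all only: d)
qed

type_synonym regs = "nat \<Rightarrow> nat \<Rightarrow> nat \<Rightarrow> nat \<Rightarrow> int"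

text \<open>The tape holds registers modulo \<open>2 ^ G\<close>. For \<open>w < 2\<close> the registers \<open>(w, k, i, j)\<close> form the matrix
  operand \<open>w\<close> of recursion level \<open>k\<close>; the weight of edge \<open>e\<close> is the sum over \<open>s\<close> of the lowest \<open>q\<close> bits of
  the registers \<open>(2, e, s, 0)\<close>, and step \<open>s\<close> of the search changes only the summand \<open>s\<close>.\<close>

definition mk :: "bool list \<Rightarrow> regs \<Rightarrow> bool list" where
  "mk C0 F = map (\<lambda>a. if a < 3 * G ^ 4
     then bit (F (a div G ^ 4) (a div G ^ 3 mod G) (a div G ^ 2 mod G) (a div G mod G)) (a mod G)
     else C0 ! a) [0..<W]"

definition upd :: "regs \<Rightarrow> nat \<Rightarrow> nat \<Rightarrow> nat \<Rightarrow> nat \<Rightarrow> int \<Rightarrow> regs" where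
  "upd F w k i j y = (\<lambda>w' k' i' j'. if w' = w \<and> k' = k \<and> i' = i \<and> j' = j then y else F w' k' i' j')"

lemma upd_upd [simp]: "upd (upd F w k i j y) w k i j z = upd F w k i j z"
  by (auto simp: upd_def fun_eq_iff)

lemma upd_same [simp]: "upd F w k i j y w k i j = y"
  by (simp add: upd_def)

lemma upd_id [simp]: "upd F w k i j (F w k i j) = F"
  by (auto simp: upd_def fun_eq_iff)

lemma length_mk [simp]: "length (mk C0 F) = W"
  by (simp add: mk_def)

lemma mk_nth:
  assumes "w < 3" "k < G" "i < G" "j < G" "b < G"
  shows "mk C0 F ! adr w k i j b = bit (F w k i j) b"
  using adr_less[OF assms] adr_dec[OF assms(2-5)] G3 by (simp add: mk_def)

text \<open>Registers are modelled by integers and only their residues modulo \<open>2 ^ G\<close>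
  reach the tape. Adding and subtracting the same amount therefore restores the tape exactly,
  whatever overflow occurs in between.\<close>

lemma mk_cong:
  assumes "\<And>w k i j. take_bit G (F w k i j) = take_bit G (F' w k i j)"
  shows "mk C0 F = mk C0 F'"
proof -
  have "bit (F w k i j) b = bit (F' w k i j) b" if "b < G" for w k i j b
    using arg_cong[OF assms[of w k i j], of "\<lambda>z. bit z b"] that by (simp add: bit_take_bit_iff)
  then show ?thesis using G3 by (auto simp: mk_def)
qed

lemma mk_flip:
  assumes "w < 3" "k < G" "i < G" "j < G" "b < G"
  shows "(mk C0 F)[adr w k i j b := \<not> mk C0 F ! adr w k i j b] = mk C0 (upd F w k i j (flip_bit b (F w k i j)))"
proof (rule nth_equalityI)
  fix a assume "a < length ((mk C0 F)[adr w k i j b := \<not> mk C0 F ! adr w k i j b])"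
  then have a: "a < W" by simp
  show "(mk C0 F)[adr w k i j b := \<not> mk C0 F ! adr w k i j b] ! a = mk C0 (upd F w k i j (flip_bit b (F w k i j))) ! a"
  proof (cases "a < 3 * G ^ 4")
    case False
    then have "a \<noteq> adr w k i j b" using adr_less[OF assms] by auto
    then show ?thesis using False a by (simp add: mk_def)
  next
    case True
    define w' k' i' j' b' where d: "w' = a div G ^ 4" "k' = a div G ^ 3 mod G" "i' = a div G ^ 2 mod G"
      "j' = a div G mod G" "b' = a mod G"
    have r: "w' < 3" "k' < G" "i' < G" "j' < G" "b' < G"
      using True G3 by (auto simp: d div_less_iff_less_mult)
    have "a = adr w' k' i' j' b'"
    proof -
      have "a = a div G * G + b'" by (simp add: d)
      also have "a div G = a div G ^ 2 * G + j'" by (simp add: d power2_eq_square div_mult2_eq)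
      also have "a div G ^ 2 = a div G ^ 3 * G + i'" by (simp add: d eval_nat_numeral div_mult2_eq)
      also have "a div G ^ 3 = a div G ^ 4 * G + k'" by (simp add: d eval_nat_numeral div_mult2_eq)
      finally show ?thesis by (simp add: adr_def d)
    qed
    then have A: "a = adr w' k' i' j' b'" .
    have inj: "adr w k i j b = adr w' k' i' j' b' \<longleftrightarrow> w = w' \<and> k = k' \<and> i = i' \<and> j = j' \<and> b = b'"
      using adr_dec[OF assms(2-5)] adr_dec[OF r(2-5)] by metis
    show ?thesis
    proof (cases "a = adr w k i j b")
      case True
      then show ?thesis using a mk_nth[OF assms] by (simp add: bit_flip_bit_iff)
    next
      case False
      then have "bit (upd F w k i j (flip_bit b (F w k i j)) w' k' i' j') b' = bit (F w' k' i' j') b'"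
        unfolding A inj[symmetric] by (auto simp: upd_def bit_flip_bit_iff)
      then show ?thesis using False mk_nth[OF r] unfolding A[symmetric] by simp
    qed
  qed
qed simp

lemma sem_flip:
  assumes "eval W x (EV 3) env (mk C0 F) = G" "eval W x ew env (mk C0 F) < 3" "eval W x ek env (mk C0 F) < G"
    "eval W x ei env (mk C0 F) < G" "eval W x ej env (mk C0 F) < G" "eval W x eb env (mk C0 F) < G"
  shows "sem W x (CFlip (adrE ew ek ei ej eb)) (env, mk C0 F, ot) =
    (env, mk C0 (upd F (eval W x ew env (mk C0 F)) (eval W x ek env (mk C0 F)) (eval W x ei env (mk C0 F)) (eval W x ej env (mk C0 F))
      (flip_bit (eval W x eb env (mk C0 F)) (F (eval W x ew env (mk C0 F)) (eval W x ek env (mk C0 F)) (eval W x ei env (mk C0 F)) (eval W x ej env (mk C0 F))))), ot)"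
  by (simp add: sem.simps(3) Let_def eval_adr[OF assms] mk_flip[OF assms(2-6)])

text \<open>Any catalytic content can be read as registers; no assumption on the initial tape is
  made.\<close>

lemma mk_exists: "length C = W \<Longrightarrow> \<exists>F. mk C F = C"
proof -
  assume C: "length C = W"
  define F where "F w k i j = (horner_sum of_bool 2 (map (\<lambda>b. C ! adr w k i j b) [0..<G]) :: int)" for w k i j
  have "mk C F ! a = C ! a" if "a < W" for a
  proof (cases "a < 3 * G ^ 4")
    case True
    have "adr (a div G ^ 4) (a div G ^ 3 mod G) (a div G ^ 2 mod G) (a div G mod G) (a mod G) = a"
    proof -
      have "a = a div G * G + a mod G" by simp
      also have "a div G = a div G ^ 2 * G + a div G mod G" by (simp add: power2_eq_square div_mult2_eq)
      also have "a div G ^ 2 = a div G ^ 3 * G + a div G ^ 2 mod G" by (simp add: eval_nat_numeral div_mult2_eq)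
      also have "a div G ^ 3 = a div G ^ 4 * G + a div G ^ 3 mod G" by (simp add: eval_nat_numeral div_mult2_eq)
      finally show ?thesis by (simp add: adr_def)
    qed
    then show ?thesis using that True G3 by (simp add: mk_def F_def bit_horner_sum_bit_iff)
  qed (use that in \<open>simp add: mk_def\<close>)
  then have "mk C F = C" using C by (intro nth_equalityI) auto
  then show ?thesis by blast
qed

lemma flip_bit_int: "flip_bit b y = (if bit y b then y - 2 ^ b else y + 2 ^ b)" for y :: int
  by (simp add: flip_bit_eq_if unset_bit_eq set_bit_eq)

lemma bit_flip_same [simp]: "bit (flip_bit c z) c \<longleftrightarrow> \<not> bit z c" for z :: int
  by (simp add: bit_flip_bit_iff)

lemma W1 [simp]: "W \<noteq> Suc 0" "W \<noteq> 0"
  using W_big by auto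

definition sg :: "nat \<Rightarrow> int" where
  "sg s = (if s = 0 then 1 else - 1)"

end

section \<open>Adding powers of two to registers, reading and replacing weights\<close>

definition ADDBIT :: cmd where
  "ADDBIT = CFor (EV 3) (CIf (ELess (EV 15) (EV 13)) CSkip (CIf (EV 0) CSkip
     (CSeq (CFlip (adrE (EV 9) (EV 10) (EV 11) (EV 12) (EV 15)))
       (CIf (EEq (ECat (adrE (EV 9) (EV 10) (EV 11) (EV 12) (EV 15))) (EV 14)) CSkip (CSet 0 (EN 1))))))"

definition READ :: cmd where
  "READ = CFor (EV 5) (CSeq (CIf (ECat (adrE (EN 2) (EV 9) (EV 10) (EN 0) (EV 12))) (CSet 0 (EAdd (EV 0) (EV 11))) CSkip)
     (CSet 11 (EMul (EV 11) (EN 2))))"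

text \<open>Only the lowest \<open>q\<close> bits of the register are replaced; slot 12 runs through
  the powers of two that extract the bits of the new value.\<close>

definition SETW :: cmd where
  "SETW = CFor (EV 5) (CSeq (CIf (EEq (ECat (adrE (EN 2) (EV 9) (EV 10) (EN 0) (EV 13))) (EMod (EDiv (EV 11) (EV 12)) (EN 2)))
       CSkip (CFlip (adrE (EN 2) (EV 9) (EV 10) (EN 0) (EV 13))))
     (CSet 12 (EMul (EV 12) (EN 2))))"

context prm
begin

text \<open>The first component turns 1 once the carry, or borrow for \<open>s = 1\<close>, is
  absorbed. A flip at \<open>c\<close> passes it on exactly if the new bit equals
  \<open>s\<close>.\<close>

primrec ab :: "nat \<Rightarrow> nat \<Rightarrow> int \<Rightarrow> nat \<Rightarrow> nat \<times> int" where
  "ab s b y 0 = (0, y)"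
| "ab s b y (Suc c) = (let (d, z) = ab s b y c in if c < b \<or> d \<noteq> 0 then (d, z)
     else (if of_bool (bit (flip_bit c z) c) = s then 0 else 1, flip_bit c z))"

text \<open>As long as the carry is alive, what is still missing is one unit at the next position to
  be treated.\<close>

lemma ab_inv:
  assumes "s < 2"
  shows "y + sg s * 2 ^ b = snd (ab s b y c) + (if fst (ab s b y c) = 0 then sg s * 2 ^ max b c else 0)"
proof (induction c)
  case (Suc c)
  obtain d z where dz: "ab s b y c = (d, z)" by (rule prod.exhaust)
  show ?case
  proof (cases "c < b \<or> d \<noteq> 0")
    case True
    then show ?thesis using Suc dz by (auto simp: max_def)
  next
    case False
    have s: "s = 0 \<or> s = 1" using assms by auto
    have "y + sg s * 2 ^ b = z + sg s * 2 ^ c" using Suc dz False by (simp add: max_def)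
    moreover have "ab s b y (Suc c) = (if of_bool (\<not> bit z c) = s then 0 else 1, if bit z c then z - 2 ^ c else z + 2 ^ c)"
      using False dz by (simp add: flip_bit_int[symmetric] split del: if_split)
    ultimately show ?thesis using False s
      by (auto simp: max_def sg_def split: if_splits)
  qed
qed (auto simp: sg_def)

lemma callr_ADDBIT:
  assumes r: "w < 3" "k < G" "i < G" "j < G" "s < 2"
  shows "snd (callr W x ADDBIT (pre @ [w, k, i, j, b, s]) (mk C0 F, ot)) =
    (mk C0 (upd F w k i j (F w k i j + sg s * 2 ^ b)), ot)"
proof -
  define y where "y = F w k i j"
  let ?g = "\<lambda>c. (fr (fst (ab s b y c)) [w, k, i, j, b, s], mk C0 (upd F w k i j (snd (ab s b y c))), ot)"
  have "sem W x ADDBIT (fr 0 [w, k, i, j, b, s], mk C0 F, ot) = ?g G"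
    unfolding ADDBIT_def
  proof (rule sem_for[where g = ?g])
    fix c assume c: "c < G"
    obtain d z where dz: "ab s b y c = (d, z)" by (rule prod.exhaust)
    show "pop (sem W x (CIf (ELess (EV 15) (EV 13)) CSkip (CIf (EV 0) CSkip
     (CSeq (CFlip (adrE (EV 9) (EV 10) (EV 11) (EV 12) (EV 15)))
       (CIf (EEq (ECat (adrE (EV 9) (EV 10) (EV 11) (EV 12) (EV 15))) (EV 14)) CSkip (CSet 0 (EN 1)))))) (push c (?g c))) = ?g (Suc c)"
      using r c by (simp add: dz push_simp pop_simp eval_adr sem_flip mk_nth Let_def)
  qed (auto simp: y_def)
  \<comment> \<open>A carry that survives all \<open>G\<close> bits, as well as a request with
    \<open>b\<close> beyond \<open>G\<close>, amounts to a multiple of \<open>2 ^ G\<close>, which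
    the tape does not show.\<close>
  moreover have "mk C0 (upd F w k i j (snd (ab s b y G))) = mk C0 (upd F w k i j (y + sg s * 2 ^ b))"
  proof (rule mk_cong)
    fix w' k' i' j'
    have "\<exists>m. y + sg s * 2 ^ b = snd (ab s b y G) + m * 2 ^ G"
    proof (cases "fst (ab s b y G) = 0")
      case True
      have "(2::int) ^ max b G = 2 ^ (max b G - G) * 2 ^ G" by (simp flip: power_add)
      then show ?thesis using ab_inv[OF r(5), of y b G] True
        by (intro exI[of _ "sg s * 2 ^ (max b G - G)"]) (simp add: mult.assoc)
    next
      case False
      then show ?thesis using ab_inv[OF r(5), of y b G] by (intro exI[of _ 0]) simp
    qed
    then have "take_bit G (snd (ab s b y G)) = take_bit G (y + sg s * 2 ^ b)" by (auto simp: take_bit_eq_mod)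
    then show "take_bit G (upd F w k i j (snd (ab s b y G)) w' k' i' j') = take_bit G (upd F w k i j (y + sg s * 2 ^ b) w' k' i' j')"
      by (simp add: upd_def)
  qed
  ultimately show ?thesis by (simp add: callr_def y_def)
qed

lemma pow_q: "b \<le> q \<Longrightarrow> 2 ^ b < W"
proof -
  assume "b \<le> q"
  then have "(2::nat) ^ b \<le> 2 ^ q" by (intro power_increasing) auto
  then show ?thesis using small(5) TQ(1) by linarith
qed

lemma q_G: "b < q \<Longrightarrow> b < G"
proof -
  have "q < 2 ^ q" by (rule less_exp)
  also have "\<dots> \<le> 2 * B ^ 7" using TQ by simp
  also have "\<dots> \<le> B * B ^ 7" using B2 by (intro mult_right_mono) auto
  also have "\<dots> = G" by (simp add: G eval_nat_numeral)
  finally show "b < q \<Longrightarrow> b < G" by simp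
qed

lemma callr_READ:
  assumes r: "e < G" "s < G"
  shows "callr W x READ (pre @ [e, s, 1]) (mk C0 F, ot) = (nat (take_bit q (F 2 e s 0)), mk C0 F, ot)"
proof -
  define y where "y = F 2 e s 0"
  let ?g = "\<lambda>b. (fr (nat (take_bit b y)) [e, s, 2 ^ b], mk C0 F, ot)"
  have "sem W x READ (fr 0 [e, s, 1], mk C0 F, ot) = ?g q"
    unfolding READ_def
  proof (rule sem_for[where g = ?g])
    fix b assume b: "b < q"
    have p: "2 * 2 ^ b < W" using pow_q[of "Suc b"] b by simp
    have t: "nat (take_bit (Suc b) y) = nat (take_bit b y) + (if bit y b then 2 ^ b else 0)"
      by (simp add: take_bit_Suc_from_most nat_add_distrib nat_power_eq)
    have "nat (take_bit (Suc b) y) < 2 ^ Suc b"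
      by (metis nat_less_iff of_nat_numeral of_nat_power take_bit_nonnegative take_bit_int_less_exp)
    then have t': "nat (take_bit (Suc b) y) < W" using p by simp
    show "pop (sem W x (CSeq (CIf (ECat (adrE (EN 2) (EV 9) (EV 10) (EN 0) (EV 12))) (CSet 0 (EAdd (EV 0) (EV 11))) CSkip)
     (CSet 11 (EMul (EV 11) (EN 2)))) (push b (?g b))) = ?g (Suc b)"
      using r b q_G[OF b] p t t' G3(2)
      by (cases "bit y b") (simp_all add: push_simp pop_simp eval_adr mk_nth y_def[symmetric] mult.commute)
  qed auto
  then show ?thesis by (simp add: callr_def y_def)
qed

text \<open>The residue modulo \<open>2 ^ q\<close> is replaced and the higher bits are kept, since
  they belong to the catalytic content.\<close>

definition sl :: "int \<Rightarrow> nat \<Rightarrow> int" where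
  "sl y w = y - y mod 2 ^ q + int w"

lemma callr_SETW:
  assumes r: "e < G" "s < G" "w < TQ"
  shows "snd (callr W x SETW (pre @ [e, s, w, 1]) (mk C0 F, ot)) = (mk C0 (upd F 2 e s 0 (sl (F 2 e s 0) w)), ot)"
proof -
  define y where "y = F 2 e s 0"
  define z where "z b = y - y mod 2 ^ b + int w mod 2 ^ b" for b
  let ?g = "\<lambda>b. (fr 0 [e, s, w, 2 ^ b], mk C0 (upd F 2 e s 0 (z b)), ot)"
  have "sem W x SETW (fr 0 [e, s, w, 1], mk C0 F, ot) = ?g q"
    unfolding SETW_def
  proof (rule sem_for[where g = ?g])
    fix b assume b: "b < q"
    have p: "2 * 2 ^ b < W" using pow_q[of "Suc b"] b by simp
    have zb: "bit (z b) b = bit y b"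
    proof -
      have "z b = (y div 2 ^ b) * 2 ^ b + int w mod 2 ^ b" by (simp add: z_def minus_mod_eq_div_mult)
      then have "z b div 2 ^ b = y div 2 ^ b" by simp
      then show ?thesis by (simp add: bit_iff_odd)
    qed
    have wb: "w div 2 ^ b mod 2 = of_bool (bit (int w) b)"
    proof -
      have "int w div 2 ^ b = int (w div 2 ^ b)" by (simp add: zdiv_int)
      then show ?thesis by (simp add: bit_iff_odd mod2_eq_if)
    qed
    have m: "v mod (2 * 2 ^ b) = v mod 2 ^ b + (if bit v b then 2 ^ b else 0)" for v :: int
      using take_bit_Suc_from_most[of b v] by (simp add: take_bit_eq_mod)
    have zS: "z (Suc b) = (if bit y b = bit (int w) b then z b else flip_bit b (z b))"
      unfolding flip_bit_int zb by (simp add: z_def m)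
    show "pop (sem W x (CSeq (CIf (EEq (ECat (adrE (EN 2) (EV 9) (EV 10) (EN 0) (EV 13))) (EMod (EDiv (EV 11) (EV 12)) (EN 2)))
       CSkip (CFlip (adrE (EN 2) (EV 9) (EV 10) (EN 0) (EV 13)))) (CSet 12 (EMul (EV 12) (EN 2)))) (push b (?g b))) = ?g (Suc b)"
      using r b q_G[OF b] p G3(2)
      by (simp add: push_simp pop_simp eval_adr mk_nth sem_flip wb zb zS mult.commute)
  qed (auto simp: z_def y_def)
  moreover have "int w mod 2 ^ q = int w" using r TQ(1) by (simp flip: of_nat_power of_nat_mod)
  ultimately show ?thesis by (simp add: callr_def z_def sl_def y_def)
qed

end

section \<open>The register program for matrix powers\<close>

lemma sem_call99: "length env \<le> 99 \<Longrightarrow> sem W x (CCall 99 es P) (env, c) =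
   (env, snd (callr W x P (map (\<lambda>e. eval W x e env (fst c)) es) c))"
  by (simp add: sem_call list_update_beyond)

text \<open>Schoolbook multiplication: for every pair of set bits a power of two is added to the
  target, so that no product has to be held in work space. Slots 14 to 16 are the summation index
  and the two bit positions.\<close>

definition MULADD :: cmd where
  "MULADD = CFor (EV 4) (CFor (EV 3) (CFor (EV 3)
     (CIf (ECat (adrE (EN 0) (EV 10) (EV 11) (EV 14) (EV 15)))
       (CIf (ECat (adrE (EN 1) (EV 10) (EV 14) (EV 12) (EV 16)))
         (CCall 99 (PRE @ [EV 9, EAdd (EV 10) (EN 1), EV 11, EV 12, EAdd (EV 15) (EV 16), EV 13]) ADDBIT) CSkip) CSkip)))"

definition MULALL :: cmd where
  "MULALL = CFor (EV 4) (CFor (EV 4) (CCall 99 (PRE @ [EV 9, EV 10, EV 12, EV 13, EV 11]) MULADD))"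

definition XADD :: cmd where
  "XADD = CFor (EMul (EV 2) (EV 2)) (CFor (EV 5) (CIf (ECat (adrE (EN 2) (EV 12) (EV 14) (EN 0) (EV 15)))
     (CCall 99 (PRE @ [EV 9, EN 0, EV 10, EV 11, EV 15, EV 13]) ADDBIT) CSkip))"

definition AADD :: cmd where
  "AADD = CIf (EEq (EV 12) (EV 15)) CSkip (CIf (EEq (EV 13) (EV 15)) CSkip
     (CIf (ELess (EV 12) (EV 13))
       (CIf (EEq (EIn (EAdd (EMul (EV 12) (EV 1)) (EV 13))) (EN 1))
         (CCall 99 (PRE @ [EV 9, EV 10, EV 11, EAdd (EMul (EV 12) (EV 1)) (EV 13), EV 14]) XADD) CSkip)
       (CIf (ELess (EV 13) (EV 12))
         (CIf (EEq (EIn (EAdd (EMul (EV 13) (EV 1)) (EV 12))) (EN 1))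
           (CCall 99 (PRE @ [EV 9, EV 10, EV 11, EAdd (EMul (EV 13) (EV 1)) (EV 12), ESub (EN 1) (EV 14)]) XADD) CSkip) CSkip)))"

definition ONE :: cmd where
  "ONE = CCall 99 (PRE @ [EV 9, EN 0, EV 10, EV 11, EN 0, EV 12]) ADDBIT"

text \<open>The case analysis of \<open>bmc\<close>. The negative coefficient of a closing edge is
  produced by exchanging addition and subtraction, that is by \<open>1 - s\<close>.\<close>

definition CELL :: cmd where
  "CELL = CIf (EEq (EV 15) (EV 1))
     (CIf (EEq (EV 16) (EV 19))
       (CIf (EEq (EV 14) (EAdd (EV 17) (EN 1)))
         (CIf (ELess (EV 17) (EV 1)) (CIf (EEq (EV 18) (EV 1)) ONE (CIf (EEq (EV 18) (EV 17)) ONE CSkip)) CSkip)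
         (CIf (EV 14) CSkip (CIf (EV 17) CSkip (CIf (EV 16) CSkip (CIf (EEq (EV 18) (EV 1)) ONE CSkip)))))
       CSkip)
     (CIf (ELess (EV 15) (EV 1)) (CIf (ELess (EV 14) (EV 1))
       (CIf (EEq (EV 16) (EAdd (EV 19) (EN 1))) (CIf (EEq (EV 17) (EV 14))
         (CIf (EEq (EV 18) (EV 1)) (CCall 99 (PRE @ [EV 9, EV 10, EV 11, EV 15, EV 14, ESub (EN 1) (EV 12), EV 13]) AADD)
           (CIf (ELess (EV 18) (EV 14)) (CCall 99 (PRE @ [EV 9, EV 10, EV 11, EV 15, EV 18, EV 12, EV 13]) AADD) CSkip))
         CSkip) CSkip) CSkip) CSkip)"

definition LEAF :: cmd where
  "LEAF = CFor (EV 4) (CFor (EV 4) (CCall 99 (PRE @ [EV 9, EV 12, EV 13, EV 10, EV 11,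
     EDiv (EV 12) (EMul (EV 2) (EV 2)), EMod (EDiv (EV 12) (EV 2)) (EV 2), EMod (EV 12) (EV 2),
     EDiv (EV 13) (EMul (EV 2) (EV 2)), EMod (EDiv (EV 13) (EV 2)) (EV 2), EMod (EV 13) (EV 2)]) CELL))"

context prm
begin

definition xv :: "regs \<Rightarrow> nat \<Rightarrow> int" where
  "xv F e = (\<Sum>t<B * B. take_bit q (F 2 e t 0))"

text \<open>The skew-symmetric weight matrix with row and column \<open>v\<close> set to 0;
  \<open>v = n\<close> deletes nothing. The edge from \<open>u\<close> to a larger \<open>u'\<close>
  has number \<open>u * n + u'\<close>, so only input bits above the diagonal are consulted.\<close>

definition tq :: "regs \<Rightarrow> nat \<Rightarrow> nat \<Rightarrow> nat \<Rightarrow> int" where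
  "tq F v u u' = (if u = v \<or> u' = v then 0
     else if u < u' then (if inval x (u * n + u') = 1 then xv F (u * n + u') else 0)
     else if u' < u then (if inval x (u' * n + u) = 1 then - xv F (u' * n + u) else 0) else 0)"

text \<open>The state \<open>(h, n, m)\<close> stands for \<open>pe h m\<close> and \<open>(h, u, m)\<close> with \<open>u < n\<close> for \<open>pf h u m\<close>; the entries are the
  coefficients of the recursion for these numbers, with a loop at the sink \<open>(0, n, 0)\<close>.\<close>

definition bmc :: "regs \<Rightarrow> nat \<Rightarrow> nat \<Rightarrow> nat \<Rightarrow> nat \<Rightarrow> nat \<Rightarrow> nat \<Rightarrow> nat \<Rightarrow> int" where
  "bmc F v h u m h' u' m' =
     (if u = n then
        if m = m' then
          if h = h' + 1 then if h' < n \<and> (u' = n \<or> u' = h') then 1 else 0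
          else if h = 0 \<and> h' = 0 \<and> m = 0 \<and> u' = n then 1 else 0
        else 0
      else if u < n \<and> h < n \<and> m = m' + 1 \<and> h' = h then
        if u' = n then - tq F v u h else if u' < h then tq F v u u' else 0
      else 0)"

definition bm :: "regs \<Rightarrow> nat \<Rightarrow> nat \<Rightarrow> nat \<Rightarrow> int" where
  "bm F v i j = bmc F v (i div (B * B)) (i div B mod B) (i mod B) (j div (B * B)) (j div B mod B) (j mod B)"

text \<open>The state in the middle of adding a matrix row by row, just before entry
  \<open>(i0, j0)\<close>.\<close>

definition part :: "regs \<Rightarrow> nat \<Rightarrow> nat \<Rightarrow> (nat \<Rightarrow> nat \<Rightarrow> int) \<Rightarrow> nat \<Rightarrow> nat \<Rightarrow> nat \<Rightarrow> regs" where
  "part F w k M s i0 j0 = (\<lambda>w' k' i' j'. if w' = w \<and> k' = k \<and> j' < N \<and> (i' < i0 \<or> i' = i0 \<and> j' < j0)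
     then F w' k' i' j' + sg s * M i' j' else F w' k' i' j')"

definition addM :: "regs \<Rightarrow> nat \<Rightarrow> nat \<Rightarrow> (nat \<Rightarrow> nat \<Rightarrow> int) \<Rightarrow> nat \<Rightarrow> regs" where
  "addM F w k M s = (\<lambda>w' k' i' j'. if w' = w \<and> k' = k \<and> i' < N \<and> j' < N
     then F w' k' i' j' + sg s * M i' j' else F w' k' i' j')"

lemma part_simps: "part F w k M s 0 0 = F" "part F w k M s i N = part F w k M s (Suc i) 0" "part F w k M s N 0 = addM F w k M s"
  by (auto simp: part_def addM_def fun_eq_iff less_Suc_eq)

lemma part_upd: "j < N \<Longrightarrow> upd (part F w k M s i j) w k i j (part F w k M s i j w k i j + sg s * M i j) = part F w k M s i (Suc j)"
  by (auto simp: part_def upd_def fun_eq_iff less_Suc_eq)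

lemma ev_PRE: "map (\<lambda>e. eval W x e (fr r args) C) PRE = pre"
  by (simp add: PRE_def)

lemma N_G: "i < N \<Longrightarrow> i < G" using G3 by simp

lemma GG_W: "a < G \<Longrightarrow> b < G \<Longrightarrow> a + b < W"
proof -
  assume "a < G" "b < G"
  moreover have "2 * G \<le> B * G" using B2 by simp
  moreover have "B * G = B ^ 9" by (simp add: G eval_nat_numeral)
  moreover have "B ^ 9 < B ^ 10" using B2 by (intro power_strict_increasing) auto
  ultimately show ?thesis using WB[of 10 "a + b"] by linarith
qed

lemma callr_MULADD:
  assumes r: "w < 2" "Suc k < G" "i < N" "j < N" "s < 2"
  shows "snd (callr W x MULADD (pre @ [w, k, i, j, s]) (mk C0 F, ot)) =
    (mk C0 (upd F w (Suc k) i j (F w (Suc k) i j + sg s * mm N (F 0 k) (F 1 k) i j)), ot)"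
proof -
  define y where "y = F w (Suc k) i j"
  let ?U = "\<lambda>v. mk C0 (upd F w (Suc k) i j v)"
  have rG: "i < G" "j < G" "k < G" "w < 3" using r N_G by auto
  let ?b1 = "CIf (ECat (adrE (EN 0) (EV 10) (EV 11) (EV 14) (EV 15)))
       (CIf (ECat (adrE (EN 1) (EV 10) (EV 14) (EV 12) (EV 16)))
         (CCall 99 (PRE @ [EV 9, EAdd (EV 10) (EN 1), EV 11, EV 12, EAdd (EV 15) (EV 16), EV 13]) ADDBIT) CSkip) CSkip"
  have L1: "sem W x (CFor (EV 3) ?b1) (fr 0 [w, k, i, j, s, t, a], ?U v, ot) =
     (fr 0 [w, k, i, j, s, t, a], ?U (v + sg s * (of_bool (bit (F 0 k i t) a) * 2 ^ a * take_bit G (F 1 k t j))), ot)"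
    if t: "t < G" and a: "a < G" for t a v
  proof -
    let ?g = "\<lambda>b. (fr 0 [w, k, i, j, s, t, a], ?U (v + sg s * (of_bool (bit (F 0 k i t) a) * 2 ^ a * take_bit b (F 1 k t j))), ot)"
    have "sem W x (CFor (EV 3) ?b1) (fr 0 [w, k, i, j, s, t, a], ?U v, ot) = ?g G"
    proof (rule sem_for[where g = ?g])
      fix b assume b: "b < G"
      have ab: "(a + b) mod W = a + b" using GG_W[OF a b] by simp
      have k1: "Suc k mod W = Suc k" using r(2) small by simp
      have rd: "upd F w (Suc k) i j z w' k i' j' = F w' k i' j'" for z w' i' j' by (simp add: upd_def)
      note A = callr_ADDBIT[OF rG(4) r(2) rG(1,2) r(5), of "a + b" C0 "upd F w (Suc k) i j z" ot for z, unfolded upd_upd upd_same]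
      show "pop (sem W x ?b1 (push b (?g b))) = ?g (Suc b)"
        using rG r t a b A
        by (simp add: push_simp pop_simp eval_adr mk_nth sem_call99 ev_PRE ab k1 rd take_bit_Suc_from_most
            algebra_simps power_add)
    qed simp_all
    then show ?thesis by simp
  qed
  let ?b2 = "CFor (EV 3) ?b1"
  have L2: "sem W x (CFor (EV 3) ?b2) (fr 0 [w, k, i, j, s, t], ?U v, ot) =
     (fr 0 [w, k, i, j, s, t], ?U (v + sg s * (take_bit G (F 0 k i t) * take_bit G (F 1 k t j))), ot)" if t: "t < G" for t v
  proof -
    let ?g = "\<lambda>a. (fr 0 [w, k, i, j, s, t], ?U (v + sg s * (take_bit a (F 0 k i t) * take_bit G (F 1 k t j))), ot)"
    have "sem W x (CFor (EV 3) ?b2) (fr 0 [w, k, i, j, s, t], ?U v, ot) = ?g G"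
    proof (rule sem_for[where g = ?g])
      fix a assume a: "a < G"
      show "pop (sem W x ?b2 (push a (?g a))) = ?g (Suc a)"
        by (simp add: push_simp pop_simp L1[OF t a] take_bit_Suc_from_most algebra_simps del: One_nat_def)
    qed simp_all
    then show ?thesis by simp
  qed
  let ?g = "\<lambda>t. (fr 0 [w, k, i, j, s], ?U (y + sg s * (\<Sum>t'<t. take_bit G (F 0 k i t') * take_bit G (F 1 k t' j))), ot)"
  have "sem W x MULADD (fr 0 [w, k, i, j, s], mk C0 F, ot) = ?g N"
    unfolding MULADD_def
  proof (rule sem_for[where g = ?g])
    fix t assume t: "t < N"
    show "pop (sem W x (CFor (EV 3) ?b2) (push t (?g t))) = ?g (Suc t)"
      by (simp add: push_simp pop_simp L2[OF N_G[OF t]] algebra_simps del: One_nat_def)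
  qed (simp_all add: y_def)
  \<comment> \<open>The loops see only the lowest \<open>G\<close> bits of the factors, which is the
    same modulo \<open>2 ^ G\<close>.\<close>
  moreover have "?U (y + sg s * (\<Sum>t'<N. take_bit G (F 0 k i t') * take_bit G (F 1 k t' j))) = ?U (y + sg s * mm N (F 0 k) (F 1 k) i j)"
  proof (rule mk_cong)
    fix w' k' i' j'
    have "take_bit G (y + sg s * (\<Sum>t'<N. take_bit G (F 0 k i t') * take_bit G (F 1 k t' j))) = take_bit G (y + sg s * mm N (F 0 k) (F 1 k) i j)"
    proof -
      have "(\<Sum>t'<N. take_bit G (F 0 k i t') * take_bit G (F 1 k t' j)) mod 2 ^ G = mm N (F 0 k) (F 1 k) i j mod 2 ^ G"
      proof -
        have "(\<Sum>t'<N. take_bit G (F 0 k i t') * take_bit G (F 1 k t' j)) mod 2 ^ G =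
            (\<Sum>t'<N. take_bit G (F 0 k i t') * take_bit G (F 1 k t' j) mod 2 ^ G) mod 2 ^ G" by (rule mod_sum_eq[symmetric])
        also have "\<dots> = (\<Sum>t'<N. F 0 k i t' * F 1 k t' j mod 2 ^ G) mod 2 ^ G" by (simp only: take_bit_eq_mod mod_mult_eq)
        also have "\<dots> = mm N (F 0 k) (F 1 k) i j mod 2 ^ G" unfolding mm_def by (rule mod_sum_eq)
        finally show ?thesis .
      qed
      then show ?thesis unfolding take_bit_eq_mod[of G "_ + _"] by (intro mod_add_cong[OF refl] mod_mult_cong[OF refl])
    qed
    then show "take_bit G (upd F w (Suc k) i j (y + sg s * (\<Sum>t'<N. take_bit G (F 0 k i t') * take_bit G (F 1 k t' j))) w' k' i' j') =
      take_bit G (upd F w (Suc k) i j (y + sg s * mm N (F 0 k) (F 1 k) i j) w' k' i' j')" by (simp add: upd_def)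
  qed
  ultimately show ?thesis by (simp add: callr_def y_def)
qed

lemma callr_MULALL:
  assumes r: "w < 2" "Suc k < G" "s < 2"
  shows "snd (callr W x MULALL (pre @ [w, k, s]) (mk C0 F, ot)) = (mk C0 (addM F w (Suc k) (mm N (F 0 k) (F 1 k)) s), ot)"
proof -
  let ?M = "mm N (F 0 k) (F 1 k)"
  let ?p = "part F w (Suc k) ?M s"
  let ?b = "CCall 99 (PRE @ [EV 9, EV 10, EV 12, EV 13, EV 11]) MULADD"
  \<comment> \<open>The target lies one level above the factors, so the product does not change
    while it is being added.\<close>
  have eqM: "mm N (?p i j 0 k) (?p i j 1 k) = ?M" for i j by (simp add: part_def mm_def fun_eq_iff)
  have L: "sem W x (CFor (EV 4) ?b) (fr 0 [w, k, s, i], mk C0 (?p i 0), ot) = (fr 0 [w, k, s, i], mk C0 (?p i N), ot)"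
    if i: "i < N" for i
  proof (rule sem_for[where g = "\<lambda>j. (fr 0 [w, k, s, i], mk C0 (?p i j), ot)"])
    fix j assume j: "j < N"
    show "pop (sem W x ?b (push j (fr 0 [w, k, s, i], mk C0 (?p i j), ot))) = (fr 0 [w, k, s, i], mk C0 (?p i (Suc j)), ot)"
      using callr_MULADD[OF r(1,2) i j r(3), of C0 "?p i j" ot] part_upd[OF j, of F w "Suc k" ?M s i]
      by (simp add: push_simp pop_simp sem_call99 ev_PRE eqM del: One_nat_def)
  qed simp_all
  have "sem W x MULALL (fr 0 [w, k, s], mk C0 F, ot) = (fr 0 [w, k, s], mk C0 (?p N 0), ot)"
    unfolding MULALL_def
  proof (rule sem_for[where g = "\<lambda>i. (fr 0 [w, k, s], mk C0 (?p i 0), ot)"])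
    fix i assume i: "i < N"
    show "pop (sem W x (CFor (EV 4) ?b) (push i (fr 0 [w, k, s], mk C0 (?p i 0), ot))) = (fr 0 [w, k, s], mk C0 (?p (Suc i) 0), ot)"
      using L[OF i] by (simp add: push_simp pop_simp part_simps)
  qed (simp_all add: part_simps)
  then show ?thesis by (simp add: callr_def part_simps)
qed


lemma BB_G: "a < B * B \<Longrightarrow> a < G" "a \<le> B * B \<Longrightarrow> a < G" "a \<le> B * B \<Longrightarrow> a < W"
proof -
  have "B ^ 2 < B ^ 8" using B2 by (intro power_strict_increasing) auto
  then show a: "a \<le> B * B \<Longrightarrow> a < G" by (simp add: G power2_eq_square)
  then show "a < B * B \<Longrightarrow> a < G" by simp
  show "a \<le> B * B \<Longrightarrow> a < W" using a small by simp
qed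

lemma callr_XADD:
  assumes r: "w < 2" "i < N" "j < N" "e < G" "s < 2"
  shows "snd (callr W x XADD (pre @ [w, i, j, e, s]) (mk C0 F, ot)) =
    (mk C0 (upd F w 0 i j (F w 0 i j + sg s * xv F e)), ot)"
proof -
  define y where "y = F w 0 i j"
  let ?U = "\<lambda>v. mk C0 (upd F w 0 i j v)"
  have rG: "i < G" "j < G" "w < 3" "w \<noteq> 2" "(0::nat) < G" using r N_G G3 by auto
  let ?b1 = "CIf (ECat (adrE (EN 2) (EV 12) (EV 14) (EN 0) (EV 15)))
     (CCall 99 (PRE @ [EV 9, EN 0, EV 10, EV 11, EV 15, EV 13]) ADDBIT) CSkip"
  have rd: "upd F w 0 i j z 2 i' j' k' = F 2 i' j' k'" for z i' j' k' using rG by (simp add: upd_def)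
  have L1: "sem W x (CFor (EV 5) ?b1) (fr 0 [w, i, j, e, s, t], ?U v, ot) =
     (fr 0 [w, i, j, e, s, t], ?U (v + sg s * take_bit q (F 2 e t 0)), ot)"
    if t: "t < G" for t v
  proof -
    let ?g = "\<lambda>b. (fr 0 [w, i, j, e, s, t], ?U (v + sg s * take_bit b (F 2 e t 0)), ot)"
    have "sem W x (CFor (EV 5) ?b1) (fr 0 [w, i, j, e, s, t], ?U v, ot) = ?g q"
    proof (rule sem_for[where g = ?g])
      fix b assume b: "b < q"
      note A = callr_ADDBIT[OF rG(3,5,1,2) r(5), of "b" C0 "upd F w 0 i j z" ot for z, unfolded upd_upd upd_same]
      show "pop (sem W x ?b1 (push b (?g b))) = ?g (Suc b)"
        using rG r t q_G[OF b] A
        by (simp add: push_simp pop_simp eval_adr mk_nth sem_call99 ev_PRE rd take_bit_Suc_from_most algebra_simps)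
    qed simp_all
    then show ?thesis by simp
  qed
  let ?g = "\<lambda>t. (fr 0 [w, i, j, e, s], ?U (y + sg s * (\<Sum>t<t. take_bit q (F 2 e t 0))), ot)"
  have "sem W x XADD (fr 0 [w, i, j, e, s], mk C0 F, ot) = ?g (B * B)"
    unfolding XADD_def
  proof (rule sem_for[where g = ?g])
    fix t assume t: "t < B * B"
    show "pop (sem W x (CFor (EV 5) ?b1) (push t (?g t))) = ?g (Suc t)"
      by (simp add: push_simp pop_simp L1[OF BB_G(1)[OF t]] algebra_simps)
  qed (use BB_G(3) in \<open>simp_all add: y_def\<close>)
  then show ?thesis by (simp add: callr_def y_def xv_def)
qed

lemma edge_less: "u < B \<Longrightarrow> v < B \<Longrightarrow> u * n + v < B * B"
proof -
  assume a: "u < B" "v < B"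
  have "u * n + v < u * B + B" using a n_less by (intro add_le_less_mono mult_left_mono) auto
  also have "\<dots> = (u + 1) * B" by simp
  also have "\<dots> \<le> B * B" using a by (intro mult_right_mono) auto
  finally show ?thesis .
qed

lemma sg_flip: "s < 2 \<Longrightarrow> sg (1 - s) = - sg s" "s < 2 \<Longrightarrow> sg (Suc 0 - s) = - sg s"
  by (auto simp: sg_def)

lemma callr_AADD:
  assumes r: "w < 2" "i < N" "j < N" "u < B" "u' < B" "s < 2"
  shows "snd (callr W x AADD (pre @ [w, i, j, u, u', s, v]) (mk C0 F, ot)) =
    (mk C0 (upd F w 0 i j (F w 0 i j + sg s * tq F v u u')), ot)"
proof -
  have e: "u * n + u' < G" "u' * n + u < G" "(u * n + u') mod W = u * n + u'" "(u' * n + u) mod W = u' * n + u"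
    using edge_less[OF r(4,5)] edge_less[OF r(5,4)] BB_G by (auto intro!: mod_less)
  have e': "(u * n mod W + u') mod W = u * n + u'" "(u' * n mod W + u) mod W = u' * n + u"
    using e(3,4) by (simp_all only: mod_add_left_eq)
  have s': "1 - s < 2" by simp
  note X = callr_XADD[OF r(1-3) e(1) r(6), of C0 F ot] callr_XADD[OF r(1-3) e(2) s', of C0 F ot]
  have "snd (sem W x AADD (fr 0 [w, i, j, u, u', s, v], mk C0 F, ot)) =
      (mk C0 (upd F w 0 i j (F w 0 i j + sg s * tq F v u u')), ot)"
    using X by (simp add: AADD_def sem_call99 ev_PRE e' tq_def sg_flip[OF r(6)])
  then show ?thesis by (simp add: callr_def)
qed

lemma callr_CELL:
  assumes r: "w < 2" "i < N" "j < N" "s < 2" "h < B" "u < B" "m < B" "h' < B" "u' < B" "m' < B"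
  shows "snd (callr W x CELL (pre @ [w, i, j, s, v, h, u, m, h', u', m']) (mk C0 F, ot)) =
    (mk C0 (upd F w 0 i j (F w 0 i j + sg s * bmc F v h u m h' u' m')), ot)"
proof -
  have rG: "i < G" "j < G" "w < 3" "(0::nat) < G" using r N_G G3 by auto
  have sW: "Suc h' mod W = Suc h'" "Suc m' mod W = Suc m'"
    using r BB_G(3)[of "Suc h'"] BB_G(3)[of "Suc m'"] mult_le_mono[of 1 B "Suc h'" B] mult_le_mono[of 1 B "Suc m'" B] B2
    by auto
  have s': "1 - s < 2" by simp
  note A1 = callr_ADDBIT[OF rG(3,4,1,2) r(4), of 0 C0 F ot]
  note A2 = callr_AADD[OF r(1-3) r(6) r(5) s', of v C0 F ot] callr_AADD[OF r(1-3) r(6) r(9) r(4), of v C0 F ot]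
  have "snd (sem W x CELL (fr 0 [w, i, j, s, v, h, u, m, h', u', m'], mk C0 F, ot)) =
    (mk C0 (upd F w 0 i j (F w 0 i j + sg s * bmc F v h u m h' u' m')), ot)"
    using A1 A2
    by (simp add: CELL_def ONE_def sem_call99 PRE_def sW bmc_def sg_flip[OF r(4)] split: if_split)
  then show ?thesis by (simp add: callr_def)
qed

text \<open>The matrix of the recursion depends only on the weight registers, those with
  \<open>w = 2\<close>.\<close>

lemma bm_part [simp]: "w \<noteq> 2 \<Longrightarrow> bm (part F w k M s i j) v = bm F v"
  by (simp add: bm_def bmc_def tq_def xv_def part_def fun_eq_iff)

lemma callr_LEAF:
  assumes r: "w < 2" "s < 2"
  shows "snd (callr W x LEAF (pre @ [w, s, v]) (mk C0 F, ot)) = (mk C0 (addM F w 0 (bm F v) s), ot)"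
proof -
  let ?M = "bm F v"
  let ?p = "part F w 0 ?M s"
  let ?b = "CCall 99 (PRE @ [EV 9, EV 12, EV 13, EV 10, EV 11,
     EDiv (EV 12) (EMul (EV 2) (EV 2)), EMod (EDiv (EV 12) (EV 2)) (EV 2), EMod (EV 12) (EV 2),
     EDiv (EV 13) (EMul (EV 2) (EV 2)), EMod (EDiv (EV 13) (EV 2)) (EV 2), EMod (EV 13) (EV 2)]) CELL"
  have BW: "B * B mod W = B * B" using BB_G(3)[of "B * B"] by simp
  have dB: "a div (B * B) < B" "a mod B < B" if "a < N" for a
    using that B2 by (simp_all add: N less_mult_imp_div_less power3_eq_cube)
  have L: "sem W x (CFor (EV 4) ?b) (fr 0 [w, s, v, i], mk C0 (?p i 0), ot) = (fr 0 [w, s, v, i], mk C0 (?p i N), ot)"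
    if i: "i < N" for i
  proof (rule sem_for[where g = "\<lambda>j. (fr 0 [w, s, v, i], mk C0 (?p i j), ot)"])
    fix j assume j: "j < N"
    have m: "a div B mod B < B" for a using B2 by simp
    show "pop (sem W x ?b (push j (fr 0 [w, s, v, i], mk C0 (?p i j), ot))) = (fr 0 [w, s, v, i], mk C0 (?p i (Suc j)), ot)"
      using callr_CELL[OF r(1) i j r(2) dB(1)[OF i] m[of i] dB(2)[OF i] dB(1)[OF j] m[of j] dB(2)[OF j], of v C0 "?p i j" ot] r
        part_upd[OF j, of F w 0 ?M s i]
      by (simp add: push_simp pop_simp sem_call99 ev_PRE BW bm_def[symmetric])
  qed simp_all
  have "sem W x LEAF (fr 0 [w, s, v], mk C0 F, ot) = (fr 0 [w, s, v], mk C0 (?p N 0), ot)"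
    unfolding LEAF_def
  proof (rule sem_for[where g = "\<lambda>i. (fr 0 [w, s, v], mk C0 (?p i 0), ot)"])
    fix i assume i: "i < N"
    show "pop (sem W x (CFor (EV 4) ?b) (push i (fr 0 [w, s, v], mk C0 (?p i 0), ot))) = (fr 0 [w, s, v], mk C0 (?p (Suc i) 0), ot)"
      using L[OF i] by (simp add: push_simp pop_simp part_simps)
  qed (simp_all add: part_simps)
  then show ?thesis by (simp add: callr_def part_simps)
qed

end

section \<open>Running the recursion transparently\<close>

definition DEVEN :: cmd where
  "DEVEN = CSeq (CSet 15 (EN 1)) (CIf (EV 13) CSkip (CCall 99 (PRE @ [EV 11, EV 10,
     EMod (EAdd (EV 12) (EDiv (EMod (EV 16) (EN 4)) (EN 2))) (EN 2)]) MULALL))"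

text \<open>One level of descent. The octal digit of the tick chooses a block: an odd one descends,
  its middle bit naming the operand and its top bit the sign; an even one multiplies, the middle bit
  reversing the sign. A multiplication takes place only at the first tick of its block.\<close>

definition DSTEP :: cmd where
  "DSTEP = CIf (EV 15) CSkip
    (CIf (EV 10)
      (CSeq (CSet 14 (EDiv (EV 14) (EN 8)))
      (CSeq (CSet 16 (EDiv (EV 13) (EV 14)))
      (CSeq (CSet 13 (EMod (EV 13) (EV 14)))
      (CSeq (CSet 10 (ESub (EV 10) (EN 1)))
       (CIf (EMod (EV 16) (EN 2))
         (CSeq (CSet 11 (EDiv (EMod (EV 16) (EN 4)) (EN 2))) (CSet 12 (EDiv (EV 16) (EN 4))))
         DEVEN)))))
      (CSeq (CCall 99 (PRE @ [EV 11, EV 12, EV 9]) LEAF) (CSet 15 (EN 1))))"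

text \<open>There is no recursion stack: the active call is recomputed from the tick by reading its
  digits from the top. There are at most \<open>l\<close> descents and one action at the leaf, hence
  \<open>l + 1\<close> rounds.\<close>

definition DESC :: cmd where
  "DESC = CFor (EAdd (EV 7) (EN 1)) DSTEP"

definition RUN :: cmd where
  "RUN = CFor (EV 8) (CCall 99 (PRE @ [EV 10, EV 7, EN 0, EV 9, EV 11, EV 8, EN 0, EN 0]) DESC)"

text \<open>Row \<open>(n, n, k)\<close> and column \<open>(0, n, 0)\<close> of the top level
  register matrix; slot 12 is the position of the bit.\<close>

definition TADR :: exp where
  "TADR = adrE (EN 0) (EV 7) (EAdd (EMul (EAdd (EMul (EV 1) (EV 2)) (EV 1)) (EV 2)) (EV 10)) (EMul (EV 1) (EV 2)) (EV 12)"

text \<open>The whole register is too long to be remembered, so the power is added and subtracted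
  again once for each bit, and one bit before the addition is compared with the same bit after it.
  Some bit differs exactly if the added entry is nonzero modulo \<open>2 ^ G\<close>.\<close>

definition TEST :: cmd where
  "TEST = CFor (EV 3) (CSeq (CSet 11 (ECat TADR)) (CSeq (CCall 99 (PRE @ [EN 0, EV 9]) RUN)
     (CSeq (CIf (EEq (EV 11) (ECat TADR)) CSkip (CSet 0 (EN 1)))
     (CSeq (CCall 99 (PRE @ [EN 1, EV 9]) RUN) (CSet 11 (EN 0))))))"

definition PHI :: cmd where
  "PHI = CFor (EAdd (EV 1) (EN 1)) (CFor (EAdd (EV 1) (EN 1))
     (CSeq (CCall 9 (PRE @ [EV 10, EV 11, EN 0]) TEST) (CSeq (CSet 0 (EAdd (EV 0) (EV 9))) (CSet 9 (EN 0)))))"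

lemma loop_add: "loop f (a + b) s = loop (\<lambda>i. f (a + i)) b (loop f a s)"
  by (induction b) auto

lemma loop_first: "0 < m \<Longrightarrow> loop (\<lambda>r s. if r = 0 then f s else s) m s = f s"
proof (induction m)
  case (Suc m)
  then show ?case by (cases m) auto
qed simp

lemma loop_cong: "(\<And>i s. i < m \<Longrightarrow> f i s = g i s) \<Longrightarrow> loop f m s = loop g m s"
  by (induction m) auto

context prm
begin

text \<open>One tick \<open>t < 8 ^ k\<close> of the program that adds the \<open>k\<close>-th iterated square to a register matrix. The eight
  blocks of a level realise \<open>F0 F1 - (F0 + X) F1 + (F0 + X) (F1 + X) - F0 (F1 + X) = X X\<close>.\<close>

primrec stp :: "nat \<Rightarrow> nat \<Rightarrow> nat \<Rightarrow> nat \<Rightarrow> nat \<Rightarrow> regs \<Rightarrow> regs" where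
  "stp v 0 w s t F = addM F w 0 (bm F v) s"
| "stp v (Suc k) w s t F = (if odd (t div 8 ^ k) then stp v k (t div 8 ^ k mod 4 div 2) (t div 8 ^ k div 4) (t mod 8 ^ k) F
     else if t mod 8 ^ k = 0 then addM F w (Suc k) (mm N (F 0 k) (F 1 k)) ((s + t div 8 ^ k mod 4 div 2) mod 2) else F)"

lemma bm_addM [simp]: "w \<noteq> 2 \<Longrightarrow> bm (addM F w k M s) v = bm F v"
  by (simp add: bm_def bmc_def tq_def xv_def addM_def fun_eq_iff)

lemma addM_undo [simp]: "addM (addM F w k M 0) w k M 1 = F" "addM (addM F w k M 0) w k M (Suc 0) = F"
  by (auto simp: addM_def sg_def fun_eq_iff)

text \<open>The even blocks write to level \<open>Suc k\<close> and the odd ones to level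
  \<open>k\<close>, so neither disturbs the other. The target collects four signed products that
  combine to the square of \<open>X\<close>, and the last two odd blocks restore both
  operands.\<close>

lemma eight_blocks:
  assumes "s < 2"
    and F1: "F1 = addM F w (Suc k) (mm N (F 0 k) (F 1 k)) s"
    and F2: "F2 = addM F1 0 k X 0"
    and F3: "F3 = addM F2 w (Suc k) (mm N (F2 0 k) (F2 1 k)) ((s + 1) mod 2)"
    and F4: "F4 = addM F3 1 k X 0"
    and F5: "F5 = addM F4 w (Suc k) (mm N (F4 0 k) (F4 1 k)) s"
    and F6: "F6 = addM F5 0 k X 1"
    and F7: "F7 = addM F6 w (Suc k) (mm N (F6 0 k) (F6 1 k)) ((s + 1) mod 2)"
    and F8: "F8 = addM F7 1 k X 1"
  shows "F8 = addM F w (Suc k) (mm N X X) s"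
proof -
  have s: "s = 0 \<or> s = 1" using assms(1) by auto
  have sg': "sg ((s + 1) mod 2) = - sg s" using s by (auto simp: sg_def)
  define X' where "X' = (\<lambda>i j. if i < N \<and> j < N then X i j else 0)"
  have a: "addM G' w' k' M s' w'' k'' = G' w'' k''" if "w'' \<noteq> w' \<or> k'' \<noteq> k'" for G' w' k' M s' w'' k''
    using that by (auto simp: addM_def)
  have b: "addM G' w' k' X s' w' k' = (\<lambda>i j. G' w' k' i j + sg s' * X' i j)" for G' w' k' s'
    by (auto simp: addM_def X'_def fun_eq_iff)
  have c: "addM G' w' k' M s' w' k' i j = G' w' k' i j + (if i < N \<and> j < N then sg s' * M i j else 0)" for G' w' k' M s' i j
    by (simp add: addM_def)
  have g: "sg 0 = 1" "sg 1 = -1" by (simp_all add: sg_def)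
  have r1: "F1 0 k = F 0 k" "F1 1 k = F 1 k" unfolding F1 by (rule a, simp)+
  have r2: "F2 0 k = (\<lambda>i j. F 0 k i j + X' i j)" "F2 1 k = F 1 k" unfolding F2 by (simp_all add: a b g r1 del: One_nat_def)
  have r3: "F3 0 k = F2 0 k" "F3 1 k = F2 1 k" unfolding F3 by (rule a, simp)+
  have r4: "F4 0 k = (\<lambda>i j. F 0 k i j + X' i j)" "F4 1 k = (\<lambda>i j. F 1 k i j + X' i j)"
    unfolding F4 by (simp_all add: a b g r3 r2 del: One_nat_def)
  have r5: "F5 0 k = F4 0 k" "F5 1 k = F4 1 k" unfolding F5 by (rule a, simp)+
  have r6: "F6 0 k = F 0 k" "F6 1 k = (\<lambda>i j. F 1 k i j + X' i j)"
    unfolding F6 by (simp_all add: a b g r5 r4 del: One_nat_def)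
  have r7: "F7 0 k = F6 0 k" "F7 1 k = F6 1 k" unfolding F7 by (rule a, simp)+
  have r8: "F8 0 k = F 0 k" "F8 1 k = F 1 k"
    unfolding F8 by (simp_all add: a b g r7 r6 del: One_nat_def)
  have p: "F8 w (Suc k) = F7 w (Suc k)" "F6 w (Suc k) = F5 w (Suc k)" "F4 w (Suc k) = F3 w (Suc k)" "F2 w (Suc k) = F1 w (Suc k)"
    unfolding F8 F6 F4 F2 by (rule a, simp)+
  have d: "F8 w (Suc k) i j = F w (Suc k) i j + (if i < N \<and> j < N then sg s * (mm N (F 0 k) (F 1 k) i j
       - mm N (F2 0 k) (F2 1 k) i j + mm N (F4 0 k) (F4 1 k) i j - mm N (F6 0 k) (F6 1 k) i j) else 0)" for i j
  proof -
    have "F7 w (Suc k) i j = F6 w (Suc k) i j + (if i < N \<and> j < N then - sg s * mm N (F6 0 k) (F6 1 k) i j else 0)"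
      unfolding F7 c sg' ..
    moreover have "F5 w (Suc k) i j = F4 w (Suc k) i j + (if i < N \<and> j < N then sg s * mm N (F4 0 k) (F4 1 k) i j else 0)"
      unfolding F5 c ..
    moreover have "F3 w (Suc k) i j = F2 w (Suc k) i j + (if i < N \<and> j < N then - sg s * mm N (F2 0 k) (F2 1 k) i j else 0)"
      unfolding F3 c sg' ..
    moreover have "F1 w (Suc k) i j = F w (Suc k) i j + (if i < N \<and> j < N then sg s * mm N (F 0 k) (F 1 k) i j else 0)"
      unfolding F1 c ..
    ultimately show ?thesis unfolding p by (simp add: algebra_simps p del: One_nat_def)
  qed
  have e: "mm N (F 0 k) (F 1 k) i j - mm N (F2 0 k) (F2 1 k) i j + mm N (F4 0 k) (F4 1 k) i j - mm N (F6 0 k) (F6 1 k) i j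
      = mm N X X i j" if "i < N" "j < N" for i j
  proof -
    have "mm N X X i j = mm N X' X' i j" using that by (simp add: mm_def X'_def)
    then show ?thesis unfolding r2 r4 r6 by (simp add: mm_def algebra_simps sum.distrib)
  qed
  show ?thesis
  proof (intro ext)
    fix w' k' i j
    show "F8 w' k' i j = addM F w (Suc k) (mm N X X) s w' k' i j"
    proof (cases "w' = w \<and> k' = Suc k")
      case True
      have "F8 w (Suc k) i j = addM F w (Suc k) (mm N X X) s w (Suc k) i j" unfolding d using e by (simp add: addM_def)
      then show ?thesis using True by simp
    next
      case False
      then have R: "addM F w (Suc k) (mm N X X) s w' k' = F w' k'" using a by blast
      consider "w' = 0 \<and> k' = k" | "w' = 1 \<and> k' = k" | "\<not> (w' = 0 \<and> k' = k)" "\<not> (w' = 1 \<and> k' = k)" by blast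
      then have "F8 w' k' = F w' k'"
      proof cases
        case 3
        then have u: "w' \<noteq> w \<or> k' \<noteq> Suc k" "w' \<noteq> 0 \<or> k' \<noteq> k" "w' \<noteq> 1 \<or> k' \<noteq> k" using False by auto
        show ?thesis unfolding F8 a[OF u(3)] F7 a[OF u(1)] F6 a[OF u(2)] F5 a[OF u(1)] F4 a[OF u(3)] F3 a[OF u(1)]
            F2 a[OF u(2)] F1 a[OF u(1)] ..
      qed (use r8 in simp_all)
      then show ?thesis using R by simp
    qed
  qed
qed

text \<open>The ticks of a level fall into eight blocks of \<open>8 ^ k\<close> ticks. An odd block
  is a complete run of the lower level and an even one acts only at its first tick, so
  \<open>eight_blocks\<close> applies.\<close>

lemma loop_stp:
  assumes "w < 2" "s < 2"
  shows "loop (stp v k w s) (8 ^ k) F = addM F w k (mp N (bm F v) k) s"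
  using assms
proof (induction k arbitrary: w s F)
  case (Suc k)
  let ?m = "8 ^ k :: nat"
  have blk: "loop (\<lambda>r. stp v (Suc k) w s (b * ?m + r)) ?m F =
     (if odd b then addM F (b mod 4 div 2) k (mp N (bm F v) k) (b div 4)
      else addM F w (Suc k) (mm N (F 0 k) (F 1 k)) ((s + b mod 4 div 2) mod 2))" if b: "b < 8" for b F
  proof -
    have d: "(b * ?m + r) div ?m = b" "(b * ?m + r) mod ?m = r" if "r < ?m" for r using that by auto
    show ?thesis
    proof (cases "odd b")
      case True
      have "loop (\<lambda>r. stp v (Suc k) w s (b * ?m + r)) ?m F = loop (stp v k (b mod 4 div 2) (b div 4)) ?m F"
        using True d by (intro loop_cong) simp
      also have "\<dots> = addM F (b mod 4 div 2) k (mp N (bm F v) k) (b div 4)" using b by (intro Suc.IH) auto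
      finally show ?thesis using True by simp
    next
      case False
      have "loop (\<lambda>r. stp v (Suc k) w s (b * ?m + r)) ?m F =
         loop (\<lambda>r F. if r = 0 then addM F w (Suc k) (mm N (F 0 k) (F 1 k)) ((s + b mod 4 div 2) mod 2) else F) ?m F"
        using False d by (intro loop_cong) simp
      also have "\<dots> = addM F w (Suc k) (mm N (F 0 k) (F 1 k)) ((s + b mod 4 div 2) mod 2)" by (rule loop_first) simp
      finally show ?thesis using False by simp
    qed
  qed
  have w2: "w \<noteq> 2" using Suc.prems by simp
  define L where "L b = loop (stp v (Suc k) w s) (b * ?m) F" for b
  have L0: "L 0 = F" by (simp add: L_def)
  have LS: "L (Suc b) = (if odd b then addM (L b) (b mod 4 div 2) k (mp N (bm (L b) v) k) (b div 4)
      else addM (L b) w (Suc k) (mm N (L b 0 k) (L b 1 k)) ((s + b mod 4 div 2) mod 2))" if "b < 8" for b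
    unfolding blk[OF that, symmetric] L_def using loop_add[of "stp v (Suc k) w s" "b * ?m" ?m F] by (simp only: mult_Suc add.commute)
  \<comment> \<open>The blocks write to operand registers only, so all recursive runs use the same
    matrix.\<close>
  have bmL: "bm (L b) v = bm F v" if "b \<le> 8" for b
    using that
  proof (induction b)
    case (Suc b)
    have "b mod 4 div 2 < 2" by (simp add: less_mult_imp_div_less)
    then have "b mod 4 div 2 \<noteq> 2" by simp
    then show ?case using Suc w2 by (simp add: LS)
  qed (simp add: L0)
  have s2: "s mod 2 = s" using Suc.prems by simp
  have S: "L (Suc b) = (if odd b then addM (L b) (b mod 4 div 2) k (mp N (bm F v) k) (b div 4)
      else addM (L b) w (Suc k) (mm N (L b 0 k) (L b 1 k)) ((s + b mod 4 div 2) mod 2))" if "b < 8" for b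
    using LS[OF that] bmL[of b] that by simp
  have "L 8 = addM F w (Suc k) (mm N (mp N (bm F v) k) (mp N (bm F v) k)) s"
  proof (rule eight_blocks[OF Suc.prems(2)])
    show "L 1 = addM F w (Suc k) (mm N (F 0 k) (F 1 k)) s" using S[of 0] by (simp add: L0 s2)
    show "L 2 = addM (L 1) 0 k (mp N (bm F v) k) 0" using S[of 1] by (simp add: numeral_2_eq_2)
    show "L 3 = addM (L 2) w (Suc k) (mm N (L 2 0 k) (L 2 1 k)) ((s + 1) mod 2)" using S[of 2] by simp
    show "L 4 = addM (L 3) 1 k (mp N (bm F v) k) 0" using S[of 3] by simp
    show "L 5 = addM (L 4) w (Suc k) (mm N (L 4 0 k) (L 4 1 k)) s" using S[of 4] by (simp add: s2)
    show "L 6 = addM (L 5) 0 k (mp N (bm F v) k) 1" using S[of 5] by simp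
    show "L 7 = addM (L 6) w (Suc k) (mm N (L 6 0 k) (L 6 1 k)) ((s + 1) mod 2)" using S[of 6] by simp
    show "L 8 = addM (L 7) 1 k (mp N (bm F v) k) 1" using S[of 7] by simp
  qed
  then show ?case by (simp only: L_def mp.simps power_Suc)
qed simp

text \<open>The rounds of \<open>DESC\<close> on abstract states: level, operand, sign, rest of the
  tick, done flag, digit, registers.\<close>

definition dst :: "nat \<Rightarrow> nat \<times> nat \<times> nat \<times> nat \<times> nat \<times> nat \<times> regs \<Rightarrow> nat \<times> nat \<times> nat \<times> nat \<times> nat \<times> nat \<times> regs" where
  "dst v = (\<lambda>(k, w, s, t, d, b, F). if d \<noteq> 0 then (k, w, s, t, d, b, F)
     else if k = 0 then (k, w, s, t, 1, b, addM F w 0 (bm F v) s)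
     else let b' = t div 8 ^ (k - 1); t' = t mod 8 ^ (k - 1) in
       if odd b' then (k - 1, b' mod 4 div 2, b' div 4, t', 0, b', F)
       else (k - 1, w, s, t', 1, b', if t' = 0 then addM F w k (mm N (F 0 (k - 1)) (F 1 (k - 1))) ((s + b' mod 4 div 2) mod 2) else F))"

lemma dst_app: "dst v (k, w, s, t, d, b, F) = (if d \<noteq> 0 then (k, w, s, t, d, b, F)
     else if k = 0 then (k, w, s, t, 1, b, addM F w 0 (bm F v) s)
     else let b' = t div 8 ^ (k - 1); t' = t mod 8 ^ (k - 1) in
       if odd b' then (k - 1, b' mod 4 div 2, b' div 4, t', 0, b', F)
       else (k - 1, w, s, t', 1, b', if t' = 0 then addM F w k (mm N (F 0 (k - 1)) (F 1 (k - 1))) ((s + b' mod 4 div 2) mod 2) else F))"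
  by (simp add: dst_def)

definition dinv :: "nat \<times> nat \<times> nat \<times> nat \<times> nat \<times> nat \<times> regs \<Rightarrow> bool" where
  "dinv = (\<lambda>(k, w, s, t, d, b, F). k \<le> l \<and> w < 2 \<and> s < 2 \<and> t < 8 ^ k)"

lemma dst_inv: "dinv st \<Longrightarrow> dinv (dst v st)"
proof -
  assume a: "dinv st"
  obtain k w s t d b F where st: "st = (k, w, s, t, d, b, F)" by (rule prod_cases7)
  show ?thesis
  proof (cases k)
    case 0
    then show ?thesis using a by (simp add: st dinv_def dst_app)
  next
    case (Suc k')
    have "t div 8 ^ k' < 8" using a Suc by (simp add: st dinv_def less_mult_imp_div_less)
    then have "t div 8 ^ k' div 4 < 2" "t div 8 ^ k' mod 4 div 2 < 2" by (simp_all add: less_mult_imp_div_less)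
    then show ?thesis using a Suc by (simp add: st dinv_def dst_app Let_def)
  qed
qed

lemma dst_done: "d \<noteq> 0 \<Longrightarrow> (dst v ^^ m) (k, w, s, t, d, b, F) = (k, w, s, t, d, b, F)"
  by (induction m) (simp_all add: dst_app)

text \<open>Each round lowers the level or finishes, and a finished state is stationary; so any
  number of rounds above \<open>k\<close> gives the same result.\<close>

lemma dst_pow: "k < m \<Longrightarrow> (case (dst v ^^ m) (k, w, s, t, 0, b, F) of (k', w', s', t', d', b', F') \<Rightarrow> F') = stp v k w s t F"
proof (induction k arbitrary: m w s t b)
  case 0
  then obtain m' where m: "m = Suc m'" by (cases m) auto
  have "dst v (0, w, s, t, 0, b, F) = (0, w, s, t, 1, b, addM F w 0 (bm F v) s)" by (simp add: dst_app)
  then show ?case by (simp add: m funpow_Suc_right dst_done del: funpow.simps(2))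
next
  case (Suc k)
  then obtain m' where m: "m = Suc m'" "k < m'" by (cases m) auto
  show ?case
  proof (cases "odd (t div 8 ^ k)")
    case True
    then have "dst v (Suc k, w, s, t, 0, b, F) = (k, t div 8 ^ k mod 4 div 2, t div 8 ^ k div 4, t mod 8 ^ k, 0, t div 8 ^ k, F)"
      by (simp add: dst_app Let_def)
    then show ?thesis using True Suc.IH[OF m(2)] by (simp add: m(1) funpow_Suc_right del: funpow.simps(2))
  next
    case False
    then have "dst v (Suc k, w, s, t, 0, b, F) = (k, w, s, t mod 8 ^ k, 1, t div 8 ^ k,
       if t mod 8 ^ k = 0 then addM F w (Suc k) (mm N (F 0 k) (F 1 k)) ((s + t div 8 ^ k mod 4 div 2) mod 2) else F)"
      by (simp add: dst_app Let_def)
    then show ?thesis using False by (simp add: m(1) funpow_Suc_right dst_done del: funpow.simps(2))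
  qed
qed

lemma sem_DEVEN:
  assumes "w < 2" "Suc k < G" "s < 2"
  shows "sem W x DEVEN (fr 0 [v, k, w, s, t, p, d, b, c], mk C0 F, ot) =
    (fr 0 [v, k, w, s, t, p, 1, b, c],
      mk C0 (if t = 0 then addM F w (Suc k) (mm N (F 0 k) (F 1 k)) ((s + b mod 4 div 2) mod 2) else F), ot)"
proof -
  have "b mod 4 div 2 < 2" by (simp add: less_mult_imp_div_less)
  then have z: "(s + b mod 4 div 2) mod W = s + b mod 4 div 2" using assms W_big by simp
  have a: "map (\<lambda>e. eval W x e (fr 0 [v, k, w, s, t, p, 1, b, c]) C) (PRE @ [EV 11, EV 10,
     EMod (EAdd (EV 12) (EDiv (EMod (EV 16) (EN 4)) (EN 2))) (EN 2)]) = pre @ [w, k, (s + b mod 4 div 2) mod 2]" for C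
    unfolding map_append ev_PRE by (simp add: z)
  have M: "snd (callr W x MULALL (pre @ [w, k, (s + b mod 4 div 2) mod 2]) (mk C0 F, ot)) =
      (mk C0 (addM F w (Suc k) (mm N (F 0 k) (F 1 k)) ((s + b mod 4 div 2) mod 2)), ot)"
    by (rule callr_MULALL) (use assms in auto)
  have "sem W x DEVEN (fr 0 [v, k, w, s, t, p, d, b, c], mk C0 F, ot) =
     sem W x (CIf (EV 13) CSkip (CCall 99 (PRE @ [EV 11, EV 10,
     EMod (EAdd (EV 12) (EDiv (EMod (EV 16) (EN 4)) (EN 2))) (EN 2)]) MULALL)) (fr 0 [v, k, w, s, t, p, 1, b, c], mk C0 F, ot)"
    by (simp add: DEVEN_def)
  also have "\<dots> = (if t \<noteq> 0 then (fr 0 [v, k, w, s, t, p, 1, b, c], mk C0 F, ot) else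
      sem W x (CCall 99 (PRE @ [EV 11, EV 10,
     EMod (EAdd (EV 12) (EDiv (EMod (EV 16) (EN 4)) (EN 2))) (EN 2)]) MULALL) (fr 0 [v, k, w, s, t, p, 1, b, c], mk C0 F, ot))"
    by simp
  also have "sem W x (CCall 99 (PRE @ [EV 11, EV 10,
     EMod (EAdd (EV 12) (EDiv (EMod (EV 16) (EN 4)) (EN 2))) (EN 2)]) MULALL) (fr 0 [v, k, w, s, t, p, 1, b, c], mk C0 F, ot) =
     (fr 0 [v, k, w, s, t, p, 1, b, c], mk C0 (addM F w (Suc k) (mm N (F 0 k) (F 1 k)) ((s + b mod 4 div 2) mod 2)), ot)"
    by (subst sem_call99, simp, simp only: a M fst_conv snd_conv)
  finally show ?thesis by simp
qed

lemma callr_DESC: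
  assumes "t < 8 ^ l" "s < 2"
  shows "snd (callr W x DESC (pre @ [v, l, 0, s, t, E8, 0, 0]) (mk C0 F, ot)) = (mk C0 (stp v l 0 s t F), ot)"
proof -
  let ?em = "\<lambda>(k, w, s, t, d, b, F). (fr 0 [v, k, w, s, t, 8 ^ k, d, b], mk C0 F, ot)"
  let ?st = "(l, 0, s, t, 0, 0, F)"
  let ?g = "\<lambda>c. ?em ((dst v ^^ c) ?st)"
  have "sem W x DESC (fr 0 [v, l, 0, s, t, E8, 0, 0], mk C0 F, ot) = ?g (Suc l)"
    unfolding DESC_def
  proof (rule sem_for[where g = ?g])
    fix c
    have inv: "dinv ((dst v ^^ c) ?st)"
    proof (induction c)
      case 0
      show ?case using assms by (simp add: dinv_def)
    qed (simp add: dst_inv)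
    obtain k w s' t' d b F' where st: "(dst v ^^ c) ?st = (k, w, s', t', d, b, F')" by (rule prod_cases7)
    have i: "k \<le> l" "w < 2" "s' < 2" "t' < 8 ^ k" using inv by (simp_all add: st dinv_def)
    have sm: "(s' + y mod 4 div 2) mod W = s' + y mod 4 div 2" for y :: nat
    proof -
      have "y mod 4 div 2 < 2" by (simp add: less_mult_imp_div_less)
      then show ?thesis using i W_big by simp
    qed
    show "pop (sem W x DSTEP (push c (?g c))) = ?g (Suc c)"
    proof (cases k)
      case 0
      show ?thesis
      proof (cases "d = 0")
        case True
        then show ?thesis using 0 callr_LEAF[OF i(2,3), of v C0 F' ot]
          by (simp add: st dst_app DSTEP_def push_simp pop_simp sem_call99 PRE_def)
      qed (simp add: st dst_app DSTEP_def push_simp pop_simp)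
    next
      case (Suc k')
      have kG: "Suc k' < G" using Suc i(1) ql by simp
      show ?thesis
      proof (cases "d = 0")
        case True
        show ?thesis
        proof (cases "odd (t' div 8 ^ k')")
          case odd: True
          then show ?thesis using \<open>d = 0\<close> Suc
            by (simp add: st dst_app DSTEP_def push_simp pop_simp Let_def odd_iff_mod_2_eq_one)
        next
          case even: False
          then have e: "t' div 8 ^ k' mod 2 = 0" by (simp add: mod_2_eq_odd)
          have D: "dst v (k, w, s', t', d, b, F') = (k', w, s', t' mod 8 ^ k', 1, t' div 8 ^ k', if t' mod 8 ^ k' = 0
              then addM F' w (Suc k') (mm N (F' 0 k') (F' 1 k')) ((s' + t' div 8 ^ k' mod 4 div 2) mod 2) else F')"
            using \<open>d = 0\<close> Suc even by (simp add: dst_app Let_def)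
          have S: "sem W x DSTEP (push c (fr 0 [v, k, w, s', t', 8 ^ k, d, b], mk C0 F', ot)) =
             sem W x DEVEN (fr 0 [v, k', w, s', t' mod 8 ^ k', 8 ^ k', 0, t' div 8 ^ k', c], mk C0 F', ot)"
            using \<open>d = 0\<close> Suc by (simp add: DSTEP_def push_simp e)
          show ?thesis using S by (simp add: st D sem_DEVEN[OF i(2) kG i(3)] pop_simp)
        qed
      qed (simp add: st dst_app DSTEP_def push_simp pop_simp)
    qed
  qed (use ql G3 small in \<open>simp_all add: E8\<close>)
  then have "snd (sem W x DESC (fr 0 [v, l, 0, s, t, E8, 0, 0], mk C0 F, ot)) = snd (?g (Suc l))" by simp
  also have "\<dots> = (mk C0 (case (dst v ^^ Suc l) ?st of (k', w', s', t', d', b', F') \<Rightarrow> F'), ot)"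
    by (simp only: case_prod_beta snd_conv)
  also have "\<dots> = (mk C0 (stp v l 0 s t F), ot)" by (subst dst_pow) auto
  finally show ?thesis by (simp add: callr_def)
qed

lemma callr_RUN:
  assumes "s < 2"
  shows "snd (callr W x RUN (pre @ [s, v]) (mk C0 F, ot)) = (mk C0 (addM F 0 l (mp N (bm F v) l) s), ot)"
proof -
  let ?g = "\<lambda>t. (fr 0 [s, v], mk C0 (loop (stp v l 0 s) t F), ot)"
  have "sem W x RUN (fr 0 [s, v], mk C0 F, ot) = ?g E8"
    unfolding RUN_def
  proof (rule sem_for[where g = ?g])
    fix t assume "t < E8"
    then show "pop (sem W x (CCall 99 (PRE @ [EV 10, EV 7, EN 0, EV 9, EV 11, EV 8, EN 0, EN 0]) DESC) (push t (?g t))) = ?g (Suc t)"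
      using callr_DESC[OF _ assms, of t v C0 "loop (stp v l 0 s) t F" ot]
      by (simp add: push_simp pop_simp sem_call99 PRE_def E8)
  qed simp_all
  then show ?thesis using loop_stp[of 0 s v l F] assms by (simp add: callr_def E8)
qed

section \<open>The zero test for coefficients and the potential\<close>

definition tv :: "regs \<Rightarrow> nat \<Rightarrow> nat \<Rightarrow> bool" where
  "tv F v k \<longleftrightarrow> mp N (bm F v) l ((n * B + n) * B + k) (n * B) \<noteq> 0"

text \<open>The potential of the search. The term \<open>v = n\<close> takes the full matrix into
  account, so the rank enters besides the avoidable vertices.\<close>

definition Phi :: "regs \<Rightarrow> nat" where
  "Phi F = (\<Sum>v<n + 1. \<Sum>k<n + 1. of_bool (tv F v k))"

lemma xv_bounds: "0 \<le> xv F e" "xv F e \<le> int B ^ 10"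
proof -
  show "0 \<le> xv F e" by (simp add: xv_def sum_nonneg)
  have "xv F e \<le> (\<Sum>t<B * B. int TQ)" unfolding xv_def
  proof (rule sum_mono)
    fix t
    have "take_bit q (F 2 e t 0) < 2 ^ q" by (rule take_bit_int_less_exp)
    then show "take_bit q (F 2 e t 0) \<le> int TQ" unfolding TQ(1) by (simp only: of_nat_power of_nat_numeral less_imp_le)
  qed
  also have "\<dots> = int (B * B * TQ)" by simp
  also have "B * B * TQ \<le> B * B * (2 * B ^ 7)" using TQ(3) by (intro mult_left_mono) auto
  also have "\<dots> \<le> B * B * (B * B ^ 7)" using B2 by (intro mult_left_mono mult_right_mono) auto
  also have "\<dots> = B ^ 10" by (simp add: eval_nat_numeral)
  finally show "xv F e \<le> int B ^ 10" by simp
qed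

lemma bm_bound: "\<bar>bm F v i j\<bar> \<le> int B ^ 10"
proof -
  have p: "1 \<le> int B ^ 10" using B2 by (simp add: one_le_power)
  have "\<bar>tq F v u u'\<bar> \<le> int B ^ 10" for u u'
    using xv_bounds[of F "u * n + u'"] xv_bounds[of F "u' * n + u"] p by (simp add: tq_def)
  then have "\<bar>- tq F v u u'\<bar> \<le> int B ^ 10" "\<bar>tq F v u u'\<bar> \<le> int B ^ 10" for u u' by simp_all
  moreover have "\<bar>0 :: int\<bar> \<le> int B ^ 10" "\<bar>1 :: int\<bar> \<le> int B ^ 10" using p by simp_all
  ultimately show ?thesis unfolding bm_def bmc_def by (simp only: split: if_split) blast
qed

text \<open>Residues modulo \<open>2 ^ G\<close> are all that can be tested; this bound makes a zero
  residue mean zero.\<close>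

lemma mp_small: "i < N \<Longrightarrow> j < N \<Longrightarrow> \<bar>mp N (bm F v) l i j\<bar> < 2 ^ G"
proof -
  assume a: "i < N" "j < N"
  have N1: "1 \<le> int N" using a by simp
  have "\<bar>mp N (bm F v) l i j\<bar> \<le> int N * \<bar>mp N (bm F v) l i j\<bar>" using N1 by (intro mult_le_cancel_right1[THEN iffD2]) auto
  also have "\<dots> \<le> (int N * int B ^ 10) ^ 2 ^ l" by (rule mp_bound[OF _ a]) (rule bm_bound)
  also have "int N * int B ^ 10 = int B ^ 13" by (simp add: N flip: power_add)
  also have "(int B ^ 13) ^ 2 ^ l = int B ^ (13 * 2 ^ l)" by (rule power_mult[symmetric])
  also have "\<dots> \<le> int B ^ (13 * (4 * B))" using B2 l(2) by (intro power_increasing) auto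
  also have "\<dots> \<le> (2 ^ B) ^ (13 * (4 * B))"
  proof (rule power_mono)
    have "B < 2 ^ B" by (rule less_exp)
    then have "int B < int (2 ^ B)" by (simp only: of_nat_less_iff)
    then show "int B \<le> 2 ^ B" by simp
  qed simp
  also have "\<dots> = 2 ^ (B * (13 * (4 * B)))" by (rule power_mult[symmetric])
  also have "\<dots> < 2 ^ G"
  proof (rule power_strict_increasing)
    have "(2::nat) ^ 6 \<le> B ^ 6" using B2 by (intro power_mono) auto
    then have "52 < B ^ 6" by simp
    then have "52 * (B * B) < B ^ 6 * (B * B)" using B2 by (intro mult_strict_right_mono) auto
    also have "B ^ 6 * (B * B) = G" unfolding G power2_eq_square[symmetric] by (simp flip: power_add)
    finally show "B * (13 * (4 * B)) < G" by simp
  qed simp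
  finally show ?thesis .
qed

lemma start_less: "k \<le> n \<Longrightarrow> (n * B + n) * B + k < N" "n * B < N" "0 < N"
proof -
  show "0 < N" using B2 by (simp add: N)
  assume k: "k \<le> n"
  have "(n * B + n) * B + k < (n * B + n) * B + B" using k n_less by simp
  also have "\<dots> = (n * B + n + 1) * B" by simp
  also have "\<dots> \<le> (n * B + B) * B" using n_less by (intro mult_right_mono) auto
  also have "\<dots> = (n + 1) * B * B" by simp
  also have "\<dots> \<le> B * B * B" using n_less by (intro mult_right_mono) auto
  finally show "(n * B + n) * B + k < N" by (simp add: N power3_eq_cube)
next
  have "n * B < B * B" using n_less by simp
  also have "\<dots> \<le> B * B * B" using B2 by simp
  finally show "n * B < N" by (simp add: N power3_eq_cube)
qed

lemma callr_TEST:
  assumes k: "k \<le> n"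
  shows "callr W x TEST (pre @ [v, k, 0]) (mk C0 F, ot) = (of_bool (tv F v k), mk C0 F, ot)"
proof -
  let ?i = "(n * B + n) * B + k" and ?j = "n * B"
  define X where "X = mp N (bm F v) l ?i ?j"
  define y where "y = F 0 l ?i ?j"
  have ij: "?i < N" "?j < N" using start_less k by auto
  have ijG: "?i < G" "?j < G" "?i < W" "?j < W" using ij[THEN N_G] small by auto
  have evi: "((n * B mod W + n) mod W * B mod W + k) mod W = ?i" "n * B mod W = n * B"
    using ijG by (simp_all only: mod_simps mod_less)
  have w2: "(0::nat) < 3" "0 < G" using G3 by auto
  have T: "eval W x TADR (fr r [v, k, c, b]) C = adr 0 l ?i ?j b" if b: "b < G" for r c b C
  proof -
    have e: "eval W x (EAdd (EMul (EAdd (EMul (EV 1) (EV 2)) (EV 1)) (EV 2)) (EV 10)) (fr r [v, k, c, b]) C = ?i"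
      "eval W x (EMul (EV 1) (EV 2)) (fr r [v, k, c, b]) C = ?j" "eval W x (EN 0) (fr r [v, k, c, b]) C = 0"
      using evi ijG by simp_all
    have "eval W x TADR (fr r [v, k, c, b]) C =
       adr (eval W x (EN 0) (fr r [v, k, c, b]) C) (eval W x (EV 7) (fr r [v, k, c, b]) C)
        (eval W x (EAdd (EMul (EAdd (EMul (EV 1) (EV 2)) (EV 1)) (EV 2)) (EV 10)) (fr r [v, k, c, b]) C)
        (eval W x (EMul (EV 1) (EV 2)) (fr r [v, k, c, b]) C) (eval W x (EV 12) (fr r [v, k, c, b]) C)"
      unfolding TADR_def by (rule eval_adr) (unfold e, use ijG ql b in simp_all)
    then show ?thesis unfolding e by simp
  qed
  have rd: "mk C0 H ! adr 0 l ?i ?j b = bit (H 0 l ?i ?j) b" if "b < G" for H b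
    using mk_nth[OF w2(1) ql(2) ijG(1,2) that] .
  have aX: "addM F 0 l (mp N (bm F v) l) 0 0 l ?i ?j = y + X" using ij by (simp add: addM_def X_def y_def sg_def)
  note R = callr_RUN[of 0 v C0 F ot] callr_RUN[of 1 v C0 "addM F 0 l (mp N (bm F v) l) 0" ot]
  let ?g = "\<lambda>b. (fr (of_bool (\<exists>b'<b. bit y b' \<noteq> bit (y + X) b')) [v, k, 0], mk C0 F, ot)"
  have "sem W x TEST (fr 0 [v, k, 0], mk C0 F, ot) = ?g G"
    unfolding TEST_def
  proof (rule sem_for[where g = ?g])
    fix b assume b: "b < G"
    have e: "(\<exists>b'<Suc b. bit y b' \<noteq> bit (y + X) b') \<longleftrightarrow> bit y b \<noteq> bit (y + X) b \<or> (\<exists>b'<b. bit y b' \<noteq> bit (y + X) b')"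
      by (auto simp: less_Suc_eq)
    show "pop (sem W x (CSeq (CSet 11 (ECat TADR)) (CSeq (CCall 99 (PRE @ [EN 0, EV 9]) RUN)
     (CSeq (CIf (EEq (EV 11) (ECat TADR)) CSkip (CSet 0 (EN 1)))
     (CSeq (CCall 99 (PRE @ [EN 1, EV 9]) RUN) (CSet 11 (EN 0)))))) (push b (?g b))) = ?g (Suc b)"
      using R b unfolding e
      by (cases "bit y b = bit (y + X) b")
         (simp_all add: push_simp pop_simp sem_call99 ev_PRE T rd aX y_def[symmetric])
  qed simp_all
  \<comment> \<open>Equality of all \<open>G\<close> bits says that \<open>2 ^ G\<close> divides
    \<open>X\<close>, and by \<open>mp_small\<close> then \<open>X = 0\<close>.\<close>
  moreover have "(\<exists>b'<G. bit y b' \<noteq> bit (y + X) b') \<longleftrightarrow> tv F v k"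
  proof -
    have "(\<exists>b'<G. bit y b' \<noteq> bit (y + X) b') \<longleftrightarrow> take_bit G y \<noteq> take_bit G (y + X)"
      by (auto simp: bit_eq_iff bit_take_bit_iff)
    also have "\<dots> \<longleftrightarrow> \<not> 2 ^ G dvd X"
      unfolding take_bit_eq_mod using mod_eq_dvd_iff[of "y + X" "2 ^ G" y] by auto
    also have "\<dots> \<longleftrightarrow> X \<noteq> 0" using mp_small[OF ij, of F v] zdvd_not_zless[of "\<bar>X\<bar>" "2 ^ G"] by (auto simp: X_def)
    finally show ?thesis by (simp add: tv_def X_def)
  qed
  ultimately show ?thesis by (simp add: callr_def)
qed

lemma Phi_le: "Phi F \<le> (n + 1) * (n + 1)"
proof -
  have "Phi F \<le> (\<Sum>v<n + 1. \<Sum>k<n + 1. 1)" unfolding Phi_def by (intro sum_mono) simp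
  then show ?thesis by simp
qed

lemma Phi_B: "Phi F \<le> B * B" "Phi F < W"
proof -
  have "(n + 1) * (n + 1) \<le> B * B" using n_less by (intro mult_mono) auto
  then show "Phi F \<le> B * B" using Phi_le[of F] by linarith
  then show "Phi F < W" using BB_G by simp
qed

lemma callr_PHI: "callr W x PHI (pre @ [0]) (mk C0 F, ot) = (Phi F, mk C0 F, ot)"
proof -
  let ?t = "\<lambda>v k. of_bool (tv F v k) :: nat"
  have nW: "Suc n mod W = Suc n" using n_less small BB_G(3)[of "Suc n"] B2 by (simp add: Suc_le_eq le_trans[of "Suc n" B "B * B"])
  let ?b = "CSeq (CCall 9 (PRE @ [EV 10, EV 11, EN 0]) TEST) (CSeq (CSet 0 (EAdd (EV 0) (EV 9))) (CSet 9 (EN 0)))"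
  have L: "sem W x (CFor (EAdd (EV 1) (EN 1)) ?b) (fr (\<Sum>v'<v. \<Sum>k<Suc n. ?t v' k) [0, v], mk C0 F, ot) =
     (fr (\<Sum>v'<Suc v. \<Sum>k<Suc n. ?t v' k) [0, v], mk C0 F, ot)" if v: "v < Suc n" for v
  proof -
    let ?g = "\<lambda>m. (fr ((\<Sum>v'<v. \<Sum>k<Suc n. ?t v' k) + (\<Sum>k<m. ?t v k)) [0, v], mk C0 F, ot)"
    have "sem W x (CFor (EAdd (EV 1) (EN 1)) ?b) (fr (\<Sum>v'<v. \<Sum>k<Suc n. ?t v' k) [0, v], mk C0 F, ot) = ?g (Suc n)"
    proof (rule sem_for[where g = ?g])
      fix m assume m: "m < Suc n"
      \<comment> \<open>Partial counts stay below the final potential, hence below the word size: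
        the addition does not wrap around.\<close>
      have "(\<Sum>v'<v. \<Sum>k<Suc n. ?t v' k) + (\<Sum>k<Suc m. ?t v k) \<le> (\<Sum>v'<Suc v. \<Sum>k<Suc n. ?t v' k)"
        unfolding sum.lessThan_Suc[of _ v] using m by (intro add_left_mono sum_mono2) auto
      also have "\<dots> \<le> Phi F" unfolding Phi_def Suc_eq_plus1[symmetric] using v by (intro sum_mono2) auto
      finally have "(\<Sum>v'<v. \<Sum>k<Suc n. ?t v' k) + (\<Sum>k<m. ?t v k) + ?t v m < W" using Phi_B(2)[of F] by simp
      then show "pop (sem W x ?b (push m (?g m))) = ?g (Suc m)" using m callr_TEST[of m v C0 F ot]
        by (simp add: push_simp pop_simp sem_call ev_PRE add.assoc del: sum.lessThan_Suc[of _ n] add: sum.lessThan_Suc[of _ m] )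
    qed (simp_all add: nW)
    then show ?thesis by simp
  qed
  let ?g = "\<lambda>v. (fr (\<Sum>v'<v. \<Sum>k<Suc n. ?t v' k) [0], mk C0 F, ot)"
  have "sem W x PHI (fr 0 [0], mk C0 F, ot) = ?g (Suc n)"
    unfolding PHI_def
  proof (rule sem_for[where g = ?g])
    fix v assume "v < Suc n"
    then show "pop (sem W x (CFor (EAdd (EV 1) (EN 1)) ?b) (push v (?g v))) = ?g (Suc v)"
      using L[of v] by (simp only: push_simp pop_simp append.simps butlast.simps list.simps if_False if_True simp_thms)
  qed (simp_all add: nW)
  then show ?thesis by (simp add: callr_def Phi_def)
qed

end

section \<open>Local search and its reversal\<close>

definition CSeqs :: "cmd list \<Rightarrow> cmd" where
  "CSeqs cs = foldr CSeq cs CSkip"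

lemma sem_CSeqs [simp]: "sem W x (CSeqs []) s = s" "sem W x (CSeqs (c # cs)) s = sem W x (CSeqs cs) (sem W x c s)"
  by (simp_all add: CSeqs_def)

definition TRYSTEP :: cmd where
  "TRYSTEP = CSeqs [CCall 99 (PRE @ [EV 9, EV 10, EV 18, EN 1]) SETW, CCall 17 (PRE @ [EN 0]) PHI,
     CIf (ELess (EV 17) (EV 15)) (CSet 16 (EAdd (EV 16) (EN 1))) CSkip, CSet 17 (EN 0)]"

text \<open>Slots 9 to 12 hold edge, step, candidate value and previous edge; 13 the old value, 14
  and 15 the old and new potential, 16 the index of the old value among the worse ones. The old
  value is written back before the verdict.\<close>

definition TRY :: cmd where
  "TRY = CSeqs [CCall 13 (PRE @ [EV 9, EV 10, EN 1]) READ, CCall 14 (PRE @ [EN 0]) PHI,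
     CCall 99 (PRE @ [EV 9, EV 10, EV 11, EN 1]) SETW, CCall 15 (PRE @ [EN 0]) PHI,
     CFor (EV 13) TRYSTEP,
     CCall 99 (PRE @ [EV 9, EV 10, EV 13, EN 1]) SETW,
     CIf (ELess (EV 14) (EV 15)) (CIf (EEq (EDiv (EV 11) (EMul (EV 4) (EV 4))) (EV 12))
       (CIf (EEq (EMod (EDiv (EV 11) (EV 4)) (EV 4)) (EV 16)) (CSet 0 (EN 1)) CSkip) CSkip) CSkip]"

text \<open>A hit is coded as \<open>1 + e + B * w\<close>, so that 0 can mean that nothing has been
  found; once set, the code is kept.\<close>

definition FINDSTEP :: cmd where
  "FINDSTEP = CIf (EV 0) CSkip (CSeqs [CCall 11 (PRE @ [EV 12, EV 9, EV 13, EV 10, EN 0, EN 0, EN 0, EN 0, EN 0]) TRY,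
     CIf (EV 11) (CSet 0 (EAdd (EAdd (EN 1) (EV 12)) (EMul (EV 2) (EV 13)))) CSkip, CSet 11 (EN 0)])"

definition FIND :: cmd where
  "FIND = CFor (EMul (EV 1) (EV 1)) (CFor (EV 6) FINDSTEP)"

text \<open>Values are tried in increasing order while the index is counted down at each worse one.
  When a worse value meets index 0, it is the old one; the flag in slot 13 then leaves it in
  place.\<close>

definition UNDSTEP :: cmd where
  "UNDSTEP = CIf (EV 13) CSkip (CSeqs [CCall 99 (PRE @ [EV 9, EV 10, EV 15, EN 1]) SETW, CCall 14 (PRE @ [EN 0]) PHI,
     CIf (ELess (EV 14) (EV 12)) (CIf (EV 11) (CSet 11 (ESub (EV 11) (EN 1))) (CSet 13 (EN 1))) CSkip, CSet 14 (EN 0)])"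

definition UND :: cmd where
  "UND = CSeq (CCall 12 (PRE @ [EN 0]) PHI) (CFor (EV 6) UNDSTEP)"

context prm
begin

section \<open>Changing one summand, trying values and finding the old one again\<close>

definition st :: "regs \<Rightarrow> nat \<Rightarrow> nat \<Rightarrow> nat \<Rightarrow> regs" where
  "st F e s a = upd F 2 e s 0 (sl (F 2 e s 0) a)"

definition rd :: "regs \<Rightarrow> nat \<Rightarrow> nat \<Rightarrow> nat" where
  "rd F e s = nat (take_bit q (F 2 e s 0))"

lemma rd_less: "rd F e s < TQ"
proof -
  have "take_bit q (F 2 e s 0) < 2 ^ q" by (rule take_bit_int_less_exp)
  then show ?thesis unfolding rd_def TQ(1) by (simp add: nat_less_iff)
qed

lemma TQ_int: "a < TQ \<Longrightarrow> int a mod 2 ^ q = int a"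
  using TQ(1) by (simp flip: of_nat_power of_nat_mod)

lemma sl_sl: "a < TQ \<Longrightarrow> sl (sl y a) b = sl y b"
  using TQ_int[of a] by (simp add: sl_def mod_add_eq minus_mod_eq_mult_div algebra_simps)

lemma st_st: "a < TQ \<Longrightarrow> st (st F e s a) e s b = st F e s b"
  by (simp add: st_def sl_sl)

lemma rd_st: "a < TQ \<Longrightarrow> rd (st F e s a) e s = a"
  using TQ_int[of a] by (simp add: rd_def st_def sl_def take_bit_eq_mod minus_mod_eq_mult_div)

lemma st_rd: "st F e s (rd F e s) = F"
  by (simp add: rd_def st_def sl_def take_bit_eq_mod)

definition cnt :: "regs \<Rightarrow> nat \<Rightarrow> nat \<Rightarrow> nat \<Rightarrow> nat \<Rightarrow> nat" where
  "cnt F e s m p = card {a. a < m \<and> Phi (st F e s a) < p}"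

lemma cnt_Suc: "cnt F e s (Suc m) p = cnt F e s m p + of_bool (Phi (st F e s m) < p)"
proof -
  have "{a. a < Suc m \<and> Phi (st F e s a) < p} =
     (if Phi (st F e s m) < p then insert m {a. a < m \<and> Phi (st F e s a) < p} else {a. a < m \<and> Phi (st F e s a) < p})"
    by (auto simp: less_Suc_eq)
  then show ?thesis by (simp add: cnt_def)
qed

lemma cnt_0: "cnt F e s 0 p = 0" by (simp add: cnt_def)

lemma cnt_le: "cnt F e s m p \<le> m"
  by (induction m) (auto simp: cnt_0 cnt_Suc)

lemma cnt_mono: "m \<le> m' \<Longrightarrow> cnt F e s m p \<le> cnt F e s m' p"
  unfolding cnt_def by (intro card_mono) auto

text \<open>The value \<open>w\<close> is an improvement that encodes the edge \<open>ep\<close> changed before and the index of the old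
  value among the values that are worse than \<open>w\<close>.\<close>

definition good :: "regs \<Rightarrow> nat \<Rightarrow> nat \<Rightarrow> nat \<Rightarrow> nat \<Rightarrow> bool" where
  "good F e s w ep \<longleftrightarrow> Phi F < Phi (st F e s w) \<and> w div (N * N) = ep \<and>
     w div N mod N = cnt F e s (rd F e s) (Phi (st F e s w))"

lemma NN_W: "N * N mod W = N * N"
proof -
  have "N * N = B ^ 6" by (simp add: N flip: power_add)
  moreover have "B ^ 6 < B ^ 7" using B2 by simp
  ultimately show ?thesis using WB[of 7 "N * N"] by simp
qed

lemma SETW_st: "e < G \<Longrightarrow> s < G \<Longrightarrow> w < TQ \<Longrightarrow> snd (callr W x SETW (pre @ [e, s, w, 1]) (mk C0 F, ot)) = (mk C0 (st F e s w), ot)"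
  using callr_SETW by (simp add: st_def)

lemma READ_rd: "e < G \<Longrightarrow> s < G \<Longrightarrow> callr W x READ (pre @ [e, s, 1]) (mk C0 F, ot) = (rd F e s, mk C0 F, ot)"
  using callr_READ by (simp add: rd_def)

lemma callr_TRY:
  assumes r: "e < G" "s < G" "w < TQ"
  shows "callr W x TRY (pre @ [e, s, w, ep, 0, 0, 0, 0, 0]) (mk C0 F, ot) = (of_bool (good F e s w ep), mk C0 F, ot)"
proof -
  define v p p' where d: "v = rd F e s" "p = Phi F" "p' = Phi (st F e s w)"
  have vT: "v < TQ" by (simp add: d rd_less)
  \<comment> \<open>Trial values are not cleared away between rounds: before round \<open>a\<close>
    the tape holds \<open>a - 1\<close>, or \<open>w\<close> at the start. The next write overwrites
    it anyway.\<close>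
  let ?h = "\<lambda>a. if a = 0 then st F e s w else st F e s (a - 1)"
  have hst: "st (?h a) e s b = st F e s b" if "a < TQ" for a b using that r(3) by (simp add: st_st)
  let ?g = "\<lambda>a. (fr 0 [e, s, w, ep, v, p, p', cnt F e s a p', 0], mk C0 (?h a), ot)"
  have L: "sem W x (CFor (EV 13) TRYSTEP) (fr 0 [e, s, w, ep, v, p, p', 0, 0], mk C0 (st F e s w), ot) = ?g v"
  proof (rule sem_for[where g = ?g])
    fix a assume a: "a < v"
    then have aT: "a < TQ" using vT by simp
    have "cnt F e s a p' < W" using cnt_le[of F e s a p'] aT small by simp
    moreover have "Suc (cnt F e s a p') < W" using cnt_le[of F e s a p'] a vT small by simp
    moreover note SETW_st[OF r(1,2) aT, of C0 "?h a" ot, unfolded hst[OF aT]]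
    moreover note callr_PHI[of C0 "st F e s a" ot]
    ultimately show "pop (sem W x TRYSTEP (push a (?g a))) = ?g (Suc a)"
      by (simp add: TRYSTEP_def push_simp pop_simp sem_call99 sem_call ev_PRE cnt_Suc)
  qed (simp_all add: cnt_0)
  have B1: "sem W x (CCall 13 (PRE @ [EV 9, EV 10, EN 1]) READ) (fr 0 [e, s, w, ep, 0, 0, 0, 0, 0], mk C0 F, ot) =
     (fr 0 [e, s, w, ep, v, 0, 0, 0, 0], mk C0 F, ot)"
    using READ_rd[OF r(1,2), of C0 F ot] by (simp add: sem_call ev_PRE d(1))
  have B2': "sem W x (CCall 14 (PRE @ [EN 0]) PHI) (fr 0 [e, s, w, ep, v, 0, 0, 0, 0], mk C0 F, ot) =
     (fr 0 [e, s, w, ep, v, p, 0, 0, 0], mk C0 F, ot)"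
    using callr_PHI[of C0 F ot] by (simp add: sem_call ev_PRE d(2))
  have B3: "sem W x (CCall 99 (PRE @ [EV 9, EV 10, EV 11, EN 1]) SETW) (fr 0 [e, s, w, ep, v, p, 0, 0, 0], mk C0 F, ot) =
     (fr 0 [e, s, w, ep, v, p, 0, 0, 0], mk C0 (st F e s w), ot)"
    using SETW_st[OF r, of C0 F ot] by (simp add: sem_call99 ev_PRE)
  have B4: "sem W x (CCall 15 (PRE @ [EN 0]) PHI) (fr 0 [e, s, w, ep, v, p, 0, 0, 0], mk C0 (st F e s w), ot) =
     (fr 0 [e, s, w, ep, v, p, p', 0, 0], mk C0 (st F e s w), ot)"
    using callr_PHI[of C0 "st F e s w" ot] by (simp add: sem_call ev_PRE d(3))
  have B5: "sem W x (CCall 99 (PRE @ [EV 9, EV 10, EV 13, EN 1]) SETW) (?g v) =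
     (fr 0 [e, s, w, ep, v, p, p', cnt F e s v p', 0], mk C0 F, ot)"
    using SETW_st[OF r(1,2) vT, of C0 "?h v" ot, unfolded hst[OF vT]] by (simp add: sem_call99 ev_PRE d(1) st_rd)
  have B6: "sem W x (CIf (ELess (EV 14) (EV 15)) (CIf (EEq (EDiv (EV 11) (EMul (EV 4) (EV 4))) (EV 12))
       (CIf (EEq (EMod (EDiv (EV 11) (EV 4)) (EV 4)) (EV 16)) (CSet 0 (EN 1)) CSkip) CSkip) CSkip)
       (fr 0 [e, s, w, ep, v, p, p', cnt F e s v p', 0], mk C0 F, ot) =
     (fr (of_bool (good F e s w ep)) [e, s, w, ep, v, p, p', cnt F e s v p', 0], mk C0 F, ot)"
    unfolding good_def d[symmetric] by (simp add: NN_W)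
  have "sem W x TRY (fr 0 [e, s, w, ep, 0, 0, 0, 0, 0], mk C0 F, ot) =
     (fr (of_bool (good F e s w ep)) [e, s, w, ep, v, p, p', cnt F e s v p', 0], mk C0 F, ot)"
    unfolding TRY_def sem_CSeqs B1 B2' B3 B4 L B5 B6 ..
  then show ?thesis by (simp add: callr_def)
qed

definition fnd :: "regs \<Rightarrow> nat \<Rightarrow> nat \<Rightarrow> nat" where
  "fnd F s ep = loop (\<lambda>e r. loop (\<lambda>w r. if r \<noteq> 0 then r else if good F e s w ep then 1 + e + B * w else 0) TQ r) (n * n) 0"

lemma nn_B: "n * n < B"
  using nB B by auto

lemma e_G: "e < n * n \<Longrightarrow> e < G"
  using nn_B BB_G(2)[of e] B2 mult_le_mono[of 1 B e B] by simp

lemma code_W: "e < n * n \<Longrightarrow> w < TQ \<Longrightarrow> 1 + e + B * w < W"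
proof -
  assume a: "e < n * n" "w < TQ"
  have "1 + e + B * w \<le> B + B * w" using nn_B a(1) by simp
  also have "\<dots> = B * (w + 1)" by simp
  also have "\<dots> \<le> B * (2 * B ^ 7)" using a(2) TQ(3) by (intro mult_left_mono) auto
  also have "\<dots> \<le> B * (B * B ^ 7)" using B2 by (intro mult_left_mono mult_right_mono) auto
  also have "\<dots> = B ^ 9" by (simp add: eval_nat_numeral)
  also have "\<dots> < B ^ 10" using B2 by (intro power_strict_increasing) auto
  finally show ?thesis using WB[of 10] by simp
qed

lemma callr_FIND:
  assumes s: "s < G"
  shows "callr W x FIND (pre @ [s, ep, 0]) (mk C0 F, ot) = (fnd F s ep, mk C0 F, ot)"
proof -
  let ?f = "\<lambda>e w r. if r \<noteq> 0 then r else if good F e s w ep then 1 + e + B * w else 0"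
  have L: "sem W x (CFor (EV 6) FINDSTEP) (fr r [s, ep, 0, e], mk C0 F, ot) = (fr (loop (?f e) TQ r) [s, ep, 0, e], mk C0 F, ot)"
    if e: "e < n * n" for e r
  proof (rule sem_for[where g = "\<lambda>w. (fr (loop (?f e) w r) [s, ep, 0, e], mk C0 F, ot)"])
    fix w assume w: "w < TQ"
    have c: "(Suc e mod W + B * w mod W) mod W = Suc (e + B * w)" using code_W[OF e w] by (simp add: mod_simps)
    show "pop (sem W x FINDSTEP (push w (fr (loop (?f e) w r) [s, ep, 0, e], mk C0 F, ot))) =
       (fr (loop (?f e) (Suc w) r) [s, ep, 0, e], mk C0 F, ot)"
    proof (cases "loop (?f e) w r = 0")
      case True
      show ?thesis using callr_TRY[OF e_G[OF e] s w, of ep C0 F ot]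
        by (simp add: True FINDSTEP_def push_simp pop_simp sem_call ev_PRE c)
    next
      case False
      then show ?thesis by (simp add: FINDSTEP_def push_simp pop_simp)
    qed
  qed simp_all
  let ?g = "\<lambda>e. (fr (loop (\<lambda>e r. loop (?f e) TQ r) e 0) [s, ep, 0], mk C0 F, ot)"
  have "sem W x FIND (fr 0 [s, ep, 0], mk C0 F, ot) = ?g (n * n)"
    unfolding FIND_def
  proof (rule sem_for[where g = ?g])
    fix e assume "e < n * n"
    then show "pop (sem W x (CFor (EV 6) FINDSTEP) (push e (?g e))) = ?g (Suc e)"
      using L[of e] by (simp add: push_simp pop_simp)
  qed (use nn_B small in simp_all)
  then show ?thesis by (simp add: callr_def fnd_def)
qed

lemma fnd_0: "fnd F s ep = 0 \<Longrightarrow> e < n * n \<Longrightarrow> w < TQ \<Longrightarrow> \<not> good F e s w ep"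
proof -
  assume z: "fnd F s ep = 0" and e: "e < n * n" and w: "w < TQ"
  let ?f = "\<lambda>e w r. if r \<noteq> 0 then r else if good F e s w ep then 1 + e + B * w else 0"
  have keep: "r \<noteq> 0 \<Longrightarrow> loop (?f e) m r = r" for e m r by (induction m) auto
  have "loop (\<lambda>e r. loop (?f e) TQ r) (Suc e) 0 = 0"
  proof (rule ccontr)
    assume a: "loop (\<lambda>e r. loop (?f e) TQ r) (Suc e) 0 \<noteq> 0"
    have "loop (\<lambda>e r. loop (?f e) TQ r) m 0 \<noteq> 0" if "Suc e \<le> m" for m
      using that
    proof (induction m rule: dec_induct)
      case (step m)
      then show ?case using keep by simp
    qed (rule a)
    from this[OF Suc_leI[OF e]] show False using z unfolding fnd_def by contradiction
  qed
  then have a: "loop (?f e) TQ (loop (\<lambda>e r. loop (?f e) TQ r) e 0) = 0" by (simp only: loop.simps)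
  have "loop (\<lambda>e r. loop (?f e) TQ r) e 0 = 0"
  proof (rule ccontr)
    assume b: "loop (\<lambda>e r. loop (?f e) TQ r) e 0 \<noteq> 0"
    show False using keep[OF b, of e TQ] a b by (simp only: )
  qed
  then have 1: "loop (?f e) TQ 0 = 0" using a by (simp only: )
  have c: "loop (?f e) m 0 \<noteq> 0" if "loop (?f e) (Suc w) 0 \<noteq> 0" "Suc w \<le> m" for m
    using that(2)
  proof (induction m rule: dec_induct)
    case (step m)
    then show ?case by simp
  qed (rule that(1))
  have "loop (?f e) (Suc w) 0 = 0"
  proof (rule ccontr)
    assume "loop (?f e) (Suc w) 0 \<noteq> 0"
    from c[OF this Suc_leI[OF w]] show False using 1 by contradiction
  qed
  then show ?thesis by (auto split: if_splits)
qed

lemma fnd_nz: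
  assumes "fnd F s ep \<noteq> 0"
  obtains e w where "e < n * n" "w < TQ" "good F e s w ep" "fnd F s ep = 1 + e + B * w"
proof -
  let ?f = "\<lambda>e w r. if r \<noteq> 0 then r else if good F e s w ep then 1 + e + B * w else 0"
  let ?Q = "\<lambda>r. r = 0 \<or> (\<exists>e<n * n. \<exists>w<TQ. good F e s w ep \<and> r = 1 + e + B * w)"
  have a: "?Q r \<Longrightarrow> e < n * n \<Longrightarrow> m \<le> TQ \<Longrightarrow> ?Q (loop (?f e) m r)" for e m r
  proof (induction m)
    case (Suc m)
    then have "?Q (loop (?f e) m r)" by simp
    then show ?case
    proof (cases "loop (?f e) m r = 0 \<and> good F e s m ep")
      case True
      then have "loop (?f e) (Suc m) r = 1 + e + B * m" by simp
      moreover have "m < TQ" using Suc.prems(3) by simp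
      ultimately show ?thesis using True Suc.prems(2) by (intro disjI2) (rule exI[of _ e], auto)
    next
      case False
      then have "loop (?f e) (Suc m) r = loop (?f e) m r" by auto
      then show ?thesis using \<open>?Q (loop (?f e) m r)\<close> by (simp only: )
    qed
  qed simp
  have b: "m \<le> n * n \<Longrightarrow> ?Q (loop (\<lambda>e r. loop (?f e) TQ r) m 0)" for m
  proof (induction m)
    case (Suc m)
    then have "?Q (loop (?f m) TQ (loop (\<lambda>e r. loop (?f e) TQ r) m 0))" by (intro a) simp_all
    then show ?case by (simp only: loop.simps)
  qed simp
  have "?Q (fnd F s ep)" unfolding fnd_def by (rule b) simp
  then show ?thesis using assms that by blast
qed

text \<open>Here \<open>F\<close> is the state after the improvement and \<open>v\<close> the old
  value. It is worse than the current one, hence it is determined by the number of worse values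
  before it.\<close>

lemma callr_UND:
  assumes r: "e < G" "s < G" and v: "v < TQ" "Phi (st F e s v) < Phi F"
  shows "snd (callr W x UND (pre @ [e, s, cnt F e s v (Phi F), 0, 0, 0]) (mk C0 F, ot)) = (mk C0 (st F e s v), ot)"
proof -
  define p i where d: "p = Phi F" "i = cnt F e s v (Phi F)"
  let ?h = "\<lambda>a. if a = 0 then F else if a \<le> v then st F e s (a - 1) else st F e s v"
  have hst: "st (?h a) e s b = st F e s b" if "a < TQ" for a b using that v(1) by (simp add: st_st)
  let ?g = "\<lambda>a. (fr 0 [e, s, i - cnt F e s a p, p, of_bool (v < a), 0], mk C0 (?h a), ot)"
  have P: "sem W x (CCall 12 (PRE @ [EN 0]) PHI) (fr 0 [e, s, i, 0, 0, 0], mk C0 F, ot) = (fr 0 [e, s, i, p, 0, 0], mk C0 F, ot)"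
    using callr_PHI[of C0 F ot] by (simp add: sem_call ev_PRE d(1))
  have "sem W x (CFor (EV 6) UNDSTEP) (fr 0 [e, s, i, p, 0, 0], mk C0 F, ot) = ?g TQ"
  proof (rule sem_for[where g = ?g])
    fix a assume a: "a < TQ"
    show "pop (sem W x UNDSTEP (push a (?g a))) = ?g (Suc a)"
    proof (cases "v < a")
      case True
      then have "i \<le> cnt F e s a p" using cnt_mono[of v a] by (simp add: d)
      then show ?thesis using True by (simp add: UNDSTEP_def push_simp pop_simp cnt_Suc)
    next
      case False
      note S = SETW_st[OF r a, of C0 "?h a" ot, unfolded hst[OF a]] callr_PHI[of C0 "st F e s a" ot]
      \<comment> \<open>Before \<open>v\<close> is reached the remaining index is positive at every
        worse value, as \<open>v\<close> itself is not yet counted; at \<open>v\<close> it is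
        exactly 0.\<close>
      have 1: "Phi (st F e s a) < p \<Longrightarrow> a < v \<Longrightarrow> i - cnt F e s a p \<noteq> 0"
        using cnt_mono[of "Suc a" v F e s p] by (simp add: d cnt_Suc)
      have 2: "a = v \<Longrightarrow> i - cnt F e s a p = 0 \<and> Phi (st F e s a) < p" using v by (simp add: d)
      consider "a = v" | "a < v" "Phi (st F e s a) < p" | "a < v" "\<not> Phi (st F e s a) < p" using False by linarith
      then show ?thesis
      proof cases
        case 1
        then show ?thesis using 2 S by (simp add: UNDSTEP_def push_simp pop_simp sem_call99 sem_call ev_PRE cnt_Suc)
      next
        case c: 2
        then show ?thesis using 1 S by (simp add: UNDSTEP_def push_simp pop_simp sem_call99 sem_call ev_PRE cnt_Suc)
      next
        case 3
        then show ?thesis using S by (simp add: UNDSTEP_def push_simp pop_simp sem_call99 sem_call ev_PRE cnt_Suc)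
      qed
    qed
  qed (simp_all add: cnt_0)
  then have "snd (sem W x UND (fr 0 [e, s, i, 0, 0, 0], mk C0 F, ot)) = (mk C0 (?h TQ), ot)"
    unfolding UND_def sem.simps(5) P by simp
  then show ?thesis using v(1) by (simp add: callr_def d)
qed

end

section \<open>Forward search, output and reversal\<close>

definition FWDSTEP :: cmd where
  "FWDSTEP = CSeqs [CCall 11 (PRE @ [EV 9, EV 10, EN 0]) FIND,
     CIf (EV 11) (CSeqs [CSet 11 (ESub (EV 11) (EN 1)),
       CCall 99 (PRE @ [EMod (EV 11) (EV 2), EV 9, EDiv (EV 11) (EV 2), EN 1]) SETW,
       CSet 10 (EMod (EV 11) (EV 2)), CSet 9 (EAdd (EV 9) (EN 1))]) CSkip,
     CSet 11 (EN 0)]"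

definition OUTSTEP :: cmd where
  "OUTSTEP = CSeqs [CCall 11 (PRE @ [EV 1, EV 14, EN 0]) TEST, CIf (EV 11) (CSet 12 (EV 14)) CSkip, CSet 11 (EN 0)]"

text \<open>The value left behind by the step tells where to go back: its middle digit is the index
  handed to \<open>UND\<close>, its leading part the edge changed in the step before.\<close>

definition UNDOSTEP :: cmd where
  "UNDOSTEP = CIf (EV 9) (CSeqs [CSet 9 (ESub (EV 9) (EN 1)), CCall 11 (PRE @ [EV 10, EV 9, EN 1]) READ,
     CCall 99 (PRE @ [EV 10, EV 9, EMod (EDiv (EV 11) (EV 4)) (EV 4), EN 0, EN 0, EN 0]) UND,
     CSet 10 (EDiv (EV 11) (EMul (EV 4) (EV 4))), CSet 11 (EN 0)]) CSkip"

text \<open>\<open>B * B\<close> rounds suffice because every step raises the potential. The output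
  is half of the rank. Its leading power of two is found by doubling from 1, so that the number 0
  yields the single digit 0.\<close>

definition SEARCH :: cmd where
  "SEARCH = CSeqs [CFor (EMul (EV 2) (EV 2)) FWDSTEP, CFor (EAdd (EV 1) (EN 1)) OUTSTEP,
     CSet 12 (EDiv (EV 12) (EN 2)), CSet 13 (EN 1),
     CFor (EV 2) (CIf (ELess (EV 12) (EMul (EV 13) (EN 2))) CSkip (CSet 13 (EMul (EV 13) (EN 2)))),
     CFor (EV 2) (CIf (EV 13) (CSeq (CEmit (EMod (EDiv (EV 12) (EV 13)) (EN 2))) (CSet 13 (EDiv (EV 13) (EN 2)))) CSkip),
     CFor (EMul (EV 2) (EV 2)) UNDOSTEP]"

text \<open>The parameters are computed from the input length, which is found by scanning until the
  end value 2 appears. The loops with \<open>G\<close> rounds stop doubling once the required bound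
  is reached; slot 10 is auxiliary.\<close>

definition SETUP :: cmd where
  "SETUP = CSeqs [CFor ETop (CIf (ELess (EIn (EV 11)) (EN 2)) (CSet 9 (EAdd (EV 9) (EN 1))) CSkip),
     CSet 2 (EAdd (EV 9) (EN 2)),
     CFor (EAdd (EV 9) (EN 1)) (CIf (ELess (EV 9) (EMul (EV 11) (EV 11))) CSkip (CSet 1 (EV 11))),
     CSet 4 (EMul (EMul (EV 2) (EV 2)) (EV 2)), CSet 3 (EMul (EMul (EV 4) (EV 4)) (EMul (EV 2) (EV 2))),
     CSet 6 (EN 1), CSet 10 (EMul (EMul (EV 4) (EV 4)) (EV 2)),
     CFor (EV 3) (CIf (ELess (EV 6) (EV 10)) (CSeq (CSet 6 (EMul (EV 6) (EN 2))) (CSet 5 (EAdd (EV 5) (EN 1)))) CSkip),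
     CSet 10 (EN 1), CSet 8 (EN 1),
     CFor (EV 3) (CIf (ELess (EV 10) (EMul (EN 2) (EV 2))) (CSeq (CSet 10 (EMul (EV 10) (EN 2)))
       (CSeq (CSet 7 (EAdd (EV 7) (EN 1))) (CSet 8 (EMul (EV 8) (EN 8))))) CSkip),
     CCall 99 (PRE @ [EN 0, EN 0, EN 0, EN 0, EN 0]) SEARCH]"

text \<open>\<open>max 1 m\<close> treats zero as having one digit, in accordance with
  \<open>binary\<close>.\<close>

lemma binary_digits:
  assumes "2 ^ j \<le> max 1 m" "m < 2 ^ Suc j"
  shows "binary m = map (\<lambda>i. odd (m div 2 ^ (j - i))) [0..<Suc j]"
  using assms
proof (induction j arbitrary: m)
  case 0
  then have "m = 0 \<or> m = 1" by auto
  then show ?case by (subst binary.simps) auto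
next
  case (Suc j)
  have m2: "2 \<le> m"
  proof (rule ccontr)
    assume "\<not> 2 \<le> m"
    then have "(2::nat) ^ Suc j \<le> 1" using Suc.prems(1) by (simp add: max_def split: if_splits)
    moreover have "(1::nat) < 2 ^ Suc j" by (rule one_less_power) auto
    ultimately show False by linarith
  qed
  have "2 ^ j \<le> max 1 (m div 2)" "m div 2 < 2 ^ Suc j" using Suc.prems m2 by auto
  then have "binary (m div 2) = map (\<lambda>i. odd (m div 2 div 2 ^ (j - i))) [0..<Suc j]" by (rule Suc.IH)
  also have "\<dots> = map (\<lambda>i. odd (m div 2 ^ (Suc j - i))) [0..<Suc j]"
    by (intro map_cong refl) (auto simp: div_mult2_eq[symmetric] Suc_diff_le less_Suc_eq_le simp del: upt_Suc)
  finally show ?case using m2 by (subst binary.simps) simp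
qed

lemma log2_exists: "\<exists>j. 2 ^ j \<le> max 1 m \<and> m < 2 ^ Suc j" for m :: nat
proof (induction m rule: less_induct)
  case (less m)
  show ?case
  proof (cases "m < 2")
    case True
    then show ?thesis by (intro exI[of _ 0]) auto
  next
    case False
    then obtain j where "2 ^ j \<le> max 1 (m div 2)" "m div 2 < 2 ^ Suc j" using less[of "m div 2"] by auto
    then show ?thesis using False by (intro exI[of _ "Suc j"]) auto
  qed
qed

lemma loop_max:
  "(\<forall>k<m. P k \<longrightarrow> k \<le> loop (\<lambda>k r. if P k then k else r) m 0) \<and>
   ((\<exists>k<m. P k) \<longrightarrow> P (loop (\<lambda>k r. if P k then k else r) m 0)) \<and> loop (\<lambda>k r. if P k then k else r) m 0 \<le> m - 1"
  by (induction m) (auto simp: less_Suc_eq)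

context prm
begin

text \<open>The history of a search from \<open>F0\<close>: after \<open>s\<close> steps, the last
  of which changed edge \<open>ep\<close>. Undoing follows it backwards.\<close>

inductive reach :: "regs \<Rightarrow> regs \<Rightarrow> nat \<Rightarrow> nat \<Rightarrow> bool" for F0 where
  reach_0: "reach F0 F0 0 0"
| reach_Suc: "reach F0 F s ep \<Longrightarrow> e < n * n \<Longrightarrow> w < TQ \<Longrightarrow> good F e s w ep \<Longrightarrow> reach F0 (st F e s w) (Suc s) e"

lemma reach_Phi: "reach F0 F s ep \<Longrightarrow> s \<le> Phi F"
proof (induction rule: reach.induct)
  case (reach_Suc F s ep e w)
  then show ?case by (simp add: good_def)
qed simp

lemma reach_ep: "reach F0 F s ep \<Longrightarrow> ep < B"
  by (induction rule: reach.induct) (use nn_B B2 in auto)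

lemma reach_back: "reach F0 F s ep \<Longrightarrow> s \<noteq> 0 \<Longrightarrow>
  \<exists>F' w ep'. reach F0 F' (s - 1) ep' \<and> ep < n * n \<and> w < TQ \<and> good F' ep (s - 1) w ep' \<and> F = st F' ep (s - 1) w"
  by (erule reach.cases) auto

lemma reach_0D: "reach F0 F 0 ep \<Longrightarrow> F = F0"
  by (erule reach.cases) auto

definition fws :: "regs \<times> nat \<times> nat \<Rightarrow> regs \<times> nat \<times> nat" where
  "fws = (\<lambda>(F, s, ep). if fnd F s ep = 0 then (F, s, ep)
     else (st F ((fnd F s ep - 1) mod B) s ((fnd F s ep - 1) div B), Suc s, (fnd F s ep - 1) mod B))"

lemma code_dec: "e < n * n \<Longrightarrow> (1 + e + B * w - 1) mod B = e \<and> (1 + e + B * w - 1) div B = w"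
  using nn_B by simp

lemma fws_inv:
  assumes "reach F0 F s ep" "fnd F s ep \<noteq> 0"
  obtains e w where "e < n * n" "w < TQ" "good F e s w ep" "(fnd F s ep - 1) mod B = e" "(fnd F s ep - 1) div B = w"
    "fws (F, s, ep) = (st F e s w, Suc s, e)"
proof -
  obtain e w where ew: "e < n * n" "w < TQ" "good F e s w ep" "fnd F s ep = 1 + e + B * w"
    using fnd_nz[OF assms(2)] .
  have d: "(fnd F s ep - 1) mod B = e" "(fnd F s ep - 1) div B = w" using code_dec[OF ew(1), of w] unfolding ew(4) by auto
  show ?thesis using that[OF ew(1-3) d] assms(2) d by (simp add: fws_def)
qed

text \<open>Either every round so far has made a step or the search is already stuck; a bound on the
  steps then yields a local optimum.\<close>

lemma fws_pow:
  "case (fws ^^ t) (F0, 0, 0) of (F, s, ep) \<Rightarrow> reach F0 F s ep \<and> s \<le> t \<and> (s = t \<or> fnd F s ep = 0)"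
proof (induction t)
  case 0
  show ?case by (simp add: reach_0)
next
  case (Suc t)
  obtain F s ep where F: "(fws ^^ t) (F0, 0, 0) = (F, s, ep)" by (rule prod_cases3)
  have IH: "reach F0 F s ep" "s \<le> t" "s = t \<or> fnd F s ep = 0" using Suc by (auto simp: F)
  show ?case
  proof (cases "fnd F s ep = 0")
    case True
    then have "fws (F, s, ep) = (F, s, ep)" by (simp add: fws_def)
    then show ?thesis using True IH by (simp add: F)
  next
    case False
    then obtain e w where ew: "e < n * n" "w < TQ" "good F e s w ep" "fws (F, s, ep) = (st F e s w, Suc s, e)"
      using fws_inv[OF IH(1)] by metis
    have "s = t" using False IH(3) by simp
    then show ?thesis using reach_Suc[OF IH(1) ew(1-3)] ew(4) by (simp add: F)
  qed
qed

lemma BW: "B * B mod W = B * B" "B * B < G"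
  using BB_G(2,3)[of "B * B"] by auto

lemma sem_FWD:
  "sem W x (CFor (EMul (EV 2) (EV 2)) FWDSTEP) (fr 0 [0, 0, 0, r, p], mk C0 F0, ot) =
    (case (fws ^^ (B * B)) (F0, 0, 0) of (F, s, ep) \<Rightarrow> (fr 0 [s, ep, 0, r, p], mk C0 F, ot))"
proof -
  let ?g = "\<lambda>t. case (fws ^^ t) (F0, 0, 0) of (F, s, ep) \<Rightarrow> (fr 0 [s, ep, 0, r, p], mk C0 F, ot)"
  show ?thesis
  proof (rule sem_for[where g = ?g])
    fix t assume t: "t < B * B"
    obtain F s ep where F: "(fws ^^ t) (F0, 0, 0) = (F, s, ep)" by (rule prod_cases3)
    have i: "reach F0 F s ep" "s \<le> t" using fws_pow[where t = t and ?F0.0 = F0] by (auto simp: F)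
    have s: "s < G" "Suc s < W" using i(2) t BB_G(1)[of s] BB_G(3)[of "Suc s"] by auto
    note FD = callr_FIND[OF s(1), of ep C0 F ot]
    have "sem W x FWDSTEP (fr 0 [s, ep, 0, r, p, t], mk C0 F, ot) =
       (case fws (F, s, ep) of (F, s, ep) \<Rightarrow> (fr 0 [s, ep, 0, r, p, t], mk C0 F, ot))"
    proof (cases "fnd F s ep = 0")
      case True
      then show ?thesis using FD by (simp add: FWDSTEP_def sem_call ev_PRE fws_def)
    next
      case False
      obtain e w where ew: "e < n * n" "w < TQ" "(fnd F s ep - 1) mod B = e" "(fnd F s ep - 1) div B = w"
         "fws (F, s, ep) = (st F e s w, Suc s, e)"
        using fws_inv[OF i(1) False] by metis
      note S = SETW_st[OF e_G[OF ew(1)] s(1) ew(2), of C0 F ot]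
      show ?thesis using FD False S s(2) ew(3,4)
        by (simp add: FWDSTEP_def sem_call sem_call99 ev_PRE ew(5))
    qed
    then show "pop (sem W x FWDSTEP (push t (?g t))) = ?g (Suc t)"
      by (simp add: F push_simp case_prod_beta pop_def)
  qed (simp_all add: BW)
qed

text \<open>The largest \<open>k\<close> that passes the test on the full matrix, which is its
  rank.\<close>

definition mx :: "regs \<Rightarrow> nat" where
  "mx F = loop (\<lambda>k r. if tv F n k then k else r) (n + 1) 0"

lemma mx_le: "mx F \<le> n"
  using loop_max[of "n + 1" "tv F n"] by (simp add: mx_def)

lemma Sn_W: "Suc n < W" "Suc n mod W = Suc n"
  using n_less small by auto

lemma sem_OUT:
  "sem W x (CFor (EAdd (EV 1) (EN 1)) OUTSTEP) (fr 0 [s, ep, 0, 0, p], mk C0 F, ot) = (fr 0 [s, ep, 0, mx F, p], mk C0 F, ot)"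
proof -
  let ?g = "\<lambda>m. (fr 0 [s, ep, 0, loop (\<lambda>k r. if tv F n k then k else r) m 0, p], mk C0 F, ot)"
  have "sem W x (CFor (EAdd (EV 1) (EN 1)) OUTSTEP) (fr 0 [s, ep, 0, 0, p], mk C0 F, ot) = ?g (n + 1)"
  proof (rule sem_for[where g = ?g])
    fix m assume "m < n + 1"
    then show "pop (sem W x OUTSTEP (push m (?g m))) = ?g (Suc m)"
      using callr_TEST[of m n C0 F ot] by (simp add: OUTSTEP_def push_simp pop_simp sem_call ev_PRE)
  qed (simp_all add: Sn_W)
  then show ?thesis by (simp add: mx_def)
qed

lemma sem_EMIT:
  assumes m: "m \<le> n"
  shows "\<exists>p. sem W x (CSeqs [CSet 13 (EN 1),
     CFor (EV 2) (CIf (ELess (EV 12) (EMul (EV 13) (EN 2))) CSkip (CSet 13 (EMul (EV 13) (EN 2)))),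
     CFor (EV 2) (CIf (EV 13) (CSeq (CEmit (EMod (EDiv (EV 12) (EV 13)) (EN 2))) (CSet 13 (EDiv (EV 13) (EN 2)))) CSkip)])
     (fr 0 [s, ep, 0, m, p0], C, ot) = (fr 0 [s, ep, 0, m, p], C, ot @ binary m)"
proof -
  obtain j where j: "2 ^ j \<le> max 1 m" "m < 2 ^ Suc j" using log2_exists by blast
  have "max 1 m < B" using m n_less B2 by simp
  then have jB: "2 ^ j < B" using j(1) by linarith
  then have j1: "Suc j \<le> B" using less_exp[of j] by linarith
  have p2: "2 * 2 ^ k < W" if "k \<le> j" for k
  proof -
    have "(2::nat) ^ k \<le> 2 ^ j" using that by (intro power_increasing) auto
    then have "2 ^ k \<le> B" using jB by linarith
    then have "2 * 2 ^ k \<le> B * B" using B2 by (intro mult_le_mono) auto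
    then show ?thesis using BB_G(3) by blast
  qed
  let ?c1 = "CFor (EV 2) (CIf (ELess (EV 12) (EMul (EV 13) (EN 2))) CSkip (CSet 13 (EMul (EV 13) (EN 2))))"
  let ?c2 = "CFor (EV 2) (CIf (EV 13) (CSeq (CEmit (EMod (EDiv (EV 12) (EV 13)) (EN 2))) (CSet 13 (EDiv (EV 13) (EN 2)))) CSkip)"
  have 1: "sem W x ?c1 (fr 0 [s, ep, 0, m, 1], C, ot) = (fr 0 [s, ep, 0, m, 2 ^ min B j], C, ot)"
  proof (rule sem_for[where g = "\<lambda>k. (fr 0 [s, ep, 0, m, 2 ^ min k j], C, ot)"])
    fix k
    show "pop (sem W x (CIf (ELess (EV 12) (EMul (EV 13) (EN 2))) CSkip (CSet 13 (EMul (EV 13) (EN 2))))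
       (push k (fr 0 [s, ep, 0, m, 2 ^ min k j], C, ot))) = (fr 0 [s, ep, 0, m, 2 ^ min (Suc k) j], C, ot)"
    proof (cases "k < j")
      case True
      have "(2::nat) ^ Suc k \<le> 2 ^ j" using True by (intro power_increasing) auto
      moreover have "(1::nat) < 2 ^ Suc k" by (rule one_less_power) auto
      ultimately have "2 * 2 ^ k \<le> m" using j(1) by (simp add: max_def split: if_splits)
      then show ?thesis using True p2[of k] by (simp add: push_simp pop_simp min_def mult.commute)
    next
      case False
      then show ?thesis using j(2) p2[of j] by (simp add: push_simp pop_simp min_def mult.commute)
    qed
  qed simp_all
  let ?d = "\<lambda>i. odd (m div 2 ^ (j - i))"
  let ?g = "\<lambda>k. (fr 0 [s, ep, 0, m, if k \<le> j then 2 ^ (j - k) else 0], C, ot @ map ?d [0..<min k (Suc j)])"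
  have 2: "sem W x ?c2 (fr 0 [s, ep, 0, m, 2 ^ j], C, ot) = ?g B"
  proof (rule sem_for[where g = ?g])
    fix k
    show "pop (sem W x (CIf (EV 13) (CSeq (CEmit (EMod (EDiv (EV 12) (EV 13)) (EN 2))) (CSet 13 (EDiv (EV 13) (EN 2)))) CSkip)
       (push k (?g k))) = ?g (Suc k)"
    proof (cases "k \<le> j")
      case True
      have "(2::nat) ^ (j - k) div 2 = (if Suc k \<le> j then 2 ^ (j - Suc k) else 0)"
      proof (cases "Suc k \<le> j")
        case True
        then have "j - k = Suc (j - Suc k)" by simp
        then show ?thesis using True by simp
      qed (use True in simp)
      then show ?thesis using True by (simp add: push_simp pop_simp odd_iff_mod_2_eq_one)
    next
      case False
      then show ?thesis by (simp add: push_simp pop_simp)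
    qed
  qed simp_all
  have "sem W x (CSeqs [CSet 13 (EN 1), ?c1, ?c2]) (fr 0 [s, ep, 0, m, p0], C, ot) = ?g B"
    using 1 2 j1 by simp
  then show ?thesis using j1 by (auto simp: binary_digits[OF j] min_def simp del: upt_Suc)
qed

text \<open>Each round inverts the last step: the weight in summand \<open>s - 1\<close> still
  carries its record, from which the old value, the previous edge and so the previous state are
  recovered. Rounds after step 0 do nothing.\<close>

lemma sem_UNDO:
  assumes "reach F0 F s ep" "s \<le> B * B"
  shows "\<exists>env. sem W x (CFor (EMul (EV 2) (EV 2)) UNDOSTEP) (fr 0 [s, ep, 0, r, p], mk C0 F, ot) = (env, mk C0 F0, ot)"
proof -
  let ?f = "\<lambda>k s. pop (sem W x UNDOSTEP (push k s))"
  have "\<exists>F' ep'. loop ?f t (fr 0 [s, ep, 0, r, p], mk C0 F, ot) = (fr 0 [s - t, ep', 0, r, p], mk C0 F', ot) \<and> reach F0 F' (s - t) ep'" for t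
  proof (induction t)
    case 0
    show ?case using assms by auto
  next
    case (Suc t)
    then obtain F' ep' where F': "loop ?f t (fr 0 [s, ep, 0, r, p], mk C0 F, ot) = (fr 0 [s - t, ep', 0, r, p], mk C0 F', ot)"
      "reach F0 F' (s - t) ep'" by blast
    show ?case
    proof (cases "s - t = 0")
      case True
      then show ?thesis using F' by (intro exI[of _ F'] exI[of _ ep']) (simp add: UNDOSTEP_def push_simp pop_simp)
    next
      case False
      define u where "u = s - Suc t"
      have u: "s - t - 1 = u" "s - t - Suc 0 = u" "s - Suc t = u" by (simp_all add: u_def)
      obtain H w e' where H: "reach F0 H u e'" "ep' < n * n" "w < TQ" "good H ep' u w e'" "F' = st H ep' u w"
        using reach_back[OF F'(2) False] unfolding u by (elim exE conjE) (rule that)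
      have uG: "u < G" using assms(2) BB_G(2)[of u] by (simp add: u_def)
      define v where "v = rd H ep' u"
      have v: "v < TQ" by (simp add: v_def rd_less)
      have bk: "st F' ep' u v = H" using H(3,5) by (simp add: st_st v_def st_rd)
      \<comment> \<open>The count tries values for the very summand in which the two states differ,
        so it is the same before and after the step.\<close>
      have cn: "cnt F' ep' u m pp = cnt H ep' u m pp" for m pp using H(3,5) by (simp add: cnt_def st_st)
      have gd: "Phi H < Phi F'" "w div (N * N) = e'" "w div N mod N = cnt F' ep' u v (Phi F')"
        using H(4) cn[of "rd H ep' u" "Phi F'"] unfolding good_def v_def H(5) by auto
      have ph: "Phi (st F' ep' u v) < Phi F'" using gd(1) by (simp add: bk)
      note U = callr_UND[OF e_G[OF H(2)] uG v ph, of C0 ot, unfolded bk gd(3)[symmetric]]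
      have rw: "rd F' ep' u = w" using H(3,5) by (simp add: rd_st)
      note R = READ_rd[OF e_G[OF H(2)] uG, of C0 F' ot, unfolded rw]
      have "?f t (fr 0 [s - t, ep', 0, r, p], mk C0 F', ot) = (fr 0 [u, e', 0, r, p], mk C0 H, ot)"
        using False U R gd(2) by (simp add: UNDOSTEP_def push_simp pop_simp sem_call sem_call99 ev_PRE u NN_W)
      then show ?thesis using F'(1) H(1) by (intro exI[of _ H] exI[of _ e']) (simp add: u)
    qed
  qed
  then obtain F' ep' where L: "loop ?f (B * B) (fr 0 [s, ep, 0, r, p], mk C0 F, ot) = (fr 0 [s - B * B, ep', 0, r, p], mk C0 F', ot)"
     "reach F0 F' (s - B * B) ep'" by blast
  have z: "s - B * B = 0" using assms by simp
  have "F' = F0" by (rule reach_0D[where ep = ep']) (use L(2) in \<open>simp only: z\<close>)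
  then have "loop ?f (B * B) (fr 0 [s, ep, 0, r, p], mk C0 F, ot) = (fr 0 [0, ep', 0, r, p], mk C0 F0, ot)"
    using L(1) z by simp
  then show ?thesis by (simp add: sem.simps(7) BW)
qed

lemma callr_SEARCH:
  "\<exists>F s ep. fnd F s ep = 0 \<and> s < B * B \<and> ep < B \<and>
     snd (callr W x SEARCH (pre @ [0, 0, 0, 0, 0]) (mk C0 F0, ot)) = (mk C0 F0, ot @ binary (mx F div 2))"
proof -
  obtain F s ep where F: "(fws ^^ (B * B)) (F0, 0, 0) = (F, s, ep)" by (rule prod_cases3)
  have i: "reach F0 F s ep" "s \<le> B * B" "s = B * B \<or> fnd F s ep = 0" using fws_pow[where t = "B * B" and ?F0.0 = F0] by (auto simp: F)
  have "n \<le> n * n" by simp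
  \<comment> \<open>\<open>B\<close> exceeds the input length by 2; the strict inequality leaves one
    spare round, which shows that the search has stopped.\<close>
  then have "n + 1 < B" using nB B by linarith
  then have "(n + 1) * (n + 1) < B * B" by (intro mult_strict_mono) auto
  then have s: "s < B * B" using reach_Phi[OF i(1)] Phi_le[of F] by linarith
  have m: "mx F div 2 \<le> n" using mx_le[of F] by simp
  obtain p where E: "sem W x (CSeqs [CSet 13 (EN 1),
     CFor (EV 2) (CIf (ELess (EV 12) (EMul (EV 13) (EN 2))) CSkip (CSet 13 (EMul (EV 13) (EN 2)))),
     CFor (EV 2) (CIf (EV 13) (CSeq (CEmit (EMod (EDiv (EV 12) (EV 13)) (EN 2))) (CSet 13 (EDiv (EV 13) (EN 2)))) CSkip)])
     (fr 0 [s, ep, 0, mx F div 2, 0], mk C0 F, ot) = (fr 0 [s, ep, 0, mx F div 2, p], mk C0 F, ot @ binary (mx F div 2))"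
    using sem_EMIT[OF m, of s ep 0 "mk C0 F" ot] by blast
  obtain env where U: "sem W x (CFor (EMul (EV 2) (EV 2)) UNDOSTEP) (fr 0 [s, ep, 0, mx F div 2, p], mk C0 F, ot @ binary (mx F div 2)) =
      (env, mk C0 F0, ot @ binary (mx F div 2))" using sem_UNDO[OF i(1,2)] by blast
  have S: "sem W x (CSet 12 (EDiv (EV 12) (EN 2))) (fr 0 [s, ep, 0, mx F, 0], mk C0 F, ot) = (fr 0 [s, ep, 0, mx F div 2, 0], mk C0 F, ot)"
    by simp
  have "sem W x SEARCH (fr 0 [0, 0, 0, 0, 0], mk C0 F0, ot) = (env, mk C0 F0, ot @ binary (mx F div 2))"
    unfolding SEARCH_def sem_CSeqs sem_FWD F case_prod_conv sem_OUT S E[unfolded sem_CSeqs] U ..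
  then have "snd (callr W x SEARCH (pre @ [0, 0, 0, 0, 0]) (mk C0 F0, ot)) = (mk C0 F0, ot @ binary (mx F div 2))"
    by (simp add: callr_def)
  then show ?thesis using i(3) s reach_ep[OF i(1)] by (intro exI[of _ F] exI[of _ s] exI[of _ ep]) simp
qed

text \<open>If some value were better, consider those whose leading part is \<open>ep\<close> and
  whose middle digit is the index with respect to the maximal potential. The last digit has
  \<open>N\<close> choices and fewer than \<open>N\<close> values are not optimal; so one of these
  is optimal and encodes what is required, and it would have been found.\<close>

lemma local_opt:
  assumes few: "\<And>b. b < TQ \<Longrightarrow> card {a. a < TQ \<and> Phi (st F e s a) < Phi (st F e s b)} < N"
    and z: "fnd F s ep = 0" and ep: "ep < B" and e: "e < n * n" and b: "b < TQ"
  shows "Phi (st F e s b) \<le> Phi F"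
proof (rule ccontr)
  assume neg: "\<not> ?thesis"
  define p where "p = Max ((\<lambda>a. Phi (st F e s a)) ` {..<TQ})"
  have ne: "{..<TQ} \<noteq> {}" using b by auto
  have "p \<in> (\<lambda>a. Phi (st F e s a)) ` {..<TQ}" unfolding p_def by (rule Max_in) (use ne in auto)
  then obtain c where c: "c < TQ" "p = Phi (st F e s c)" by auto
  have mx: "Phi (st F e s a) \<le> p" if "a < TQ" for a unfolding p_def using that by (intro Max_ge) auto
  have lt: "Phi F < p" using mx[OF b] neg by linarith
  let ?bad = "{a. a < TQ \<and> Phi (st F e s a) < p}"
  have bad: "card ?bad < N" using few[OF c(1)] by (simp add: c(2))
  define i where "i = cnt F e s (rd F e s) p"
  have "i \<le> card ?bad" unfolding i_def cnt_def using rd_less[of F e s] by (intro card_mono) auto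
  then have i: "i < N" using bad by simp
  \<comment> \<open>The index is taken with respect to the maximum \<open>p\<close>, which is
    justified because the chosen value will attain \<open>p\<close>.\<close>
  let ?S = "(\<lambda>r. ep * (N * N) + i * N + r) ` {..<N}"
  have "card ?S = N" by (subst card_image) (auto simp: inj_on_def)
  then have "\<not> ?S \<subseteq> ?bad" using bad card_mono[of ?bad ?S] by fastforce
  then obtain w where "w \<in> ?S" "w \<notin> ?bad" by blast
  then obtain r where r: "r < N" "w = ep * (N * N) + (i * N + r)" by (auto simp: add.assoc)
  have ir: "i * N + r < N * N"
  proof -
    have "i * N + r < (i + 1) * N" using r by simp
    also have "\<dots> \<le> N * N" using i by (intro mult_right_mono) auto
    finally show ?thesis .
  qed
  have "w < (ep + 1) * (N * N)" using ir r(2) by simp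
  also have "\<dots> \<le> B * (N * N)" using ep by (intro mult_right_mono) auto
  also have "\<dots> = B ^ 7" by (simp add: N eval_nat_numeral)
  also have "\<dots> \<le> TQ" by (rule TQ)
  finally have w: "w < TQ" .
  have "Phi (st F e s w) = p" using mx[OF w] \<open>w \<notin> ?bad\<close> w by auto
  moreover have "w div (N * N) = ep" using ir r(2) start_less(3) by (simp add: div_mult_self3)
  moreover have "w div N mod N = i"
  proof -
    have "w = (ep * N + i) * N + r" by (simp add: r(2) algebra_simps)
    then have "w div N = ep * N + i" using r(1) by simp
    then show ?thesis using i by simp
  qed
  ultimately have "good F e s w ep" using lt by (simp add: good_def i_def)
  then show False using fnd_0[OF z e w] by simp
qed

lemma callr_SETUP:
  assumes nl: "n = loop (\<lambda>a r. if length x < a * a then r else a) (length x + 1) 0"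
    and qm: "\<And>k. k < q \<Longrightarrow> 2 ^ k < B ^ 7" and lm: "\<And>k. k < l \<Longrightarrow> 2 ^ k < 2 * B"
  shows "snd (callr W x SETUP (replicate 10 0) c) = snd (callr W x SEARCH (pre @ [0, 0, 0, 0, 0]) c)"
proof -
  let ?L = "length x"
  obtain C ot where c: "c = (C, ot)" by (rule prod.exhaust)
  have LW: "?L + 2 < W" using small(2) B by simp
  have 1: "sem W x (CFor ETop (CIf (ELess (EIn (EV 11)) (EN 2)) (CSet 9 (EAdd (EV 9) (EN 1))) CSkip))
     ([0, 0, 0, 0, 0, 0, 0, 0, 0, 0, 0], C, ot) = ([0, 0, 0, 0, 0, 0, 0, 0, 0, min (W - 1) ?L, 0], C, ot)"
  proof (rule sem_for[where g = "\<lambda>k. ([0, 0, 0, 0, 0, 0, 0, 0, 0, min k ?L, 0], C, ot)"])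
    fix k
    show "pop (sem W x (CIf (ELess (EIn (EV 11)) (EN 2)) (CSet 9 (EAdd (EV 9) (EN 1))) CSkip)
       (push k ([0, 0, 0, 0, 0, 0, 0, 0, 0, min k ?L, 0], C, ot))) = ([0, 0, 0, 0, 0, 0, 0, 0, 0, min (Suc k) ?L, 0], C, ot)"
      using LW by (cases "k < ?L") (simp_all add: push_simp pop_simp inval_def min_def)
  qed simp_all
  \<comment> \<open>The scan has \<open>W - 1\<close> rounds and so passes the end of the
    input.\<close>
  have mL: "min (W - 1) ?L = ?L" using LW by simp
  have 2: "sem W x (CSet 2 (EAdd (EV 9) (EN 2))) ([0, 0, 0, 0, 0, 0, 0, 0, 0, ?L, 0], C, ot) = ([0, 0, B, 0, 0, 0, 0, 0, 0, ?L, 0], C, ot)"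
    using LW by (simp add: B)
  have 3: "sem W x (CFor (EAdd (EV 9) (EN 1)) (CIf (ELess (EV 9) (EMul (EV 11) (EV 11))) CSkip (CSet 1 (EV 11))))
     ([0, 0, B, 0, 0, 0, 0, 0, 0, ?L, 0], C, ot) = ([0, n, B, 0, 0, 0, 0, 0, 0, ?L, 0], C, ot)"
  proof -
    let ?g = "\<lambda>k. ([0, loop (\<lambda>a r. if ?L < a * a then r else a) k 0, B, 0, 0, 0, 0, 0, 0, ?L, 0], C, ot)"
    have "sem W x (CFor (EAdd (EV 9) (EN 1)) (CIf (ELess (EV 9) (EMul (EV 11) (EV 11))) CSkip (CSet 1 (EV 11))))
     ([0, 0, B, 0, 0, 0, 0, 0, 0, ?L, 0], C, ot) = ?g (?L + 1)"
    proof (rule sem_for[where g = ?g])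
      fix k assume "k < ?L + 1"
      then have "k * k \<le> B * B" using B by (intro mult_le_mono) auto
      then have "k * k mod W = k * k" using BB_G(3) by simp
      then show "pop (sem W x (CIf (ELess (EV 9) (EMul (EV 11) (EV 11))) CSkip (CSet 1 (EV 11))) (push k (?g k))) = ?g (Suc k)"
        by (simp add: push_simp pop_simp)
    qed (use LW in simp_all)
    then show ?thesis using nl by simp
  qed
  have "B * B * B = N" "N * N * (B * B) = G" "N * N * B = B ^ 7" by (simp_all add: N G eval_nat_numeral)
  moreover have "B ^ 7 < B ^ 8" using B2 by (intro power_strict_increasing) auto
  then have B7: "B ^ 7 < W" using WB[of 8] by simp
  ultimately have m: "(B * B mod W) * B mod W = N" "(N * N mod W) * (B * B mod W) mod W = G" "(N * N mod W) * B mod W = B ^ 7"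
    using small by (simp_all only: mod_mult_left_eq mod_mult_right_eq mod_less)
  have 4: "sem W x (CSet 4 (EMul (EMul (EV 2) (EV 2)) (EV 2))) ([0, n, B, 0, 0, 0, 0, 0, 0, ?L, 0], C, ot) = ([0, n, B, 0, N, 0, 0, 0, 0, ?L, 0], C, ot)"
    "sem W x (CSet 3 (EMul (EMul (EV 4) (EV 4)) (EMul (EV 2) (EV 2)))) ([0, n, B, 0, N, 0, 0, 0, 0, ?L, 0], C, ot) = ([0, n, B, G, N, 0, 0, 0, 0, ?L, 0], C, ot)"
    "sem W x (CSet 6 (EN 1)) ([0, n, B, G, N, 0, 0, 0, 0, ?L, 0], C, ot) = ([0, n, B, G, N, 0, 1, 0, 0, ?L, 0], C, ot)"
    "sem W x (CSet 10 (EMul (EMul (EV 4) (EV 4)) (EV 2))) ([0, n, B, G, N, 0, 1, 0, 0, ?L, 0], C, ot) = ([0, n, B, G, N, 0, 1, 0, 0, ?L, B ^ 7], C, ot)"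
    by (simp_all add: m)
  have qG': "q \<le> G" using q_G by (meson leI less_irrefl)
  have lG: "l \<le> G" using ql by simp
  have 5: "sem W x (CFor (EV 3) (CIf (ELess (EV 6) (EV 10)) (CSeq (CSet 6 (EMul (EV 6) (EN 2))) (CSet 5 (EAdd (EV 5) (EN 1)))) CSkip))
     ([0, n, B, G, N, 0, 1, 0, 0, ?L, B ^ 7], C, ot) = ([0, n, B, G, N, min G q, 2 ^ min G q, 0, 0, ?L, B ^ 7], C, ot)"
  proof (rule sem_for[where g = "\<lambda>k. ([0, n, B, G, N, min k q, 2 ^ min k q, 0, 0, ?L, B ^ 7], C, ot)"])
    fix k
    show "pop (sem W x (CIf (ELess (EV 6) (EV 10)) (CSeq (CSet 6 (EMul (EV 6) (EN 2))) (CSet 5 (EAdd (EV 5) (EN 1)))) CSkip)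
       (push k ([0, n, B, G, N, min k q, 2 ^ min k q, 0, 0, ?L, B ^ 7], C, ot))) =
       ([0, n, B, G, N, min (Suc k) q, 2 ^ min (Suc k) q, 0, 0, ?L, B ^ 7], C, ot)"
    proof (cases "k < q")
      case True
      have "2 ^ Suc k < W" using pow_q[of "Suc k"] True by simp
      moreover have "Suc k < W" using True ql by simp
      ultimately show ?thesis using qm[OF True] True by (simp add: push_simp pop_simp min_def mult.commute)
    next
      case False
      then show ?thesis using TQ by (simp add: push_simp pop_simp min_def)
    qed
  qed simp_all
  have 6: "sem W x (CSet 10 (EN 1)) ([0, n, B, G, N, q, TQ, 0, 0, ?L, B ^ 7], C, ot) = ([0, n, B, G, N, q, TQ, 0, 0, ?L, 1], C, ot)"
    "sem W x (CSet 8 (EN 1)) ([0, n, B, G, N, q, TQ, 0, 0, ?L, 1], C, ot) = ([0, n, B, G, N, q, TQ, 0, 1, ?L, 1], C, ot)"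
    by simp_all
  have 7: "sem W x (CFor (EV 3) (CIf (ELess (EV 10) (EMul (EN 2) (EV 2))) (CSeq (CSet 10 (EMul (EV 10) (EN 2)))
       (CSeq (CSet 7 (EAdd (EV 7) (EN 1))) (CSet 8 (EMul (EV 8) (EN 8))))) CSkip))
     ([0, n, B, G, N, q, TQ, 0, 1, ?L, 1], C, ot) = ([0, n, B, G, N, q, TQ, min G l, 8 ^ min G l, ?L, 2 ^ min G l], C, ot)"
  proof (rule sem_for[where g = "\<lambda>k. ([0, n, B, G, N, q, TQ, min k l, 8 ^ min k l, ?L, 2 ^ min k l], C, ot)"])
    fix k
    have B2W: "2 * B < W" using BB_G(3)[of "2 * B"] B2 by simp
    show "pop (sem W x (CIf (ELess (EV 10) (EMul (EN 2) (EV 2))) (CSeq (CSet 10 (EMul (EV 10) (EN 2)))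
       (CSeq (CSet 7 (EAdd (EV 7) (EN 1))) (CSet 8 (EMul (EV 8) (EN 8))))) CSkip)
       (push k ([0, n, B, G, N, q, TQ, min k l, 8 ^ min k l, ?L, 2 ^ min k l], C, ot))) =
       ([0, n, B, G, N, q, TQ, min (Suc k) l, 8 ^ min (Suc k) l, ?L, 2 ^ min (Suc k) l], C, ot)"
    proof (cases "k < l")
      case True
      have a: "(8::nat) ^ Suc k \<le> 8 ^ l" using True by (intro power_increasing) auto
      have "(2::nat) ^ Suc k \<le> 8 ^ Suc k" by (rule power_mono) auto
      note a = a this
      then have "8 ^ Suc k < W" "2 ^ Suc k < W" using small(6) unfolding E8 by linarith+
      moreover have "Suc k < W" using True ql by simp
      ultimately show ?thesis using lm[OF True] True B2W by (simp add: push_simp pop_simp min_def mult.commute)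
    next
      case False
      then show ?thesis using l B2W by (simp add: push_simp pop_simp min_def)
    qed
  qed simp_all
  have mq: "min G q = q" "min G l = l" using qG' lG by auto
  have 8: "snd (sem W x (CCall 99 (PRE @ [EN 0, EN 0, EN 0, EN 0, EN 0]) SEARCH) (fr 0 [?L, 2 ^ l], C, ot)) =
      snd (callr W x SEARCH (pre @ [0, 0, 0, 0, 0]) (C, ot))"
    by (simp add: sem_call99 ev_PRE)
  have rep: "0 # replicate 10 0 = [0, 0, 0, 0, 0, 0, 0, 0, 0, 0, 0 :: nat]" by (simp add: numeral_eq_Suc)
  have "sem W x SETUP (0 # replicate 10 0, C, ot) =
     sem W x (CCall 99 (PRE @ [EN 0, EN 0, EN 0, EN 0, EN 0]) SEARCH) (fr 0 [?L, 2 ^ l], C, ot)"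
    unfolding rep SETUP_def sem_CSeqs 1 mL 2 3 4 5 mq TQ(1)[symmetric] 6 7 mq E8[symmetric] ..
  then show ?thesis using 8 by (simp add: callr_def c)
qed

end

definition MAIN :: cmd where
  "MAIN = CCall 99 (replicate 10 (EN 0)) SETUP"

lemma sem_MAIN: "snd (sem W x MAIN ([], c)) = snd (callr W x SETUP (replicate 10 0) c)"
  by (simp add: MAIN_def sem_call)

lemma doubling_exists:
  fixes M :: nat assumes "1 \<le> M"
  obtains q where "M \<le> 2 ^ q" "2 ^ q \<le> 2 * M" "\<And>k. k < q \<Longrightarrow> 2 ^ k < M"
proof -
  define q where "q = (LEAST q. M \<le> 2 ^ q)"
  have "M \<le> 2 ^ M" using less_exp[of M] by simp
  then have 1: "M \<le> 2 ^ q" unfolding q_def by (rule LeastI)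
  have 2: "2 ^ k < M" if "k < q" for k using that not_less_Least[of k "\<lambda>q. M \<le> 2 ^ q"] by (simp add: q_def)
  have 3: "2 ^ q \<le> 2 * M" using 2[of "q - 1"] assms by (cases q) auto
  show ?thesis using that 1 2 3 by blast
qed

section \<open>Correctness of the local search\<close>

lemma nonsing_cong:
  assumes "\<And>i j. i \<in> X \<Longrightarrow> j \<in> X \<Longrightarrow> T i j = T' i j"
  shows "nonsing T X \<longleftrightarrow> nonsing T' X"
proof -
  have "mv X T y i = mv X T' y i" if "i \<in> X" for y i
    unfolding mv_def using assms that by (intro sum.cong) auto
  then show ?thesis by (simp add: nonsing_def)
qed

text \<open>The unit vector at \<open>v\<close> would lie in the kernel. Hence clearing row and
  column \<open>v\<close> has the effect of deleting the vertex.\<close>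

lemma nonsing_zero_column:
  assumes "nonsing T X" "\<And>i. T i v = 0" "finite X"
  shows "v \<notin> X"
proof
  assume v: "v \<in> X"
  let ?y = "\<lambda>i. of_bool (i = v) :: real"
  have "mv X T ?y i = 0" for i
    unfolding mv_def by (intro sum.neutral) (use assms(2) in auto)
  then have "?y v = 0" using assms(1) v unfolding nonsing_def by blast
  then show False by simp
qed

context prm
begin

lemma cell_cases:
  assumes "i < N"
  obtains h u m where "h < B" "u < B" "m < B" "i = h * (B * B) + u * B + m"
    "i div (B * B) = h" "i div B mod B = u" "i mod B = m"
proof -
  have 1: "i div (B * B) < B" using assms by (simp add: N less_mult_imp_div_less power3_eq_cube)
  have 2: "i div B mod B < B" "i mod B < B" using B2 by auto
  have e: "i div B div B * B + i div B mod B = i div B" by simp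
  have "i = (i div B div B * B + i div B mod B) * B + i mod B" unfolding e by simp
  also have "\<dots> = i div (B * B) * (B * B) + i div B mod B * B + i mod B"
    by (simp only: div_mult2_eq add_mult_distrib mult.assoc)
  finally show ?thesis using that[OF 1 2] by simp
qed

section \<open>The path recursion computes the coefficients\<close>

definition cd :: "nat \<Rightarrow> nat \<Rightarrow> nat \<Rightarrow> nat" where
  "cd h u m = h * (B * B) + u * B + m"

lemma cd_dec:
  assumes "u < B" "m < B"
  shows "cd h u m div (B * B) = h" "cd h u m div B mod B = u" "cd h u m mod B = m"
proof -
  have e: "cd h u m = (h * B + u) * B + m" by (simp add: cd_def algebra_simps)
  have d: "cd h u m div B = h * B + u" unfolding e using assms by simp
  show "cd h u m mod B = m" unfolding e using assms by simp
  show "cd h u m div B mod B = u" unfolding d using assms by simp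
  show "cd h u m div (B * B) = h" unfolding div_mult2_eq d using assms by simp
qed

lemma cd_less: "h < B \<Longrightarrow> u < B \<Longrightarrow> m < B \<Longrightarrow> cd h u m < N"
proof -
  assume a: "h < B" "u < B" "m < B"
  have "cd h u m < (h * B + u) * B + B" using a by (simp add: cd_def algebra_simps)
  also have "\<dots> = (h * B + (u + 1)) * B" by (simp add: algebra_simps)
  also have "\<dots> \<le> (h * B + B) * B" using a by (intro mult_right_mono) auto
  also have "\<dots> = (h + 1) * B * B" by (simp add: algebra_simps)
  also have "\<dots> \<le> B * B * B" using a by (intro mult_right_mono) auto
  finally show ?thesis by (simp add: N power3_eq_cube)
qed

text \<open>The number that a state of the recursion stands for; codes that denote no state get
  0.\<close>

definition vl :: "(nat \<Rightarrow> nat \<Rightarrow> int) \<Rightarrow> nat \<Rightarrow> int" where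
  "vl T i = (if i div B mod B = n \<and> i div (B * B) \<le> n then pe n T (i div (B * B)) (i mod B)
     else if i div B mod B < n \<and> i div (B * B) < n then pf n T (i div (B * B)) (i div B mod B) (i mod B) else 0)"

lemma vl_cd: "u < B \<Longrightarrow> m < B \<Longrightarrow> vl T (cd h u m) = (if u = n \<and> h \<le> n then pe n T h m else if u < n \<and> h < n then pf n T h u m else 0)"
  by (simp add: vl_def cd_dec)

lemma sum_two_cells:
  fixes g :: "nat \<Rightarrow> int"
  assumes "finite S" "S \<subseteq> {..<N}" "\<And>j. j < N \<Longrightarrow> j \<notin> S \<Longrightarrow> g j = 0"
  shows "(\<Sum>j<N. g j) = (\<Sum>j\<in>S. g j)"
  by (rule sum.mono_neutral_right) (use assms in auto)

text \<open>State by state this is \<open>pe_0\<close>, \<open>pe_Suc\<close>, \<open>pf_0\<close>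
  or \<open>pf_Suc\<close>; each row of \<open>bm\<close> has nonzero entries only at the states
  which these equations mention.\<close>

lemma vl_step:
  assumes i: "i < N"
  shows "vl (tq F v) i = (\<Sum>j<N. bm F v i j * vl (tq F v) j)"
proof -
  let ?T = "tq F v"
  obtain h u m where c: "h < B" "u < B" "m < B" "i = cd h u m"
    using cell_cases[OF i] unfolding cd_def[symmetric] by metis
  have nB: "n < B" by (rule n_less)
  have bmcd: "bm F v i j = bmc F v h u m (j div (B * B)) (j div B mod B) (j mod B)" for j
    unfolding bm_def c(4) using cd_dec[OF c(2,3)] by simp
  have bmcc: "bm F v i (cd h' u' m') = bmc F v h u m h' u' m'" if "u' < B" "m' < B" for h' u' m'
    unfolding bmcd using cd_dec[OF that] by simp
  consider (e) "u = n" "h = 0" | (s) h' where "u = n" "h = Suc h'" | (f0) "u < n" "m = 0" | (f) m' where "u < n" "h < n" "m = Suc m'"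
    | (z) "u < n" "\<not> h < n" | (y) "n < u"
    by (metis linorder_neqE_nat not0_implies_Suc)
  then show ?thesis
  proof cases
    case e
    have "(\<Sum>j<N. bm F v i j * vl ?T j) = (\<Sum>j\<in>{cd 0 n 0}. bm F v i j * vl ?T j)"
    proof (rule sum_two_cells)
      fix j assume j: "j < N" "j \<notin> {cd 0 n 0}"
      obtain h' u' m' where d: "h' < B" "u' < B" "m' < B" "j = cd h' u' m'" using cell_cases[OF j(1)] unfolding cd_def[symmetric] by metis
      have "\<not> (h' = 0 \<and> u' = n \<and> m' = 0)" using j(2) d(4) by blast
      then show "bm F v i j * vl ?T j = 0" using e by (auto simp: d(4) bmcc[OF d(2,3)] bmc_def)
    qed (use cd_less[of 0 n 0] nB in auto)
    also have "\<dots> = bm F v i (cd 0 n 0) * vl ?T (cd 0 n 0)" by simp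
    also have "vl ?T (cd 0 n 0) = 1" using nB by (simp add: vl_cd pe_0)
    also have "bm F v i (cd 0 n 0) = of_bool (m = 0)" using e nB bmcc[of n 0 0] by (simp add: bmc_def)
    also have "of_bool (m = 0) * 1 = vl ?T i" unfolding c(4) using e nB c by (simp add: vl_cd pe_0)
    finally show ?thesis ..
  next
    case (s h')
    show ?thesis
    proof (cases "h' < n")
      case True
      have B': "h' < B" using True nB by simp
      have "(\<Sum>j<N. bm F v i j * vl ?T j) = (\<Sum>j\<in>{cd h' n m, cd h' h' m}. bm F v i j * vl ?T j)"
      proof (rule sum_two_cells)
        fix j assume j: "j < N" "j \<notin> {cd h' n m, cd h' h' m}"
        obtain h2 u2 m2 where d: "h2 < B" "u2 < B" "m2 < B" "j = cd h2 u2 m2" using cell_cases[OF j(1)] unfolding cd_def[symmetric] by metis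
        have "\<not> (h2 = h' \<and> (u2 = n \<or> u2 = h') \<and> m2 = m)" using j(2) d by auto
        then show "bm F v i j * vl ?T j = 0" using s by (auto simp: d(4) bmcc[OF d(2,3)] bmc_def)
      qed (use cd_less nB c B' in auto)
      also have "\<dots> = bm F v i (cd h' n m) * vl ?T (cd h' n m) + bm F v i (cd h' h' m) * vl ?T (cd h' h' m)"
        using True nB by (subst sum.insert) (auto simp: cd_def)
      also have "\<dots> = pe n ?T h' m + pf n ?T h' h' m"
        using True s nB c(3) B' by (simp add: bmcc vl_cd bmc_def)
      also have "\<dots> = vl ?T i" using True s nB c by (simp add: vl_cd pe_Suc)
      finally show ?thesis ..
    next
      case False
      have "(\<Sum>j<N. bm F v i j * vl ?T j) = 0"
      proof (rule sum.neutral, rule ballI)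
        fix j
        show "bm F v i j * vl ?T j = 0" unfolding bmcd bmc_def using s False by simp
      qed
      then show ?thesis using False s c nB by (simp add: vl_cd)
    qed
  next
    case f0
    have "(\<Sum>j<N. bm F v i j * vl ?T j) = 0"
    proof (rule sum.neutral, rule ballI)
      fix j
      show "bm F v i j * vl ?T j = 0" unfolding bmcd bmc_def using f0 by simp
    qed
    then show ?thesis using f0 c nB by (simp add: vl_cd pf_0)
  next
    case (f m')
    have mB: "m' < B" "h < B" using f c by auto
    have inj: "inj_on (\<lambda>u'. cd h u' m') {..<h}" using nB using nB using nB by (auto simp: inj_on_def cd_def)
    have "(\<Sum>j<N. bm F v i j * vl ?T j) = (\<Sum>j\<in>insert (cd h n m') ((\<lambda>u'. cd h u' m') ` {..<h}). bm F v i j * vl ?T j)"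
    proof (rule sum_two_cells)
      fix j assume j: "j < N" "j \<notin> insert (cd h n m') ((\<lambda>u'. cd h u' m') ` {..<h})"
      obtain h2 u2 m2 where d: "h2 < B" "u2 < B" "m2 < B" "j = cd h2 u2 m2" using cell_cases[OF j(1)] unfolding cd_def[symmetric] by metis
      have "\<not> (h2 = h \<and> (u2 = n \<or> u2 < h) \<and> m2 = m')" using j(2) d by auto
      then show "bm F v i j * vl ?T j = 0" using f by (auto simp: d(4) bmcc[OF d(2,3)] bmc_def)
    qed (use cd_less nB c mB in auto)
    also have "\<dots> = bm F v i (cd h n m') * vl ?T (cd h n m') + (\<Sum>u'<h. bm F v i (cd h u' m') * vl ?T (cd h u' m'))"
    proof -
      have "cd h n m' \<notin> (\<lambda>u'. cd h u' m') ` {..<h}" using f nB by (auto simp: cd_def)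
      then show ?thesis by (simp add: sum.reindex[OF inj])
    qed
    also have "bm F v i (cd h n m') * vl ?T (cd h n m') = - ?T u h * pe n ?T h m'"
      using f nB mB by (simp add: bmcc vl_cd bmc_def)
    also have "(\<Sum>u'<h. bm F v i (cd h u' m') * vl ?T (cd h u' m')) = (\<Sum>u'<h. ?T u u' * pf n ?T h u' m')"
      using f nB mB by (intro sum.cong) (auto simp: bmcc vl_cd bmc_def)
    also have "- ?T u h * pe n ?T h m' + (\<Sum>u'<h. ?T u u' * pf n ?T h u' m') = vl ?T i"
      using f c by (simp add: vl_cd pf_Suc)
    finally show ?thesis ..
  next
    case z
    have "(\<Sum>j<N. bm F v i j * vl ?T j) = 0"
    proof (rule sum.neutral, rule ballI)
      fix j
      show "bm F v i j * vl ?T j = 0" unfolding bmcd bmc_def using z by simp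
    qed
    then show ?thesis using z c nB by (simp add: vl_cd)
  next
    case y
    have "(\<Sum>j<N. bm F v i j * vl ?T j) = 0"
    proof (rule sum.neutral, rule ballI)
      fix j
      show "bm F v i j * vl ?T j = 0" unfolding bmcd bmc_def using y by simp
    qed
    then show ?thesis using y c nB by (simp add: vl_cd)
  qed
qed

text \<open>The rank of a state is \<open>h + m\<close>. Every transition off the sink lowers
  \<open>h\<close> or \<open>m\<close> by 1, and the start has rank \<open>n + k\<close>, below
  \<open>2 ^ l\<close>; so \<open>mp_dag\<close> applies.\<close>

lemma tv_cc:
  assumes k: "k \<le> n"
  shows "tv F v k \<longleftrightarrow> cc n (tq F v) k \<noteq> 0"
proof -
  let ?T = "tq F v"
  have nB: "n < B" by (rule n_less)
  let ?rk = "\<lambda>i. i div (B * B) + i mod B"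
  have "mp N (bm F v) l (cd n n k) (cd 0 n 0) = vl ?T (cd n n k)"
  proof (rule mp_dag[where rk = ?rk])
    show "vl ?T i = (\<Sum>j<N. bm F v i j * vl ?T j)" if "i < N" for i by (rule vl_step[OF that])
    show "cd 0 n 0 < N" "cd n n k < N" using cd_less nB k by auto
    show "vl ?T (cd 0 n 0) = 1" using nB by (simp add: vl_cd pe_0)
    show "?rk (cd 0 n 0) = 0" using nB by (simp add: cd_dec)
    have "?rk (cd n n k) = n + k" using cd_dec(1,3)[of n k n] nB k by simp
    then show "?rk (cd n n k) < 2 ^ l" using l(1) nB k by linarith
    fix i j assume ij: "i < N" "j < N" "j \<noteq> cd 0 n 0" "bm F v i j \<noteq> 0"
    obtain h u m where d: "h < B" "u < B" "m < B" "j = cd h u m" using cell_cases[OF ij(2)] unfolding cd_def[symmetric] by metis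
    have "\<not> (h = 0 \<and> u = n \<and> m = 0)" using ij(3) d(4) by blast
    moreover have j: "j div (B * B) = h" "j div B mod B = u" "j mod B = m" unfolding d(4) using cd_dec[OF d(2,3)] by auto
    ultimately show "?rk j < ?rk i" using ij(4) unfolding bm_def bmc_def j by (simp split: if_splits)
  qed
  also have "\<dots> = cc n ?T k" using nB k by (simp add: vl_cd pe_n)
  finally have "mp N (bm F v) l (cd n n k) (cd 0 n 0) = cc n ?T k" .
  moreover have "cd n n k = (n * B + n) * B + k" "cd 0 n 0 = n * B" by (simp_all add: cd_def algebra_simps)
  ultimately show ?thesis by (simp add: tv_def)
qed

definition TR :: "regs \<Rightarrow> nat \<Rightarrow> nat \<Rightarrow> real" where
  "TR F i j = real_of_int (tq F n i j)"

lemma tq_skew: "tq F v i j = - tq F v j i"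
  by (auto simp: tq_def)

lemma tv_nonsing:
  assumes k: "k \<le> n"
  shows "tv F v k \<longleftrightarrow> (\<exists>X\<subseteq>{0..<n}. v \<notin> X \<and> card X = k \<and> nonsing (TR F) X)"
proof -
  have a: "nonsing (\<lambda>i j. real_of_int (tq F v i j)) X \<longleftrightarrow> v \<notin> X \<and> nonsing (TR F) X" if X: "X \<subseteq> {0..<n}" for X
  proof (cases "v \<in> X")
    case True
    have "finite X" using X finite_subset by blast
    then show ?thesis using True nonsing_zero_column[of "\<lambda>i j. real_of_int (tq F v i j)" X v] by (auto simp: tq_def)
  next
    case False
    have "nonsing (\<lambda>i j. real_of_int (tq F v i j)) X \<longleftrightarrow> nonsing (TR F) X"
    proof (rule nonsing_cong)
      fix i j assume "i \<in> X" "j \<in> X"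
      then have "i \<noteq> v" "j \<noteq> v" "i \<noteq> n" "j \<noteq> n" using False X by auto
      then show "real_of_int (tq F v i j) = TR F i j" by (simp add: TR_def tq_def)
    qed
    then show ?thesis using False by simp
  qed
  have "tv F v k \<longleftrightarrow> (\<exists>X\<subseteq>{0..<n}. card X = k \<and> nonsing (\<lambda>i j. real_of_int (tq F v i j)) X)"
    unfolding tv_cc[OF k] by (rule cc_nonzero_iff) (rule tq_skew)
  then show ?thesis using a by blast
qed

section \<open>Dependence on a single weight and local optimality\<close>

lemma xv_st:
  assumes "s < B * B" "a < TQ"
  shows "xv (st F e s a) e' = xv F e' + (if e' = e then int a - int (rd F e s) else 0)"
proof (cases "e' = e")
  case True
  have t: "take_bit q (sl (F 2 e s 0) a) = int a"
    using TQ_int[OF assms(2)] by (simp add: sl_def take_bit_eq_mod minus_mod_eq_mult_div)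
  have "xv (st F e s a) e = (\<Sum>t<B * B. take_bit q (F 2 e t 0) + (if t = s then int a - int (rd F e s) else 0))"
    unfolding xv_def by (intro sum.cong) (auto simp: st_def upd_def t rd_def)
  also have "\<dots> = xv F e + (int a - int (rd F e s))" using assms(1) by (simp add: sum.distrib xv_def)
  finally show ?thesis using True by simp
next
  case False
  then show ?thesis by (simp add: xv_def st_def upd_def)
qed

text \<open>Setting summand \<open>s\<close> of edge \<open>e\<close> to \<open>a\<close> changes
  the matrix affinely in \<open>a\<close>, so \<open>cc_poly\<close> applies, simultaneously for all
  deleted vertices.\<close>

lemma tq_poly:
  assumes s: "s < B * B"
  obtains P :: "nat \<Rightarrow> nat \<Rightarrow> int poly" where "\<And>v k. degree (P v k) \<le> k"
    "\<And>v k a. a < TQ \<Longrightarrow> poly (P v k) (int a) = cc n (tq (st F e s a) v) k"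
proof -
  have T0: "0 < TQ" by (simp add: TQ(1))
  define c where "c v i j = (if i = v \<or> j = v then 0 else if i < j then (if inval x (i * n + j) = 1 \<and> i * n + j = e then 1 else 0)
     else if j < i then (if inval x (j * n + i) = 1 \<and> j * n + i = e then -1 else 0) else (0::int))" for v i j
  have tqa: "tq (st F e s a) v = (\<lambda>i j. tq (st F e s 0) v i j + int a * c v i j)" if "a < TQ" for a v
    by (intro ext) (simp add: tq_def c_def xv_st[OF s that] xv_st[OF s T0])
  have "\<forall>v k. \<exists>p :: int poly. degree p \<le> k \<and> (\<forall>a. poly p a = cc n (\<lambda>i j. tq (st F e s 0) v i j + a * c v i j) k)"
    using cc_poly by blast
  then obtain P :: "nat \<Rightarrow> nat \<Rightarrow> int poly" where P: "\<forall>v k. degree (P v k) \<le> k \<and> (\<forall>a. poly (P v k) a = cc n (\<lambda>i j. tq (st F e s 0) v i j + a * c v i j) k)"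
    by metis
  show ?thesis
  proof (rule that)
    show "degree (P v k) \<le> k" for v k using P by blast
    show "poly (P v k) (int a) = cc n (tq (st F e s a) v) k" if "a < TQ" for v k a
      unfolding tqa[OF that] using P by blast
  qed
qed

text \<open>The exceptional values are roots of those coefficient polynomials that are not
  identically zero. A nonzero value at \<open>b\<close> shows that its polynomial is one of
  them.\<close>

lemma exceptional_values:
  assumes s: "s < B * B"
  obtains R where "finite R" "card R < N"
    "\<And>a b v k. a < TQ \<Longrightarrow> b < TQ \<Longrightarrow> a \<notin> R \<Longrightarrow> v < n + 1 \<Longrightarrow> k < n + 1 \<Longrightarrow> tv (st F e s b) v k \<Longrightarrow> tv (st F e s a) v k"
proof -
  obtain P :: "nat \<Rightarrow> nat \<Rightarrow> int poly" where P: "\<And>v k. degree (P v k) \<le> k"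
    "\<And>v k a. a < TQ \<Longrightarrow> poly (P v k) (int a) = cc n (tq (st F e s a) v) k"
    using tq_poly[OF s] by metis
  define Z where "Z v k = (if P v k = 0 then {} else {a. poly (P v k) (int a) = 0})" for v k
  have Z: "finite (Z v k) \<and> card (Z v k) \<le> k" for v k
  proof (cases "P v k = 0")
    case False
    have f: "finite {y. poly (P v k) y = 0}" using False by (rule poly_roots_finite)
    have sub: "int ` Z v k \<subseteq> {y. poly (P v k) y = 0}" by (auto simp: Z_def)
    have i: "inj_on int (Z v k)" by (simp add: inj_on_def)
    have fin: "finite (Z v k)" using finite_subset[OF sub f] i by (simp add: finite_image_iff)
    have "card (Z v k) = card (int ` Z v k)" using i by (simp add: card_image)
    also have "\<dots> \<le> card {y. poly (P v k) y = 0}" using sub f by (rule card_mono[rotated])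
    also have "\<dots> \<le> degree (P v k)" using False by (rule card_poly_roots_bound)
    also have "\<dots> \<le> k" by (rule P)
    finally show ?thesis using fin by simp
  qed (simp add: Z_def)
  have Zn: "card (Z v k) \<le> n" if "k < n + 1" for v k using Z[of v k] that by linarith
  define R where "R = (\<Union>v<n + 1. \<Union>k<n + 1. Z v k)"
  have "card R \<le> (\<Sum>v<n + 1. card (\<Union>k<n + 1. Z v k))" unfolding R_def by (rule card_UN_le) simp
  also have "\<dots> \<le> (\<Sum>v<n + 1. \<Sum>k<n + 1. card (Z v k))" by (intro sum_mono card_UN_le) simp
  also have "\<dots> \<le> (\<Sum>v<n + 1. \<Sum>k<n + 1. n)" by (intro sum_mono) (use Zn in auto)
  \<comment> \<open>There are \<open>(n + 1) * (n + 1)\<close> polynomials, each with at most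
    \<open>n\<close> roots; this is where \<open>N = B ^ 3\<close> is needed.\<close>
  also have "\<dots> = (n + 1) * (n + 1) * n" by (simp add: algebra_simps)
  also have "\<dots> \<le> B * B * n" using n_less by (intro mult_right_mono mult_mono) auto
  also have "\<dots> < B * B * B" using n_less B2 by simp
  finally have "card R < N" by (simp add: N power3_eq_cube)
  moreover have "finite R" unfolding R_def using Z by blast
  moreover have "tv (st F e s a) v k" if a: "a < TQ" "b < TQ" "a \<notin> R" "v < n + 1" "k < n + 1" "tv (st F e s b) v k" for a b v k
  proof -
    have k: "k \<le> n" using a by simp
    have "P v k \<noteq> 0" using a(6) unfolding tv_cc[OF k] P(2)[OF a(2), symmetric] by auto
    moreover have "a \<notin> Z v k" using a unfolding R_def by blast
    ultimately have "poly (P v k) (int a) \<noteq> 0" by (simp add: Z_def)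
    then show ?thesis unfolding tv_cc[OF k] P(2)[OF a(1)] .
  qed
  ultimately show ?thesis using that by blast
qed

text \<open>The second part turns equal potential into equal sets of pairs: for nested finite sets
  it suffices to compare sizes.\<close>

lemma Phi_mono:
  assumes "\<And>v k. v < n + 1 \<Longrightarrow> k < n + 1 \<Longrightarrow> tv F v k \<Longrightarrow> tv F' v k"
  shows "Phi F \<le> Phi F'" "Phi F' \<le> Phi F \<Longrightarrow> v < n + 1 \<Longrightarrow> k < n + 1 \<Longrightarrow> tv F' v k \<Longrightarrow> tv F v k"
proof -
  let ?g = "\<lambda>F p. of_bool (tv F (fst p) (snd p)) :: nat"
  let ?S = "{..<n + 1} \<times> {..<n + 1}"
  have P: "Phi F = sum (?g F) ?S" for F
    by (simp only: Phi_def sum.cartesian_product case_prod_unfold)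
  have le: "?g F p \<le> ?g F' p" if "p \<in> ?S" for p using assms[of "fst p" "snd p"] that by auto
  show "Phi F \<le> Phi F'" unfolding P by (rule sum_mono) (rule le)
  show "tv F v k" if a: "Phi F' \<le> Phi F" "v < n + 1" "k < n + 1" "tv F' v k"
  proof (rule ccontr)
    assume "\<not> tv F v k"
    then have "sum (?g F) ?S < sum (?g F') ?S"
      using a le by (intro sum_strict_mono_ex1) (auto intro!: bexI[of _ "(v, k)"])
    then show False using a(1) unfolding P by simp
  qed
qed

lemma few:
  assumes s: "s < B * B" and b: "b < TQ"
  shows "card {a. a < TQ \<and> Phi (st F e s a) < Phi (st F e s b)} < N"
proof -
  obtain R where R: "finite R" "card R < N"
    "\<And>a b v k. a < TQ \<Longrightarrow> b < TQ \<Longrightarrow> a \<notin> R \<Longrightarrow> v < n + 1 \<Longrightarrow> k < n + 1 \<Longrightarrow> tv (st F e s b) v k \<Longrightarrow> tv (st F e s a) v k"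
    using exceptional_values[OF s] by metis
  have "{a. a < TQ \<and> Phi (st F e s a) < Phi (st F e s b)} \<subseteq> R"
  proof
    fix a assume a: "a \<in> {a. a < TQ \<and> Phi (st F e s a) < Phi (st F e s b)}"
    show "a \<in> R"
    proof (rule ccontr)
      assume "a \<notin> R"
      then have "Phi (st F e s b) \<le> Phi (st F e s a)" using R(3) a b by (intro Phi_mono(1)) auto
      then show False using a by simp
    qed
  qed
  then show ?thesis using card_mono[OF R(1)] R(2) by (meson le_less_trans)
qed

text \<open>Reading only the bits above the diagonal turns every input into an undirected graph
  without loops.\<close>

definition EG :: "nat \<Rightarrow> nat \<Rightarrow> bool" where
  "EG u v \<longleftrightarrow> u < n \<and> v < n \<and> (u < v \<and> inval x (u * n + v) = 1 \<or> v < u \<and> inval x (v * n + u) = 1)"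

sublocale sk: skew "{0..<n}" "TR F" for F
  by unfold_locales (auto simp: TR_def tq_def)

lemma maxns_exists: "\<exists>X. skew.maxns {0..<n} (TR F) X"
proof -
  let ?S = "{X. X \<subseteq> {0..<n} \<and> nonsing (TR F) X}"
  have "{} \<in> ?S" by (simp add: nonsing_def)
  moreover have fin: "finite ?S" by (rule finite_subset[of _ "Pow {0..<n}"]) auto
  ultimately have "Max (card ` ?S) \<in> card ` ?S" by (intro Max_in) auto
  then obtain X where X: "X \<in> ?S" "card X = Max (card ` ?S)" by auto
  have "card Y \<le> card X" if "Y \<in> ?S" for Y unfolding X(2) using fin that by (intro Max_ge) auto
  then have "\<forall>Y\<in>?S. card Y \<le> card X" by blast
  then show ?thesis using X(1) unfolding sk.maxns_def by blast
qed

lemma pert_swap: "u \<noteq> v \<Longrightarrow> pert T u v \<delta> = pert T v u (- \<delta>)"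
  by (auto simp: pert_def fun_eq_iff)

text \<open>A value \<open>a\<close> that is neither exceptional nor the current one can only
  enlarge the set of pairs, and optimality forbids that it does so properly. The same pairs mean the
  same rank and the same avoidable vertices, and the difference of the values is the required
  \<open>\<delta>\<close>.\<close>

lemma stable_edge:
  assumes s: "s < B * B" and opt: "\<And>e b. e < n * n \<Longrightarrow> b < TQ \<Longrightarrow> Phi (st F e s b) \<le> Phi F"
    and uv: "u < v" "v < n" "inval x (u * n + v) = 1"
  shows "\<exists>\<delta>. \<delta> \<noteq> 0 \<and> (\<forall>X. sk.maxns F X \<longrightarrow> (\<exists>Y\<subseteq>{0..<n}. nonsing (pert (TR F) u v \<delta>) Y \<and> card Y = card X) \<and>
        (\<forall>Y\<subseteq>{0..<n}. nonsing (pert (TR F) u v \<delta>) Y \<longrightarrow> card Y \<le> card X) \<and>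
        (\<forall>w\<in>{0..<n}. \<forall>Y\<subseteq>{0..<n}. w \<notin> Y \<longrightarrow> nonsing (pert (TR F) u v \<delta>) Y \<longrightarrow> card Y = card X \<longrightarrow> (\<exists>Z. sk.maxns F Z \<and> w \<notin> Z)))"
proof -
  define e where "e = u * n + v"
  have e: "e < n * n"
  proof -
    have "e < u * n + n" using uv by (simp add: e_def)
    also have "\<dots> = (u + 1) * n" by simp
    also have "\<dots> \<le> n * n" using uv by (intro mult_right_mono) auto
    finally show ?thesis .
  qed
  obtain R where R: "finite R" "card R < N"
    "\<And>a b v k. a < TQ \<Longrightarrow> b < TQ \<Longrightarrow> a \<notin> R \<Longrightarrow> v < n + 1 \<Longrightarrow> k < n + 1 \<Longrightarrow> tv (st F e s b) v k \<Longrightarrow> tv (st F e s a) v k"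
    using exceptional_values[OF s] by metis
  let ?o = "rd F e s"
  \<comment> \<open>There are at least \<open>B ^ 7\<close> values against at most \<open>N\<close>
    excluded ones.\<close>
  have "card (insert ?o R) \<le> N" using R by (simp add: card_insert_if)
  also have "N < B ^ 7" unfolding N using B2 by (intro power_strict_increasing) auto
  also have "\<dots> \<le> card {..<TQ}" using TQ by simp
  finally have "\<not> {..<TQ} \<subseteq> insert ?o R" using card_mono[of "insert ?o R" "{..<TQ}"] R(1) by auto
  then obtain a where a: "a < TQ" "a \<notin> R" "a \<noteq> ?o" by auto
  define F' where "F' = st F e s a"
  have up: "tv F' w k" if "w < n + 1" "k < n + 1" "tv F w k" for w k
    using R(3)[OF a(1) rd_less[of F e s] a(2) that(1,2)] that(3) by (simp add: F'_def st_rd)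
  have eq: "tv F' w k \<longleftrightarrow> tv F w k" if "w < n + 1" "k < n + 1" for w k
    using Phi_mono(2)[of F F' w k] up opt[OF e a(1)] that unfolding F'_def[symmetric] by blast
  define \<delta> where "\<delta> = real a - real ?o"
  have d0: "\<delta> \<noteq> 0" using a(3) by (simp add: \<delta>_def)
  have pair: "i * n + j = e \<longleftrightarrow> i = u \<and> j = v" if "j < n" for i j
  proof
    assume h: "i * n + j = e"
    have "e div n = u" "e mod n = v" using uv by (auto simp: e_def)
    moreover have "(i * n + j) div n = i" "(i * n + j) mod n = j" using that by auto
    ultimately show "i = u \<and> j = v" using h by metis
  qed (simp add: e_def)
  have pT: "pert (TR F) u v \<delta> i j = TR F' i j" if ij: "i < n" "j < n" for i j
  proof -
    have "xv F' (i * n + j) = xv F (i * n + j) + (if i = u \<and> j = v then int a - int ?o else 0)"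
      "xv F' (j * n + i) = xv F (j * n + i) + (if j = u \<and> i = v then int a - int ?o else 0)"
      unfolding F'_def xv_st[OF s a(1)] using pair ij by auto
    then show ?thesis using ij uv by (auto simp: pert_def TR_def tq_def \<delta>_def)
  qed
  have ns: "nonsing (pert (TR F) u v \<delta>) Y \<longleftrightarrow> nonsing (TR F') Y" if "Y \<subseteq> {0..<n}" for Y
  proof (rule nonsing_cong)
    fix i j assume "i \<in> Y" "j \<in> Y"
    then have "i < n" "j < n" using that by auto
    then show "pert (TR F) u v \<delta> i j = TR F' i j" by (rule pT)
  qed
  have cd': "card Y \<le> n" if "Y \<subseteq> {0..<n}" for Y using card_mono[of "{0..<n}" Y] that by simp
  have tr: "\<exists>Z\<subseteq>{0..<n}. w \<notin> Z \<and> card Z = card Y \<and> nonsing (TR H') Z"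
    if "Y \<subseteq> {0..<n}" "w \<notin> Y" "w < n + 1" "nonsing (TR H) Y" "\<forall>k<n + 1. tv H w k \<longrightarrow> tv H' w k" for Y w H H'
  proof -
    have "tv H w (card Y)" unfolding tv_nonsing[OF cd'[OF that(1)]] using that by blast
    then have "tv H' w (card Y)" using that(5) cd'[OF that(1)] by simp
    then show ?thesis unfolding tv_nonsing[OF cd'[OF that(1)]] .
  qed
  show ?thesis
  proof (intro exI[of _ \<delta>] conjI allI impI ballI)
    show "\<delta> \<noteq> 0" by (rule d0)
    fix X assume X: "sk.maxns F X"
    then have X': "X \<subseteq> {0..<n}" "nonsing (TR F) X" "\<And>Y. Y \<subseteq> {0..<n} \<Longrightarrow> nonsing (TR F) Y \<Longrightarrow> card Y \<le> card X"
      unfolding sk.maxns_def by auto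
    \<comment> \<open>Taking \<open>w = n\<close> compares the full matrices, no vertex of the graph
      being deleted.\<close>
    have "\<exists>Z\<subseteq>{0..<n}. n \<notin> Z \<and> card Z = card X \<and> nonsing (TR F') Z"
      by (rule tr[OF X'(1) _ _ X'(2)]) (use X'(1) eq in auto)
    then show "\<exists>Y\<subseteq>{0..<n}. nonsing (pert (TR F) u v \<delta>) Y \<and> card Y = card X" using ns by blast
    show "card Y \<le> card X" if Y: "Y \<subseteq> {0..<n}" "nonsing (pert (TR F) u v \<delta>) Y" for Y
    proof -
      have "\<exists>Z\<subseteq>{0..<n}. n \<notin> Z \<and> card Z = card Y \<and> nonsing (TR F) Z"
        by (rule tr[OF Y(1), where H = F']) (use Y ns eq in auto)
      then show ?thesis using X'(3) by metis
    qed
    fix w Y assume w: "w \<in> {0..<n}" "Y \<subseteq> {0..<n}" "w \<notin> Y" "nonsing (pert (TR F) u v \<delta>) Y" "card Y = card X"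
    have "\<exists>Z\<subseteq>{0..<n}. w \<notin> Z \<and> card Z = card Y \<and> nonsing (TR F) Z"
      by (rule tr[OF w(2,3), where H = F']) (use w ns eq in auto)
    then obtain Z where "Z \<subseteq> {0..<n}" "w \<notin> Z" "card Z = card X" "nonsing (TR F) Z" using w(5) by auto
    then show "\<exists>Z. sk.maxns F Z \<and> w \<notin> Z" unfolding sk.maxns_def using X'(3) by auto
  qed
qed

text \<open>Optimality makes all edges stable, so the maximum size of a nonsingular principal
  submatrix is twice the matching number, and \<open>mx\<close> finds this size.\<close>

lemma mx_matching:
  assumes s: "s < B * B" and opt: "\<And>e b. e < n * n \<Longrightarrow> b < TQ \<Longrightarrow> Phi (st F e s b) \<le> Phi F"
  shows "mx F div 2 = matching_number {{u, v} | u v. EG u v}"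
proof -
  have stb: "sk.stable F u v" if "EG u v" for u v
  proof (cases "u < v")
    case True
    then show ?thesis using stable_edge[OF s opt, of u v] that unfolding sk.stable_def EG_def by auto
  next
    case False
    then have "\<exists>\<delta>. \<delta> \<noteq> 0 \<and> (\<forall>X. sk.maxns F X \<longrightarrow> (\<exists>Y\<subseteq>{0..<n}. nonsing (pert (TR F) v u \<delta>) Y \<and> card Y = card X) \<and>
        (\<forall>Y\<subseteq>{0..<n}. nonsing (pert (TR F) v u \<delta>) Y \<longrightarrow> card Y \<le> card X) \<and>
        (\<forall>w\<in>{0..<n}. \<forall>Y\<subseteq>{0..<n}. w \<notin> Y \<longrightarrow> nonsing (pert (TR F) v u \<delta>) Y \<longrightarrow> card Y = card X \<longrightarrow> (\<exists>Z. sk.maxns F Z \<and> w \<notin> Z)))"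
      using stable_edge[OF s opt, of v u] that unfolding EG_def by auto
    then obtain \<delta> where d: "\<delta> \<noteq> 0" "\<forall>X. sk.maxns F X \<longrightarrow> (\<exists>Y\<subseteq>{0..<n}. nonsing (pert (TR F) v u \<delta>) Y \<and> card Y = card X) \<and>
        (\<forall>Y\<subseteq>{0..<n}. nonsing (pert (TR F) v u \<delta>) Y \<longrightarrow> card Y \<le> card X) \<and>
        (\<forall>w\<in>{0..<n}. \<forall>Y\<subseteq>{0..<n}. w \<notin> Y \<longrightarrow> nonsing (pert (TR F) v u \<delta>) Y \<longrightarrow> card Y = card X \<longrightarrow> (\<exists>Z. sk.maxns F Z \<and> w \<notin> Z))"
      by (elim exE conjE) (rule that)
    have "u \<noteq> v" using that by (auto simp: EG_def)
    \<comment> \<open>Optimality has been used for the orientation with the smaller end first;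
      reversing the edge negates \<open>\<delta>\<close>.\<close>
    then have p: "pert (TR F) v u \<delta> = pert (TR F) u v (- \<delta>)" by (intro pert_swap) auto
    show ?thesis unfolding sk.stable_def by (rule exI[of _ "- \<delta>"]) (use d p in simp)
  qed
  interpret sg: stable_graph "{0..<n}" "TR F" EG
  proof unfold_locales
    show "EG v u" if "EG u v" for u v using that by (auto simp: EG_def)
    show "\<not> EG u u" for u by (simp add: EG_def)
    show "u \<in> {0..<n} \<and> v \<in> {0..<n}" if "EG u v" for u v using that by (simp add: EG_def)
    show "EG u v" if "TR F u v \<noteq> 0" "u \<in> {0..<n}" "v \<in> {0..<n}" for u v
      using that by (auto simp: EG_def TR_def tq_def split: if_splits)
    show "sk.stable F u v" if "EG u v" for u v by (rule stb[OF that])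
  qed
  obtain X where X: "sk.maxns F X" using maxns_exists by blast
  have X': "X \<subseteq> {0..<n}" "nonsing (TR F) X" "\<And>Y. Y \<subseteq> {0..<n} \<Longrightarrow> nonsing (TR F) Y \<Longrightarrow> card Y \<le> card X"
    using X unfolding sk.maxns_def by auto
  have cX: "card X \<le> n" using card_mono[of "{0..<n}" X] X'(1) by simp
  have "tv F n (card X)" unfolding tv_nonsing[OF cX] using X' by (intro exI[of _ X]) auto
  then have 1: "card X \<le> mx F" "tv F n (mx F)" using loop_max[of "n + 1" "tv F n"] cX by (auto simp: mx_def less_Suc_eq_le)
  obtain Z where "Z \<subseteq> {0..<n}" "card Z = mx F" "nonsing (TR F) Z" using 1(2) unfolding tv_nonsing[OF mx_le] by blast
  then have "mx F \<le> card X" using X'(3)[of Z] by simp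
  then have "mx F = card X" using 1(1) by simp
  then show ?thesis using sg.rank_eq_matching_number[OF X] by simp
qed

end

definition isq :: "nat \<Rightarrow> nat" where
  "isq L = loop (\<lambda>a r. if L < a * a then r else a) (L + 1) 0"

lemma isq_bound: "isq L * isq L \<le> L"
proof -
  have "loop (\<lambda>a r. if L < a * a then r else a) m 0 * loop (\<lambda>a r. if L < a * a then r else a) m 0 \<le> L" for m
    by (induction m) auto
  then show ?thesis by (simp add: isq_def)
qed

lemma isq_square: "isq (m * m) = m"
proof -
  let ?P = "\<lambda>a. \<not> m * m < a * a"
  have sw: "(\<lambda>a r. if m * m < a * a then r else a) = (\<lambda>k r. if ?P k then k else r)" by (auto simp: fun_eq_iff)
  have sq: "?P k \<longleftrightarrow> k \<le> m" for k by (simp add: not_less flip: power2_eq_square)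
  have "m < m * m + 1" by (simp add: less_Suc_eq_le)
  then have "m \<le> isq (m * m)" "?P (isq (m * m))"
    using loop_max[of "m * m + 1" ?P] unfolding isq_def sw sq by auto
  then show ?thesis using sq by auto
qed

text \<open>A function on all strings, as the machine must also be correct on those that are not
  adjacency matrices: the number of vertices is the integer square root of the length.\<close>

definition MF :: "bool list \<Rightarrow> bool list" where
  "MF x = binary (matching_number {{u, v} | u v. u < v \<and> v < isq (length x) \<and> inval x (u * isq (length x) + v) = 1})"

text \<open>The exponent 40 makes the word size at least \<open>B ^ 40\<close>, as the locale of
  parameters demands; decoding the given tape into registers then starts the search.\<close>

lemma MF_in_CLP: "MF \<in> CLP"
proof (rule program_in_CLP[where \<kappa> = 40 and c = MAIN])
  show "(2::nat) \<le> 40" by simp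
  fix x \<tau> :: "bool list"
  define L where "L = length x"
  define W :: nat where "W = (2 ^ 40) ^ LL (length x + 1)"
  assume "length \<tau> = (2 ^ 40) ^ LL (length x + 1)"
  then have tau: "length \<tau> = W" by (simp add: W_def)
  define B where "B = length x + 2"
  have p: "1 \<le> B ^ 7" "1 \<le> 2 * B" by (simp_all add: B_def)
  have "\<exists>q. B ^ 7 \<le> 2 ^ q \<and> 2 ^ q \<le> 2 * B ^ 7 \<and> (\<forall>k<q. 2 ^ k < B ^ 7)" by (rule doubling_exists[OF p(1)]) blast
  then obtain q where q: "B ^ 7 \<le> 2 ^ q" "2 ^ q \<le> 2 * B ^ 7" "\<forall>k<q. 2 ^ k < B ^ 7" by blast
  have "\<exists>l. 2 * B \<le> 2 ^ l \<and> 2 ^ l \<le> 2 * (2 * B) \<and> (\<forall>k<l. 2 ^ k < 2 * B)" by (rule doubling_exists[OF p(2)]) blast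
  then obtain l where ll: "2 * B \<le> 2 ^ l" "2 ^ l \<le> 2 * (2 * B)" "\<forall>k<l. 2 ^ k < 2 * B" by blast
  have BW: "B ^ 40 \<le> W"
  proof -
    have "B \<le> 2 ^ LL (length x + 1)" using LL_bounds(1)[of "length x + 1"] by (simp add: B_def)
    then have "B ^ 40 \<le> (2 ^ LL (length x + 1)) ^ 40" by (intro power_mono) auto
    also have "\<dots> = W" unfolding W_def by (simp only: power_mult[symmetric] mult.commute)
    finally show ?thesis .
  qed
  interpret prm W x "isq (length x)" B "B ^ 8" "B ^ 3" q "2 ^ q" l "8 ^ l"
    by unfold_locales (use BW q ll isq_bound in \<open>auto simp: B_def\<close>)
  obtain F0 where F0: "mk \<tau> F0 = \<tau>" using mk_exists[OF tau] by blast
  have sm: "snd (sem W x MAIN ([], \<tau>, [])) = snd (callr W x SEARCH (pre @ [0, 0, 0, 0, 0]) (mk \<tau> F0, []))"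
    unfolding sem_MAIN F0 by (rule callr_SETUP) (use q(3) ll(3) in \<open>auto simp: isq_def\<close>)
  obtain F s ep where F: "fnd F s ep = 0" "s < B * B" "ep < B"
     "snd (callr W x SEARCH (pre @ [0, 0, 0, 0, 0]) (mk \<tau> F0, [])) = (mk \<tau> F0, [] @ binary (mx F div 2))"
    using callr_SEARCH[of \<tau> F0 "[]"] by blast
  have opt: "Phi (st F e s b) \<le> Phi F" if "e < isq (length x) * isq (length x)" "b < 2 ^ q" for e b
    by (rule local_opt[OF few[OF F(2)] F(1,3) that])
  have "{{u, v} | u v. EG u v} = {{u, v} | u v. u < v \<and> v < isq (length x) \<and> inval x (u * isq (length x) + v) = 1}"
  proof (rule equalityI; rule subsetI)
    fix A assume "A \<in> {{u, v} | u v. EG u v}"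
    then obtain u v where uv: "A = {u, v}" "EG u v" by blast
    show "A \<in> {{u, v} | u v. u < v \<and> v < isq (length x) \<and> inval x (u * isq (length x) + v) = 1}"
    proof (cases "u < v")
      case True
      then show ?thesis using uv by (auto simp: EG_def)
    next
      case False
      have "A = {v, u}" using uv by auto
      then show ?thesis using uv(2) False unfolding EG_def by blast
    qed
  next
    fix A assume "A \<in> {{u, v} | u v. u < v \<and> v < isq (length x) \<and> inval x (u * isq (length x) + v) = 1}"
    then obtain u v where "A = {u, v}" "u < v" "v < isq (length x)" "inval x (u * isq (length x) + v) = 1" by blast
    then have "A = {u, v}" "EG u v" by (auto simp: EG_def)
    then show "A \<in> {{u, v} | u v. EG u v}" by blast
  qed
  then have "mx F div 2 = matching_number {{u, v} | u v. u < v \<and> v < isq (length x) \<and> inval x (u * isq (length x) + v) = 1}"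
    using mx_matching[OF F(2) opt] by simp
  then have "snd (sem W x MAIN ([], \<tau>, [])) = (\<tau>, MF x)"
    unfolding sm F(4) by (simp add: F0 MF_def)
  then show "snd (sem ((2 ^ 40) ^ LL (length x + 1)) x MAIN ([], \<tau>, [])) = (\<tau>, MF x)" unfolding W_def .
qed

text \<open>Renaming vertices injectively is a bijection between matchings that preserves their
  size; it leads from positions in the enumeration back to vertices.\<close>

lemma matching_number_image:
  assumes g: "inj_on g V" and E: "\<And>A. A \<in> E \<Longrightarrow> A \<subseteq> V"
  shows "matching_number ((`) g ` E) = matching_number E"
proof -
  have gi: "inj_on ((`) g) E" using g E by (meson inj_on_image_eq_iff inj_onI)
  have dj: "disjnt (g ` A) (g ` B) \<longleftrightarrow> disjnt A B" if "A \<in> E" "B \<in> E" for A B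
    using inj_on_image_Int[OF g E[OF that(1)] E[OF that(2)]] by (auto simp: disjnt_def)
  have inj: "g ` A = g ` B \<longleftrightarrow> A = B" if "A \<in> E" "B \<in> E" for A B using gi that by (auto simp: inj_on_def)
  have "card ` {M. matching ((`) g ` E) M} = card ` {M. matching E M}"
  proof (rule equalityI; rule subsetI)
    fix c assume "c \<in> card ` {M. matching ((`) g ` E) M}"
    then obtain M where M: "M \<subseteq> (`) g ` E" "pairwise disjnt M" "c = card M" by (auto simp: matching_def)
    obtain M' where M': "M' \<subseteq> E" "M = (`) g ` M'" using M(1) by (meson subset_imageE)
    have "pairwise disjnt M'"
      unfolding pairwise_def
    proof (intro ballI impI)
      fix A B assume a: "A \<in> M'" "B \<in> M'" "A \<noteq> B"
      then have e: "A \<in> E" "B \<in> E" using M' by auto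
      have "g ` A \<in> M" "g ` B \<in> M" "g ` A \<noteq> g ` B" using a M'(2) inj[OF e] by auto
      then have "disjnt (g ` A) (g ` B)" by (rule pairwiseD[OF M(2)])
      then show "disjnt A B" using dj[OF e] by simp
    qed
    moreover have "card M = card M'" using M' gi by (metis card_image inj_on_subset)
    ultimately show "c \<in> card ` {M. matching E M}" using M' M(3) by (auto simp: matching_def)
  next
    fix c assume "c \<in> card ` {M. matching E M}"
    then obtain M where M: "M \<subseteq> E" "pairwise disjnt M" "c = card M" by (auto simp: matching_def)
    have "pairwise disjnt ((`) g ` M)"
      unfolding pairwise_def
    proof (intro ballI impI)
      fix A' B' assume a: "A' \<in> (`) g ` M" "B' \<in> (`) g ` M" "A' \<noteq> B'"
      then obtain A B where AB: "A \<in> M" "B \<in> M" "A' = g ` A" "B' = g ` B" by blast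
      have "A \<noteq> B" using a(3) AB by auto
      then have "disjnt A B" by (rule pairwiseD[OF M(2) AB(1,2)])
      then show "disjnt A' B'" using dj[of A B] AB M(1) by auto
    qed
    moreover have "card ((`) g ` M) = card M" using M gi by (metis card_image inj_on_subset)
    ultimately have "matching ((`) g ` E) ((`) g ` M)" "c = card ((`) g ` M)" using M by (auto simp: matching_def)
    then show "c \<in> card ` {M. matching ((`) g ` E) M}" by blast
  qed
  then show ?thesis by (simp add: matching_number_def)
qed

lemma length_concat_rows: "(\<And>r. r \<in> set rs \<Longrightarrow> length r = m) \<Longrightarrow> length (concat rs) = length rs * m"
  by (induction rs) auto

lemma nth_concat_rows:
  "(\<And>r. r \<in> set rs \<Longrightarrow> length r = m) \<Longrightarrow> i < length rs \<Longrightarrow> j < m \<Longrightarrow> concat rs ! (i * m + j) = rs ! i ! j"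
proof (induction rs arbitrary: i)
  case (Cons r rs)
  have r: "length r = m" using Cons.prems(1) by simp
  show ?case
  proof (cases i)
    case 0
    then show ?thesis using Cons.prems r by (simp add: nth_append)
  next
    case (Suc i')
    then show ?thesis using Cons.prems Cons.IH[of i'] r by (simp add: nth_append add.assoc)
  qed
qed simp

theorem theorem3p7:
  shows "\<exists>f \<in> CLP. \<forall>(V :: 'a set) E vs.
           simple_graph V E \<and> distinct vs \<and> set vs = V \<longrightarrow>
           f (adjacency_string vs E) = binary (matching_number E)"
proof (rule bexI[OF _ MF_in_CLP], intro allI impI)
  fix V :: "'a set" and E vs
  assume a: "simple_graph V E \<and> distinct vs \<and> set vs = V"
  define m where "m = length vs"
  let ?x = "adjacency_string vs E"
  let ?rows = "map (\<lambda>u. map (\<lambda>v. {u, v} \<in> E) vs) vs"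
  have row: "length r = m" if "r \<in> set ?rows" for r using that by (auto simp: m_def)
  have "length (concat ?rows) = length ?rows * m" by (rule length_concat_rows) (rule row)
  then have len: "length ?x = m * m" by (simp add: adjacency_string_def m_def)
  have nth: "?x ! (i * m + j) \<longleftrightarrow> {vs ! i, vs ! j} \<in> E" if ij: "i < m" "j < m" for i j
  proof -
    have "concat ?rows ! (i * m + j) = ?rows ! i ! j"
      by (rule nth_concat_rows) (use ij in \<open>auto simp: m_def\<close>)
    then show ?thesis using ij by (simp add: adjacency_string_def m_def)
  qed
  have bnd: "i * m + j < m * m" if "i < m" "j < m" for i j
  proof -
    have "i * m + j < (i + 1) * m" using that by simp
    also have "\<dots> \<le> m * m" using that by (intro mult_right_mono) auto
    finally show ?thesis .
  qed
  let ?E' = "{{u, v} | u v. u < v \<and> v < m \<and> inval ?x (u * m + v) = 1}"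
  have iv: "inval ?x (u * m + v) = 1 \<longleftrightarrow> {vs ! u, vs ! v} \<in> E" if "u < v" "v < m" for u v
    using bnd[of u v] nth[of u v] that by (simp add: inval_def len)
  have inj: "inj_on ((!) vs) {0..<m}" using a by (auto simp: inj_on_def m_def nth_eq_iff_index_eq)
  have "(`) ((!) vs) ` ?E' = E"
  proof (rule equalityI; rule subsetI)
    fix A assume "A \<in> (`) ((!) vs) ` ?E'"
    then obtain u v where "u < v" "v < m" "inval ?x (u * m + v) = 1" "A = {vs ! u, vs ! v}" by auto
    then show "A \<in> E" using iv by simp
  next
    fix A assume A: "A \<in> E"
    then have "A \<subseteq> set vs" "card A = 2" using a by (auto simp: simple_graph_def)
    then obtain y z where yz: "A = {y, z}" "y \<noteq> z" by (auto simp: card_2_iff)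
    then obtain i j where ij: "i < m" "j < m" "y = vs ! i" "z = vs ! j" using \<open>A \<subseteq> set vs\<close> by (auto simp: m_def in_set_conv_nth)
    have *: "A \<in> (`) ((!) vs) ` ?E'" if "u < v" "v < m" "A = {vs ! u, vs ! v}" for u v
    proof -
      have "{u, v} \<in> ?E'" using iv[OF that(1,2)] that A by blast
      moreover have "A = (!) vs ` {u, v}" using that by simp
      ultimately show ?thesis by blast
    qed
    have "i \<noteq> j" using yz ij by auto
    then show "A \<in> (`) ((!) vs) ` ?E'" using *[of i j] *[of j i] ij yz by (cases "i < j") auto
  qed
  then have "matching_number E = matching_number ?E'"
    using matching_number_image[OF inj, of ?E'] by force
  then show "MF ?x = binary (matching_number E)" by (simp add: MF_def len isq_square)
qed

end
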